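(* Let $(H,B)$ be a Rota-Baxter Hopf algebra of weight $-1$ and let $(H_+,H_-,\rhd,\lhd)$ be the matched pair of Hopf algebras on $(H,B)$. Let $(C,\widetilde{C})$ be the projection homomorphism pair on $(H_+,H_-,\rhd,\lhd)$ given in the context, and let $H_2=\operatorname{Im}\widetilde{C}$. Define $B_2:H_2\to H_2$, $\widetilde{B_2}:H_2\to H_2$ and $\pi:H\to H_2$ by $$B_2((x,y))=\widetilde{C}\big((x,\epsilon(y)1_H)\big),\quad \forall\,(x,y)\in H_2,$$ $$\widetilde{B_2}((x,y))=(x_1,y_1)\,B_2\big(S((x_2,y_2))\big),\quad \forall\,(x,y)\in H_2,$$ $$\pi(x)=\Big(\widetilde{B}\big(S(B(x_1))\big),\ S\big(B(\widetilde{B}(S(x_2)))\big)\Big),\quad \forall\, x\in H.$$ Then $\pi$ is a surjective homomorphism of Rota-Baxter Hopf algebras from $(H_B,B)$ to $(H_2,B_2)$, and $\pi\circ S$ is a surjective homomorphism of Rota-Baxter Hopf algebras from $(H_{\widetilde{B}},\widetilde{B})$ to $(H_2,\widetilde{B_2})$.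
   Context: The base field $\mathbb{K}$ has characteristic $0$; Hopf algebras are written $(H,\cdot,1,\Delta,\epsilon,S)$ and Sweedler notation $\Delta(x)=x_1\otimes x_2$ is used. A coalgebra map is a linear map $f$ with $\Delta\circ f=(f\otimes f)\circ\Delta$ and $\epsilon\circ f=\epsilon$. Rota-Baxter Hopf algebra of weight $-1$: a pair $(H,B)$ where $H$ is a cocommutative Hopf algebra and $B:H\to H$ is a coalgebra map with $B(x)B(y)=B\big(B(x_1)\,y\,S(B(x_2))\,x_3\big)$ for all $x,y\in H$. A homomorphism of Rota-Baxter Hopf algebras $(H,B)\to(H',B')$ is a Hopf algebra homomorphism $f:H\to H'$ with $f\circ B=B'\circ f$. Put $\widetilde{B}(x)=x_1B(S(x_2))$ (again a Rota-Baxter operator of weight $-1$ on $H$). The descendent Hopf algebra $H_B$ is the coalgebra $(H,\Delta,\epsilon)$ with unit $1$, product $x*_By=B(x_1)\,y\,S(B(x_2))\,x_3$ and antipode $S_B(x)=S(B(x_1))S(x_2)B(x_3)$; $(H_B,B)$ is again a Rota-Baxter Hopf algebra of weight $-1$ (the descendent Rota-Baxter Hopf algebra). $H_{\widetilde{B}}$ is the same construction with $\widetilde{B}$ in place of $B$. In $\pi\circ S$, and in the formula for $\pi$, $S$ is the antipode of $H$. Put $H_+=\operatorname{Im}B$ and $H_-=\operatorname{Im}\widetilde{B}$ (Hopf subalgebras of $H$). The matched pair of Hopf algebras on $(H,B)$ is $(H_+,H_-,\rhd,\lhd)$ with $B(x)\rhd\widetilde{B}(y)=\widetilde{B}(B(x_1)yS(B(x_2)))\in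 H_-$ and $B(x)\lhd\widetilde{B}(y)=S\big(B(S(\widetilde{B}(y_1))S_B(x)\widetilde{B}(y_2))\big)\in H_+$ for $x,y\in H$. Its double cross product $H_-\bowtie H_+$ is the Hopf algebra on $H_-\otimes H_+$ with product $(a\otimes x)(a'\otimes x')=a(x_1\rhd a'_1)\otimes(x_2\lhd a'_2)x'$, unit $1\otimes1$ and the usual tensor product coalgebra structure. The element $a\otimes x$ is written $(a,x)$; formulas on such elements are extended linearly, and $S((x,y))$ is the antipode of $H_-\bowtie H_+$. The projection homomorphism pair $(C,\widetilde{C})$ on $(H_+,H_-,\rhd,\lhd)$ consists of the idempotent Hopf algebra endomorphisms of $H_-\bowtie H_+$ given for $x,y\in H$ by $C((\widetilde{B}(x),B(y)))=\big(\widetilde{B}(\widetilde{B}(x_1)B(y_1)),\,S(B(S(\widetilde{B}(x_2)B(y_2))))\big)$ and $\widetilde{C}((\widetilde{B}(x),B(y)))=\big(\widetilde{B}(S(B(S(x_1))B(y_1))),\,S(B(\widetilde{B}(x_2)\widetilde{B}(S(y_2))))\big)$; they satisfy $C(z_1)\widetilde{C}(z_2)=z$ for all $z$. $\operatorname{Im}\widetilde{C}$ is a Hopf subalgebra of $H_-\bowtie H_+$. *)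

theory Defs
  imports Complex_Main "HOL-Library.Function_Algebras"
begin

section \<open>Vector spaces and tensor products\<close>

text \<open>
  A space is a subspace \<open>carr V\<close> of a vector space living on a whole type; addition is that of the
  type.  Maps between spaces are only constrained on carriers.
\<close>

record ('k, 'a) vspace =
  carr :: "'a set"
  scl :: "'k \<Rightarrow> 'a \<Rightarrow> 'a"

definition vspace :: "('k::field, 'a::ab_group_add, 'z) vspace_scheme \<Rightarrow> bool" where
  "vspace V \<longleftrightarrow> vector_space (scl V) \<and> module.subspace (scl V) (carr V)"

definition base_field :: "('k::field, 'k) vspace" where
  "base_field = \<lparr>carr = UNIV, scl = (*)\<rparr>"

definition linear_map ::
  "('k::field, 'a::ab_group_add, 'y) vspace_scheme \<Rightarrow> ('k, 'b::ab_group_add, 'z) vspace_scheme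
    \<Rightarrow> ('a \<Rightarrow> 'b) \<Rightarrow> bool" where
  "linear_map V W f \<longleftrightarrow>
     (\<forall>x\<in>carr V. f x \<in> carr W) \<and>
     (\<forall>x\<in>carr V. \<forall>y\<in>carr V. f (x + y) = f x + f y) \<and>
     (\<forall>c. \<forall>x\<in>carr V. f (scl V c x) = scl W c (f x))"

definition bilinear_map ::
  "('k::field, 'a::ab_group_add, 'x) vspace_scheme \<Rightarrow> ('k, 'b::ab_group_add, 'y) vspace_scheme
    \<Rightarrow> ('k, 'c::ab_group_add, 'z) vspace_scheme \<Rightarrow> ('a \<Rightarrow> 'b \<Rightarrow> 'c) \<Rightarrow> bool" where
  "bilinear_map V W U F \<longleftrightarrow>
     (\<forall>x\<in>carr V. linear_map W U (F x)) \<and> (\<forall>y\<in>carr W. linear_map V U (\<lambda>x. F x y))"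

text \<open>
  The elementary tensor \<open>v \<otimes> w\<close> is evaluation of bilinear forms at \<open>(v, w)\<close>; over a field this
  identifies the tensor product with a subspace of the dual of the space of bilinear forms.  The
  bilinear forms are those of the ambient vector spaces, so that for subspaces \<open>V' \<subseteq> V\<close>,
  \<open>W' \<subseteq> W\<close> the space \<open>V' \<otimes> W'\<close> is literally a subspace of \<open>V \<otimes> W\<close>.
\<close>

type_synonym ('k, 'a, 'b) tensor = "('a \<Rightarrow> 'b \<Rightarrow> 'k) \<Rightarrow> 'k"

definition bilinear_form ::
  "('k::field \<Rightarrow> 'a::ab_group_add \<Rightarrow> 'a) \<Rightarrow> ('k \<Rightarrow> 'b::ab_group_add \<Rightarrow> 'b) \<Rightarrow> ('a \<Rightarrow> 'b \<Rightarrow> 'k) \<Rightarrow> bool" where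
  "bilinear_form s1 s2 \<beta> \<longleftrightarrow>
     (\<forall>x. Vector_Spaces.linear s2 (*) (\<beta> x)) \<and> (\<forall>y. Vector_Spaces.linear s1 (*) (\<lambda>x. \<beta> x y))"

definition tens ::
  "('k::field, 'a::ab_group_add, 'y) vspace_scheme \<Rightarrow> ('k, 'b::ab_group_add, 'z) vspace_scheme
    \<Rightarrow> 'a \<Rightarrow> 'b \<Rightarrow> ('k, 'a, 'b) tensor" where
  "tens V W v w = (\<lambda>\<beta>. if bilinear_form (scl V) (scl W) \<beta> then \<beta> v w else 0)"

definition tensor_scl :: "'k::field \<Rightarrow> ('k, 'a, 'b) tensor \<Rightarrow> ('k, 'a, 'b) tensor" where
  "tensor_scl c t = (\<lambda>\<beta>. c * t \<beta>)"

definition tensor_space ::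
  "('k::field, 'a::ab_group_add, 'y) vspace_scheme \<Rightarrow> ('k, 'b::ab_group_add, 'z) vspace_scheme
    \<Rightarrow> ('k, ('k, 'a, 'b) tensor) vspace" where
  "tensor_space V W =
     \<lparr>carr = module.span tensor_scl {tens V W v w | v w. v \<in> carr V \<and> w \<in> carr W},
      scl = tensor_scl\<rparr>"

text \<open>
  \<open>tlift V W F\<close> is the linear map on \<open>V \<otimes> W\<close> with \<open>v \<otimes> w \<mapsto> F v w\<close> determined by a map \<open>F\<close> that
  is bilinear on \<open>carr V \<times> carr W\<close>.
\<close>

definition tlift ::
  "('k::field, 'a::ab_group_add, 'y) vspace_scheme \<Rightarrow> ('k, 'b::ab_group_add, 'z) vspace_scheme
    \<Rightarrow> ('a \<Rightarrow> 'b \<Rightarrow> 'c::ab_group_add) \<Rightarrow> ('k, 'a, 'b) tensor \<Rightarrow> 'c" where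
  "tlift V W F t =
     (THE u. \<exists>ps. set ps \<subseteq> carr V \<times> carr W \<and>
        t = (\<Sum>(v, w)\<leftarrow>ps. tens V W v w) \<and> u = (\<Sum>(v, w)\<leftarrow>ps. F v w))"


section \<open>Hopf algebras\<close>

record ('k, 'a) bialg = "('k, 'a) vspace" +
  hmult :: "'a \<Rightarrow> 'a \<Rightarrow> 'a"
  hone :: "'a"
  comult :: "'a \<Rightarrow> ('k, 'a, 'a) tensor"
  counit :: "'a \<Rightarrow> 'k"

record ('k, 'a) hopf = "('k, 'a) bialg" +
  antipode :: "'a \<Rightarrow> 'a"

text \<open>
  Sweedler notation: \<open>sweedler H (\<lambda>x\<^sub>1 x\<^sub>2. F x\<^sub>1 x\<^sub>2) x\<close> is \<open>F x\<^sub>1 x\<^sub>2\<close> summed over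
  \<open>\<Delta>(x) = x\<^sub>1 \<otimes> x\<^sub>2\<close>; the three-leg version uses \<open>(\<Delta> \<otimes> id) \<circ> \<Delta>\<close>.
\<close>

definition sweedler ::
  "('k::field, 'a::ab_group_add, 'z) bialg_scheme \<Rightarrow> ('a \<Rightarrow> 'a \<Rightarrow> 'c::ab_group_add) \<Rightarrow> 'a \<Rightarrow> 'c" where
  "sweedler H F x = tlift H H F (comult H x)"

definition sweedler3 ::
  "('k::field, 'a::ab_group_add, 'z) bialg_scheme \<Rightarrow> ('a \<Rightarrow> 'a \<Rightarrow> 'a \<Rightarrow> 'c::ab_group_add) \<Rightarrow> 'a \<Rightarrow> 'c" where
  "sweedler3 H F x = sweedler H (\<lambda>y x3. sweedler H (\<lambda>x1 x2. F x1 x2 x3) y) x"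

definition algebra :: "('k::field, 'a::ab_group_add, 'z) bialg_scheme \<Rightarrow> bool" where
  "algebra H \<longleftrightarrow> vspace H \<and> bilinear_map H H H (hmult H) \<and> hone H \<in> carr H \<and>
     (\<forall>x\<in>carr H. \<forall>y\<in>carr H. \<forall>z\<in>carr H. hmult H (hmult H x y) z = hmult H x (hmult H y z)) \<and>
     (\<forall>x\<in>carr H. hmult H (hone H) x = x \<and> hmult H x (hone H) = x)"

text \<open>
  Coassociativity is stated in \<open>H \<otimes> (H \<otimes> H)\<close>: the left-hand side is \<open>(\<Delta> \<otimes> id)(\<Delta>(x))\<close> after
  reassociation, the right-hand side is \<open>(id \<otimes> \<Delta>)(\<Delta>(x))\<close>.
\<close>

definition coalgebra :: "('k::field, 'a::ab_group_add, 'z) bialg_scheme \<Rightarrow> bool" where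
  "coalgebra H \<longleftrightarrow> vspace H \<and>
     linear_map H (tensor_space H H) (comult H) \<and> linear_map H base_field (counit H) \<and>
     (\<forall>x\<in>carr H.
        sweedler3 H (\<lambda>x1 x2 x3. tens H (tensor_space H H) x1 (tens H H x2 x3)) x =
        sweedler H (\<lambda>x1 y. tens H (tensor_space H H) x1 (comult H y)) x) \<and>
     (\<forall>x\<in>carr H. sweedler H (\<lambda>x1 x2. scl H (counit H x1) x2) x = x \<and>
                 sweedler H (\<lambda>x1 x2. scl H (counit H x2) x1) x = x)"

definition cocommutative :: "('k::field, 'a::ab_group_add, 'z) bialg_scheme \<Rightarrow> bool" where
  "cocommutative H \<longleftrightarrow> (\<forall>x\<in>carr H. sweedler H (\<lambda>x1 x2. tens H H x2 x1) x = comult H x)"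

definition tensor_mult ::
  "('k::field, 'a::ab_group_add, 'z) bialg_scheme
    \<Rightarrow> ('k, 'a, 'a) tensor \<Rightarrow> ('k, 'a, 'a) tensor \<Rightarrow> ('k, 'a, 'a) tensor" where
  "tensor_mult H s t =
     tlift H H (\<lambda>a b. tlift H H (\<lambda>c d. tens H H (hmult H a c) (hmult H b d)) t) s"

definition bialgebra :: "('k::field, 'a::ab_group_add, 'z) bialg_scheme \<Rightarrow> bool" where
  "bialgebra H \<longleftrightarrow> algebra H \<and> coalgebra H \<and>
     (\<forall>x\<in>carr H. \<forall>y\<in>carr H. comult H (hmult H x y) = tensor_mult H (comult H x) (comult H y)) \<and>
     comult H (hone H) = tens H H (hone H) (hone H) \<and>
     (\<forall>x\<in>carr H. \<forall>y\<in>carr H. counit H (hmult H x y) = counit H x * counit H y) \<and>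
     counit H (hone H) = 1"

definition is_antipode ::
  "('k::field, 'a::ab_group_add, 'z) bialg_scheme \<Rightarrow> ('a \<Rightarrow> 'a) \<Rightarrow> bool" where
  "is_antipode H S \<longleftrightarrow> linear_map H H S \<and>
     (\<forall>x\<in>carr H. sweedler H (\<lambda>x1 x2. hmult H (S x1) x2) x = scl H (counit H x) (hone H) \<and>
                 sweedler H (\<lambda>x1 x2. hmult H x1 (S x2)) x = scl H (counit H x) (hone H))"

definition hopf_algebra :: "('k::field, 'a::ab_group_add) hopf \<Rightarrow> bool" where
  "hopf_algebra H \<longleftrightarrow> bialgebra H \<and> is_antipode H (antipode H)"

definition coalgebra_map ::
  "('k::field, 'a::ab_group_add, 'y) bialg_scheme \<Rightarrow> ('k, 'b::ab_group_add, 'z) bialg_scheme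
    \<Rightarrow> ('a \<Rightarrow> 'b) \<Rightarrow> bool" where
  "coalgebra_map H H' f \<longleftrightarrow> linear_map H H' f \<and>
     (\<forall>x\<in>carr H. comult H' (f x) = sweedler H (\<lambda>x1 x2. tens H' H' (f x1) (f x2)) x) \<and>
     (\<forall>x\<in>carr H. counit H' (f x) = counit H x)"

definition hopf_hom ::
  "('k::field, 'a::ab_group_add) hopf \<Rightarrow> ('k, 'b::ab_group_add) hopf \<Rightarrow> ('a \<Rightarrow> 'b) \<Rightarrow> bool" where
  "hopf_hom H H' f \<longleftrightarrow> coalgebra_map H H' f \<and>
     (\<forall>x\<in>carr H. \<forall>y\<in>carr H. f (hmult H x y) = hmult H' (f x) (f y)) \<and>
     f (hone H) = hone H' \<and>
     (\<forall>x\<in>carr H. f (antipode H x) = antipode H' (f x))"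


section \<open>Rota-Baxter Hopf algebras of weight -1\<close>

definition rota_baxter_hopf ::
  "('k::field, 'a::ab_group_add) hopf \<Rightarrow> ('a \<Rightarrow> 'a) \<Rightarrow> bool" where
  "rota_baxter_hopf H B \<longleftrightarrow> hopf_algebra H \<and> cocommutative H \<and> coalgebra_map H H B \<and>
     (\<forall>x\<in>carr H. \<forall>y\<in>carr H. hmult H (B x) (B y) =
        B (sweedler3 H (\<lambda>x1 x2 x3.
             hmult H (hmult H (hmult H (B x1) y) (antipode H (B x2))) x3) x))"

definition rota_baxter_hom ::
  "('k::field, 'a::ab_group_add) hopf \<Rightarrow> ('a \<Rightarrow> 'a)
    \<Rightarrow> ('k, 'b::ab_group_add) hopf \<Rightarrow> ('b \<Rightarrow> 'b) \<Rightarrow> ('a \<Rightarrow> 'b) \<Rightarrow> bool" where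
  "rota_baxter_hom H B H' B' f \<longleftrightarrow> rota_baxter_hopf H B \<and> rota_baxter_hopf H' B' \<and>
     hopf_hom H H' f \<and> (\<forall>x\<in>carr H. f (B x) = B' (f x))"

definition rb_tilde ::
  "('k::field, 'a::ab_group_add) hopf \<Rightarrow> ('a \<Rightarrow> 'a) \<Rightarrow> 'a \<Rightarrow> 'a" where
  "rb_tilde H B x = sweedler H (\<lambda>x1 x2. hmult H x1 (B (antipode H x2))) x"

definition descendent_mult ::
  "('k::field, 'a::ab_group_add) hopf \<Rightarrow> ('a \<Rightarrow> 'a) \<Rightarrow> 'a \<Rightarrow> 'a \<Rightarrow> 'a" where
  "descendent_mult H B x y =
     sweedler3 H (\<lambda>x1 x2 x3.
       hmult H (hmult H (hmult H (B x1) y) (antipode H (B x2))) x3) x"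

definition descendent_antipode ::
  "('k::field, 'a::ab_group_add) hopf \<Rightarrow> ('a \<Rightarrow> 'a) \<Rightarrow> 'a \<Rightarrow> 'a" where
  "descendent_antipode H B x =
     sweedler3 H (\<lambda>x1 x2 x3.
       hmult H (hmult H (antipode H (B x1)) (antipode H x2)) (B x3)) x"

definition descendent ::
  "('k::field, 'a::ab_group_add) hopf \<Rightarrow> ('a \<Rightarrow> 'a) \<Rightarrow> ('k, 'a) hopf" where
  "descendent H B =
     H\<lparr>hmult := descendent_mult H B, antipode := descendent_antipode H B\<rparr>"


section \<open>The matched pair and its double cross product\<close>

definition H_plus :: "('k::field, 'a::ab_group_add) hopf \<Rightarrow> ('a \<Rightarrow> 'a) \<Rightarrow> ('k, 'a) hopf" where
  "H_plus H B = H\<lparr>carr := B ` carr H\<rparr>"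

definition H_minus :: "('k::field, 'a::ab_group_add) hopf \<Rightarrow> ('a \<Rightarrow> 'a) \<Rightarrow> ('k, 'a) hopf" where
  "H_minus H B = H\<lparr>carr := rb_tilde H B ` carr H\<rparr>"

text \<open>
  The actions are given on the images of \<open>B\<close> and \<open>rb_tilde H B\<close> in terms of preimages \<open>x\<close>, \<open>y\<close>; the
  description asks for one value that is valid for all of them.
\<close>

definition rhd ::
  "('k::field, 'a::ab_group_add) hopf \<Rightarrow> ('a \<Rightarrow> 'a) \<Rightarrow> 'a \<Rightarrow> 'a \<Rightarrow> 'a" where
  "rhd H B h a =
     (THE c. \<forall>x\<in>carr H. \<forall>y\<in>carr H. h = B x \<longrightarrow> a = rb_tilde H B y \<longrightarrow>
        c = rb_tilde H B
              (sweedler H (\<lambda>x1 x2. hmult H (hmult H (B x1) y) (antipode H (B x2))) x))"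

definition lhd ::
  "('k::field, 'a::ab_group_add) hopf \<Rightarrow> ('a \<Rightarrow> 'a) \<Rightarrow> 'a \<Rightarrow> 'a \<Rightarrow> 'a" where
  "lhd H B h a =
     (THE c. \<forall>x\<in>carr H. \<forall>y\<in>carr H. h = B x \<longrightarrow> a = rb_tilde H B y \<longrightarrow>
        c = antipode H (B
              (sweedler H (\<lambda>y1 y2.
                 hmult H (hmult H (antipode H (rb_tilde H B y1)) (descendent_antipode H B x))
                         (rb_tilde H B y2)) y)))"

text \<open>
  \<open>A \<bowtie> K\<close> for a left action \<open>l : K \<otimes> A \<rightarrow> A\<close> and a right action \<open>r : K \<otimes> A \<rightarrow> K\<close>.
\<close>

definition double_cross_bialg ::
  "('k::field, 'a::ab_group_add, 'y) bialg_scheme \<Rightarrow> ('k, 'b::ab_group_add, 'z) bialg_scheme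
    \<Rightarrow> ('b \<Rightarrow> 'a \<Rightarrow> 'a) \<Rightarrow> ('b \<Rightarrow> 'a \<Rightarrow> 'b) \<Rightarrow> ('k, ('k, 'a, 'b) tensor) bialg" where
  "double_cross_bialg A K l r =
     \<lparr>carr = carr (tensor_space A K),
      scl = scl (tensor_space A K),
      hmult = (\<lambda>s t.
        tlift A K (\<lambda>a x.
          tlift A K (\<lambda>a' x'.
            sweedler K (\<lambda>x1 x2.
              sweedler A (\<lambda>a1' a2'.
                tens A K (hmult A a (l x1 a1')) (hmult K (r x2 a2') x')) a') x) t) s),
      hone = tens A K (hone A) (hone K),
      comult = tlift A K (\<lambda>a x.
        sweedler A (\<lambda>a1 a2.
          sweedler K (\<lambda>x1 x2.
            tens (tensor_space A K) (tensor_space A K) (tens A K a1 x1) (tens A K a2 x2)) x) a),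
      counit = tlift A K (\<lambda>a x. counit A a * counit K x)\<rparr>"

text \<open>The antipode is unique on the carrier, so the choice below only affects junk values.\<close>

definition double_cross ::
  "('k::field, 'a::ab_group_add, 'y) bialg_scheme \<Rightarrow> ('k, 'b::ab_group_add, 'z) bialg_scheme
    \<Rightarrow> ('b \<Rightarrow> 'a \<Rightarrow> 'a) \<Rightarrow> ('b \<Rightarrow> 'a \<Rightarrow> 'b) \<Rightarrow> ('k, ('k, 'a, 'b) tensor) hopf" where
  "double_cross A K l r =
     bialg.extend (double_cross_bialg A K l r)
       (hopf.fields (SOME S. is_antipode (double_cross_bialg A K l r) S))"

definition H_bowtie ::
  "('k::field, 'a::ab_group_add) hopf \<Rightarrow> ('a \<Rightarrow> 'a) \<Rightarrow> ('k, ('k, 'a, 'a) tensor) hopf" where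
  "H_bowtie H B = double_cross (H_minus H B) (H_plus H B) (rhd H B) (lhd H B)"


section \<open>The projection homomorphism pair\<close>

text \<open>
  The elements \<open>(Bt x, B y)\<close> span the carrier of \<open>H_bowtie H B\<close>, so the displayed formulas determine
  these linear maps there.
\<close>

definition proj_C ::
  "('k::field, 'a::ab_group_add) hopf \<Rightarrow> ('a \<Rightarrow> 'a) \<Rightarrow> ('k, 'a, 'a) tensor \<Rightarrow> ('k, 'a, 'a) tensor" where
  "proj_C H B =
     (let Bt = rb_tilde H B; S = antipode H; m = hmult H in
      SOME f. linear_map (H_bowtie H B) (H_bowtie H B) f \<and>
        (\<forall>x\<in>carr H. \<forall>y\<in>carr H. f (tens H H (Bt x) (B y)) =
           sweedler H (\<lambda>x1 x2. sweedler H (\<lambda>y1 y2.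
             tens H H (Bt (m (Bt x1) (B y1))) (S (B (S (m (Bt x2) (B y2)))))) y) x))"

definition proj_C_tilde ::
  "('k::field, 'a::ab_group_add) hopf \<Rightarrow> ('a \<Rightarrow> 'a) \<Rightarrow> ('k, 'a, 'a) tensor \<Rightarrow> ('k, 'a, 'a) tensor" where
  "proj_C_tilde H B =
     (let Bt = rb_tilde H B; S = antipode H; m = hmult H in
      SOME f. linear_map (H_bowtie H B) (H_bowtie H B) f \<and>
        (\<forall>x\<in>carr H. \<forall>y\<in>carr H. f (tens H H (Bt x) (B y)) =
           sweedler H (\<lambda>x1 x2. sweedler H (\<lambda>y1 y2.
             tens H H (Bt (S (m (B (S x1)) (B y1)))) (S (B (m (Bt x2) (Bt (S y2)))))) y) x))"

definition H_two ::
  "('k::field, 'a::ab_group_add) hopf \<Rightarrow> ('a \<Rightarrow> 'a) \<Rightarrow> ('k, ('k, 'a, 'a) tensor) hopf" where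
  "H_two H B = (H_bowtie H B)\<lparr>carr := proj_C_tilde H B ` carr (H_bowtie H B)\<rparr>"

definition B_two ::
  "('k::field, 'a::ab_group_add) hopf \<Rightarrow> ('a \<Rightarrow> 'a) \<Rightarrow> ('k, 'a, 'a) tensor \<Rightarrow> ('k, 'a, 'a) tensor" where
  "B_two H B =
     tlift (H_minus H B) (H_plus H B)
       (\<lambda>x y. proj_C_tilde H B (tens H H x (scl H (counit H y) (hone H))))"

definition B_two_tilde ::
  "('k::field, 'a::ab_group_add) hopf \<Rightarrow> ('a \<Rightarrow> 'a) \<Rightarrow> ('k, 'a, 'a) tensor \<Rightarrow> ('k, 'a, 'a) tensor" where
  "B_two_tilde H B = rb_tilde (H_two H B) (B_two H B)"

definition pi_map ::
  "('k::field, 'a::ab_group_add) hopf \<Rightarrow> ('a \<Rightarrow> 'a) \<Rightarrow> 'a \<Rightarrow> ('k, 'a, 'a) tensor" where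
  "pi_map H B x =
     (let Bt = rb_tilde H B; S = antipode H in
      sweedler H (\<lambda>x1 x2. tens H H (Bt (S (B x1))) (S (B (Bt (S x2))))) x)"

end

(*
  The coalgebra maps from a cocommutative coalgebra C into a cocommutative Hopf algebra H form a group
  under convolution, on which a Rota-Baxter operator B of H acts by composition as a Rota-Baxter
  operator of a group.  Every identity needed in H is therefore an identity in Rota-Baxter groups,
  read off at the projections of a tensor power of H.

  In a Rota-Baxter group put x o y = B(x) y B(x)^-1 x and Bm(x) = x^-1 B(x) = Bt(x^-1).  Both B and Bm
  are homomorphisms for o, they commute, and the group of pairs (Bm w, B y) is the direct product of
  the original group, embedded by g |-> (Bt(g), B(g^-1)^-1), and of the pairs
  pi(t) = (Bm(B t), B(Bm t)^-1); the pair (Bm w, B y) corresponds to g = Bm(w) B(y), t = w o y.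
  This isomorphism gives associativity and the antipode of the double cross product, and it shows
  that the second projection sends (Bm w, B y) to pi(w o y).  Hence H_2 is the image of pi and
  inherits its whole structure from the descendent Hopf algebra; the second statement follows since
  inversion is an isomorphism from the descendent algebra of Bt to that of B.
*)
theory Submission
  imports Defs "HOL-Algebra.Group"
begin

section \<open>Linear algebra on subspaces\<close>

text \<open>Cocommutativity is what makes the convolution of coalgebra maps again a coalgebra map,
  and H \<otimes> H with its two projections then plays the role of a product: a law for elements x,
  y is a law for the two projections, evaluated at x \<otimes> y. The obstacle that group theory
  does not remove by itself is well-definedness. The actions, the antipode of the double cross
  product and the projection are prescribed on values of \<open>B\<close> and \<open>Bt\<close>
  through preimages, and an equality of two such values says nothing about the Sweedler legs of the
  preimages. The way out is to give each such expression two words: one in which the first variable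
  occurs only under its operator, one in which the second does. Each word factors through a linear
  map on H \<otimes> H that applies one operator and keeps the other variable, and both
  factorisations together give independence of the preimages. This is why the group identities come
  in pairs. Moreover H_2, the antipode and the projection enter as bare records or by choice; their
  properties are obtained from explicit witnesses or by transport along a surjection.\<close>

lemma vspace_zero: "vspace V \<Longrightarrow> 0 \<in> carr V"
  and vspace_add: "vspace V \<Longrightarrow> x \<in> carr V \<Longrightarrow> y \<in> carr V \<Longrightarrow> x + y \<in> carr V"
  and vspace_scl: "vspace V \<Longrightarrow> x \<in> carr V \<Longrightarrow> scl V c x \<in> carr V"
  and vspace_vector_space: "vspace V \<Longrightarrow> vector_space (scl V)"
  unfolding vspace_def module_iff_vector_space[symmetric]
  by (auto intro: module.subspace_0 module.subspace_add module.subspace_scale)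

lemma vspace_scl_one: "vspace V \<Longrightarrow> scl V 1 x = x"
  and vspace_scl_scl: "vspace V \<Longrightarrow> scl V a (scl V b x) = scl V (a * b) x"
  and vspace_scl_zero_right: "vspace V \<Longrightarrow> scl V a 0 = 0"
  and vspace_scl_add_right: "vspace V \<Longrightarrow> scl V a (x + y) = scl V a x + scl V a y"
  and vspace_scl_add_left: "vspace V \<Longrightarrow> scl V (a + b) x = scl V a x + scl V b x"
  by (simp_all add: vspace_def vector_space_def module.scale_zero_left module.scale_zero_right
      module_def)

lemma vspace_uminus:
  assumes "vspace V" and "x \<in> carr V" shows "- x \<in> carr V"
proof -
  interpret vector_space "scl V" using assms(1) by (rule vspace_vector_space)
  show ?thesis using vspace_scl[OF assms, of "-1"] by simp
qed

lemma vspace_sum_list: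
  "vspace V \<Longrightarrow> (\<And>p. p \<in> set ps \<Longrightarrow> f p \<in> carr V) \<Longrightarrow> (\<Sum>p\<leftarrow>ps. f p) \<in> carr V"
  by (induction ps) (auto intro: vspace_zero vspace_add)

lemma vspace_base_field: "vspace (base_field :: ('k::field, 'k) vspace)"
proof -
  interpret vector_space "(*) :: 'k \<Rightarrow> 'k \<Rightarrow> 'k"
    by standard (simp_all add: algebra_simps)
  show ?thesis
    unfolding vspace_def base_field_def using subspace_UNIV vector_space_axioms by simp
qed

lemma carr_base_field [simp]: "carr base_field = UNIV"
  and scl_base_field [simp]: "scl base_field = (*)"
  by (simp_all add: base_field_def)

lemma linear_mapI:
  assumes "\<And>x. x \<in> carr V \<Longrightarrow> f x \<in> carr W"
    and "\<And>x y. x \<in> carr V \<Longrightarrow> y \<in> carr V \<Longrightarrow> f (x + y) = f x + f y"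
    and "\<And>c x. x \<in> carr V \<Longrightarrow> f (scl V c x) = scl W c (f x)"
  shows "linear_map V W f"
  using assms by (simp add: linear_map_def)

lemma linear_map_carr: "linear_map V W f \<Longrightarrow> x \<in> carr V \<Longrightarrow> f x \<in> carr W"
  and linear_map_add: "linear_map V W f \<Longrightarrow> x \<in> carr V \<Longrightarrow> y \<in> carr V \<Longrightarrow> f (x + y) = f x + f y"
  and linear_map_scl: "linear_map V W f \<Longrightarrow> x \<in> carr V \<Longrightarrow> f (scl V c x) = scl W c (f x)"
  by (simp_all add: linear_map_def)

lemma linear_map_zero:
  assumes "vspace V" and "linear_map V W f" shows "f 0 = 0"
  using linear_map_add[OF assms(2) vspace_zero vspace_zero] assms(1) by simp

lemma linear_map_uminus:
  assumes "vspace V" and "linear_map V W f" and "x \<in> carr V" shows "f (- x) = - f x"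
  using linear_map_add[OF assms(2,3) vspace_uminus[OF assms(1,3)]] linear_map_zero[OF assms(1,2)]
  by (simp add: eq_neg_iff_add_eq_0 add.commute)

lemma linear_map_sum_list:
  assumes "vspace V" and "linear_map V W f" and "\<And>p. p \<in> set ps \<Longrightarrow> g p \<in> carr V"
  shows "f (\<Sum>p\<leftarrow>ps. g p) = (\<Sum>p\<leftarrow>ps. f (g p))"
  using assms(3)
proof (induction ps)
  case Nil
  then show ?case using linear_map_zero[OF assms(1,2)] by simp
next
  case (Cons p ps)
  then show ?case
    using linear_map_add[OF assms(2), of "g p" "\<Sum>p\<leftarrow>ps. g p"] vspace_sum_list[OF assms(1), of ps g]
    by simp
qed

lemma linear_map_cong:
  assumes "vspace V" and "linear_map V W f" and "\<And>x. x \<in> carr V \<Longrightarrow> f x = g x"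
  shows "linear_map V W g"
  using assms(2) vspace_add[OF assms(1)] vspace_scl[OF assms(1)]
  by (simp add: linear_map_def assms(3))

lemma linear_map_ident: "linear_map V V (\<lambda>x. x)"
  by (simp add: linear_map_def)

lemma linear_map_comp:
  "linear_map W U f \<Longrightarrow> linear_map V W g \<Longrightarrow> linear_map V U (\<lambda>x. f (g x))"
  by (simp add: linear_map_def)

lemma linear_map_plus:
  "vspace W \<Longrightarrow> linear_map V W f \<Longrightarrow> linear_map V W g \<Longrightarrow> linear_map V W (\<lambda>x. f x + g x)"
  by (simp add: linear_map_def vspace_add vspace_scl_add_right algebra_simps)

lemma linear_map_const_zero: "vspace W \<Longrightarrow> linear_map V W (\<lambda>x. 0)"
  by (simp add: linear_map_def vspace_zero vspace_scl_zero_right)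

text \<open>\<open>U\<close> is any record with the image as carrier, so the lemma applies directly
  to records made by overwriting \<open>carr\<close>, such as \<open>H_plus H B\<close> and
  \<open>H_two H B\<close>.\<close>

lemma linear_map_image_vspace:
  assumes "vspace V" and "vspace W" and "linear_map V W f" and "carr U = f ` carr V"
    and "scl U = scl W"
  shows "vspace U"
proof -
  interpret W: vector_space "scl W" using assms(2) by (rule vspace_vector_space)
  have "W.subspace (f ` carr V)"
  proof (rule W.subspaceI)
    show "0 \<in> f ` carr V"
      using linear_map_zero[OF assms(1,3)] vspace_zero[OF assms(1)] by (metis image_eqI)
    show "x + y \<in> f ` carr V" if "x \<in> f ` carr V" "y \<in> f ` carr V" for x y
      using that linear_map_add[OF assms(3)] vspace_add[OF assms(1)] by (metis (no_types, lifting) image_iff)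
    show "scl W c x \<in> f ` carr V" if "x \<in> f ` carr V" for c x
      using that linear_map_scl[OF assms(3)] vspace_scl[OF assms(1)] by (metis (no_types, lifting) image_iff)
  qed
  then show ?thesis
    unfolding vspace_def assms(4,5) using W.vector_space_axioms by blast
qed

lemma bilinear_mapI:
  assumes "\<And>x. x \<in> carr V \<Longrightarrow> linear_map W U (F x)"
    and "\<And>y. y \<in> carr W \<Longrightarrow> linear_map V U (\<lambda>x. F x y)"
  shows "bilinear_map V W U F"
  using assms by (simp add: bilinear_map_def)

lemma bilinear_map_right: "bilinear_map V W U F \<Longrightarrow> x \<in> carr V \<Longrightarrow> linear_map W U (F x)"
  and bilinear_map_left: "bilinear_map V W U F \<Longrightarrow> y \<in> carr W \<Longrightarrow> linear_map V U (\<lambda>x. F x y)"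
  by (simp_all add: bilinear_map_def)

lemma bilinear_map_carr:
  "bilinear_map V W U F \<Longrightarrow> x \<in> carr V \<Longrightarrow> y \<in> carr W \<Longrightarrow> F x y \<in> carr U"
  by (meson bilinear_map_right linear_map_carr)

lemma bilinear_map_comp_left:
  "bilinear_map V W U F \<Longrightarrow> linear_map A V f \<Longrightarrow> y \<in> carr W \<Longrightarrow> linear_map A U (\<lambda>x. F (f x) y)"
  by (rule linear_map_comp[OF bilinear_map_left])

lemma bilinear_map_comp_right:
  "bilinear_map V W U F \<Longrightarrow> linear_map A W f \<Longrightarrow> x \<in> carr V \<Longrightarrow> linear_map A U (\<lambda>y. F x (f y))"
  by (rule linear_map_comp[OF bilinear_map_right])

lemma bilinear_map_comp:
  assumes "bilinear_map V W U F" "linear_map A V f" "linear_map D W g"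
  shows "bilinear_map A D U (\<lambda>x y. F (f x) (g y))"
  by (rule bilinear_mapI)
    (rule bilinear_map_comp_right[OF assms(1,3) linear_map_carr[OF assms(2)]]
      bilinear_map_comp_left[OF assms(1,2) linear_map_carr[OF assms(3)]], assumption)+

lemma linear_comp_bilinear:
  "linear_map U U' h \<Longrightarrow> bilinear_map V W U F \<Longrightarrow> bilinear_map V W U' (\<lambda>x y. h (F x y))"
  by (simp add: bilinear_map_def linear_map_def)

lemma bilinear_map_flip: "bilinear_map V W U F \<Longrightarrow> bilinear_map W V U (\<lambda>x y. F y x)"
  by (simp add: bilinear_map_def)

lemma bilinear_map_cong:
  assumes "vspace V" "vspace W" "bilinear_map V W U F"
    and "\<And>x y. x \<in> carr V \<Longrightarrow> y \<in> carr W \<Longrightarrow> F x y = G x y"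
  shows "bilinear_map V W U G"
proof (rule bilinear_mapI)
  show "linear_map W U (G x)" if "x \<in> carr V" for x
    by (rule linear_map_cong[OF assms(2) bilinear_map_right[OF assms(3) that]])
      (rule assms(4)[OF that])
  show "linear_map V U (\<lambda>x. G x y)" if "y \<in> carr W" for y
    by (rule linear_map_cong[OF assms(1) bilinear_map_left[OF assms(3) that]])
      (rule assms(4)[OF _ that])
qed

lemma bilinear_scl:
  assumes "vspace V" shows "bilinear_map base_field V V (scl V)"
  using assms
  by (intro bilinear_mapI linear_mapI)
    (simp_all add: vspace_scl vspace_scl_add_right vspace_scl_add_left vspace_scl_scl mult.commute)

section \<open>Maps that are linear in three or four arguments\<close>

definition trilinear_map where
  "trilinear_map A B C U F \<longleftrightarrow>
    (\<forall>a\<in>carr A. bilinear_map B C U (F a)) \<and>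
    (\<forall>b\<in>carr B. \<forall>c\<in>carr C. linear_map A U (\<lambda>a. F a b c))"

definition quadrilinear_map where
  "quadrilinear_map A B C D U F \<longleftrightarrow>
    (\<forall>a\<in>carr A. trilinear_map B C D U (F a)) \<and>
    (\<forall>b\<in>carr B. \<forall>c\<in>carr C. \<forall>d\<in>carr D. linear_map A U (\<lambda>a. F a b c d))"

lemma trilinear_mapI:
  assumes "\<And>b c. b \<in> carr B \<Longrightarrow> c \<in> carr C \<Longrightarrow> linear_map A U (\<lambda>a. F a b c)"
    and "\<And>a c. a \<in> carr A \<Longrightarrow> c \<in> carr C \<Longrightarrow> linear_map B U (\<lambda>b. F a b c)"
    and "\<And>a b. a \<in> carr A \<Longrightarrow> b \<in> carr B \<Longrightarrow> linear_map C U (\<lambda>c. F a b c)"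
  shows "trilinear_map A B C U F"
  using assms by (simp add: trilinear_map_def bilinear_map_def)

lemma trilinear_map_1: "trilinear_map A B C U F \<Longrightarrow> b \<in> carr B \<Longrightarrow> c \<in> carr C \<Longrightarrow> linear_map A U (\<lambda>a. F a b c)"
  and trilinear_map_2: "trilinear_map A B C U F \<Longrightarrow> a \<in> carr A \<Longrightarrow> c \<in> carr C \<Longrightarrow> linear_map B U (\<lambda>b. F a b c)"
  and trilinear_map_3: "trilinear_map A B C U F \<Longrightarrow> a \<in> carr A \<Longrightarrow> b \<in> carr B \<Longrightarrow> linear_map C U (F a b)"
  and trilinear_map_23: "trilinear_map A B C U F \<Longrightarrow> a \<in> carr A \<Longrightarrow> bilinear_map B C U (F a)"
  and trilinear_map_12: "trilinear_map A B C U F \<Longrightarrow> c \<in> carr C \<Longrightarrow> bilinear_map A B U (\<lambda>a b. F a b c)"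
  by (simp_all add: trilinear_map_def bilinear_map_def)

lemma quadrilinear_mapI:
  assumes "\<And>b c d. b \<in> carr B \<Longrightarrow> c \<in> carr C \<Longrightarrow> d \<in> carr D \<Longrightarrow> linear_map A U (\<lambda>a. F a b c d)"
    and "\<And>a c d. a \<in> carr A \<Longrightarrow> c \<in> carr C \<Longrightarrow> d \<in> carr D \<Longrightarrow> linear_map B U (\<lambda>b. F a b c d)"
    and "\<And>a b d. a \<in> carr A \<Longrightarrow> b \<in> carr B \<Longrightarrow> d \<in> carr D \<Longrightarrow> linear_map C U (\<lambda>c. F a b c d)"
    and "\<And>a b c. a \<in> carr A \<Longrightarrow> b \<in> carr B \<Longrightarrow> c \<in> carr C \<Longrightarrow> linear_map D U (\<lambda>d. F a b c d)"
  shows "quadrilinear_map A B C D U F"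
  using assms by (simp add: quadrilinear_map_def trilinear_map_def bilinear_map_def)

section \<open>Tensor products\<close>

lemma vector_space_tensor_scl: "vector_space (tensor_scl :: 'k::field \<Rightarrow> ('k, 'a, 'b) tensor \<Rightarrow> _)"
  by standard (auto simp: tensor_scl_def fun_eq_iff algebra_simps)

lemma vspace_tensor_space: "vspace (tensor_space V W)"
proof -
  interpret vector_space tensor_scl by (rule vector_space_tensor_scl)
  show ?thesis
    unfolding vspace_def tensor_space_def using vector_space_axioms subspace_span by simp
qed

lemma scl_tensor_space [simp]: "scl (tensor_space V W) = tensor_scl"
  by (simp add: tensor_space_def)

lemma tens_in_tensor_space:
  assumes "v \<in> carr V" "w \<in> carr W" shows "tens V W v w \<in> carr (tensor_space V W)"
proof -
  interpret vector_space tensor_scl by (rule vector_space_tensor_scl)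
  show ?thesis unfolding tensor_space_def using assms by (auto intro: span_base)
qed

text \<open>\<open>tens\<close> is 0 at every argument that is not a bilinear form, so additivity
  and homogeneity have to be checked only at bilinear forms, where they are those of the
  form.\<close>

lemma bilinear_tens: "bilinear_map V W (tensor_space V W) (tens V W)"
  by (intro bilinear_mapI linear_mapI tens_in_tensor_space)
    (auto simp: fun_eq_iff tens_def bilinear_form_def tensor_scl_def module_hom_iff linear_iff_module_hom)

text \<open>Scalars are absorbed into the left factor, so sums without coefficients reach the whole
  span. This is the shape in which \<open>tlift\<close> reads a tensor.\<close>

lemma tensor_space_sum_list:
  assumes "vspace V" "vspace W"
  shows "t \<in> carr (tensor_space V W) \<longleftrightarrow>
    (\<exists>ps. set ps \<subseteq> carr V \<times> carr W \<and> t = (\<Sum>(v, w)\<leftarrow>ps. tens V W v w))"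
proof
  interpret T: vector_space "tensor_scl :: 'a \<Rightarrow> ('a, 'b, 'd) tensor \<Rightarrow> _" by (rule vector_space_tensor_scl)
  assume "t \<in> carr (tensor_space V W)"
  then have "t \<in> T.span {tens V W v w | v w. v \<in> carr V \<and> w \<in> carr W}"
    by (simp add: tensor_space_def)
  then show "\<exists>ps. set ps \<subseteq> carr V \<times> carr W \<and> t = (\<Sum>(v, w)\<leftarrow>ps. tens V W v w)"
  proof (induction rule: T.span_induct_alt)
    case base
    show ?case by (rule exI[of _ "[]"]) simp
  next
    case (step c x y)
    then obtain v w ps where *: "x = tens V W v w" "v \<in> carr V" "w \<in> carr W"
      "set ps \<subseteq> carr V \<times> carr W" "y = (\<Sum>(v, w)\<leftarrow>ps. tens V W v w)" by blast
    have "tensor_scl c (tens V W v w) = tens V W (scl V c v) w"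
      using linear_map_scl[OF bilinear_map_left[OF bilinear_tens *(3), of V] *(2)] by simp
    then show ?case using * vspace_scl[OF assms(1) *(2)]
      by (intro exI[of _ "(scl V c v, w) # ps"]) simp
  qed
next
  assume "\<exists>ps. set ps \<subseteq> carr V \<times> carr W \<and> t = (\<Sum>(v, w)\<leftarrow>ps. tens V W v w)"
  then obtain ps where "set ps \<subseteq> carr V \<times> carr W" "t = (\<Sum>(v, w)\<leftarrow>ps. tens V W v w)" by blast
  then show "t \<in> carr (tensor_space V W)"
    by (auto intro!: vspace_sum_list vspace_tensor_space tens_in_tensor_space)
qed

text \<open>A linear left inverse of the identity on the subspace, that is, the projection along a
  chosen complement. It carries maps given on a carrier to the ambient space, where the bilinear
  forms of \<open>tens\<close> live.\<close>

lemma linear_projection_exists: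
  assumes "vspace V"
  obtains p where "Vector_Spaces.linear (scl V) (scl V) p" "\<And>x. p x \<in> carr V"
    "\<And>x. x \<in> carr V \<Longrightarrow> p x = x"
proof -
  interpret V: vector_space "scl V" using assms by (rule vspace_vector_space)
  interpret vector_space_pair "scl V" "scl V" ..
  have "V.subspace (carr V)" using assms by (simp add: vspace_def)
  from linear_exists_left_inverse_on[OF V.linear_id this] obtain g where
    "g ` UNIV \<subseteq> carr V" "Vector_Spaces.linear (scl V) (scl V) g" "\<forall>v\<in>carr V. g (id v) = v"
    by (auto simp: inj_on_def)
  then show ?thesis by (intro that[of g]) auto
qed

lemma (in vector_space) functional_separates:
  assumes "u \<noteq> 0"
  obtains \<phi> where "Vector_Spaces.linear scale (*) \<phi>" "\<phi> u \<noteq> 0"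
proof -
  interpret k: vector_space "(*) :: 'a \<Rightarrow> 'a \<Rightarrow> 'a"
    using vspace_vector_space[OF vspace_base_field] by simp
  interpret vector_space_pair scale "(*) :: 'a \<Rightarrow> 'a \<Rightarrow> 'a" ..
  have "independent {u}" using assms by simp
  from linear_independent_extend[OF this, of "\<lambda>_. 1"] obtain g where
    "Vector_Spaces.linear scale (*) g" "g u = 1" by auto
  then show ?thesis using that[of g] by simp
qed

text \<open>A bilinear map on the carriers, composed with a functional on its target, extends to an
  ambient bilinear form along linear projections onto the carriers.\<close>

lemma bilinear_sum_eq_zero:
  assumes "vspace V" "vspace W" "vspace U" and F: "bilinear_map V W U F"
    and ps: "set ps \<subseteq> carr V \<times> carr W" and z: "(\<Sum>(v, w)\<leftarrow>ps. tens V W v w) = 0"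
  shows "(\<Sum>(v, w)\<leftarrow>ps. F v w) = 0"
proof (rule ccontr)
  let ?u = "\<Sum>(v, w)\<leftarrow>ps. F v w"
  assume "?u \<noteq> 0"
  obtain p where p: "Vector_Spaces.linear (scl V) (scl V) p" "\<And>x. p x \<in> carr V"
    "\<And>x. x \<in> carr V \<Longrightarrow> p x = x" using linear_projection_exists[OF assms(1)] by blast
  obtain q where q: "Vector_Spaces.linear (scl W) (scl W) q" "\<And>x. q x \<in> carr W"
    "\<And>x. x \<in> carr W \<Longrightarrow> q x = x" using linear_projection_exists[OF assms(2)] by blast
  interpret U: vector_space "scl U" using assms(3) by (rule vspace_vector_space)
  obtain \<phi> where \<phi>: "Vector_Spaces.linear (scl U) (*) \<phi>" "\<phi> ?u \<noteq> 0"
    using U.functional_separates[OF \<open>?u \<noteq> 0\<close>] by blast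
  interpret p: Vector_Spaces.linear "scl V" "scl V" p by (rule p(1))
  interpret q: Vector_Spaces.linear "scl W" "scl W" q by (rule q(1))
  interpret \<phi>: Vector_Spaces.linear "scl U" "(*)" \<phi> by (rule \<phi>(1))
  define \<beta> where "\<beta> = (\<lambda>v w. \<phi> (F (p v) (q w)))"
  have "bilinear_form (scl V) (scl W) \<beta>"
    unfolding bilinear_form_def \<beta>_def
  proof (intro conjI allI)
    fix v
    show "Vector_Spaces.linear (scl W) (*) (\<lambda>w. \<phi> (F (p v) (q w)))"
      using bilinear_map_right[OF F p(2), of v] q(2)
      by unfold_locales (simp_all add: linear_map_def q.add \<phi>.add q.scale \<phi>.scale)
  next
    fix w
    show "Vector_Spaces.linear (scl V) (*) (\<lambda>v. \<phi> (F (p v) (q w)))"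
      using bilinear_map_left[OF F q(2), of w] p(2)
      by unfold_locales (simp_all add: linear_map_def p.add \<phi>.add p.scale \<phi>.scale)
  qed
  \<comment> \<open>Tensors are functions on forms: evaluating the sum at \<open>\<beta>\<close>
    gives 0 by hypothesis and \<open>\<phi> ?u\<close> by the choice of the projections.\<close>
  then have "(\<Sum>(v, w)\<leftarrow>ps. tens V W v w) \<beta> = (\<Sum>(v, w)\<leftarrow>ps. \<beta> v w)"
    by (induction ps) (auto simp: tens_def)
  also have "\<dots> = \<phi> ?u"
    using ps by (induction ps) (auto simp: \<beta>_def p(3) q(3) \<phi>.zero \<phi>.add)
  finally show False using z \<phi>(2) by simp
qed

lemma sum_list_bilinear_uminus:
  assumes "vspace V" and "bilinear_map V W U G" and "set ps \<subseteq> carr V \<times> carr W"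
  shows "(\<Sum>(v, w)\<leftarrow>map (\<lambda>(v, w). (- v, w)) ps. G v w) = - (\<Sum>(v, w)\<leftarrow>ps. G v w)"
  using assms(3) by (induction ps) (auto simp: linear_map_uminus[OF assms(1) bilinear_map_left[OF assms(2)]])

lemma sum_list_bilinear_scl:
  assumes "bilinear_map V W U G" and "vspace U" and "set ps \<subseteq> carr V \<times> carr W"
  shows "(\<Sum>(v, w)\<leftarrow>map (\<lambda>(v, w). (scl V c v, w)) ps. G v w) = scl U c (\<Sum>(v, w)\<leftarrow>ps. G v w)"
  using assms(3)
  by (induction ps) (auto simp: linear_map_scl[OF bilinear_map_left[OF assms(1)]]
      vspace_scl_zero_right[OF assms(2)] vspace_scl_add_right[OF assms(2)])

text \<open>The content is that the description in \<open>tlift\<close> determines one value. If two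
  lists represent the same tensor, the first list followed by the second with negated left entries
  represents 0, and by \<open>bilinear_sum_eq_zero\<close> the values of \<open>F\<close> then sum
  to 0 as well.\<close>

lemma tlift_sum_list:
  assumes V: "vspace V" and W: "vspace W" and U: "vspace U" and F: "bilinear_map V W U F"
    and ps: "set ps \<subseteq> carr V \<times> carr W"
  shows "tlift V W F (\<Sum>(v, w)\<leftarrow>ps. tens V W v w) = (\<Sum>(v, w)\<leftarrow>ps. F v w)"
  unfolding tlift_def
proof (rule the_equality)
  show "\<exists>qs. set qs \<subseteq> carr V \<times> carr W \<and>
      (\<Sum>(v, w)\<leftarrow>ps. tens V W v w) = (\<Sum>(v, w)\<leftarrow>qs. tens V W v w) \<and>
      (\<Sum>(v, w)\<leftarrow>ps. F v w) = (\<Sum>(v, w)\<leftarrow>qs. F v w)"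
    using ps by blast
next
  fix u
  assume "\<exists>qs. set qs \<subseteq> carr V \<times> carr W \<and>
      (\<Sum>(v, w)\<leftarrow>ps. tens V W v w) = (\<Sum>(v, w)\<leftarrow>qs. tens V W v w) \<and> u = (\<Sum>(v, w)\<leftarrow>qs. F v w)"
  then obtain qs where qs: "set qs \<subseteq> carr V \<times> carr W"
      "(\<Sum>(v, w)\<leftarrow>ps. tens V W v w) = (\<Sum>(v, w)\<leftarrow>qs. tens V W v w)" "u = (\<Sum>(v, w)\<leftarrow>qs. F v w)"
    by blast
  define ns where "ns = map (\<lambda>(v, w). (- v, w)) qs"
  note neg = sum_list_bilinear_uminus[OF V _ qs(1), folded ns_def]
  have "set (ps @ ns) \<subseteq> carr V \<times> carr W"
    using ps qs(1) vspace_uminus[OF V] by (auto simp: ns_def)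
  moreover have "(\<Sum>(v, w)\<leftarrow>ps @ ns. tens V W v w) = 0"
    using neg[OF bilinear_tens] qs(2) by simp
  ultimately have "(\<Sum>(v, w)\<leftarrow>ps @ ns. F v w) = 0"
    by (rule bilinear_sum_eq_zero[OF V W U F])
  then show "u = (\<Sum>(v, w)\<leftarrow>ps. F v w)"
    using neg[OF F] qs(3) by simp
qed

lemma tlift_tens:
  assumes "vspace V" "vspace W" "vspace U" "bilinear_map V W U F" "v \<in> carr V" "w \<in> carr W"
  shows "tlift V W F (tens V W v w) = F v w"
  using tlift_sum_list[OF assms(1-4), of "[(v, w)]"] assms(5,6) by simp

lemma linear_tlift:
  assumes V: "vspace V" and W: "vspace W" and U: "vspace U" and F: "bilinear_map V W U F"
  shows "linear_map (tensor_space V W) U (tlift V W F)"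
proof (rule linear_mapI)
  note T = tlift_sum_list[OF V W U F] and S = tensor_space_sum_list[OF V W]
  show "tlift V W F t \<in> carr U" if prem: "t \<in> carr (tensor_space V W)" for t
  proof -
    obtain ps where ps: "set ps \<subseteq> carr V \<times> carr W" "t = (\<Sum>(v, w)\<leftarrow>ps. tens V W v w)"
      using iffD1[OF S prem] by blast
    have "(\<Sum>(v, w)\<leftarrow>ps. F v w) \<in> carr U"
      using ps(1) bilinear_map_carr[OF F] by (intro vspace_sum_list[OF U]) auto
    then show ?thesis using T[OF ps(1)] ps(2) by simp
  qed
  show "tlift V W F (s + t) = tlift V W F s + tlift V W F t"
    if prem: "s \<in> carr (tensor_space V W)" "t \<in> carr (tensor_space V W)" for s t
  proof -
    obtain ps qs where "set ps \<subseteq> carr V \<times> carr W" "s = (\<Sum>(v, w)\<leftarrow>ps. tens V W v w)"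
      "set qs \<subseteq> carr V \<times> carr W" "t = (\<Sum>(v, w)\<leftarrow>qs. tens V W v w)"
      using iffD1[OF S prem(1)] iffD1[OF S prem(2)] by blast
    then show ?thesis using T[of ps] T[of qs] T[of "ps @ qs"] by simp
  qed
  show "tlift V W F (scl (tensor_space V W) c t) = scl U c (tlift V W F t)"
    if prem: "t \<in> carr (tensor_space V W)" for c t
  proof -
    obtain ps where ps: "set ps \<subseteq> carr V \<times> carr W" "t = (\<Sum>(v, w)\<leftarrow>ps. tens V W v w)"
      using iffD1[OF S prem] by blast
    define qs where "qs = map (\<lambda>(v, w). (scl V c v, w)) ps"
    note scl = sum_list_bilinear_scl[OF _ _ ps(1), where c = c, folded qs_def]
    have "set qs \<subseteq> carr V \<times> carr W" using ps(1) vspace_scl[OF V] by (auto simp: qs_def)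
    then show ?thesis
      using T[of ps] T[of qs] ps scl[OF F U] scl[OF bilinear_tens vspace_tensor_space] by simp
  qed
qed

text \<open>The extensionality principle behind the computations on tensors. The targets
  \<open>U\<close> and \<open>U'\<close> may differ because only values are compared.\<close>

lemma tensor_space_linear_eq:
  assumes "vspace V" "vspace W"
    and "linear_map (tensor_space V W) U f" "linear_map (tensor_space V W) U' g"
    and "\<And>v w. v \<in> carr V \<Longrightarrow> w \<in> carr W \<Longrightarrow> f (tens V W v w) = g (tens V W v w)"
    and "t \<in> carr (tensor_space V W)"
  shows "f t = g t"
proof -
  obtain ps where ps: "set ps \<subseteq> carr V \<times> carr W" "t = (\<Sum>(v, w)\<leftarrow>ps. tens V W v w)"
    using iffD1[OF tensor_space_sum_list[OF assms(1,2)] assms(6)] by blast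
  have mem: "\<And>p. p \<in> set ps \<Longrightarrow> (\<lambda>(v, w). tens V W v w) p \<in> carr (tensor_space V W)"
    using ps(1) by (auto intro: tens_in_tensor_space)
  have "f t = (\<Sum>p\<leftarrow>ps. f (case p of (v, w) \<Rightarrow> tens V W v w))"
    unfolding ps(2) by (rule linear_map_sum_list[OF vspace_tensor_space assms(3) mem])
  also have "\<dots> = (\<Sum>p\<leftarrow>ps. g (case p of (v, w) \<Rightarrow> tens V W v w))"
    using ps(1) assms(5) by (intro arg_cong[where f = sum_list] map_cong) auto
  also have "\<dots> = g t"
    unfolding ps(2) by (rule linear_map_sum_list[OF vspace_tensor_space assms(4) mem, symmetric])
  finally show ?thesis .
qed

text \<open>The description in \<open>tlift\<close> mentions \<open>F\<close> only through sums over
  pairs from the carriers, so both sides are described by the same predicate.\<close>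

lemma tlift_cong:
  assumes "\<And>v w. v \<in> carr V \<Longrightarrow> w \<in> carr W \<Longrightarrow> F v w = G v w"
  shows "tlift V W F t = tlift V W G t"
proof -
  have "(\<Sum>(v, w)\<leftarrow>ps. F v w) = (\<Sum>(v, w)\<leftarrow>ps. G v w)" if "set ps \<subseteq> carr V \<times> carr W" for ps
    using that assms by (induction ps) auto
  then show ?thesis unfolding tlift_def by (intro arg_cong[where f = The]) (metis (no_types, lifting))
qed

lemma linear_comp_tlift:
  assumes "vspace V" "vspace W" "vspace U" "vspace U'" "bilinear_map V W U F" "linear_map U U' h"
    and t: "t \<in> carr (tensor_space V W)"
  shows "h (tlift V W F t) = tlift V W (\<lambda>v w. h (F v w)) t"
  by (rule tensor_space_linear_eq[OF assms(1,2) linear_map_comp[OF assms(6) linear_tlift]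
        linear_tlift[OF assms(1,2,4) linear_comp_bilinear[OF assms(6,5)]] _ t])
    (simp_all add: assms tlift_tens[OF assms(1-3)] tlift_tens[OF assms(1,2,4) linear_comp_bilinear[OF assms(6,5)]])

lemma tlift_tens_self:
  assumes "vspace V" "vspace W" "t \<in> carr (tensor_space V W)"
  shows "tlift V W (tens V W) t = t"
  by (rule tensor_space_linear_eq[OF assms(1,2) linear_tlift[OF assms(1,2) vspace_tensor_space
        bilinear_tens] linear_map_ident _ assms(3)])
    (simp add: tlift_tens[OF assms(1,2) vspace_tensor_space bilinear_tens])

text \<open>One representation of \<open>t\<close> serves for all \<open>a\<close>, which turns the
  map into a finite sum of linear maps.\<close>

lemma linear_map_tlift_param:
  assumes "vspace A" "vspace V" "vspace W" "vspace U" "trilinear_map A V W U F" and t: "t \<in> carr (tensor_space V W)"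
  shows "linear_map A U (\<lambda>a. tlift V W (F a) t)"
proof -
  obtain ps where ps: "set ps \<subseteq> carr V \<times> carr W" "t = (\<Sum>(v, w)\<leftarrow>ps. tens V W v w)"
    using iffD1[OF tensor_space_sum_list[OF assms(2,3)] t] by blast
  have "linear_map A U (\<lambda>a. \<Sum>(v, w)\<leftarrow>ps. F a v w)"
    using ps(1)
    by (induction ps) (auto intro!: linear_map_const_zero linear_map_plus trilinear_map_1[OF assms(5)] assms(4))
  then show ?thesis
    by (rule linear_map_cong[OF assms(1)])
      (simp add: ps(2) tlift_sum_list[OF assms(2-4) trilinear_map_23[OF assms(5)] ps(1)])
qed

section \<open>Sweedler sums\<close>

text \<open>Only the scalar multiplications enter, not the carriers: elementary tensors over a
  subspace such as \<open>H_plus\<close> are literally those of \<open>H\<close>.\<close>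

lemma tens_cong_space: "scl V = scl V' \<Longrightarrow> scl W = scl W' \<Longrightarrow> tens V W = tens V' W'"
  by (intro ext) (simp add: tens_def)

lemma tlift_cong_space:
  "carr V = carr V' \<Longrightarrow> scl V = scl V' \<Longrightarrow> carr W = carr W' \<Longrightarrow> scl W = scl W' \<Longrightarrow>
    tlift V W = tlift V' W'"
  using tens_cong_space[of V V' W W'] by (intro ext) (simp add: tlift_def)

lemma tensor_space_cong_space:
  "carr V = carr V' \<Longrightarrow> scl V = scl V' \<Longrightarrow> carr W = carr W' \<Longrightarrow> scl W = scl W' \<Longrightarrow>
    tensor_space V W = tensor_space V' W'"
  using tens_cong_space[of V V' W W'] by (simp add: tensor_space_def)

lemma vspace_cong_space: "carr V = carr V' \<Longrightarrow> scl V = scl V' \<Longrightarrow> vspace V \<longleftrightarrow> vspace V'"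
  by (simp add: vspace_def)

lemma linear_map_cong_space:
  "carr V = carr V' \<Longrightarrow> scl V = scl V' \<Longrightarrow> carr W = carr W' \<Longrightarrow> scl W = scl W' \<Longrightarrow>
    linear_map V W f \<longleftrightarrow> linear_map V' W' f"
  by (simp add: linear_map_def)

lemma bilinear_map_cong_space:
  "carr V = carr V' \<Longrightarrow> scl V = scl V' \<Longrightarrow> carr W = carr W' \<Longrightarrow> scl W = scl W' \<Longrightarrow>
    carr U = carr U' \<Longrightarrow> scl U = scl U' \<Longrightarrow> bilinear_map V W U F \<longleftrightarrow> bilinear_map V' W' U' F"
  by (simp add: bilinear_map_def linear_map_def)

lemma sweedler_cong_space:
  "carr C = carr D \<Longrightarrow> scl C = scl D \<Longrightarrow> comult C = comult D \<Longrightarrow> sweedler C F = sweedler D F"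
  by (intro ext) (simp add: sweedler_def tlift_cong_space[of C D C D])

lemma coalgebra_vspace: "coalgebra C \<Longrightarrow> vspace C"
  and linear_comult: "coalgebra C \<Longrightarrow> linear_map C (tensor_space C C) (comult C)"
  and linear_counit: "coalgebra C \<Longrightarrow> linear_map C base_field (counit C)"
  by (simp_all add: coalgebra_def)

lemma sweedler_cong:
  assumes "\<And>a b. a \<in> carr C \<Longrightarrow> b \<in> carr C \<Longrightarrow> F a b = G a b"
  shows "sweedler C F x = sweedler C G x"
  unfolding sweedler_def using assms by (rule tlift_cong)

lemma linear_sweedler:
  assumes "coalgebra C" "vspace U" "bilinear_map C C U F"
  shows "linear_map C U (sweedler C F)"
  unfolding sweedler_def
  by (rule linear_map_comp[OF linear_tlift[OF _ _ assms(2,3)] linear_comult[OF assms(1)]])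
    (simp_all add: coalgebra_vspace[OF assms(1)])

lemma linear_comp_sweedler:
  assumes "coalgebra C" "vspace U" "vspace U'" "bilinear_map C C U F" "linear_map U U' h" "x \<in> carr C"
  shows "h (sweedler C F x) = sweedler C (\<lambda>a b. h (F a b)) x"
  unfolding sweedler_def
  by (rule linear_comp_tlift[OF _ _ assms(2-5)])
    (simp_all add: coalgebra_vspace[OF assms(1)] linear_map_carr[OF linear_comult[OF assms(1)] assms(6)])

lemma linear_sweedler_param:
  assumes "coalgebra C" "vspace A" "vspace U" "trilinear_map A C C U F" "x \<in> carr C"
  shows "linear_map A U (\<lambda>a. sweedler C (F a) x)"
  unfolding sweedler_def
  by (rule linear_map_tlift_param[OF assms(2) _ _ assms(3,4)])
    (simp_all add: coalgebra_vspace[OF assms(1)] linear_map_carr[OF linear_comult[OF assms(1)] assms(5)])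

lemma sweedler_tens_self: "coalgebra C \<Longrightarrow> x \<in> carr C \<Longrightarrow> sweedler C (tens C C) x = comult C x"
  unfolding sweedler_def
  by (rule tlift_tens_self) (simp_all add: coalgebra_vspace linear_map_carr[OF linear_comult])

lemma tlift_sweedler_tens:
  assumes "coalgebra C" "vspace V" "vspace W" "vspace U" "bilinear_map V W U F"
    "linear_map C V f" "linear_map C W g" "x \<in> carr C"
  shows "tlift V W F (sweedler C (\<lambda>a b. tens V W (f a) (g b)) x) = sweedler C (\<lambda>a b. F (f a) (g b)) x"
proof -
  have "tlift V W F (sweedler C (\<lambda>a b. tens V W (f a) (g b)) x)
      = sweedler C (\<lambda>a b. tlift V W F (tens V W (f a) (g b))) x"
    by (rule linear_comp_sweedler[OF assms(1) vspace_tensor_space assms(4)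
          bilinear_map_comp[OF bilinear_tens assms(6,7)] linear_tlift[OF assms(2-5)] assms(8)])
  also have "\<dots> = sweedler C (\<lambda>a b. F (f a) (g b)) x"
    by (intro sweedler_cong tlift_tens[OF assms(2-5)] linear_map_carr[OF assms(6)] linear_map_carr[OF assms(7)])
  finally show ?thesis .
qed

lemma bilinear_sweedler_left:
  assumes "coalgebra C" "vspace A" "vspace U" "trilinear_map C C A U F"
  shows "bilinear_map C A U (\<lambda>y c. sweedler C (\<lambda>a b. F a b c) y)"
proof (rule bilinear_mapI)
  show "linear_map A U (\<lambda>c. sweedler C (\<lambda>a b. F a b c) y)" if "y \<in> carr C" for y
    by (rule linear_sweedler_param[OF assms(1-3) _ that])
      (rule trilinear_mapI; simp add: trilinear_map_1[OF assms(4)] trilinear_map_2[OF assms(4)]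
        trilinear_map_3[OF assms(4)])
  show "linear_map C U (\<lambda>y. sweedler C (\<lambda>a b. F a b c) y)" if "c \<in> carr A" for c
    by (rule linear_sweedler[OF assms(1,3) trilinear_map_12[OF assms(4) that]])
qed

lemma trilinear_tens: "trilinear_map A B C (tensor_space A (tensor_space B C)) (\<lambda>a b c. tens A (tensor_space B C) a (tens B C b c))"
proof (rule trilinear_mapI)
  fix a b c assume *: "a \<in> carr A" "b \<in> carr B"
  show "linear_map C (tensor_space A (tensor_space B C)) (\<lambda>c. tens A (tensor_space B C) a (tens B C b c))"
    by (rule bilinear_map_comp_right[OF bilinear_tens bilinear_map_right[OF bilinear_tens *(2)] *(1)])
next
  fix a b c assume *: "a \<in> carr A" "c \<in> carr C"
  show "linear_map B (tensor_space A (tensor_space B C)) (\<lambda>b. tens A (tensor_space B C) a (tens B C b c))"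
    by (rule bilinear_map_comp_right[OF bilinear_tens bilinear_map_left[OF bilinear_tens *(2)] *(1)])
next
  fix a b c assume *: "b \<in> carr B" "c \<in> carr C"
  show "linear_map A (tensor_space A (tensor_space B C)) (\<lambda>a. tens A (tensor_space B C) a (tens B C b c))"
    by (rule bilinear_map_left[OF bilinear_tens tens_in_tensor_space[OF *]])
qed

text \<open>The axiom is the case of the universal trilinear map a \<otimes> (b \<otimes> c). The
  linear map \<open>L\<close> with value \<open>F a b c\<close> there carries both sides of the
  axiom to the general case.\<close>

lemma sweedler_coassoc:
  assumes C: "coalgebra C" and U: "vspace U" and F: "trilinear_map C C C U F" and x: "x \<in> carr C"
  shows "sweedler C (\<lambda>y c. sweedler C (\<lambda>a b. F a b c) y) x = sweedler C (\<lambda>a y. sweedler C (F a) y) x"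
proof -
  note V = coalgebra_vspace[OF C] and Tv = vspace_tensor_space
  let ?T = "tensor_space C C"
  define L where "L = tlift C ?T (\<lambda>a t. tlift C C (F a) t)"
  have bil: "bilinear_map C ?T U (\<lambda>a t. tlift C C (F a) t)"
    by (rule bilinear_mapI) (auto intro: linear_tlift linear_map_tlift_param V U F trilinear_map_23[OF F])
  have L: "linear_map (tensor_space C ?T) U L"
    unfolding L_def by (rule linear_tlift[OF V Tv U bil])
  have L_tens: "L (tens C ?T a t) = tlift C C (F a) t" if "a \<in> carr C" "t \<in> carr ?T" for a t
    unfolding L_def by (rule tlift_tens[OF V Tv U bil that])
  have "L (sweedler C (\<lambda>y c. sweedler C (\<lambda>a b. tens C ?T a (tens C C b c)) y) x)
      = sweedler C (\<lambda>y c. L (sweedler C (\<lambda>a b. tens C ?T a (tens C C b c)) y)) x"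
    by (rule linear_comp_sweedler[OF C Tv U bilinear_sweedler_left[OF C V Tv trilinear_tens] L x])
  also have "\<dots> = sweedler C (\<lambda>y c. sweedler C (\<lambda>a b. F a b c) y) x"
  proof (rule sweedler_cong)
    fix y c assume y: "y \<in> carr C" and c: "c \<in> carr C"
    have "L (sweedler C (\<lambda>a b. tens C ?T a (tens C C b c)) y)
        = sweedler C (\<lambda>a b. L (tens C ?T a (tens C C b c))) y"
      by (rule linear_comp_sweedler[OF C Tv U trilinear_map_12[OF trilinear_tens c] L y])
    also have "\<dots> = sweedler C (\<lambda>a b. F a b c) y"
      by (rule sweedler_cong)
        (simp add: L_tens tens_in_tensor_space c tlift_tens[OF V V U trilinear_map_23[OF F]])
    finally show "L (sweedler C (\<lambda>a b. tens C ?T a (tens C C b c)) y) = sweedler C (\<lambda>a b. F a b c) y" .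
  qed
  finally have lhs: "L (sweedler3 C (\<lambda>a b c. tens C ?T a (tens C C b c)) x)
      = sweedler C (\<lambda>y c. sweedler C (\<lambda>a b. F a b c) y) x"
    by (simp add: sweedler3_def)
  have "L (sweedler C (\<lambda>a y. tens C ?T a (comult C y)) x) = sweedler C (\<lambda>a y. L (tens C ?T a (comult C y))) x"
    by (rule linear_comp_sweedler[OF C Tv U bilinear_map_comp[OF bilinear_tens linear_map_ident linear_comult[OF C]] L x])
  also have "\<dots> = sweedler C (\<lambda>a y. sweedler C (F a) y) x"
    by (rule sweedler_cong) (simp add: L_tens linear_map_carr[OF linear_comult[OF C]] sweedler_def)
  finally show ?thesis
    using lhs C x by (simp add: coalgebra_def)
qed

lemma sweedler_counit_left:
  assumes C: "coalgebra C" and U: "vspace U" and f: "linear_map C U f" and x: "x \<in> carr C"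
  shows "sweedler C (\<lambda>a b. scl U (counit C a) (f b)) x = f x"
proof -
  note V = coalgebra_vspace[OF C]
  have "f (sweedler C (\<lambda>a b. scl C (counit C a) b) x) = sweedler C (\<lambda>a b. f (scl C (counit C a) b)) x"
    by (rule linear_comp_sweedler[OF C V U
          bilinear_map_comp[OF bilinear_scl[OF V] linear_counit[OF C] linear_map_ident] f x])
  also have "\<dots> = sweedler C (\<lambda>a b. scl U (counit C a) (f b)) x"
    by (rule sweedler_cong) (rule linear_map_scl[OF f])
  finally show ?thesis using C x by (simp add: coalgebra_def)
qed

lemma sweedler_counit_right:
  assumes C: "coalgebra C" and U: "vspace U" and f: "linear_map C U f" and x: "x \<in> carr C"
  shows "sweedler C (\<lambda>a b. scl U (counit C b) (f a)) x = f x"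
proof -
  note V = coalgebra_vspace[OF C]
  have "f (sweedler C (\<lambda>a b. scl C (counit C b) a) x) = sweedler C (\<lambda>a b. f (scl C (counit C b) a)) x"
    by (rule linear_comp_sweedler[OF C V U bilinear_map_flip[OF
          bilinear_map_comp[OF bilinear_scl[OF V] linear_counit[OF C] linear_map_ident]] f x])
  also have "\<dots> = sweedler C (\<lambda>a b. scl U (counit C b) (f a)) x"
    by (rule sweedler_cong) (rule linear_map_scl[OF f])
  finally show ?thesis using C x by (simp add: coalgebra_def)
qed

text \<open>The axiom is the case where \<open>F\<close> is \<open>tens\<close>; the lift of
  \<open>F\<close> carries it to the general case.\<close>

lemma sweedler_cocommutative:
  assumes C: "coalgebra C" and cc: "cocommutative C" and U: "vspace U" and F: "bilinear_map C C U F"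
    and x: "x \<in> carr C"
  shows "sweedler C (\<lambda>a b. F b a) x = sweedler C F x"
proof -
  note V = coalgebra_vspace[OF C]
  have "tlift C C F (sweedler C (\<lambda>a b. tens C C b a) x) = sweedler C (\<lambda>a b. tlift C C F (tens C C b a)) x"
    by (rule linear_comp_sweedler[OF C vspace_tensor_space U bilinear_map_flip[OF bilinear_tens]
          linear_tlift[OF V V U F] x])
  also have "\<dots> = sweedler C (\<lambda>a b. F b a) x"
    by (rule sweedler_cong) (rule tlift_tens[OF V V U F])
  finally show ?thesis using cc x by (simp add: cocommutative_def sweedler_def)
qed

lemma trilinear_sweedler_last:
  assumes "coalgebra C" "vspace A" "vspace B" "vspace U" "quadrilinear_map A B C C U F"
  shows "trilinear_map A B C U (\<lambda>a b y. sweedler C (F a b) y)"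
proof (rule trilinear_mapI)
  show "linear_map A U (\<lambda>a. sweedler C (F a b) y)" if "b \<in> carr B" "y \<in> carr C" for b y
    using assms(5) that
    by (intro linear_sweedler_param[OF assms(1,2,4) _ that(2)] trilinear_mapI)
      (simp_all add: quadrilinear_map_def trilinear_map_def bilinear_map_def)
  show "linear_map B U (\<lambda>b. sweedler C (F a b) y)" if "a \<in> carr A" "y \<in> carr C" for a y
    using assms(5) that
    by (intro linear_sweedler_param[OF assms(1,3,4) _ that(2)])
      (simp add: quadrilinear_map_def)
  show "linear_map C U (\<lambda>y. sweedler C (F a b) y)" if "a \<in> carr A" "b \<in> carr B" for a b
    using assms(5) that
    by (intro linear_sweedler[OF assms(1,4)]) (simp add: quadrilinear_map_def trilinear_map_def)
qed

lemma bilinear_sweedler_sweedler: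
  assumes A: "coalgebra A" and K: "coalgebra K" and U: "vspace U" and F: "quadrilinear_map A A K K U F"
  shows "bilinear_map A K U (\<lambda>a k. sweedler A (\<lambda>a1 a2. sweedler K (F a1 a2) k) a)"
  by (rule bilinear_sweedler_left[OF A coalgebra_vspace[OF K] U trilinear_sweedler_last[OF K _ _ U F]])
    (rule coalgebra_vspace[OF A])+

text \<open>Swaps the two inner ones of four legs. After reassociation the inner legs are the two
  legs of a single element, and cocommutativity applies to it.\<close>

lemma sweedler_interchange:
  assumes C: "coalgebra C" and cc: "cocommutative C" and U: "vspace U"
    and F: "quadrilinear_map C C C C U F" and x: "x \<in> carr C"
  shows "sweedler C (\<lambda>a b. sweedler C (\<lambda>a1 a2. sweedler C (\<lambda>b1 b2. F a1 a2 b1 b2) b) a) x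
    = sweedler C (\<lambda>a b. sweedler C (\<lambda>a1 a2. sweedler C (\<lambda>b1 b2. F a1 b1 a2 b2) b) a) x"
proof -
  note V = coalgebra_vspace[OF C]
  \<comment> \<open>Four legs bracketed as two pairs are rebracketed so that the second and third
    leg come from one comultiplication, that of \<open>d\<close>.\<close>
  have regroup: "sweedler C (\<lambda>a b. sweedler C (\<lambda>a1 a2. sweedler C (\<lambda>b1 b2. G a1 a2 b1 b2) b) a) x
    = sweedler C (\<lambda>a1 y. sweedler C (\<lambda>d b2. sweedler C (\<lambda>a2 b1. G a1 a2 b1 b2) d) y) x"
    if G: "quadrilinear_map C C C C U G" for G
  proof -
    have "sweedler C (\<lambda>a b. sweedler C (\<lambda>a1 a2. sweedler C (\<lambda>b1 b2. G a1 a2 b1 b2) b) a) x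
      = sweedler C (\<lambda>a1 y. sweedler C (\<lambda>a2 b. sweedler C (\<lambda>b1 b2. G a1 a2 b1 b2) b) y) x"
      by (rule sweedler_coassoc[OF C U trilinear_sweedler_last[OF C V V U G] x])
    also have "\<dots> = sweedler C (\<lambda>a1 y. sweedler C (\<lambda>d b2. sweedler C (\<lambda>a2 b1. G a1 a2 b1 b2) d) y) x"
      using G
      by (intro sweedler_cong sweedler_coassoc[OF C U, symmetric]) (simp_all add: quadrilinear_map_def)
    finally show ?thesis .
  qed
  have G: "quadrilinear_map C C C C U (\<lambda>a1 a2 b1 b2. F a1 b1 a2 b2)"
    using F by (intro quadrilinear_mapI) (simp_all add: quadrilinear_map_def trilinear_map_def bilinear_map_def)
  have "sweedler C (\<lambda>d b2. sweedler C (\<lambda>a2 b1. F a1 a2 b1 b2) d) y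
      = sweedler C (\<lambda>d b2. sweedler C (\<lambda>a2 b1. F a1 b1 a2 b2) d) y" if "a1 \<in> carr C" for a1 y
    using G that
    by (intro sweedler_cong sweedler_cocommutative[OF C cc U])
      (simp_all add: quadrilinear_map_def trilinear_map_def bilinear_map_def)
  then show ?thesis
    unfolding regroup[OF F] regroup[OF G] by (rule sweedler_cong)
qed

lemma sweedler_fubini:
  assumes A: "coalgebra A" and K: "coalgebra K" and U: "vspace U" and F: "quadrilinear_map A A K K U F"
    and a: "a \<in> carr A" and k: "k \<in> carr K"
  shows "sweedler A (\<lambda>a1 a2. sweedler K (\<lambda>k1 k2. F a1 a2 k1 k2) k) a
    = sweedler K (\<lambda>k1 k2. sweedler A (\<lambda>a1 a2. F a1 a2 k1 k2) a) k"
proof -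
  note VA = coalgebra_vspace[OF A] and VK = coalgebra_vspace[OF K]
  let ?T = "tensor_space K K"
  have b: "bilinear_map K K U (F a1 a2)" if "a1 \<in> carr A" "a2 \<in> carr A" for a1 a2
    using F that by (simp add: quadrilinear_map_def trilinear_map_def)
  have tri: "trilinear_map A A ?T U (\<lambda>a1 a2 t. tlift K K (F a1 a2) t)"
    using F
    by (intro trilinear_mapI linear_map_tlift_param[OF VA VK VK U] linear_tlift[OF VK VK U] b; assumption?)
      (simp_all add: quadrilinear_map_def trilinear_map_def bilinear_map_def)
  have bA: "bilinear_map A A U (\<lambda>a1 a2. F a1 a2 k1 k2)" if "k1 \<in> carr K" "k2 \<in> carr K" for k1 k2
    using F that by (simp add: quadrilinear_map_def trilinear_map_def bilinear_map_def)
  have b2: "bilinear_map K K U (\<lambda>k1 k2. sweedler A (\<lambda>a1 a2. F a1 a2 k1 k2) a)"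
    using F
    by (intro bilinear_mapI linear_sweedler_param[OF A VK U _ a] trilinear_mapI)
      (simp_all add: quadrilinear_map_def trilinear_map_def bilinear_map_def)
  \<comment> \<open>Generalised from \<open>comult K k\<close> to an arbitrary tensor
    \<open>t\<close>: both sides are linear in \<open>t\<close>, so elementary tensors
    suffice.\<close>
  have "sweedler A (\<lambda>a1 a2. tlift K K (F a1 a2) t) a = tlift K K (\<lambda>k1 k2. sweedler A (\<lambda>a1 a2. F a1 a2 k1 k2) a) t"
    if "t \<in> carr ?T" for t
  proof (rule tensor_space_linear_eq[OF VK VK _ linear_tlift[OF VK VK U b2] _ that])
    show "linear_map ?T U (\<lambda>t. sweedler A (\<lambda>a1 a2. tlift K K (F a1 a2) t) a)"
      by (rule bilinear_map_right[OF bilinear_sweedler_left[OF A vspace_tensor_space U tri] a])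
    show "sweedler A (\<lambda>a1 a2. tlift K K (F a1 a2) (tens K K k1 k2)) a
        = tlift K K (\<lambda>k1 k2. sweedler A (\<lambda>a1 a2. F a1 a2 k1 k2) a) (tens K K k1 k2)"
      if "k1 \<in> carr K" "k2 \<in> carr K" for k1 k2
      unfolding tlift_tens[OF VK VK U b2 that]
      by (rule sweedler_cong) (rule tlift_tens[OF VK VK U b that])
  qed
  then show ?thesis
    unfolding sweedler_def[of K] using linear_map_carr[OF linear_comult[OF K] k] by blast
qed

section \<open>Coalgebra maps and convolution\<close>

lemma coalgebra_map_linear: "coalgebra_map C D f \<Longrightarrow> linear_map C D f"
  and coalgebra_map_counit: "coalgebra_map C D f \<Longrightarrow> x \<in> carr C \<Longrightarrow> counit D (f x) = counit C x"
  and coalgebra_map_carr: "coalgebra_map C D f \<Longrightarrow> x \<in> carr C \<Longrightarrow> f x \<in> carr D"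
  by (simp_all add: coalgebra_map_def linear_map_def)

lemma sweedler_coalgebra_map:
  assumes C: "coalgebra C" and D: "vspace D" and f: "coalgebra_map C D f" and U: "vspace U"
    and F: "bilinear_map D D U F" and x: "x \<in> carr C"
  shows "sweedler D F (f x) = sweedler C (\<lambda>a b. F (f a) (f b)) x"
proof -
  note l = coalgebra_map_linear[OF f]
  have "sweedler D F (f x) = tlift D D F (sweedler C (\<lambda>a b. tens D D (f a) (f b)) x)"
    using f x by (simp add: sweedler_def[of D] coalgebra_map_def)
  also have "\<dots> = sweedler C (\<lambda>a b. F (f a) (f b)) x"
    by (rule tlift_sweedler_tens[OF C D D U F l l x])
  finally show ?thesis .
qed

lemma coalgebra_map_comp:
  assumes C: "coalgebra C" and D: "coalgebra D" and E: "vspace E"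
    and f: "coalgebra_map C D f" and g: "coalgebra_map D E g"
  shows "coalgebra_map C E (\<lambda>x. g (f x))"
  unfolding coalgebra_map_def
proof (intro conjI ballI)
  note lg = coalgebra_map_linear[OF g]
  show "linear_map C E (\<lambda>x. g (f x))"
    by (rule linear_map_comp[OF lg coalgebra_map_linear[OF f]])
  show "counit E (g (f x)) = counit C x" if "x \<in> carr C" for x
    using that f g by (simp add: coalgebra_map_counit[OF f] coalgebra_map_counit[OF g] coalgebra_map_carr[OF f])
  fix x assume x: "x \<in> carr C"
  have "comult E (g (f x)) = sweedler D (\<lambda>a b. tens E E (g a) (g b)) (f x)"
    using g coalgebra_map_carr[OF f x] by (simp add: coalgebra_map_def)
  also have "\<dots> = sweedler C (\<lambda>a b. tens E E (g (f a)) (g (f b))) x"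
    by (rule sweedler_coalgebra_map[OF C coalgebra_vspace[OF D] f vspace_tensor_space
          bilinear_map_comp[OF bilinear_tens lg lg] x])
  finally show "comult E (g (f x)) = sweedler C (\<lambda>a b. tens E E (g (f a)) (g (f b))) x" .
qed

lemma coalgebra_map_ident: "coalgebra C \<Longrightarrow> coalgebra_map C C (\<lambda>x. x)"
  by (simp add: coalgebra_map_def linear_map_ident sweedler_tens_self)

lemma coalgebra_map_cong:
  assumes C: "coalgebra C" and f: "coalgebra_map C D f" and "\<And>x. x \<in> carr C \<Longrightarrow> f x = g x"
  shows "coalgebra_map C D g"
proof -
  have "linear_map C D g"
    by (rule linear_map_cong[OF coalgebra_vspace[OF C] coalgebra_map_linear[OF f] assms(3)])
  moreover have "sweedler C (\<lambda>a b. tens D D (f a) (f b)) x = sweedler C (\<lambda>a b. tens D D (g a) (g b)) x" for x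
    by (rule sweedler_cong) (simp add: assms(3))
  ultimately show ?thesis using f assms(3) by (simp add: coalgebra_map_def)
qed

text \<open>Convolution products are set to \<open>0\<close> off the carrier, so that equality on the carrier is
  equality of functions.\<close>

definition convol ::
  "('k::field, 'c::ab_group_add, 'z) bialg_scheme \<Rightarrow> ('a \<Rightarrow> 'b \<Rightarrow> 'u::ab_group_add) \<Rightarrow>
    ('c \<Rightarrow> 'a) \<Rightarrow> ('c \<Rightarrow> 'b) \<Rightarrow> 'c \<Rightarrow> 'u" where
  "convol C \<mu> f g = (\<lambda>x. if x \<in> carr C then sweedler C (\<lambda>a b. \<mu> (f a) (g b)) x else 0)"

lemma convol_outside [simp]: "x \<notin> carr C \<Longrightarrow> convol C \<mu> f g x = 0"
  and convol_inside: "x \<in> carr C \<Longrightarrow> convol C \<mu> f g x = sweedler C (\<lambda>a b. \<mu> (f a) (g b)) x"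
  by (simp_all add: convol_def)

lemma convol_cong:
  assumes "\<And>a b. a \<in> carr C \<Longrightarrow> b \<in> carr C \<Longrightarrow> \<mu> (f a) (g b) = \<mu>' (f' a) (g' b)"
  shows "convol C \<mu> f g = convol C \<mu>' f' g'"
  unfolding convol_def using sweedler_cong[of C, OF assms] by (simp add: fun_eq_iff)

lemma linear_convol:
  assumes C: "coalgebra C" and U: "vspace U" and \<mu>: "bilinear_map A K U \<mu>"
    and f: "linear_map C A f" and g: "linear_map C K g"
  shows "linear_map C U (convol C \<mu> f g)"
  by (rule linear_map_cong[OF coalgebra_vspace[OF C] linear_sweedler[OF C U bilinear_map_comp[OF \<mu> f g]]])
    (simp add: convol_inside)

lemma linear_comp_convol:
  assumes C: "coalgebra C" and U: "vspace U" and U': "vspace U'" and \<mu>: "bilinear_map A K U \<mu>"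
    and f: "linear_map C A f" and g: "linear_map C K g" and h: "linear_map U U' h"
  shows "(\<lambda>x. h (convol C \<mu> f g x)) = convol C (\<lambda>a b. h (\<mu> a b)) f g"
  using linear_comp_sweedler[OF C U U' bilinear_map_comp[OF \<mu> f g] h] linear_map_zero[OF U h]
  by (simp add: convol_def fun_eq_iff)

text \<open>Stated for four bilinear maps instead of one product. In this form it also covers the
  mixed products \<open>mult_left\<close>, \<open>mult_right\<close> and \<open>act\<close> on the
  double cross product and the pairing by \<open>tens\<close>.\<close>

lemma convol_assoc:
  assumes C: "coalgebra C" and X: "vspace X" and Y: "vspace Y" and U: "vspace U"
    and f: "linear_map C A f" and g: "linear_map C K g" and h: "linear_map C E h"
    and \<nu>: "bilinear_map A K X \<nu>" and \<mu>: "bilinear_map X E U \<mu>"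
    and \<nu>': "bilinear_map K E Y \<nu>'" and \<mu>': "bilinear_map A Y U \<mu>'"
    and eq: "\<And>a k e. a \<in> carr A \<Longrightarrow> k \<in> carr K \<Longrightarrow> e \<in> carr E \<Longrightarrow> \<mu> (\<nu> a k) e = \<mu>' a (\<nu>' k e)"
  shows "convol C \<mu> (convol C \<nu> f g) h = convol C \<mu>' f (convol C \<nu>' g h)"
proof
  fix x
  note V = coalgebra_vspace[OF C]
  note fc = linear_map_carr[OF f] and gc = linear_map_carr[OF g] and hc = linear_map_carr[OF h]
  define F where "F = (\<lambda>a b c. \<mu> (\<nu> (f a) (g b)) (h c))"
  have F_eq: "F a b c = \<mu>' (f a) (\<nu>' (g b) (h c))" if "a \<in> carr C" "b \<in> carr C" "c \<in> carr C" for a b c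
    unfolding F_def by (rule eq) (use that fc gc hc in auto)
  have tri: "trilinear_map C C C U F"
    unfolding F_def
  proof (rule trilinear_mapI)
    show "linear_map C U (\<lambda>a. \<mu> (\<nu> (f a) (g b)) (h c))" if "b \<in> carr C" "c \<in> carr C" for b c
      by (rule bilinear_map_comp_left[OF \<mu> bilinear_map_comp_left[OF \<nu> f gc[OF that(1)]] hc[OF that(2)]])
    show "linear_map C U (\<lambda>b. \<mu> (\<nu> (f a) (g b)) (h c))" if "a \<in> carr C" "c \<in> carr C" for a c
      by (rule bilinear_map_comp_left[OF \<mu> bilinear_map_comp_right[OF \<nu> g fc[OF that(1)]] hc[OF that(2)]])
    show "linear_map C U (\<lambda>c. \<mu> (\<nu> (f a) (g b)) (h c))" if "a \<in> carr C" "b \<in> carr C" for a b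
      by (rule bilinear_map_comp_right[OF \<mu> h bilinear_map_carr[OF \<nu> fc[OF that(1)] gc[OF that(2)]]])
  qed
  show "convol C \<mu> (convol C \<nu> f g) h x = convol C \<mu>' f (convol C \<nu>' g h) x"
  proof (cases "x \<in> carr C")
    case x: True
    have "convol C \<mu> (convol C \<nu> f g) h x = sweedler C (\<lambda>y c. sweedler C (\<lambda>a b. F a b c) y) x"
      unfolding convol_inside[OF x]
    proof (rule sweedler_cong)
      fix y c assume "y \<in> carr C" "c \<in> carr C"
      then show "\<mu> (convol C \<nu> f g y) (h c) = sweedler C (\<lambda>a b. F a b c) y"
        using linear_comp_sweedler[OF C X U bilinear_map_comp[OF \<nu> f g] bilinear_map_left[OF \<mu> hc]]
        by (simp add: convol_inside F_def)
    qed
    also have "\<dots> = sweedler C (\<lambda>a y. sweedler C (F a) y) x"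
      by (rule sweedler_coassoc[OF C U tri x])
    also have "\<dots> = convol C \<mu>' f (convol C \<nu>' g h) x"
      unfolding convol_inside[OF x]
    proof (rule sweedler_cong)
      fix a y assume a: "a \<in> carr C" and y: "y \<in> carr C"
      have "sweedler C (F a) y = sweedler C (\<lambda>b c. \<mu>' (f a) (\<nu>' (g b) (h c))) y"
        by (rule sweedler_cong) (rule F_eq[OF a])
      also have "\<dots> = \<mu>' (f a) (convol C \<nu>' g h y)"
        using linear_comp_sweedler[OF C Y U bilinear_map_comp[OF \<nu>' g h] bilinear_map_right[OF \<mu>' fc[OF a]] y]
        by (simp add: convol_inside y)
      finally show "sweedler C (F a) y = \<mu>' (f a) (convol C \<nu>' g h y)" .
    qed
    finally show ?thesis .
  qed simp
qed

lemma convol_commute: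
  assumes C: "coalgebra C" and cc: "cocommutative C" and U: "vspace U" and \<mu>: "bilinear_map A K U \<mu>"
    and f: "linear_map C A f" and g: "linear_map C K g"
  shows "convol C \<mu> f g = convol C (\<lambda>a b. \<mu> b a) g f"
  using sweedler_cocommutative[OF C cc U bilinear_map_comp[OF \<mu> f g]]
  by (simp add: convol_def fun_eq_iff)

text \<open>Expands an expression in two convolutions into its four legs, the form on which
  \<open>sweedler_interchange\<close> acts.\<close>

lemma bilinear_convol_convol:
  assumes C: "coalgebra C" and X: "vspace X" and X': "vspace X'" and U: "vspace U"
    and f: "linear_map C A f" and g: "linear_map C K g" and h: "linear_map C E h" and k: "linear_map C L k"
    and \<nu>: "bilinear_map A K X \<nu>" and \<nu>': "bilinear_map E L X' \<nu>'" and \<mu>: "bilinear_map X X' U \<mu>"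
    and a: "a \<in> carr C" and b: "b \<in> carr C"
  shows "\<mu> (convol C \<nu> f g a) (convol C \<nu>' h k b)
      = sweedler C (\<lambda>a1 a2. sweedler C (\<lambda>b1 b2. \<mu> (\<nu> (f a1) (g a2)) (\<nu>' (h b1) (k b2))) b) a"
proof -
  have "\<mu> (convol C \<nu> f g a) (convol C \<nu>' h k b)
    = sweedler C (\<lambda>a1 a2. \<mu> (\<nu> (f a1) (g a2)) (convol C \<nu>' h k b)) a"
    using linear_comp_sweedler[OF C X U bilinear_map_comp[OF \<nu> f g]
        bilinear_map_left[OF \<mu> linear_map_carr[OF linear_convol[OF C X' \<nu>' h k] b]] a]
    by (simp add: convol_inside a)
  also have "\<dots> = sweedler C (\<lambda>a1 a2. sweedler C (\<lambda>b1 b2. \<mu> (\<nu> (f a1) (g a2)) (\<nu>' (h b1) (k b2))) b) a"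
  proof (rule sweedler_cong)
    fix a1 a2 assume "a1 \<in> carr C" "a2 \<in> carr C"
    then have "\<nu> (f a1) (g a2) \<in> carr X"
      by (intro bilinear_map_carr[OF \<nu>] linear_map_carr[OF f] linear_map_carr[OF g])
    from linear_comp_sweedler[OF C X' U bilinear_map_comp[OF \<nu>' h k] bilinear_map_right[OF \<mu> this] b]
    show "\<mu> (\<nu> (f a1) (g a2)) (convol C \<nu>' h k b)
      = sweedler C (\<lambda>b1 b2. \<mu> (\<nu> (f a1) (g a2)) (\<nu>' (h b1) (k b2))) b"
      by (simp add: convol_inside b)
  qed
  finally show ?thesis .
qed

text \<open>Cocommutativity enters through \<open>sweedler_interchange\<close>: the four maps sit on
  four legs, and the inner two change places.\<close>

lemma convol_interchange:
  assumes C: "coalgebra C" and cc: "cocommutative C"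
    and X: "vspace X" and X': "vspace X'" and Y: "vspace Y" and Y': "vspace Y'" and U: "vspace U"
    and f: "linear_map C A f" and g: "linear_map C K g" and h: "linear_map C E h" and k: "linear_map C L k"
    and \<nu>: "bilinear_map A K X \<nu>" and \<nu>': "bilinear_map E L X' \<nu>'" and \<mu>: "bilinear_map X X' U \<mu>"
    and \<sigma>: "bilinear_map A E Y \<sigma>" and \<sigma>': "bilinear_map K L Y' \<sigma>'" and \<mu>': "bilinear_map Y Y' U \<mu>'"
    and eq: "\<And>a b c d. a \<in> carr A \<Longrightarrow> b \<in> carr K \<Longrightarrow> c \<in> carr E \<Longrightarrow> d \<in> carr L \<Longrightarrow>
      \<mu> (\<nu> a b) (\<nu>' c d) = \<mu>' (\<sigma> a c) (\<sigma>' b d)"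
  shows "convol C \<mu> (convol C \<nu> f g) (convol C \<nu>' h k) = convol C \<mu>' (convol C \<sigma> f h) (convol C \<sigma>' g k)"
proof
  fix x
  note carr = linear_map_carr[OF f] linear_map_carr[OF g] linear_map_carr[OF h] linear_map_carr[OF k]
  define F where "F = (\<lambda>a b c d. \<mu> (\<nu> (f a) (g b)) (\<nu>' (h c) (k d)))"
  have quad: "quadrilinear_map C C C C U F"
    unfolding F_def
  proof (rule quadrilinear_mapI)
    fix a b c d assume *: "b \<in> carr C" "c \<in> carr C" "d \<in> carr C"
    show "linear_map C U (\<lambda>a. \<mu> (\<nu> (f a) (g b)) (\<nu>' (h c) (k d)))"
      by (rule bilinear_map_comp_left[OF \<mu> bilinear_map_comp_left[OF \<nu> f]])
        (auto intro: bilinear_map_carr[OF \<nu>'] carr *)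
  next
    fix a b c d assume *: "a \<in> carr C" "c \<in> carr C" "d \<in> carr C"
    show "linear_map C U (\<lambda>b. \<mu> (\<nu> (f a) (g b)) (\<nu>' (h c) (k d)))"
      by (rule bilinear_map_comp_left[OF \<mu> bilinear_map_comp_right[OF \<nu> g]])
        (auto intro: bilinear_map_carr[OF \<nu>'] carr *)
  next
    fix a b c d assume *: "a \<in> carr C" "b \<in> carr C" "d \<in> carr C"
    show "linear_map C U (\<lambda>c. \<mu> (\<nu> (f a) (g b)) (\<nu>' (h c) (k d)))"
      by (rule bilinear_map_comp_right[OF \<mu> bilinear_map_comp_left[OF \<nu>' h]])
        (auto intro: bilinear_map_carr[OF \<nu>] carr *)
  next
    fix a b c d assume *: "a \<in> carr C" "b \<in> carr C" "c \<in> carr C"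
    show "linear_map C U (\<lambda>d. \<mu> (\<nu> (f a) (g b)) (\<nu>' (h c) (k d)))"
      by (rule bilinear_map_comp_right[OF \<mu> bilinear_map_comp_right[OF \<nu>' k]])
        (auto intro: bilinear_map_carr[OF \<nu>] carr *)
  qed
  show "convol C \<mu> (convol C \<nu> f g) (convol C \<nu>' h k) x = convol C \<mu>' (convol C \<sigma> f h) (convol C \<sigma>' g k) x"
  proof (cases "x \<in> carr C")
    case x: True
    have "convol C \<mu> (convol C \<nu> f g) (convol C \<nu>' h k) x
      = sweedler C (\<lambda>a b. sweedler C (\<lambda>a1 a2. sweedler C (\<lambda>b1 b2. F a1 a2 b1 b2) b) a) x"
      unfolding convol_inside[OF x] F_def
      by (rule sweedler_cong) (rule bilinear_convol_convol[OF C X X' U f g h k \<nu> \<nu>' \<mu>])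
    also have "\<dots> = sweedler C (\<lambda>a b. sweedler C (\<lambda>a1 a2. sweedler C (\<lambda>b1 b2. F a1 b1 a2 b2) b) a) x"
      by (rule sweedler_interchange[OF C cc U quad x])
    also have "\<dots> = convol C \<mu>' (convol C \<sigma> f h) (convol C \<sigma>' g k) x"
      unfolding convol_inside[OF x]
    proof (rule sweedler_cong)
      fix a b assume ab: "a \<in> carr C" "b \<in> carr C"
      have "sweedler C (\<lambda>a1 a2. sweedler C (\<lambda>b1 b2. F a1 b1 a2 b2) b) a
        = sweedler C (\<lambda>a1 a2. sweedler C (\<lambda>b1 b2. \<mu>' (\<sigma> (f a1) (h a2)) (\<sigma>' (g b1) (k b2))) b) a"
        unfolding F_def by (intro sweedler_cong eq carr)
      also have "\<dots> = \<mu>' (convol C \<sigma> f h a) (convol C \<sigma>' g k b)"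
        by (rule bilinear_convol_convol[OF C Y Y' U f h g k \<sigma> \<sigma>' \<mu>' ab, symmetric])
      finally show "sweedler C (\<lambda>a1 a2. sweedler C (\<lambda>b1 b2. F a1 b1 a2 b2) b) a
        = \<mu>' (convol C \<sigma> f h a) (convol C \<sigma>' g k b)" .
    qed
    finally show ?thesis .
  qed simp
qed

section \<open>Tensor products of coalgebras\<close>

text \<open>Expresses that the induced linear map on A \<otimes> K is a coalgebra map, on elementary
  tensors and without naming a coalgebra record on the tensor product.\<close>

definition coalg_bimap where
  "coalg_bimap A K D \<mu> \<longleftrightarrow> bilinear_map A K D \<mu> \<and>
    (\<forall>a\<in>carr A. \<forall>k\<in>carr K.
      comult D (\<mu> a k) = sweedler A (\<lambda>a1 a2. sweedler K (\<lambda>k1 k2. tens D D (\<mu> a1 k1) (\<mu> a2 k2)) k) a \<and>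
      counit D (\<mu> a k) = counit A a * counit K k)"

lemma coalg_bimap_bilinear: "coalg_bimap A K D \<mu> \<Longrightarrow> bilinear_map A K D \<mu>"
  by (simp add: coalg_bimap_def)

lemma coalg_bimap_cong:
  assumes A: "coalgebra A" and K: "coalgebra K" and \<mu>: "coalg_bimap A K D \<mu>"
    and eq: "\<And>a k. a \<in> carr A \<Longrightarrow> k \<in> carr K \<Longrightarrow> \<mu> a k = \<nu> a k"
  shows "coalg_bimap A K D \<nu>"
proof -
  have "sweedler A (\<lambda>a1 a2. sweedler K (\<lambda>k1 k2. tens D D (\<mu> a1 k1) (\<mu> a2 k2)) k) a
    = sweedler A (\<lambda>a1 a2. sweedler K (\<lambda>k1 k2. tens D D (\<nu> a1 k1) (\<nu> a2 k2)) k) a" for a k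
    by (intro sweedler_cong) (simp add: eq)
  then show ?thesis
    using \<mu> eq bilinear_map_cong[OF coalgebra_vspace[OF A] coalgebra_vspace[OF K] coalg_bimap_bilinear[OF \<mu>] eq]
    by (simp add: coalg_bimap_def)
qed

lemma quadrilinear_bilinear_bilinear:
  assumes \<mu>: "bilinear_map A K X \<mu>" and \<nu>: "bilinear_map A' K' X' \<nu>" and F: "bilinear_map X X' U F"
  shows "quadrilinear_map A A' K K' U (\<lambda>a1 a2 k1 k2. F (\<mu> a1 k1) (\<nu> a2 k2))"
proof (rule quadrilinear_mapI)
  fix a1 a2 k1 k2
  assume *: "a2 \<in> carr A'" "k1 \<in> carr K" "k2 \<in> carr K'"
  show "linear_map A U (\<lambda>a1. F (\<mu> a1 k1) (\<nu> a2 k2))"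
    by (rule bilinear_map_comp_left[OF F bilinear_map_left[OF \<mu>]]) (auto intro: bilinear_map_carr[OF \<nu>] *)
next
  fix a1 a2 k1 k2
  assume *: "a1 \<in> carr A" "k1 \<in> carr K" "k2 \<in> carr K'"
  show "linear_map A' U (\<lambda>a2. F (\<mu> a1 k1) (\<nu> a2 k2))"
    by (rule bilinear_map_comp_right[OF F bilinear_map_left[OF \<nu>]]) (auto intro: bilinear_map_carr[OF \<mu>] *)
next
  fix a1 a2 k1 k2
  assume *: "a1 \<in> carr A" "a2 \<in> carr A'" "k2 \<in> carr K'"
  show "linear_map K U (\<lambda>k1. F (\<mu> a1 k1) (\<nu> a2 k2))"
    by (rule bilinear_map_comp_left[OF F bilinear_map_right[OF \<mu>]]) (auto intro: bilinear_map_carr[OF \<nu>] *)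
next
  fix a1 a2 k1 k2
  assume *: "a1 \<in> carr A" "a2 \<in> carr A'" "k1 \<in> carr K"
  show "linear_map K' U (\<lambda>k2. F (\<mu> a1 k1) (\<nu> a2 k2))"
    by (rule bilinear_map_comp_right[OF F bilinear_map_right[OF \<nu>]]) (auto intro: bilinear_map_carr[OF \<mu>] *)
qed

lemma quadrilinear_map_34:
  "quadrilinear_map A B C D U F \<Longrightarrow> a \<in> carr A \<Longrightarrow> b \<in> carr B \<Longrightarrow> bilinear_map C D U (F a b)"
  by (simp add: quadrilinear_map_def trilinear_map_def)

lemma linear_comp_sweedler_sweedler:
  assumes A: "coalgebra A" and K: "coalgebra K" and U: "vspace U" and U': "vspace U'"
    and F: "quadrilinear_map A A K K U F" and h: "linear_map U U' h"
    and a: "a \<in> carr A" and k: "k \<in> carr K"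
  shows "h (sweedler A (\<lambda>a1 a2. sweedler K (\<lambda>k1 k2. F a1 a2 k1 k2) k) a)
    = sweedler A (\<lambda>a1 a2. sweedler K (\<lambda>k1 k2. h (F a1 a2 k1 k2)) k) a"
proof -
  have "h (sweedler A (\<lambda>a1 a2. sweedler K (F a1 a2) k) a) = sweedler A (\<lambda>a1 a2. h (sweedler K (F a1 a2) k)) a"
    by (rule linear_comp_sweedler[OF A U U' trilinear_map_12[OF
          trilinear_sweedler_last[OF K coalgebra_vspace[OF A] coalgebra_vspace[OF A] U F] k] h a])
  also have "\<dots> = sweedler A (\<lambda>a1 a2. sweedler K (\<lambda>k1 k2. h (F a1 a2 k1 k2)) k) a"
    using F by (intro sweedler_cong linear_comp_sweedler[OF K U U' _ h k])
      (simp add: quadrilinear_map_def trilinear_map_def)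
  finally show ?thesis .
qed

lemma sweedler_coalg_bimap:
  assumes A: "coalgebra A" and K: "coalgebra K" and D: "vspace D" and U: "vspace U"
    and \<mu>: "coalg_bimap A K D \<mu>" and F: "bilinear_map D D U F"
    and a: "a \<in> carr A" and k: "k \<in> carr K"
  shows "sweedler D F (\<mu> a k)
    = sweedler A (\<lambda>a1 a2. sweedler K (\<lambda>k1 k2. F (\<mu> a1 k1) (\<mu> a2 k2)) k) a"
proof -
  note b = coalg_bimap_bilinear[OF \<mu>]
  have "sweedler D F (\<mu> a k)
    = tlift D D F (sweedler A (\<lambda>a1 a2. sweedler K (\<lambda>k1 k2. tens D D (\<mu> a1 k1) (\<mu> a2 k2)) k) a)"
    using \<mu> a k by (simp add: sweedler_def[of D] coalg_bimap_def)
  also have "\<dots> = sweedler A (\<lambda>a1 a2. sweedler K (\<lambda>k1 k2. tlift D D F (tens D D (\<mu> a1 k1) (\<mu> a2 k2))) k) a"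
    by (rule linear_comp_sweedler_sweedler[OF A K vspace_tensor_space U
          quadrilinear_bilinear_bilinear[OF b b bilinear_tens] linear_tlift[OF D D U F] a k])
  also have "\<dots> = sweedler A (\<lambda>a1 a2. sweedler K (\<lambda>k1 k2. F (\<mu> a1 k1) (\<mu> a2 k2)) k) a"
    by (intro sweedler_cong tlift_tens[OF D D U F] bilinear_map_carr[OF b])
  finally show ?thesis .
qed

text \<open>This closure makes the coalgebra maps into a Hopf algebra a group. Comultiplying a value
  \<open>\<mu> (f a) (g b)\<close> pairs the legs of \<open>a\<close> with those of
  \<open>b\<close>, whereas the claim pairs neighbouring legs; \<open>sweedler_interchange\<close>
  passes from one order to the other.\<close>

lemma coalgebra_map_convol:
  assumes C: "coalgebra C" and cc: "cocommutative C" and A: "coalgebra A" and K: "coalgebra K"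
    and D: "coalgebra D" and \<mu>: "coalg_bimap A K D \<mu>"
    and f: "coalgebra_map C A f" and g: "coalgebra_map C K g"
  shows "coalgebra_map C D (convol C \<mu> f g)"
  unfolding coalgebra_map_def
proof (intro conjI ballI)
  note b = coalg_bimap_bilinear[OF \<mu>] and lf = coalgebra_map_linear[OF f] and lg = coalgebra_map_linear[OF g]
  note VD = coalgebra_vspace[OF D] and VA = coalgebra_vspace[OF A] and VK = coalgebra_vspace[OF K]
  note Tv = vspace_tensor_space
  note bfg = bilinear_map_comp[OF b lf lg]
  show "linear_map C D (convol C \<mu> f g)"
    by (rule linear_convol[OF C VD b lf lg])
  fix x assume x: "x \<in> carr C"
  let ?T = "tensor_space D D"
  have "comult D (convol C \<mu> f g x) = sweedler C (\<lambda>a b. comult D (\<mu> (f a) (g b))) x"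
    unfolding convol_inside[OF x]
    by (rule linear_comp_sweedler[OF C VD Tv bfg linear_comult[OF D] x])
  also have "\<dots> = sweedler C (\<lambda>a b. sweedler C (\<lambda>a1 a2. sweedler C (\<lambda>b1 b2.
      tens D D (\<mu> (f a1) (g b1)) (\<mu> (f a2) (g b2))) b) a) x"
  proof (rule sweedler_cong)
    fix p q assume p: "p \<in> carr C" and q: "q \<in> carr C"
    note fp = linear_map_carr[OF lf p] and gq = linear_map_carr[OF lg q]
    note Q = quadrilinear_bilinear_bilinear[OF b b bilinear_tens]
    have "comult D (\<mu> (f p) (g q))
      = sweedler A (\<lambda>a1 a2. sweedler K (\<lambda>k1 k2. tens D D (\<mu> a1 k1) (\<mu> a2 k2)) (g q)) (f p)"
      using \<mu> fp gq by (simp add: coalg_bimap_def)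
    also have "\<dots> = sweedler C (\<lambda>a1 a2. sweedler K (\<lambda>k1 k2. tens D D (\<mu> (f a1) k1) (\<mu> (f a2) k2)) (g q)) p"
      by (rule sweedler_coalgebra_map[OF C VA f Tv trilinear_map_12[OF
            trilinear_sweedler_last[OF K VA VA Tv Q] gq] p])
    also have "\<dots> = sweedler C (\<lambda>a1 a2. sweedler C (\<lambda>b1 b2. tens D D (\<mu> (f a1) (g b1)) (\<mu> (f a2) (g b2))) q) p"
      by (rule sweedler_cong)
        (rule sweedler_coalgebra_map[OF C VK g Tv quadrilinear_map_34[OF Q] q]; rule linear_map_carr[OF lf])
    finally show "comult D (\<mu> (f p) (g q)) = sweedler C (\<lambda>a1 a2. sweedler C (\<lambda>b1 b2.
      tens D D (\<mu> (f a1) (g b1)) (\<mu> (f a2) (g b2))) q) p" .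
  qed
  also have "\<dots> = sweedler C (\<lambda>a b. sweedler C (\<lambda>a1 a2. sweedler C (\<lambda>b1 b2.
      tens D D (\<mu> (f a1) (g a2)) (\<mu> (f b1) (g b2))) b) a) x"
    by (rule sweedler_interchange[OF C cc Tv quadrilinear_bilinear_bilinear[OF bfg bfg bilinear_tens] x])
  also have "\<dots> = sweedler C (\<lambda>a b. tens D D (convol C \<mu> f g a) (convol C \<mu> f g b)) x"
    by (rule sweedler_cong) (rule bilinear_convol_convol[OF C VD VD Tv lf lg lf lg b b bilinear_tens, symmetric])
  finally show "comult D (convol C \<mu> f g x)
    = sweedler C (\<lambda>a b. tens D D (convol C \<mu> f g a) (convol C \<mu> f g b)) x" .
  have "counit D (convol C \<mu> f g x) = sweedler C (\<lambda>a b. counit D (\<mu> (f a) (g b))) x"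
    unfolding convol_inside[OF x]
    by (rule linear_comp_sweedler[OF C VD vspace_base_field bfg linear_counit[OF D] x])
  also have "\<dots> = sweedler C (\<lambda>a b. scl base_field (counit C a) (counit C b)) x"
    using \<mu> coalgebra_map_carr[OF f] coalgebra_map_carr[OF g]
    by (intro sweedler_cong) (simp add: coalg_bimap_def coalgebra_map_counit[OF f] coalgebra_map_counit[OF g])
  also have "\<dots> = counit C x"
    by (rule sweedler_counit_left[OF C vspace_base_field linear_counit[OF C] x])
  finally show "counit D (convol C \<mu> f g x) = counit C x" .
qed

text \<open>A predicate on the record \<open>T\<close>, so that one proof covers the bare tensor
  coalgebra \<open>tcoalg\<close> and the double cross product \<open>H_bowtie\<close>, which carry
  the same kind of coalgebra but different products.\<close>

definition tensor_coalg where
  "tensor_coalg A K T \<longleftrightarrow> carr T = carr (tensor_space A K) \<and> scl T = scl (tensor_space A K) \<and>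
    comult T = tlift A K (\<lambda>a x. sweedler A (\<lambda>a1 a2. sweedler K (\<lambda>x1 x2.
      tens (tensor_space A K) (tensor_space A K) (tens A K a1 x1) (tens A K a2 x2)) x) a) \<and>
    counit T = tlift A K (\<lambda>a x. counit A a * counit K x)"

lemma tensor_coalg_double_cross_bialg: "tensor_coalg A K (double_cross_bialg A K l r)"
  by (simp add: tensor_coalg_def double_cross_bialg_def)

context
  fixes A :: "('k::field, 'a::ab_group_add, 'x) bialg_scheme"
    and K :: "('k, 'b::ab_group_add, 'y) bialg_scheme"
    and T :: "('k, ('k, 'a, 'b) tensor, 'z) bialg_scheme"
  assumes A: "coalgebra A" and K: "coalgebra K" and T: "tensor_coalg A K T"
begin

private lemma VA: "vspace A" and VK: "vspace K"
  using A K by (simp_all add: coalgebra_vspace)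

private lemma carr_T: "carr T = carr (tensor_space A K)" and scl_T: "scl T = scl (tensor_space A K)"
  using T by (simp_all add: tensor_coalg_def)

lemma vspace_tensor_coalg: "vspace T"
  using vspace_cong_space[OF carr_T scl_T] vspace_tensor_space by blast

lemma bilinear_tens_coalg: "bilinear_map A K T (tens A K)"
  using bilinear_map_cong_space[OF refl refl refl refl carr_T scl_T, of A K] bilinear_tens by blast

lemma tens_in_tensor_coalg: "a \<in> carr A \<Longrightarrow> k \<in> carr K \<Longrightarrow> tens A K a k \<in> carr T"
  by (rule bilinear_map_carr[OF bilinear_tens_coalg])

private lemma tens_T: "tens (tensor_space A K) (tensor_space A K) = tens T T"
  by (rule tens_cong_space) (simp_all add: scl_T)

lemma tensor_coalg_linear_eq:
  assumes "linear_map T U f" "linear_map T U' g"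
    and "\<And>a k. a \<in> carr A \<Longrightarrow> k \<in> carr K \<Longrightarrow> f (tens A K a k) = g (tens A K a k)"
    and "t \<in> carr T"
  shows "f t = g t"
  using tensor_space_linear_eq[OF VA VK, of U f U' g t] assms
  by (simp add: carr_T linear_map_cong_space[OF carr_T scl_T refl refl])

lemma linear_tlift_coalg: "vspace U \<Longrightarrow> bilinear_map A K U F \<Longrightarrow> linear_map T U (tlift A K F)"
  using linear_tlift[OF VA VK] linear_map_cong_space[OF carr_T scl_T refl refl] by blast

private lemma quad_tens: "bilinear_map T T U F \<Longrightarrow>
    quadrilinear_map A A K K U (\<lambda>a1 a2 k1 k2. F (tens A K a1 k1) (tens A K a2 k2))"
  by (rule quadrilinear_bilinear_bilinear[OF bilinear_tens_coalg bilinear_tens_coalg])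

private lemma bil_comult: "bilinear_map A K (tensor_space T T)
    (\<lambda>a k. sweedler A (\<lambda>a1 a2. sweedler K (\<lambda>k1 k2. tens T T (tens A K a1 k1) (tens A K a2 k2)) k) a)"
  by (rule bilinear_sweedler_sweedler[OF A K vspace_tensor_space quad_tens[OF bilinear_tens]])

private lemma bil_counit: "bilinear_map A K base_field (\<lambda>a k. counit A a * counit K k)"
  using bilinear_map_comp[OF bilinear_scl[OF vspace_base_field] linear_counit[OF A] linear_counit[OF K]]
  by simp

lemma coalg_bimap_tens: "coalg_bimap A K T (tens A K)"
  unfolding coalg_bimap_def
proof (intro conjI ballI)
  show "bilinear_map A K T (tens A K)" by (rule bilinear_tens_coalg)
  fix a k assume a: "a \<in> carr A" and k: "k \<in> carr K"
  show "comult T (tens A K a k)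
    = sweedler A (\<lambda>a1 a2. sweedler K (\<lambda>k1 k2. tens T T (tens A K a1 k1) (tens A K a2 k2)) k) a"
    using T tlift_tens[OF VA VK vspace_tensor_space bil_comult a k] by (simp add: tensor_coalg_def tens_T)
  show "counit T (tens A K a k) = counit A a * counit K k"
    using T tlift_tens[OF VA VK vspace_base_field bil_counit a k] by (simp add: tensor_coalg_def)
qed

private lemma linear_comult_T: "linear_map T (tensor_space T T) (comult T)"
  using linear_tlift_coalg[OF vspace_tensor_space bil_comult] T by (simp add: tensor_coalg_def tens_T)

private lemma linear_counit_T: "linear_map T base_field (counit T)"
  using linear_tlift_coalg[OF vspace_base_field bil_counit] T by (simp add: tensor_coalg_def)

lemma sweedler_tens:
  assumes "vspace U" "bilinear_map T T U F" "a \<in> carr A" "k \<in> carr K"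
  shows "sweedler T F (tens A K a k)
    = sweedler A (\<lambda>a1 a2. sweedler K (\<lambda>k1 k2. F (tens A K a1 k1) (tens A K a2 k2)) k) a"
  by (rule sweedler_coalg_bimap[OF A K vspace_tensor_coalg assms(1) coalg_bimap_tens assms(2-4)])

private lemma linear_sweedler_T: "vspace U \<Longrightarrow> bilinear_map T T U F \<Longrightarrow> linear_map T U (sweedler T F)"
  unfolding sweedler_def
  by (rule linear_map_comp[OF linear_tlift[OF vspace_tensor_coalg vspace_tensor_coalg] linear_comult_T])

text \<open>\<open>sweedler_fubini\<close> separates the legs of \<open>a\<close> from those of
  \<open>k\<close>, coassociativity is applied in each factor on its own, and Fubini restores the
  mixed order.\<close>

private lemma coassoc_T:
  assumes U: "vspace U" and F: "trilinear_map T T T U F"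
    and b1: "bilinear_map T T U (\<lambda>y c. sweedler T (\<lambda>p q. F p q c) y)"
    and b2: "bilinear_map T T U (\<lambda>p y. sweedler T (F p) y)"
    and a: "a \<in> carr A" and k: "k \<in> carr K"
  shows "sweedler T (\<lambda>y c. sweedler T (\<lambda>p q. F p q c) y) (tens A K a k)
    = sweedler T (\<lambda>p y. sweedler T (F p) y) (tens A K a k)"
proof -
  note t = tens_in_tensor_coalg
  define G where "G = (\<lambda>a1 k1 a2 k2 a3 k3. F (tens A K a1 k1) (tens A K a2 k2) (tens A K a3 k3))"
  have tl: "k \<in> carr K \<Longrightarrow> linear_map A T (\<lambda>a. tens A K a k)"
    and tr: "a \<in> carr A \<Longrightarrow> linear_map K T (\<lambda>k. tens A K a k)" for a k
    using bilinear_map_left[OF bilinear_tens_coalg] bilinear_map_right[OF bilinear_tens_coalg] by auto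
  note F1 = linear_map_comp[OF trilinear_map_1[OF F]] and F2 = linear_map_comp[OF trilinear_map_2[OF F]]
    and F3 = linear_map_comp[OF trilinear_map_3[OF F]]
  have G: "k1 \<in> carr K \<Longrightarrow> a2 \<in> carr A \<Longrightarrow> k2 \<in> carr K \<Longrightarrow> a3 \<in> carr A \<Longrightarrow> k3 \<in> carr K \<Longrightarrow> linear_map A U (\<lambda>a1. G a1 k1 a2 k2 a3 k3)"
    "a1 \<in> carr A \<Longrightarrow> a2 \<in> carr A \<Longrightarrow> k2 \<in> carr K \<Longrightarrow> a3 \<in> carr A \<Longrightarrow> k3 \<in> carr K \<Longrightarrow> linear_map K U (\<lambda>k1. G a1 k1 a2 k2 a3 k3)"
    "a1 \<in> carr A \<Longrightarrow> k1 \<in> carr K \<Longrightarrow> k2 \<in> carr K \<Longrightarrow> a3 \<in> carr A \<Longrightarrow> k3 \<in> carr K \<Longrightarrow> linear_map A U (\<lambda>a2. G a1 k1 a2 k2 a3 k3)"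
    "a1 \<in> carr A \<Longrightarrow> k1 \<in> carr K \<Longrightarrow> a2 \<in> carr A \<Longrightarrow> a3 \<in> carr A \<Longrightarrow> k3 \<in> carr K \<Longrightarrow> linear_map K U (\<lambda>k2. G a1 k1 a2 k2 a3 k3)"
    "a1 \<in> carr A \<Longrightarrow> k1 \<in> carr K \<Longrightarrow> a2 \<in> carr A \<Longrightarrow> k2 \<in> carr K \<Longrightarrow> k3 \<in> carr K \<Longrightarrow> linear_map A U (\<lambda>a3. G a1 k1 a2 k2 a3 k3)"
    "a1 \<in> carr A \<Longrightarrow> k1 \<in> carr K \<Longrightarrow> a2 \<in> carr A \<Longrightarrow> k2 \<in> carr K \<Longrightarrow> a3 \<in> carr A \<Longrightarrow> linear_map K U (\<lambda>k3. G a1 k1 a2 k2 a3 k3)"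
    for a1 k1 a2 k2 a3 k3
    unfolding G_def using F1[OF t t tl] F1[OF t t tr] F2[OF t t tl] F2[OF t t tr] F3[OF t t tl] F3[OF t t tr]
    by simp_all
  \<comment> \<open>\<open>M\<close> and \<open>N\<close> are the inner sums of the two bracketings
    of the three legs of \<open>k\<close>, with the legs of \<open>a\<close> as parameters.\<close>
  define M where "M = (\<lambda>a1 a2 a3 k' k3. sweedler K (\<lambda>k1 k2. G a1 k1 a2 k2 a3 k3) k')"
  define N where "N = (\<lambda>a1 a2 a3 k1 k'. sweedler K (\<lambda>k2 k3. G a1 k1 a2 k2 a3 k3) k')"
  note tri = trilinear_mapI and param = linear_sweedler_param[OF K _ U] and lin = linear_sweedler[OF K U bilinear_mapI]
  have M: "a2 \<in> carr A \<Longrightarrow> a3 \<in> carr A \<Longrightarrow> k1 \<in> carr K \<Longrightarrow> k2 \<in> carr K \<Longrightarrow> linear_map A U (\<lambda>a1. M a1 a2 a3 k1 k2)"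
    "a1 \<in> carr A \<Longrightarrow> a3 \<in> carr A \<Longrightarrow> k1 \<in> carr K \<Longrightarrow> k2 \<in> carr K \<Longrightarrow> linear_map A U (\<lambda>a2. M a1 a2 a3 k1 k2)"
    "a1 \<in> carr A \<Longrightarrow> a2 \<in> carr A \<Longrightarrow> k1 \<in> carr K \<Longrightarrow> k2 \<in> carr K \<Longrightarrow> linear_map A U (\<lambda>a3. M a1 a2 a3 k1 k2)"
    "a1 \<in> carr A \<Longrightarrow> a2 \<in> carr A \<Longrightarrow> a3 \<in> carr A \<Longrightarrow> k2 \<in> carr K \<Longrightarrow> linear_map K U (\<lambda>k1. M a1 a2 a3 k1 k2)"
    "a1 \<in> carr A \<Longrightarrow> a2 \<in> carr A \<Longrightarrow> a3 \<in> carr A \<Longrightarrow> k1 \<in> carr K \<Longrightarrow> linear_map K U (\<lambda>k2. M a1 a2 a3 k1 k2)"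
    for a1 a2 a3 k1 k2
    unfolding M_def
    by (rule param[OF VA tri] param[OF VK tri] lin; simp add: G)+
  have N: "a2 \<in> carr A \<Longrightarrow> a3 \<in> carr A \<Longrightarrow> k1 \<in> carr K \<Longrightarrow> k2 \<in> carr K \<Longrightarrow> linear_map A U (\<lambda>a1. N a1 a2 a3 k1 k2)"
    "a1 \<in> carr A \<Longrightarrow> a3 \<in> carr A \<Longrightarrow> k1 \<in> carr K \<Longrightarrow> k2 \<in> carr K \<Longrightarrow> linear_map A U (\<lambda>a2. N a1 a2 a3 k1 k2)"
    "a1 \<in> carr A \<Longrightarrow> a2 \<in> carr A \<Longrightarrow> k1 \<in> carr K \<Longrightarrow> k2 \<in> carr K \<Longrightarrow> linear_map A U (\<lambda>a3. N a1 a2 a3 k1 k2)"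
    "a1 \<in> carr A \<Longrightarrow> a2 \<in> carr A \<Longrightarrow> a3 \<in> carr A \<Longrightarrow> k2 \<in> carr K \<Longrightarrow> linear_map K U (\<lambda>k1. N a1 a2 a3 k1 k2)"
    "a1 \<in> carr A \<Longrightarrow> a2 \<in> carr A \<Longrightarrow> a3 \<in> carr A \<Longrightarrow> k1 \<in> carr K \<Longrightarrow> linear_map K U (\<lambda>k2. N a1 a2 a3 k1 k2)"
    for a1 a2 a3 k1 k2
    unfolding N_def
    by (rule param[OF VA tri] param[OF VK tri] lin; simp add: G)+
  have MN: "sweedler K (M a1 a2 a3) k = sweedler K (N a1 a2 a3) k"
    if "a1 \<in> carr A" "a2 \<in> carr A" "a3 \<in> carr A" for a1 a2 a3
    unfolding M_def N_def using that G
    by (intro sweedler_coassoc[OF K U _ k] tri) simp_all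
  have "sweedler T (\<lambda>y c. sweedler T (\<lambda>p q. F p q c) y) (tens A K a k)
    = sweedler A (\<lambda>a' a3. sweedler K (\<lambda>k' k3. sweedler A (\<lambda>a1 a2. M a1 a2 a3 k' k3) a') k) a"
    unfolding sweedler_tens[OF U b1 a k] M_def G_def
    by (intro sweedler_cong sweedler_tens[OF U trilinear_map_12[OF F]] t)
  also have "\<dots> = sweedler A (\<lambda>a' a3. sweedler A (\<lambda>a1 a2. sweedler K (M a1 a2 a3) k) a') a"
    by (intro sweedler_cong sweedler_fubini[OF A K U _ _ k, symmetric] quadrilinear_mapI) (simp_all add: M)
  also have "\<dots> = sweedler A (\<lambda>a1 a'. sweedler A (\<lambda>a2 a3. sweedler K (M a1 a2 a3) k) a') a"
    by (intro sweedler_coassoc[OF A U _ a] tri param[OF VA _ k]) (simp_all add: M)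
  also have "\<dots> = sweedler A (\<lambda>a1 a'. sweedler A (\<lambda>a2 a3. sweedler K (N a1 a2 a3) k) a') a"
    by (intro sweedler_cong MN)
  also have "\<dots> = sweedler A (\<lambda>a1 a'. sweedler K (\<lambda>k1 k'. sweedler A (\<lambda>a2 a3. N a1 a2 a3 k1 k') a') k) a"
    by (intro sweedler_cong sweedler_fubini[OF A K U _ _ k] quadrilinear_mapI) (simp_all add: N)
  also have "\<dots> = sweedler T (\<lambda>p y. sweedler T (F p) y) (tens A K a k)"
    unfolding sweedler_tens[OF U b2 a k] N_def G_def
    by (intro sweedler_cong sweedler_tens[OF U trilinear_map_23[OF F], symmetric] t)
  finally show ?thesis .
qed

lemma coalgebra_tensor_coalg: "coalgebra T"
  unfolding coalgebra_def
proof (intro conjI ballI)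
  note V = vspace_tensor_coalg and Tv = vspace_tensor_space and t = tens_in_tensor_coalg
  show "vspace T" by (rule V)
  show "linear_map T (tensor_space T T) (comult T)" by (rule linear_comult_T)
  show "linear_map T base_field (counit T)" by (rule linear_counit_T)
  fix x assume x: "x \<in> carr T"
  let ?U = "tensor_space T (tensor_space T T)" and ?F = "\<lambda>p q c. tens T (tensor_space T T) p (tens T T q c)"
  have F: "trilinear_map T T T ?U ?F" by (rule trilinear_tens)
  have lp: "linear_map T ?U (\<lambda>p. sweedler T (G p) y)"
    if "trilinear_map T T T ?U G" "y \<in> carr T" for G :: "_ \<Rightarrow> _ \<Rightarrow> _ \<Rightarrow> ('k, _, ('k, _, _) tensor) tensor" and y
    unfolding sweedler_def
    by (rule linear_map_tlift_param[OF V V V Tv that(1) linear_map_carr[OF linear_comult_T that(2)]])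
  have F': "trilinear_map T T T ?U (\<lambda>c p q. ?F p q c)"
    by (rule trilinear_mapI) (simp_all add: trilinear_map_1[OF F] trilinear_map_2[OF F] trilinear_map_3[OF F])
  have b1: "bilinear_map T T ?U (\<lambda>y c. sweedler T (\<lambda>p q. ?F p q c) y)"
    by (rule bilinear_mapI) (simp_all add: lp[OF F'] linear_sweedler_T[OF Tv trilinear_map_12[OF F]])
  have b2: "bilinear_map T T ?U (\<lambda>p y. sweedler T (?F p) y)"
    by (rule bilinear_mapI) (simp_all add: lp[OF F] linear_sweedler_T[OF Tv trilinear_map_23[OF F]])
  have "sweedler T (\<lambda>y c. sweedler T (\<lambda>p q. ?F p q c) y) x = sweedler T (\<lambda>p y. sweedler T (?F p) y) x"
    by (rule tensor_coalg_linear_eq[OF linear_sweedler_T[OF Tv b1] linear_sweedler_T[OF Tv b2] _ x])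
      (rule coassoc_T[OF Tv F b1 b2])
  also have "\<dots> = sweedler T (\<lambda>p y. tens T (tensor_space T T) p (comult T y)) x"
  proof (rule sweedler_cong)
    fix p y assume p: "p \<in> carr T" and y: "y \<in> carr T"
    note cy = linear_map_carr[OF linear_comult_T y]
    have "tens T (tensor_space T T) p (tlift T T (tens T T) (comult T y))
        = tlift T T (?F p) (comult T y)"
      by (rule linear_comp_tlift[OF V V Tv Tv bilinear_tens bilinear_map_right[OF bilinear_tens p] cy])
    then show "sweedler T (?F p) y = tens T (tensor_space T T) p (comult T y)"
      by (simp add: sweedler_def tlift_tens_self[OF V V cy])
  qed
  finally show "sweedler3 T (\<lambda>x1 x2 x3. tens T (tensor_space T T) x1 (tens T T x2 x3)) x
    = sweedler T (\<lambda>x1 y. tens T (tensor_space T T) x1 (comult T y)) x"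
    by (simp add: sweedler3_def)
  have s: "bilinear_map T T T (\<lambda>p q. scl T (counit T p) q)"
    by (rule bilinear_map_comp[OF bilinear_scl[OF V] linear_counit_T linear_map_ident])
  have cu: "counit T (tens A K a k) = counit A a * counit K k" if "a \<in> carr A" "k \<in> carr K" for a k
    using coalg_bimap_tens that by (simp add: coalg_bimap_def)
  note tl = bilinear_map_left[OF bilinear_tens_coalg] and tr = bilinear_map_right[OF bilinear_tens_coalg]
  have ls: "linear_map C T (\<lambda>y. scl T c (f y))" if "linear_map C T f"
    for C :: "('k, 'f::ab_group_add, 'h) bialg_scheme" and c f
    using bilinear_map_comp_right[OF bilinear_scl[OF V] that, of c] by simp
  show "sweedler T (\<lambda>x1 x2. scl T (counit T x1) x2) x = x"
  proof (rule tensor_coalg_linear_eq[OF linear_sweedler_T[OF V s] linear_map_ident _ x])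
    fix a k assume a: "a \<in> carr A" and k: "k \<in> carr K"
    have "sweedler T (\<lambda>x1 x2. scl T (counit T x1) x2) (tens A K a k)
      = sweedler A (\<lambda>a1 a2. sweedler K (\<lambda>k1 k2. scl T (counit K k1) (scl T (counit A a1) (tens A K a2 k2))) k) a"
      unfolding sweedler_tens[OF V s a k]
      by (intro sweedler_cong) (simp add: cu vspace_scl_scl[OF V] mult.commute)
    also have "\<dots> = sweedler A (\<lambda>a1 a2. scl T (counit A a1) (tens A K a2 k)) a"
      by (rule sweedler_cong)
        (rule sweedler_counit_left[OF K V linear_map_comp[OF bilinear_map_right[OF bilinear_scl[OF V]] tr] k]; simp)
    also have "\<dots> = tens A K a k"
      by (rule sweedler_counit_left[OF A V tl[OF k] a])
    finally show "sweedler T (\<lambda>x1 x2. scl T (counit T x1) x2) (tens A K a k) = tens A K a k" .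
  qed
  show "sweedler T (\<lambda>x1 x2. scl T (counit T x2) x1) x = x"
  proof (rule tensor_coalg_linear_eq[OF linear_sweedler_T[OF V bilinear_map_flip[OF s]] linear_map_ident _ x])
    fix a k assume a: "a \<in> carr A" and k: "k \<in> carr K"
    have "sweedler T (\<lambda>x1 x2. scl T (counit T x2) x1) (tens A K a k)
      = sweedler A (\<lambda>a1 a2. sweedler K (\<lambda>k1 k2. scl T (counit K k2) (scl T (counit A a2) (tens A K a1 k1))) k) a"
      unfolding sweedler_tens[OF V bilinear_map_flip[OF s] a k]
      by (intro sweedler_cong) (simp add: cu vspace_scl_scl[OF V] mult.commute)
    also have "\<dots> = sweedler A (\<lambda>a1 a2. scl T (counit A a2) (tens A K a1 k)) a"
      by (rule sweedler_cong)
        (rule sweedler_counit_right[OF K V linear_map_comp[OF bilinear_map_right[OF bilinear_scl[OF V]] tr] k]; simp)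
    also have "\<dots> = tens A K a k"
      by (rule sweedler_counit_right[OF A V tl[OF k] a])
    finally show "sweedler T (\<lambda>x1 x2. scl T (counit T x2) x1) (tens A K a k) = tens A K a k" .
  qed
qed

text \<open>On an elementary tensor the legs of \<open>k\<close> are swapped first and then those of
  \<open>a\<close>, each by cocommutativity of its own factor.\<close>

lemma cocommutative_tensor_coalg:
  assumes cA: "cocommutative A" and cK: "cocommutative K"
  shows "cocommutative T"
  unfolding cocommutative_def
proof
  fix x assume x: "x \<in> carr T"
  note Tv = vspace_tensor_space
  let ?F = "\<lambda>p q. tens T T q p"
  have F: "bilinear_map T T (tensor_space T T) ?F" by (rule bilinear_map_flip[OF bilinear_tens])
  note Q = quad_tens[OF F] and Q' = quad_tens[OF bilinear_tens]
  show "sweedler T ?F x = comult T x"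
  proof (rule tensor_coalg_linear_eq[OF linear_sweedler_T[OF Tv F] linear_comult_T _ x])
    fix a k assume a: "a \<in> carr A" and k: "k \<in> carr K"
    have "sweedler T ?F (tens A K a k)
      = sweedler A (\<lambda>a1 a2. sweedler K (\<lambda>k1 k2. tens T T (tens A K a2 k2) (tens A K a1 k1)) k) a"
      by (rule sweedler_tens[OF Tv F a k])
    also have "\<dots> = sweedler A (\<lambda>a1 a2. sweedler K (\<lambda>k1 k2. tens T T (tens A K a2 k1) (tens A K a1 k2)) k) a"
      by (rule sweedler_cong) (rule sweedler_cocommutative[OF K cK Tv quadrilinear_map_34[OF Q] k, symmetric])
    also have "\<dots> = sweedler A (\<lambda>a1 a2. sweedler K (\<lambda>k1 k2. tens T T (tens A K a1 k1) (tens A K a2 k2)) k) a"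
      by (rule sweedler_cocommutative[OF A cA Tv trilinear_map_12[OF trilinear_sweedler_last[OF K VA VA Tv Q'] k] a])
    also have "\<dots> = comult T (tens A K a k)"
      using coalg_bimap_tens a k by (simp add: coalg_bimap_def)
    finally show "sweedler T ?F (tens A K a k) = comult T (tens A K a k)" .
  qed
qed

text \<open>Together with \<open>coalg_bimap_of_coalgebra_map\<close> this says that
  \<open>coalg_bimap\<close> is the notion of a coalgebra map on the tensor product, seen on
  elementary tensors.\<close>

lemma coalg_bimap_lift:
  assumes D: "coalgebra D" and \<mu>: "coalg_bimap A K D \<mu>"
  shows "coalgebra_map T D (tlift A K \<mu>)"
  unfolding coalgebra_map_def
proof (intro conjI ballI)
  note b = coalg_bimap_bilinear[OF \<mu>] and VD = coalgebra_vspace[OF D] and Tv = vspace_tensor_space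
  note C = coalgebra_tensor_coalg
  show l: "linear_map T D (tlift A K \<mu>)" by (rule linear_tlift_coalg[OF VD b])
  note bl = bilinear_map_comp[OF bilinear_tens l l]
  have ev: "tlift A K \<mu> (tens A K a k) = \<mu> a k" if "a \<in> carr A" "k \<in> carr K" for a k
    by (rule tlift_tens[OF VA VK VD b that])
  fix x assume x: "x \<in> carr T"
  show "comult D (tlift A K \<mu> x) = sweedler T (\<lambda>p q. tens D D (tlift A K \<mu> p) (tlift A K \<mu> q)) x"
  proof (rule tensor_coalg_linear_eq[OF linear_map_comp[OF linear_comult[OF D] l] linear_sweedler[OF C Tv bl] _ x])
    fix a k assume a: "a \<in> carr A" and k: "k \<in> carr K"
    have "comult D (tlift A K \<mu> (tens A K a k))
      = sweedler A (\<lambda>a1 a2. sweedler K (\<lambda>k1 k2. tens D D (\<mu> a1 k1) (\<mu> a2 k2)) k) a"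
      using \<mu> a k by (simp add: ev coalg_bimap_def)
    also have "\<dots> = sweedler A (\<lambda>a1 a2. sweedler K (\<lambda>k1 k2.
        tens D D (tlift A K \<mu> (tens A K a1 k1)) (tlift A K \<mu> (tens A K a2 k2))) k) a"
      by (intro sweedler_cong) (simp add: ev)
    also have "\<dots> = sweedler T (\<lambda>p q. tens D D (tlift A K \<mu> p) (tlift A K \<mu> q)) (tens A K a k)"
      by (rule sweedler_tens[OF Tv bl a k, symmetric])
    finally show "comult D (tlift A K \<mu> (tens A K a k))
      = sweedler T (\<lambda>p q. tens D D (tlift A K \<mu> p) (tlift A K \<mu> q)) (tens A K a k)" .
  qed
  show "counit D (tlift A K \<mu> x) = counit T x"
    by (rule tensor_coalg_linear_eq[OF linear_map_comp[OF linear_counit[OF D] l] linear_counit_T _ x])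
      (use \<mu> coalg_bimap_tens in \<open>simp add: ev coalg_bimap_def\<close>)
qed

lemma coalg_bimap_of_coalgebra_map:
  assumes D: "coalgebra D" and h: "coalgebra_map T D h"
  shows "coalg_bimap A K D (\<lambda>a k. h (tens A K a k))"
  unfolding coalg_bimap_def
proof (intro conjI ballI)
  note l = coalgebra_map_linear[OF h]
  show "bilinear_map A K D (\<lambda>a k. h (tens A K a k))"
    by (rule linear_comp_bilinear[OF l bilinear_tens_coalg])
  fix a k assume a: "a \<in> carr A" and k: "k \<in> carr K"
  have "comult D (h (tens A K a k)) = sweedler T (\<lambda>p q. tens D D (h p) (h q)) (tens A K a k)"
    using h tens_in_tensor_coalg[OF a k] by (simp add: coalgebra_map_def)
  also have "\<dots> = sweedler A (\<lambda>a1 a2. sweedler K (\<lambda>k1 k2. tens D D (h (tens A K a1 k1)) (h (tens A K a2 k2))) k) a"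
    by (rule sweedler_tens[OF vspace_tensor_space bilinear_map_comp[OF bilinear_tens l l] a k])
  finally show "comult D (h (tens A K a k))
    = sweedler A (\<lambda>a1 a2. sweedler K (\<lambda>k1 k2. tens D D (h (tens A K a1 k1)) (h (tens A K a2 k2))) k) a" .
  show "counit D (h (tens A K a k)) = counit A a * counit K k"
    using coalg_bimap_tens coalgebra_map_counit[OF h tens_in_tensor_coalg[OF a k]] a k
    by (simp add: coalg_bimap_def)
qed

end

section \<open>Rota-Baxter groups\<close>

text \<open>The weight -1 identity at a group-like element: all Sweedler legs of \<open>x\<close>
  equal \<open>x\<close>, and the antipode is the inverse.\<close>

locale rb_group = group G for G (structure) +
  fixes B
  assumes B_closed [simp, intro]: "x \<in> carrier G \<Longrightarrow> B x \<in> carrier G"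
    and B_mult: "x \<in> carrier G \<Longrightarrow> y \<in> carrier G \<Longrightarrow>
      B x \<otimes> B y = B (B x \<otimes> y \<otimes> inv (B x) \<otimes> x)"
begin

definition circ where "circ x y = B x \<otimes> y \<otimes> inv (B x) \<otimes> x"
text \<open>The inverse for \<open>circ\<close>, and the group form of
  \<open>descendent_antipode\<close>.\<close>

definition cinv where "cinv x = inv (B x) \<otimes> inv x \<otimes> B x"
definition Bt where "Bt x = x \<otimes> B (inv x)"
definition Bm where "Bm x = inv x \<otimes> B x"

lemma cancel [simp]:
  "x \<in> carrier G \<Longrightarrow> y \<in> carrier G \<Longrightarrow> x \<otimes> (inv x \<otimes> y) = y"
  "x \<in> carrier G \<Longrightarrow> y \<in> carrier G \<Longrightarrow> inv x \<otimes> (x \<otimes> y) = y"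
  by (simp_all add: m_assoc[symmetric])

lemmas group_simps = m_assoc inv_mult_group

lemma circ_closed [simp, intro]: "x \<in> carrier G \<Longrightarrow> y \<in> carrier G \<Longrightarrow> circ x y \<in> carrier G"
  and cinv_closed [simp, intro]: "x \<in> carrier G \<Longrightarrow> cinv x \<in> carrier G"
  and Bt_closed [simp, intro]: "x \<in> carrier G \<Longrightarrow> Bt x \<in> carrier G"
  and Bm_closed [simp, intro]: "x \<in> carrier G \<Longrightarrow> Bm x \<in> carrier G"
  by (simp_all add: circ_def cinv_def Bt_def Bm_def)

lemma Bt_inv: "x \<in> carrier G \<Longrightarrow> Bt (inv x) = Bm x"
  and Bm_inv: "x \<in> carrier G \<Longrightarrow> Bm (inv x) = Bt x"
  by (simp_all add: Bt_def Bm_def)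

lemma B_circ: "x \<in> carrier G \<Longrightarrow> y \<in> carrier G \<Longrightarrow> B (circ x y) = B x \<otimes> B y"
  by (simp add: circ_def B_mult)

lemma B_one [simp]: "B \<one> = \<one>"
proof -
  have "B \<one> \<otimes> B \<one> = B \<one> \<otimes> \<one>" using B_mult[of \<one> \<one>] by (simp add: group_simps)
  then have "inv (B \<one>) \<otimes> (B \<one> \<otimes> B \<one>) = inv (B \<one>) \<otimes> (B \<one> \<otimes> \<one>)" by simp
  then show ?thesis by simp
qed

lemma circ_assoc:
  "x \<in> carrier G \<Longrightarrow> y \<in> carrier G \<Longrightarrow> z \<in> carrier G \<Longrightarrow> circ (circ x y) z = circ x (circ y z)"
  using B_circ[of x y] by (simp add: circ_def[of "circ x y"]) (simp add: circ_def group_simps)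

lemma circ_one [simp]: "x \<in> carrier G \<Longrightarrow> circ \<one> x = x" "x \<in> carrier G \<Longrightarrow> circ x \<one> = x"
  by (simp_all add: circ_def group_simps)

lemma circ_cinv [simp]: "x \<in> carrier G \<Longrightarrow> circ x (cinv x) = \<one>"
  by (simp add: circ_def cinv_def group_simps)

lemma B_cinv: assumes "x \<in> carrier G" shows "B (cinv x) = inv (B x)"
proof -
  have "B x \<otimes> B (cinv x) = \<one>" using B_circ[of x "cinv x"] assms by simp
  then have "inv (B x) \<otimes> (B x \<otimes> B (cinv x)) = inv (B x) \<otimes> \<one>" by simp
  then show ?thesis using assms by simp
qed

lemma cinv_circ [simp]: "x \<in> carrier G \<Longrightarrow> circ (cinv x) x = \<one>"
  using B_cinv[of x] by (simp add: circ_def[of "cinv x"]) (simp add: cinv_def group_simps)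

lemma cinv_cinv [simp]: "x \<in> carrier G \<Longrightarrow> cinv (cinv x) = x"
  using B_cinv[of x] by (simp add: cinv_def[of "cinv x"]) (simp add: cinv_def group_simps)

text \<open>This is the Rota-Baxter identity of \<open>B\<close> for the operation
  \<open>circ\<close>. As \<open>B\<close> turns \<open>circ\<close> into the product, the
  right-hand side expands to the definition of the left-hand side.\<close>

lemma B_circ_B:
  assumes "x \<in> carrier G" "y \<in> carrier G"
  shows "circ (B x) (B y) = B (circ (circ (circ (B x) y) (cinv (B x))) x)"
  using assms by (simp add: B_circ B_cinv circ_def[of "B x" "B y"])

lemma Bm_circ: "x \<in> carrier G \<Longrightarrow> y \<in> carrier G \<Longrightarrow> Bm (circ x y) = Bm x \<otimes> Bm y"
  using B_circ[of x y] by (simp add: Bm_def[of "circ x y"]) (simp add: Bm_def circ_def group_simps)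

lemma Bm_one [simp]: "Bm \<one> = \<one>"
  by (simp add: Bm_def)

lemma Bm_cinv: assumes "x \<in> carrier G" shows "Bm (cinv x) = inv (Bm x)"
  using B_cinv[of x] assms by (simp add: Bm_def[of "cinv x"]) (simp add: Bm_def cinv_def group_simps)

text \<open>\<open>Bm x\<close> is the \<open>circ\<close> quotient of \<open>B x\<close> by
  \<open>x\<close>, so the homomorphism \<open>B\<close> sends it to the quotient of
  \<open>B (B x)\<close> by \<open>B x\<close>, which is \<open>Bm (B x)\<close>.\<close>

lemma Bm_B: assumes "x \<in> carrier G" shows "Bm (B x) = B (Bm x)"
proof -
  have "circ (cinv x) (B x) = Bm x"
    using assms B_cinv[of x] by (simp add: circ_def) (simp add: cinv_def Bm_def group_simps)
  then have "B (Bm x) = B (cinv x) \<otimes> B (B x)" using B_circ[of "cinv x" "B x"] assms by simp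
  then show ?thesis using assms by (simp add: B_cinv Bm_def)
qed

text \<open>\<open>Bt\<close> is \<open>Bm\<close> after inversion, and inversion turns the
  operation attached to \<open>Bt\<close> into \<open>circ\<close>; the claim is then the
  homomorphism property of \<open>Bm\<close>.\<close>

lemma Bt_mult:
  assumes x: "x \<in> carrier G" and y: "y \<in> carrier G"
  shows "Bt x \<otimes> Bt y = Bt (Bt x \<otimes> y \<otimes> inv (Bt x) \<otimes> x)"
proof -
  have "circ (inv x) (inv y) = inv (Bt x \<otimes> y \<otimes> inv (Bt x) \<otimes> x)"
    using x y by (simp add: circ_def Bt_def group_simps)
  moreover have "Bt x \<otimes> y \<otimes> inv (Bt x) \<otimes> x \<in> carrier G" using x y by simp
  ultimately show ?thesis
    using Bm_circ[of "inv x" "inv y"] x y Bm_inv by simp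
qed

text \<open>Inside the inverse stands the operation attached to \<open>Bt\<close>. With
  \<open>inv_cinv_Bt\<close> and \<open>inv_Bt\<close> this yields the homomorphism property of the
  antipode in the second half of the theorem.\<close>

lemma inv_circ_Bt:
  "x \<in> carrier G \<Longrightarrow> y \<in> carrier G \<Longrightarrow>
    inv (Bt x \<otimes> y \<otimes> inv (Bt x) \<otimes> x) = circ (inv x) (inv y)"
  by (simp add: circ_def Bt_def group_simps)

lemma inv_cinv_Bt:
  "x \<in> carrier G \<Longrightarrow> inv (inv (Bt x) \<otimes> inv x \<otimes> Bt x) = cinv (inv x)"
  by (simp add: cinv_def Bt_def group_simps)

text \<open>The right-hand side is the tilde operator of \<open>B\<close> formed in the group with
  operation \<open>circ\<close>, at the point \<open>inv x\<close>.\<close>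

lemma inv_Bt: "x \<in> carrier G \<Longrightarrow> inv (Bt x) = circ (inv x) (B (cinv (inv x)))"
  using B_cinv[of "inv x"] by (simp add: circ_def Bt_def group_simps)

text \<open>Neither \<open>B\<close> nor \<open>Bm\<close> says anything about a conjugate directly.
  Written as a \<open>circ\<close> product it can be split by both, and this produces the second
  expression for each action.\<close>

lemma conj_eq_circ:
  assumes "x \<in> carrier G" "w \<in> carrier G"
  defines "v \<equiv> circ x w"
  shows "B x \<otimes> w \<otimes> inv (B x) = circ v (inv (Bm v) \<otimes> inv x \<otimes> Bm v)"
  using assms by (simp add: circ_def[of v] Bm_def group_simps) (simp add: v_def circ_def group_simps)

text \<open>The actions of the matched pair are \<open>Bm (B x \<otimes> w \<otimes> inv (B x))\<close> and
  \<open>inv (B (inv (Bm w) \<otimes> cinv x \<otimes> Bm w))\<close>; each has one expression depending on \<open>x\<close> only through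
  \<open>B x\<close> and one depending on \<open>w\<close> only through \<open>Bm w\<close>.\<close>

lemma left_action_eq:
  assumes "x \<in> carrier G" "w \<in> carrier G"
  shows "Bm (B x \<otimes> w \<otimes> inv (B x))
    = Bm x \<otimes> Bm w \<otimes> Bm (inv (Bm x \<otimes> Bm w) \<otimes> inv x \<otimes> (Bm x \<otimes> Bm w))"
  using assms by (simp add: conj_eq_circ Bm_circ)

lemma right_action_eq:
  assumes "x \<in> carrier G" "w \<in> carrier G"
  shows "inv (B (inv (Bm w) \<otimes> cinv x \<otimes> Bm w)) = inv (B (B x \<otimes> w \<otimes> inv (B x))) \<otimes> B x \<otimes> B w"
proof -
  have "inv (Bm (circ x w)) \<otimes> inv x \<otimes> Bm (circ x w) = inv (Bm w) \<otimes> cinv x \<otimes> Bm w"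
    using assms by (simp add: Bm_circ) (simp add: Bm_def cinv_def group_simps)
  then have "B (B x \<otimes> w \<otimes> inv (B x)) = B x \<otimes> B w \<otimes> B (inv (Bm w) \<otimes> cinv x \<otimes> Bm w)"
    using assms conj_eq_circ[of x w] by (simp add: B_circ)
  then show ?thesis using assms by (simp add: group_simps)
qed

text \<open>\<open>psiL g t\<close> and \<open>psiR g t\<close> are the components of the product of
  the embedded \<open>g\<close> and the pair belonging to \<open>t\<close>. For trivial
  \<open>t\<close> they are \<open>Bt g\<close> and the inverse of \<open>B (inv g)\<close>, for
  trivial \<open>g\<close> those of the map called pi, and their product in the group is always
  \<open>g\<close>.\<close>

definition psiL where "psiL g t = Bm (B t \<otimes> inv g)"
definition psiR where "psiR g t = inv (B (B t \<otimes> inv g)) \<otimes> B t"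

lemma psi_closed [simp, intro]:
  "g \<in> carrier G \<Longrightarrow> t \<in> carrier G \<Longrightarrow> psiL g t \<in> carrier G"
  "g \<in> carrier G \<Longrightarrow> t \<in> carrier G \<Longrightarrow> psiR g t \<in> carrier G"
  by (simp_all add: psiL_def psiR_def)

lemma psi_one: "psiL \<one> \<one> = \<one>" "psiR \<one> \<one> = \<one>"
  by (simp_all add: psiL_def psiR_def)

lemma psiR_in_B:
  assumes "g \<in> carrier G" "t \<in> carrier G"
  shows "psiR g t = B (circ (cinv (B t \<otimes> inv g)) t)"
  using assms by (simp add: psiR_def B_circ B_cinv)

text \<open>The coordinates recover \<open>w\<close> itself: with t the \<open>circ\<close> product
  of \<open>w\<close> and \<open>y\<close>, and g the product of \<open>Bm w\<close> and
  \<open>B y\<close>, the element B(t) g^-1 is \<open>w\<close>.\<close>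

lemma psi_surj:
  assumes "w \<in> carrier G" "y \<in> carrier G"
  shows "psiL (Bm w \<otimes> B y) (circ w y) = Bm w" "psiR (Bm w \<otimes> B y) (circ w y) = B y"
proof -
  have "B (circ w y) \<otimes> inv (Bm w \<otimes> B y) = w" using assms by (simp add: B_circ Bm_def group_simps)
  then show "psiL (Bm w \<otimes> B y) (circ w y) = Bm w" "psiR (Bm w \<otimes> B y) (circ w y) = B y"
    using assms by (simp_all add: psiL_def psiR_def B_circ group_simps)
qed

text \<open>The terms in \<open>h\<close> and \<open>w'\<close> are the two actions in the form of
  \<open>left_action_eq\<close> and \<open>right_action_eq\<close>. Hence the lemma says that the
  pair of \<open>psiL\<close> and \<open>psiR\<close> is multiplicative into the double cross
  product, from the direct product of the group and its \<open>circ\<close> group.\<close>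

lemma psi_mult:
  assumes g: "g \<in> carrier G" and t: "t \<in> carrier G" and g': "g' \<in> carrier G" and t': "t' \<in> carrier G"
  defines "h \<equiv> psiR g t" and "w' \<equiv> B t' \<otimes> inv g'"
  shows "psiL (g \<otimes> g') (circ t t') = psiL g t \<otimes> Bm (h \<otimes> w' \<otimes> inv h)"
    and "psiR (g \<otimes> g') (circ t t') = inv (B (h \<otimes> w' \<otimes> inv h)) \<otimes> h \<otimes> B w' \<otimes> psiR g' t'"
proof -
  define w where "w = B t \<otimes> inv g"
  have w: "w \<in> carrier G" "w' \<in> carrier G" "h \<in> carrier G" using assms by (auto simp: w_def)
  have h: "h = inv (B w) \<otimes> B t" by (simp add: h_def psiR_def w_def)
  \<comment> \<open>The element from which \<open>psiL\<close> and \<open>psiR\<close> are computed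
    is itself a \<open>circ\<close> product for the product of two pairs, so \<open>B\<close> and
    \<open>Bm\<close> split it.\<close>
  have e: "B (circ t t') \<otimes> inv (g \<otimes> g') = circ w (h \<otimes> w' \<otimes> inv h)"
  proof -
    have "circ w (h \<otimes> w' \<otimes> inv h) = B t \<otimes> (w' \<otimes> (inv (B t) \<otimes> w))"
      using w t by (simp add: circ_def h group_simps)
    also have "\<dots> = B (circ t t') \<otimes> inv (g \<otimes> g')"
      using assms by (simp add: w_def w'_def B_circ group_simps)
    finally show ?thesis by simp
  qed
  show "psiL (g \<otimes> g') (circ t t') = psiL g t \<otimes> Bm (h \<otimes> w' \<otimes> inv h)"
    using w by (simp add: psiL_def[of "g \<otimes> g'"] e Bm_circ) (simp add: psiL_def w_def)
  have "psiR (g \<otimes> g') (circ t t') = inv (B (h \<otimes> w' \<otimes> inv h)) \<otimes> h \<otimes> B t'"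
    unfolding psiR_def[of "g \<otimes> g'"] e
    using w t t' by (simp add: B_circ) (simp add: h group_simps)
  also have "\<dots> = inv (B (h \<otimes> w' \<otimes> inv h)) \<otimes> h \<otimes> B w' \<otimes> psiR g' t'"
    using w t' by (simp add: psiR_def w'_def[symmetric] group_simps)
  finally show "psiR (g \<otimes> g') (circ t t') = inv (B (h \<otimes> w' \<otimes> inv h)) \<otimes> h \<otimes> B w' \<otimes> psiR g' t'" .
qed

text \<open>The inverse of \<open>(Bm w, B y)\<close> in the double cross product.\<close>

lemma psi_inv:
  assumes w: "w \<in> carrier G" and y: "y \<in> carrier G"
  defines "w' \<equiv> inv (B y) \<otimes> cinv w \<otimes> B y"
  shows "psiL (inv (Bm w \<otimes> B y)) (cinv (circ w y)) = Bm w'"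
    and "psiR (inv (Bm w \<otimes> B y)) (cinv (circ w y)) = inv (B w') \<otimes> inv (B y) \<otimes> inv (B w)"
proof -
  have "B (cinv (circ w y)) \<otimes> inv (inv (Bm w \<otimes> B y)) = w'"
    using w y by (simp add: B_cinv B_circ w'_def) (simp add: Bm_def cinv_def group_simps)
  then show "psiL (inv (Bm w \<otimes> B y)) (cinv (circ w y)) = Bm w'"
    and "psiR (inv (Bm w \<otimes> B y)) (cinv (circ w y)) = inv (B w') \<otimes> inv (B y) \<otimes> inv (B w)"
    using w y by (simp_all add: psiL_def psiR_def B_cinv B_circ group_simps w'_def)
qed

text \<open>The expressions of \<open>psi_inv\<close> involve \<open>y\<close> only through
  \<open>B y\<close>; these involve \<open>w\<close> only through \<open>Bm w\<close>. They are the
  two action identities at the \<open>circ\<close> inverses of \<open>y\<close> and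
  \<open>w\<close>.\<close>

lemma psi_inv_left:
  assumes w: "w \<in> carrier G" and y: "y \<in> carrier G"
  defines "w' \<equiv> inv (B y) \<otimes> cinv w \<otimes> B y"
  shows "Bm w' = inv (Bm y) \<otimes> inv (Bm w) \<otimes>
      Bm (Bm w \<otimes> Bm y \<otimes> inv (cinv y) \<otimes> inv (Bm y) \<otimes> inv (Bm w))"
    and "inv (B w') \<otimes> inv (B y) \<otimes> inv (B w) = inv (B (Bm w \<otimes> y \<otimes> inv (Bm w)))"
proof -
  have "w' = B (cinv y) \<otimes> cinv w \<otimes> inv (B (cinv y))"
    using w y by (simp add: w'_def B_cinv)
  then show "Bm w' = inv (Bm y) \<otimes> inv (Bm w) \<otimes>
      Bm (Bm w \<otimes> Bm y \<otimes> inv (cinv y) \<otimes> inv (Bm y) \<otimes> inv (Bm w))"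
    and "inv (B w') \<otimes> inv (B y) \<otimes> inv (B w) = inv (B (Bm w \<otimes> y \<otimes> inv (Bm w)))"
    using left_action_eq[of "cinv y" "cinv w"] right_action_eq[of "cinv y" "cinv w"] w y
    by (simp_all add: Bm_cinv B_cinv group_simps)
qed

end

section \<open>The group of coalgebra maps into a cocommutative Hopf algebra\<close>

text \<open>Normalised to 0 off the carrier, in accordance with \<open>convol\<close>, so that maps
  agreeing on the carrier are equal as group elements.\<close>

definition coalg_maps where
  "coalg_maps C D = {f. coalgebra_map C D f \<and> (\<forall>x. x \<notin> carr C \<longrightarrow> f x = 0)}"

definition conv_group where
  "conv_group C H = \<lparr>carrier = coalg_maps C H, mult = convol C (hmult H),
    one = (\<lambda>x. if x \<in> carr C then scl H (counit C x) (hone H) else 0)\<rparr>"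

lemma carrier_conv_group [simp]: "carrier (conv_group C H) = coalg_maps C H"
  and mult_conv_group [simp]: "mult (conv_group C H) = convol C (hmult H)"
  and one_conv_group: "one (conv_group C H) = (\<lambda>x. if x \<in> carr C then scl H (counit C x) (hone H) else 0)"
  by (simp_all add: conv_group_def)

lemma coalg_mapsD: "f \<in> coalg_maps C D \<Longrightarrow> coalgebra_map C D f"
  and coalg_maps_linear: "f \<in> coalg_maps C D \<Longrightarrow> linear_map C D f"
  and coalg_maps_outside: "f \<in> coalg_maps C D \<Longrightarrow> x \<notin> carr C \<Longrightarrow> f x = 0"
  and coalg_maps_carr: "f \<in> coalg_maps C D \<Longrightarrow> x \<in> carr C \<Longrightarrow> f x \<in> carr D"
  by (simp_all add: coalg_maps_def coalgebra_map_def linear_map_def)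

lemma coalg_mapsI:
  "coalgebra C \<Longrightarrow> coalgebra_map C D f \<Longrightarrow> (\<And>x. x \<in> carr C \<Longrightarrow> g x = f x) \<Longrightarrow>
    (\<And>x. x \<notin> carr C \<Longrightarrow> g x = 0) \<Longrightarrow> g \<in> coalg_maps C D"
  using coalgebra_map_cong[of C D f g] by (simp add: coalg_maps_def)

lemma coalg_maps_eqI:
  "f \<in> coalg_maps C D \<Longrightarrow> g \<in> coalg_maps C D' \<Longrightarrow> (\<And>x. x \<in> carr C \<Longrightarrow> f x = g x) \<Longrightarrow> f = g"
  by (rule ext) (metis coalg_maps_outside)

lemma coalg_maps_comp:
  assumes C: "coalgebra C" and D: "coalgebra D" and E: "vspace E"
    and f: "f \<in> coalg_maps C D" and g: "coalgebra_map D E g"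
  shows "(\<lambda>x. g (f x)) \<in> coalg_maps C E"
  using coalgebra_map_comp[OF C D E coalg_mapsD[OF f] g] coalg_maps_outside[OF f]
    linear_map_zero[OF coalgebra_vspace[OF D] coalgebra_map_linear[OF g]]
  by (simp add: coalg_maps_def)

text \<open>The identity in the normal form of \<open>coalg_maps\<close>: the generic point of a
  coalgebra, at which one-variable identities are read.\<close>

definition ident_on where "ident_on C = (\<lambda>x. if x \<in> carr C then x else 0)"

lemma ident_on_in_coalg_maps: "coalgebra C \<Longrightarrow> ident_on C \<in> coalg_maps C C"
  by (rule coalg_mapsI[OF _ coalgebra_map_ident]) (simp_all add: ident_on_def)

lemma ident_on_apply [simp]: "x \<in> carr C \<Longrightarrow> ident_on C x = x"
  by (simp add: ident_on_def)

text \<open>Precomposition with a coalgebra map respects convolution, so a formula at the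
  projections specialises to every other pair of points.\<close>

lemma convol_precomp:
  assumes C: "coalgebra C" and D: "coalgebra D" and U: "vspace U" and \<mu>: "bilinear_map A K U \<mu>"
    and f: "linear_map D A f" and g: "linear_map D K g" and h: "h \<in> coalg_maps C D"
  shows "(\<lambda>x. convol D \<mu> f g (h x)) = convol C \<mu> (\<lambda>x. f (h x)) (\<lambda>x. g (h x))"
proof
  fix x
  note VD = coalgebra_vspace[OF D]
  show "convol D \<mu> f g (h x) = convol C \<mu> (\<lambda>x. f (h x)) (\<lambda>x. g (h x)) x"
  proof (cases "x \<in> carr C")
    case True
    then show ?thesis
      using sweedler_coalgebra_map[OF C VD coalg_mapsD[OF h] U bilinear_map_comp[OF \<mu> f g]]
      by (simp add: convol_inside coalg_maps_carr[OF h])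
  next
    case False
    then show ?thesis
      using linear_map_zero[OF VD linear_convol[OF D U \<mu> f g]] coalg_maps_outside[OF h] by simp
  qed
qed

text \<open>Convolution with a multiple of the counit is multiplication by a constant. This gives
  the unit laws; the version on the other side also removes a tensor factor on which a map does not
  depend.\<close>

lemma convol_counit_left:
  assumes C: "coalgebra C" and E: "vspace E" and U: "vspace U" and \<mu>: "bilinear_map E K U \<mu>"
    and e: "e \<in> carr E" and g: "linear_map C K g" and x: "x \<in> carr C"
  shows "convol C \<mu> (\<lambda>x. if x \<in> carr C then scl E (counit C x) e else 0) g x = \<mu> e (g x)"
proof -
  have "convol C \<mu> (\<lambda>x. if x \<in> carr C then scl E (counit C x) e else 0) g x
    = sweedler C (\<lambda>a b. scl U (counit C a) (\<mu> e (g b))) x"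
    unfolding convol_inside[OF x] using linear_map_carr[OF g] linear_map_scl[OF bilinear_map_left[OF \<mu>] e]
    by (intro sweedler_cong) simp
  also have "\<dots> = \<mu> e (g x)"
    by (rule sweedler_counit_left[OF C U bilinear_map_comp_right[OF \<mu> g e] x])
  finally show ?thesis .
qed

lemma convol_counit_right:
  assumes C: "coalgebra C" and E: "vspace E" and U: "vspace U" and \<mu>: "bilinear_map K E U \<mu>"
    and e: "e \<in> carr E" and f: "linear_map C K f" and x: "x \<in> carr C"
  shows "convol C \<mu> f (\<lambda>x. if x \<in> carr C then scl E (counit C x) e else 0) x = \<mu> (f x) e"
proof -
  have "convol C \<mu> f (\<lambda>x. if x \<in> carr C then scl E (counit C x) e else 0) x
    = sweedler C (\<lambda>a b. scl U (counit C b) (\<mu> (f a) e)) x"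
    unfolding convol_inside[OF x] using linear_map_carr[OF f] linear_map_scl[OF bilinear_map_right[OF \<mu>] e]
    by (intro sweedler_cong) simp
  also have "\<dots> = \<mu> (f x) e"
    by (rule sweedler_counit_right[OF C U bilinear_map_comp_left[OF \<mu> f e] x])
  finally show ?thesis .
qed

lemma bialgebra_coalgebra: "bialgebra H \<Longrightarrow> coalgebra H"
  and bialgebra_bilinear: "bialgebra H \<Longrightarrow> bilinear_map H H H (hmult H)"
  and bialgebra_one: "bialgebra H \<Longrightarrow> hone H \<in> carr H"
  and bialgebra_assoc: "bialgebra H \<Longrightarrow> x \<in> carr H \<Longrightarrow> y \<in> carr H \<Longrightarrow> z \<in> carr H \<Longrightarrow>
    hmult H (hmult H x y) z = hmult H x (hmult H y z)"
  and bialgebra_unit: "bialgebra H \<Longrightarrow> x \<in> carr H \<Longrightarrow> hmult H (hone H) x = x"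
    "bialgebra H \<Longrightarrow> x \<in> carr H \<Longrightarrow> hmult H x (hone H) = x"
  by (simp_all add: bialgebra_def algebra_def)

lemma bialgebra_coalg_bimap: "bialgebra H \<Longrightarrow> coalg_bimap H H H (hmult H)"
  by (simp add: coalg_bimap_def bialgebra_def algebra_def tensor_mult_def sweedler_def)

lemma tensor_mult_eq_sweedler:
  "tensor_mult H (comult H x) (comult H y)
    = sweedler H (\<lambda>a b. sweedler H (\<lambda>c d. tens H H (hmult H a c) (hmult H b d)) y) x"
  by (simp add: tensor_mult_def sweedler_def)

lemma counit_unit_in_coalg_maps:
  assumes C: "coalgebra C" and H: "bialgebra H"
  shows "(\<lambda>x. if x \<in> carr C then scl H (counit C x) (hone H) else 0) \<in> coalg_maps C H"
proof (rule coalg_mapsI[OF C])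
  note V = coalgebra_vspace[OF bialgebra_coalgebra[OF H]] and o = bialgebra_one[OF H]
  show "coalgebra_map C H (\<lambda>x. scl H (counit C x) (hone H))"
    unfolding coalgebra_map_def
  proof (intro conjI ballI)
    show "linear_map C H (\<lambda>x. scl H (counit C x) (hone H))"
      by (rule bilinear_map_comp_left[OF bilinear_scl[OF V] linear_counit[OF C] o])
    fix x assume x: "x \<in> carr C"
    let ?T = "tensor_space H H" and ?o = "tens H H (hone H) (hone H)"
    have lo: "linear_map C ?T (\<lambda>x. scl ?T (counit C x) ?o)"
      by (rule bilinear_map_comp_left[OF bilinear_scl[OF vspace_tensor_space] linear_counit[OF C]
            tens_in_tensor_space[OF o o]])
    have "sweedler C (\<lambda>a b. tens H H (scl H (counit C a) (hone H)) (scl H (counit C b) (hone H))) x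
      = sweedler C (\<lambda>a b. scl ?T (counit C a) (scl ?T (counit C b) ?o)) x"
      using linear_map_scl[OF bilinear_map_left[OF bilinear_tens], of _ H "hone H" H]
        linear_map_scl[OF bilinear_map_right[OF bilinear_tens] o, of _ H] vspace_scl[OF V o] o
      by (intro sweedler_cong) (simp add: tensor_scl_def mult.left_commute)
    also have "\<dots> = scl ?T (counit C x) ?o"
      by (rule sweedler_counit_left[OF C vspace_tensor_space lo x])
    also have "\<dots> = comult H (scl H (counit C x) (hone H))"
      using H linear_map_scl[OF linear_comult[OF bialgebra_coalgebra[OF H]] o] by (simp add: bialgebra_def)
    finally show "comult H (scl H (counit C x) (hone H))
      = sweedler C (\<lambda>a b. tens H H (scl H (counit C a) (hone H)) (scl H (counit C b) (hone H))) x" ..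
    show "counit H (scl H (counit C x) (hone H)) = counit C x"
      using H linear_map_scl[OF linear_counit[OF bialgebra_coalgebra[OF H]] o] by (simp add: bialgebra_def)
  qed
qed simp_all

section \<open>Bilinear maps on a pair of tensor spaces\<close>

context
  fixes A :: "('k::field, 'a::ab_group_add, 'x) vspace_scheme" and K :: "('k, 'b::ab_group_add, 'y) vspace_scheme"
    and A' :: "('k, 'c::ab_group_add, 'z) vspace_scheme" and K' :: "('k, 'd::ab_group_add, 'w) vspace_scheme"
    and U :: "('k, 'u::ab_group_add, 'v) vspace_scheme" and M
  assumes A: "vspace A" and K: "vspace K" and A': "vspace A'" and K': "vspace K'" and U: "vspace U"
    and M: "quadrilinear_map A K A' K' U M"
begin

private lemma bil_inner:
  assumes t: "t \<in> carr (tensor_space A' K')"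
  shows "bilinear_map A K U (\<lambda>a k. tlift A' K' (M a k) t)"
proof (rule bilinear_mapI)
  show "linear_map K U (\<lambda>k. tlift A' K' (M a k) t)" if "a \<in> carr A" for a
    using M that by (intro linear_map_tlift_param[OF K A' K' U _ t]) (simp add: quadrilinear_map_def)
  show "linear_map A U (\<lambda>a. tlift A' K' (M a k) t)" if "k \<in> carr K" for k
    using M that by (intro linear_map_tlift_param[OF A A' K' U _ t] trilinear_mapI)
      (simp_all add: quadrilinear_map_def trilinear_map_def bilinear_map_def)
qed

lemma bilinear_tlift_tlift:
  "bilinear_map (tensor_space A K) (tensor_space A' K') U (\<lambda>s t. tlift A K (\<lambda>a k. tlift A' K' (M a k) t) s)"
proof (rule bilinear_mapI)
  show "linear_map (tensor_space A K) U (\<lambda>s. tlift A K (\<lambda>a k. tlift A' K' (M a k) t) s)"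
    if "t \<in> carr (tensor_space A' K')" for t
    by (rule linear_tlift[OF A K U bil_inner[OF that]])
  have tri: "trilinear_map (tensor_space A' K') A K U (\<lambda>t a k. tlift A' K' (M a k) t)"
    using bil_inner linear_tlift[OF A' K' U quadrilinear_map_34[OF M]]
    by (simp add: trilinear_map_def)
  show "linear_map (tensor_space A' K') U (\<lambda>t. tlift A K (\<lambda>a k. tlift A' K' (M a k) t) s)"
    if "s \<in> carr (tensor_space A K)" for s
    by (rule linear_map_tlift_param[OF vspace_tensor_space A K U tri that])
qed

lemma tlift_tlift_tens:
  assumes "a \<in> carr A" "k \<in> carr K" "a' \<in> carr A'" "k' \<in> carr K'"
  shows "tlift A K (\<lambda>a k. tlift A' K' (M a k) (tens A' K' a' k')) (tens A K a k) = M a k a' k'"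
  by (simp add: tlift_tens[OF A K U bil_inner] tens_in_tensor_space assms
      tlift_tens[OF A' K' U quadrilinear_map_34[OF M]])

end

section \<open>The algebra H \<otimes> H, and the antipode as a coalgebra map\<close>

context
  fixes H :: "('k::field, 'a::ab_group_add, 'z) bialg_scheme"
  assumes H: "bialgebra H"
begin

private lemma V: "vspace H" and C: "coalgebra H"
  using bialgebra_coalgebra[OF H] coalgebra_vspace by auto

private lemma quad_mult: "quadrilinear_map H H H H (tensor_space H H) (\<lambda>a b c d. tens H H (hmult H a c) (hmult H b d))"
  by (rule quadrilinear_bilinear_bilinear[OF bialgebra_bilinear[OF H] bialgebra_bilinear[OF H] bilinear_tens])

lemma bilinear_tensor_mult: "bilinear_map (tensor_space H H) (tensor_space H H) (tensor_space H H) (tensor_mult H)"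
  unfolding tensor_mult_def by (rule bilinear_tlift_tlift[OF V V V V vspace_tensor_space quad_mult])

lemma tensor_mult_tens:
  assumes "a \<in> carr H" "b \<in> carr H" "c \<in> carr H" "d \<in> carr H"
  shows "tensor_mult H (tens H H a b) (tens H H c d) = tens H H (hmult H a c) (hmult H b d)"
  unfolding tensor_mult_def
  by (rule tlift_tlift_tens[OF V V V V vspace_tensor_space quad_mult assms])

lemma tensor_mult_assoc:
  assumes r: "r \<in> carr (tensor_space H H)" and s: "s \<in> carr (tensor_space H H)" and t: "t \<in> carr (tensor_space H H)"
  shows "tensor_mult H (tensor_mult H r s) t = tensor_mult H r (tensor_mult H s t)"
proof -
  note b = bilinear_tensor_mult
  note l = bilinear_map_left[OF b] and rr = bilinear_map_right[OF b] and c = bilinear_map_carr[OF b]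
  note E = tensor_space_linear_eq[OF V V] and tc = tens_in_tensor_space
  show ?thesis
  proof (rule E[OF linear_map_comp[OF l[OF t] l[OF s]] l[OF c[OF s t]] _ r])
    fix a1 a2 assume a: "a1 \<in> carr H" "a2 \<in> carr H"
    let ?a = "tens H H a1 a2"
    show "tensor_mult H (tensor_mult H ?a s) t = tensor_mult H ?a (tensor_mult H s t)"
    proof (rule E[OF linear_map_comp[OF l[OF t] rr[OF tc[OF a]]] linear_map_comp[OF rr[OF tc[OF a]] l[OF t]] _ s])
      fix b1 b2 assume b: "b1 \<in> carr H" "b2 \<in> carr H"
      let ?b = "tens H H b1 b2"
      show "tensor_mult H (tensor_mult H ?a ?b) t = tensor_mult H ?a (tensor_mult H ?b t)"
        by (rule E[OF rr[OF c[OF tc[OF a] tc[OF b]]] linear_map_comp[OF rr[OF tc[OF a]] rr[OF tc[OF b]]] _ t])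
          (simp add: tensor_mult_tens a b bilinear_map_carr[OF bialgebra_bilinear[OF H]] bialgebra_assoc[OF H])
    qed
  qed
qed

lemma tensor_mult_unit:
  assumes "t \<in> carr (tensor_space H H)"
  shows "tensor_mult H (tens H H (hone H) (hone H)) t = t" "tensor_mult H t (tens H H (hone H) (hone H)) = t"
proof -
  note b = bilinear_tensor_mult and o = bialgebra_one[OF H]
  show "tensor_mult H (tens H H (hone H) (hone H)) t = t"
    by (rule tensor_space_linear_eq[OF V V bilinear_map_right[OF b tens_in_tensor_space[OF o o]] linear_map_ident _ assms])
      (simp add: tensor_mult_tens o bialgebra_unit[OF H])
  show "tensor_mult H t (tens H H (hone H) (hone H)) = t"
    by (rule tensor_space_linear_eq[OF V V bilinear_map_left[OF b tens_in_tensor_space[OF o o]] linear_map_ident _ assms])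
      (simp add: tensor_mult_tens o bialgebra_unit[OF H])
qed

text \<open>Both \<open>\<Delta> \<circ> S\<close> and \<open>(S \<otimes> S) \<circ> \<Delta>\<close> are convolution inverses of \<open>\<Delta>\<close>.\<close>

lemma antipode_coalgebra_map:
  assumes cc: "cocommutative H" and S: "is_antipode H S"
  shows "coalgebra_map H H S"
  unfolding coalgebra_map_def
proof (intro conjI ballI)
  note o = bialgebra_one[OF H] and Tv = vspace_tensor_space
  note bm = bialgebra_bilinear[OF H]
  show lS: "linear_map H H S" using S by (simp add: is_antipode_def)
  let ?m = "tensor_mult H" and ?\<Delta> = "comult H" and ?o = "tens H H (hone H) (hone H)"
  let ?SS = "convol H (tens H H) S S" and ?u = "\<lambda>x. if x \<in> carr H then scl (tensor_space H H) (counit H x) ?o else 0"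
  have l\<Delta>: "linear_map H (tensor_space H H) ?\<Delta>" by (rule linear_comult[OF C])
  have l\<Delta>S: "linear_map H (tensor_space H H) (\<lambda>x. ?\<Delta> (S x))" by (rule linear_map_comp[OF l\<Delta> lS])
  have lSS: "linear_map H (tensor_space H H) ?SS" by (rule linear_convol[OF C Tv bilinear_tens lS lS])
  have oT: "?o \<in> carr (tensor_space H H)" by (rule tens_in_tensor_space[OF o o])
  have \<Delta>o: "?\<Delta> (scl H c (hone H)) = scl (tensor_space H H) c ?o" for c
    using H linear_map_scl[OF l\<Delta> o] by (simp add: bialgebra_def)
  have 1: "convol H ?m (\<lambda>x. ?\<Delta> (S x)) ?\<Delta> = ?u"
  proof
    fix x
    show "convol H ?m (\<lambda>x. ?\<Delta> (S x)) ?\<Delta> x = ?u x"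
    proof (cases "x \<in> carr H")
      case x: True
      have "convol H ?m (\<lambda>x. ?\<Delta> (S x)) ?\<Delta> x = sweedler H (\<lambda>a b. ?\<Delta> (hmult H (S a) b)) x"
        unfolding convol_inside[OF x] using H linear_map_carr[OF lS]
        by (intro sweedler_cong) (simp add: bialgebra_def)
      also have "\<dots> = ?\<Delta> (sweedler H (\<lambda>a b. hmult H (S a) b) x)"
        by (rule linear_comp_sweedler[OF C V Tv bilinear_map_comp[OF bm lS linear_map_ident] l\<Delta> x, symmetric])
      finally show ?thesis using S x \<Delta>o by (simp add: is_antipode_def)
    qed simp
  qed
  have 2: "convol H ?m ?\<Delta> ?SS = ?u"
  proof -
    have "convol H ?m ?\<Delta> ?SS = convol H ?m (convol H (tens H H) (\<lambda>x. x) (\<lambda>x. x)) ?SS"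
      by (rule convol_cong) (simp add: convol_inside sweedler_tens_self[OF C])
    \<comment> \<open>The interchange law makes the product componentwise; in each component the
      identity is convolved with \<open>S\<close>.\<close>
    also have "\<dots> = convol H (tens H H) (convol H (hmult H) (\<lambda>x. x) S) (convol H (hmult H) (\<lambda>x. x) S)"
      by (rule convol_interchange[OF C cc Tv Tv V V Tv linear_map_ident linear_map_ident lS lS
            bilinear_tens bilinear_tens bilinear_tensor_mult bm bm bilinear_tens])
        (rule tensor_mult_tens)
    also have "\<dots> = convol H (tens H H) (\<lambda>x. if x \<in> carr H then scl H (counit H x) (hone H) else 0)
        (\<lambda>x. scl H (counit H x) (hone H))"
      using S by (intro convol_cong) (simp add: convol_inside is_antipode_def)
    also have "\<dots> = ?u"
    proof
      fix x
      have lh: "linear_map H H (\<lambda>x. scl H (counit H x) (hone H))"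
        by (rule bilinear_map_comp_left[OF bilinear_scl[OF V] linear_counit[OF C] o])
      show "convol H (tens H H) (\<lambda>x. if x \<in> carr H then scl H (counit H x) (hone H) else 0)
        (\<lambda>x. scl H (counit H x) (hone H)) x = ?u x"
        using convol_counit_left[OF C V Tv bilinear_tens o lh, of x]
          linear_map_scl[OF bilinear_map_right[OF bilinear_tens o] o, of "counit H x"]
        by (cases "x \<in> carr H") simp_all
    qed
    finally show ?thesis .
  qed
  have "convol H ?m (convol H ?m (\<lambda>x. ?\<Delta> (S x)) ?\<Delta>) ?SS = convol H ?m (\<lambda>x. ?\<Delta> (S x)) (convol H ?m ?\<Delta> ?SS)"
    by (rule convol_assoc[OF C Tv Tv Tv l\<Delta>S l\<Delta> lSS bilinear_tensor_mult bilinear_tensor_mult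
          bilinear_tensor_mult bilinear_tensor_mult])
      (rule tensor_mult_assoc)
  then have 3: "convol H ?m ?u ?SS = convol H ?m (\<lambda>x. ?\<Delta> (S x)) ?u"
    unfolding 1 2 .
  fix x assume x: "x \<in> carr H"
  have "?SS x = ?m ?o (?SS x)"
    using tensor_mult_unit(1) linear_map_carr[OF lSS x] by simp
  also have "\<dots> = convol H ?m ?u ?SS x"
    by (rule convol_counit_left[OF C Tv Tv bilinear_tensor_mult oT lSS x, symmetric])
  also have "\<dots> = ?m (?\<Delta> (S x)) ?o"
    unfolding 3 by (rule convol_counit_right[OF C Tv Tv bilinear_tensor_mult oT l\<Delta>S x])
  also have "\<dots> = ?\<Delta> (S x)"
    using tensor_mult_unit(2) linear_map_carr[OF l\<Delta>S x] by simp
  finally show "?\<Delta> (S x) = sweedler H (\<lambda>x1 x2. tens H H (S x1) (S x2)) x"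
    by (simp add: convol_inside x)
  \<comment> \<open>A second leg is split off by the counit axiom, so that multiplicativity of the
    counit brings in the antipode axiom.\<close>
  have "counit H (S x) = sweedler H (\<lambda>a b. scl base_field (counit H b) (counit H (S a))) x"
    by (rule sweedler_counit_right[OF C vspace_base_field linear_map_comp[OF linear_counit[OF C] lS] x, symmetric])
  also have "\<dots> = sweedler H (\<lambda>a b. counit H (hmult H (S a) b)) x"
    using H linear_map_carr[OF lS] by (intro sweedler_cong) (simp add: bialgebra_def)
  also have "\<dots> = counit H (sweedler H (\<lambda>a b. hmult H (S a) b) x)"
    by (rule linear_comp_sweedler[OF C V vspace_base_field bilinear_map_comp[OF bm lS linear_map_ident] linear_counit[OF C] x, symmetric])
  also have "\<dots> = counit H x"
    using S H x linear_map_scl[OF linear_counit[OF C] o] by (simp add: is_antipode_def bialgebra_def)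
  finally show "counit H (S x) = counit H x" .
qed

end

definition cocommutative_coalgebra where
  "cocommutative_coalgebra C \<longleftrightarrow> coalgebra C \<and> cocommutative C"

locale cocommutative_hopf =
  fixes H :: "('k::field, 'a::ab_group_add) hopf"
  assumes hopf: "hopf_algebra H" and cocomm: "cocommutative H"
begin

abbreviation "m \<equiv> hmult H"
abbreviation "S \<equiv> antipode H"

lemma bialg: "bialgebra H" and antipode: "is_antipode H S"
  using hopf by (simp_all add: hopf_algebra_def)

lemma coalg: "coalgebra H" and V: "vspace H" and cocommutative_coalg: "cocommutative_coalgebra H"
  using bialgebra_coalgebra[OF bialg] coalgebra_vspace cocomm by (auto simp: cocommutative_coalgebra_def)

lemmas bilinear_m = bialgebra_bilinear[OF bialg]
lemmas m_carr = bilinear_map_carr[OF bilinear_m]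
lemmas one_carr = bialgebra_one[OF bialg]

lemma S_coalgebra_map: "coalgebra_map H H S"
  by (rule antipode_coalgebra_map[OF bialg cocomm antipode])

lemmas S_linear = coalgebra_map_linear[OF S_coalgebra_map]

lemma comp_in_coalg_maps:
  "cocommutative_coalgebra C \<Longrightarrow> coalgebra_map H H T \<Longrightarrow> f \<in> coalg_maps C H \<Longrightarrow> (\<lambda>x. T (f x)) \<in> coalg_maps C H"
  unfolding cocommutative_coalgebra_def by (blast intro: coalg_maps_comp coalg V)

lemma convol_in_coalg_maps:
  assumes C: "cocommutative_coalgebra C" and f: "f \<in> coalg_maps C H" and g: "g \<in> coalg_maps C H"
    and \<mu>: "coalg_bimap H H H \<mu>"
  shows "convol C \<mu> f g \<in> coalg_maps C H"
  using coalgebra_map_convol[OF _ _ coalg coalg coalg \<mu> coalg_mapsD[OF f] coalg_mapsD[OF g]] C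
  by (simp add: coalg_maps_def cocommutative_coalgebra_def)

lemma S_inverse:
  assumes C: "coalgebra C" and f: "f \<in> coalg_maps C H"
  shows "convol C m (\<lambda>x. S (f x)) f = one (conv_group C H)"
    and "convol C m f (\<lambda>x. S (f x)) = one (conv_group C H)"
proof -
  have "sweedler C (\<lambda>a b. m (S (f a)) (f b)) x = scl H (counit C x) (hone H)" if x: "x \<in> carr C" for x
  proof -
    have "sweedler C (\<lambda>a b. m (S (f a)) (f b)) x = sweedler H (\<lambda>a b. m (S a) b) (f x)"
      by (rule sweedler_coalgebra_map[OF C V coalg_mapsD[OF f] V
            bilinear_map_comp[OF bilinear_m S_linear linear_map_ident] x, symmetric])
    then show ?thesis
      using antipode coalg_maps_carr[OF f x] coalgebra_map_counit[OF coalg_mapsD[OF f] x]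
      by (simp add: is_antipode_def)
  qed
  then show "convol C m (\<lambda>x. S (f x)) f = one (conv_group C H)"
    by (simp add: convol_def one_conv_group fun_eq_iff)
  have "sweedler C (\<lambda>a b. m (f a) (S (f b))) x = scl H (counit C x) (hone H)" if x: "x \<in> carr C" for x
  proof -
    have "sweedler C (\<lambda>a b. m (f a) (S (f b))) x = sweedler H (\<lambda>a b. m a (S b)) (f x)"
      by (rule sweedler_coalgebra_map[OF C V coalg_mapsD[OF f] V
            bilinear_map_comp[OF bilinear_m linear_map_ident S_linear] x, symmetric])
    then show ?thesis
      using antipode coalg_maps_carr[OF f x] coalgebra_map_counit[OF coalg_mapsD[OF f] x]
      by (simp add: is_antipode_def)
  qed
  then show "convol C m f (\<lambda>x. S (f x)) = one (conv_group C H)"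
    by (simp add: convol_def one_conv_group fun_eq_iff)
qed

lemma group_conv_group:
  assumes CC: "cocommutative_coalgebra C"
  shows "group (conv_group C H)"
proof (rule groupI)
  have C: "coalgebra C" using CC by (simp add: cocommutative_coalgebra_def)
  note b = bilinear_m
  show "\<one>\<^bsub>conv_group C H\<^esub> \<in> carrier (conv_group C H)"
    using counit_unit_in_coalg_maps[OF C bialg] by (simp add: one_conv_group)
  fix f assume "f \<in> carrier (conv_group C H)"
  then have f: "f \<in> coalg_maps C H" by simp
  show "\<one>\<^bsub>conv_group C H\<^esub> \<otimes>\<^bsub>conv_group C H\<^esub> f = f"
  proof
    show "(\<one>\<^bsub>conv_group C H\<^esub> \<otimes>\<^bsub>conv_group C H\<^esub> f) x = f x" for x
      using convol_counit_left[OF C V V b one_carr coalg_maps_linear[OF f], of x] coalg_maps_outside[OF f, of x]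
        bialgebra_unit(1)[OF bialg coalg_maps_carr[OF f, of x]]
      by (cases "x \<in> carr C") (simp_all add: one_conv_group)
  qed
  show "\<exists>g\<in>carrier (conv_group C H). g \<otimes>\<^bsub>conv_group C H\<^esub> f = \<one>\<^bsub>conv_group C H\<^esub>"
    using S_inverse(1)[OF C f] comp_in_coalg_maps[OF CC S_coalgebra_map f] by auto
  fix g assume "g \<in> carrier (conv_group C H)"
  then have g: "g \<in> coalg_maps C H" by simp
  show "f \<otimes>\<^bsub>conv_group C H\<^esub> g \<in> carrier (conv_group C H)"
    using convol_in_coalg_maps[OF CC f g bialgebra_coalg_bimap[OF bialg]] by simp
  fix h assume "h \<in> carrier (conv_group C H)"
  then have h: "h \<in> coalg_maps C H" by simp
  show "f \<otimes>\<^bsub>conv_group C H\<^esub> g \<otimes>\<^bsub>conv_group C H\<^esub> h = f \<otimes>\<^bsub>conv_group C H\<^esub> (g \<otimes>\<^bsub>conv_group C H\<^esub> h)"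
    unfolding mult_conv_group
    by (rule convol_assoc[OF C V V V coalg_maps_linear[OF f] coalg_maps_linear[OF g] coalg_maps_linear[OF h]
        b b b b]) (rule bialgebra_assoc[OF bialg])
qed

lemma inv_conv_group:
  assumes CC: "cocommutative_coalgebra C" and f: "f \<in> coalg_maps C H"
  shows "inv\<^bsub>conv_group C H\<^esub> f = (\<lambda>x. S (f x))"
proof -
  have C: "coalgebra C" using CC by (simp add: cocommutative_coalgebra_def)
  show ?thesis
    using group.inv_equality[OF group_conv_group[OF CC], of "\<lambda>x. S (f x)" f] S_inverse(1)[OF C f] f
      comp_in_coalg_maps[OF CC S_coalgebra_map f] by simp
qed

end

section \<open>Projections from a tensor product of coalgebras\<close>

lemma tens_scl_left: "tens V W (scl V c v) w = tensor_scl c (tens V W v w)"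
  and tens_scl_right: "tens V W v (scl W c w) = tensor_scl c (tens V W v w)"
  by (auto simp: fun_eq_iff tens_def bilinear_form_def tensor_scl_def module_hom_iff linear_iff_module_hom)

text \<open>Encoded as a double cross product with zero actions, so that its coalgebra is literally
  the one in \<open>double_cross_bialg\<close>.\<close>

definition tcoalg where "tcoalg A K = double_cross_bialg A K (\<lambda>_ _. 0) (\<lambda>_ _. 0)"

lemma tensor_coalg_tcoalg: "tensor_coalg A K (tcoalg A K)"
  unfolding tcoalg_def by (rule tensor_coalg_double_cross_bialg)

text \<open>\<open>proj1\<close> is id \<otimes> counit and \<open>proj2\<close> is counit \<otimes>
  id; as points of the convolution group they are two independent variables.\<close>

definition proj1 where
  "proj1 A K = (\<lambda>t. if t \<in> carr (tcoalg A K) then tlift A K (\<lambda>a k. scl A (counit K k) a) t else 0)"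

definition proj2 where
  "proj2 A K = (\<lambda>t. if t \<in> carr (tcoalg A K) then tlift A K (\<lambda>a k. scl K (counit A a) k) t else 0)"

lemma cocommutative_coalgebraD:
  "cocommutative_coalgebra C \<Longrightarrow> coalgebra C" "cocommutative_coalgebra C \<Longrightarrow> cocommutative C"
  "cocommutative_coalgebra C \<Longrightarrow> vspace C"
  by (simp_all add: cocommutative_coalgebra_def coalgebra_vspace)

lemma cocommutative_coalgebra_tcoalg:
  "cocommutative_coalgebra A \<Longrightarrow> cocommutative_coalgebra K \<Longrightarrow> cocommutative_coalgebra (tcoalg A K)"
  unfolding cocommutative_coalgebra_def
  by (blast intro: coalgebra_tensor_coalg cocommutative_tensor_coalg tensor_coalg_tcoalg)

context
  fixes A :: "('k::field, 'a::ab_group_add, 'x) bialg_scheme"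
    and K :: "('k, 'b::ab_group_add, 'y) bialg_scheme"
  assumes A: "coalgebra A" and K: "coalgebra K"
begin

private lemma vsp_A: "vspace A" and vsp_K: "vspace K"
  using A K by (simp_all add: coalgebra_vspace)

lemma coalgebra_tcoalg: "coalgebra (tcoalg A K)"
  by (rule coalgebra_tensor_coalg[OF A K tensor_coalg_tcoalg])

lemma tens_in_tcoalg: "a \<in> carr A \<Longrightarrow> k \<in> carr K \<Longrightarrow> tens A K a k \<in> carr (tcoalg A K)"
  by (rule tens_in_tensor_coalg[OF A K tensor_coalg_tcoalg])

lemma coalg_bimap_tens_tcoalg: "coalg_bimap A K (tcoalg A K) (tens A K)"
  by (rule coalg_bimap_tens[OF A K tensor_coalg_tcoalg])

lemmas bilinear_tens_tcoalg = coalg_bimap_bilinear[OF coalg_bimap_tens_tcoalg]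

lemma bilinear_counit_scl: "bilinear_map A K A (\<lambda>a k. scl A (counit K k) a)"
  by (rule bilinear_map_flip[OF bilinear_map_comp[OF bilinear_scl[OF vsp_A] linear_counit[OF K] linear_map_ident]])

lemma bilinear_counit_scl': "bilinear_map A K K (\<lambda>a k. scl K (counit A a) k)"
  by (rule bilinear_map_comp[OF bilinear_scl[OF vsp_K] linear_counit[OF A] linear_map_ident])

private lemma linear_scl_tens:
  "linear_map V (tensor_space U U') f \<Longrightarrow> linear_map V (tensor_space U U') (\<lambda>x. scl (tensor_space U U') c (f x))"
  using bilinear_map_comp_right[OF bilinear_scl[OF vspace_tensor_space]] by simp

lemma coalg_bimap_counit_left: "coalg_bimap A K A (\<lambda>a k. scl A (counit K k) a)"
  unfolding coalg_bimap_def
proof (intro conjI ballI bilinear_counit_scl)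
  fix a k assume a: "a \<in> carr A" and k: "k \<in> carr K"
  let ?T = "tensor_space A A"
  have "sweedler A (\<lambda>a1 a2. sweedler K (\<lambda>k1 k2. tens A A (scl A (counit K k1) a1) (scl A (counit K k2) a2)) k) a
    = sweedler A (\<lambda>a1 a2. scl ?T (counit K k) (tens A A a1 a2)) a"
  proof (rule sweedler_cong)
    fix a1 a2 assume *: "a1 \<in> carr A" "a2 \<in> carr A"
    have "sweedler K (\<lambda>k1 k2. tens A A (scl A (counit K k1) a1) (scl A (counit K k2) a2)) k
      = sweedler K (\<lambda>k1 k2. scl ?T (counit K k1) (scl ?T (counit K k2) (tens A A a1 a2))) k"
      by (simp add: tens_scl_left tens_scl_right tensor_scl_def mult.left_commute)
    also have "\<dots> = scl ?T (counit K k) (tens A A a1 a2)"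
      by (rule sweedler_counit_left[OF K vspace_tensor_space bilinear_map_comp_left[OF
            bilinear_scl[OF vspace_tensor_space] linear_counit[OF K] tens_in_tensor_space[OF *]] k])
    finally show "sweedler K (\<lambda>k1 k2. tens A A (scl A (counit K k1) a1) (scl A (counit K k2) a2)) k
      = scl ?T (counit K k) (tens A A a1 a2)" .
  qed
  also have "\<dots> = scl ?T (counit K k) (sweedler A (tens A A) a)"
    by (rule linear_comp_sweedler[OF A vspace_tensor_space vspace_tensor_space bilinear_tens
          linear_scl_tens[OF linear_map_ident] a, symmetric])
  also have "\<dots> = comult A (scl A (counit K k) a)"
    using linear_map_scl[OF linear_comult[OF A] a] by (simp add: sweedler_tens_self[OF A a])
  finally show "comult A (scl A (counit K k) a) = sweedler A (\<lambda>a1 a2. sweedler K (\<lambda>k1 k2.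
      tens A A (scl A (counit K k1) a1) (scl A (counit K k2) a2)) k) a" ..
  show "counit A (scl A (counit K k) a) = counit A a * counit K k"
    using linear_map_scl[OF linear_counit[OF A] a] by simp
qed

lemma coalg_bimap_counit_right: "coalg_bimap A K K (\<lambda>a k. scl K (counit A a) k)"
  unfolding coalg_bimap_def
proof (intro conjI ballI bilinear_counit_scl')
  fix a k assume a: "a \<in> carr A" and k: "k \<in> carr K"
  let ?T = "tensor_space K K"
  have "sweedler A (\<lambda>a1 a2. sweedler K (\<lambda>k1 k2. tens K K (scl K (counit A a1) k1) (scl K (counit A a2) k2)) k) a
    = sweedler A (\<lambda>a1 a2. scl ?T (counit A a1) (scl ?T (counit A a2) (comult K k))) a"
  proof (rule sweedler_cong)
    fix a1 a2
    have "sweedler K (\<lambda>k1 k2. tens K K (scl K (counit A a1) k1) (scl K (counit A a2) k2)) k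
      = sweedler K (\<lambda>k1 k2. scl ?T (counit A a1) (scl ?T (counit A a2) (tens K K k1 k2))) k"
      by (simp add: tens_scl_left tens_scl_right tensor_scl_def mult.left_commute)
    also have "\<dots> = scl ?T (counit A a1) (scl ?T (counit A a2) (sweedler K (tens K K) k))"
      by (rule linear_comp_sweedler[OF K vspace_tensor_space vspace_tensor_space bilinear_tens
          linear_scl_tens[OF linear_scl_tens[OF linear_map_ident]] k, symmetric])
    finally show "sweedler K (\<lambda>k1 k2. tens K K (scl K (counit A a1) k1) (scl K (counit A a2) k2)) k
      = scl ?T (counit A a1) (scl ?T (counit A a2) (comult K k))"
      by (simp add: sweedler_tens_self[OF K k])
  qed
  also have "\<dots> = scl ?T (counit A a) (comult K k)"
    by (rule sweedler_counit_left[OF A vspace_tensor_space bilinear_map_comp_left[OF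
            bilinear_scl[OF vspace_tensor_space] linear_counit[OF A] linear_map_carr[OF linear_comult[OF K] k]] a])
  also have "\<dots> = comult K (scl K (counit A a) k)"
    using linear_map_scl[OF linear_comult[OF K] k] by simp
  finally show "comult K (scl K (counit A a) k) = sweedler A (\<lambda>a1 a2. sweedler K (\<lambda>k1 k2.
      tens K K (scl K (counit A a1) k1) (scl K (counit A a2) k2)) k) a" ..
  show "counit K (scl K (counit A a) k) = counit A a * counit K k"
    using linear_map_scl[OF linear_counit[OF K] k] by simp
qed

lemma proj1_in_coalg_maps: "proj1 A K \<in> coalg_maps (tcoalg A K) A"
  by (rule coalg_mapsI[OF coalgebra_tcoalg coalg_bimap_lift[OF A K tensor_coalg_tcoalg A coalg_bimap_counit_left]])
    (simp_all add: proj1_def)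

lemma proj2_in_coalg_maps: "proj2 A K \<in> coalg_maps (tcoalg A K) K"
  by (rule coalg_mapsI[OF coalgebra_tcoalg coalg_bimap_lift[OF A K tensor_coalg_tcoalg K coalg_bimap_counit_right]])
    (simp_all add: proj2_def)

lemma proj1_tens: "a \<in> carr A \<Longrightarrow> k \<in> carr K \<Longrightarrow> proj1 A K (tens A K a k) = scl A (counit K k) a"
  and proj2_tens: "a \<in> carr A \<Longrightarrow> k \<in> carr K \<Longrightarrow> proj2 A K (tens A K a k) = scl K (counit A a) k"
  using tlift_tens[OF vsp_A vsp_K vsp_A bilinear_counit_scl] tlift_tens[OF vsp_A vsp_K vsp_K bilinear_counit_scl']
  by (simp_all add: proj1_def proj2_def tens_in_tcoalg)

text \<open>One convolution factor depends on the first tensor factor alone. The counit then absorbs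
  one leg of \<open>k\<close>, and there remains a convolution over \<open>A\<close> in which
  \<open>k\<close> is a parameter.\<close>

lemma convol_proj1_right:
  assumes U: "vspace U" and \<mu>: "bilinear_map X Y U \<mu>" and u: "linear_map (tcoalg A K) X u" and f: "linear_map A Y f"
    and a: "a \<in> carr A" and k: "k \<in> carr K"
  shows "convol (tcoalg A K) \<mu> u (\<lambda>t. f (proj1 A K t)) (tens A K a k) = convol A \<mu> (\<lambda>x. u (tens A K x k)) f a"
proof -
  have p: "linear_map (tcoalg A K) Y (\<lambda>t. f (proj1 A K t))"
    by (rule linear_map_comp[OF f coalg_maps_linear[OF proj1_in_coalg_maps]])
  have "convol (tcoalg A K) \<mu> u (\<lambda>t. f (proj1 A K t)) (tens A K a k)
    = sweedler A (\<lambda>a1 a2. sweedler K (\<lambda>k1 k2. \<mu> (u (tens A K a1 k1)) (f (proj1 A K (tens A K a2 k2)))) k) a"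
    unfolding convol_inside[OF tens_in_tcoalg[OF a k]]
    by (rule sweedler_tens[OF A K tensor_coalg_tcoalg U bilinear_map_comp[OF \<mu> u p] a k])
  also have "\<dots> = sweedler A (\<lambda>a1 a2. \<mu> (u (tens A K a1 k)) (f a2)) a"
  proof (rule sweedler_cong)
    fix a1 a2 assume *: "a1 \<in> carr A" "a2 \<in> carr A"
    have "sweedler K (\<lambda>k1 k2. \<mu> (u (tens A K a1 k1)) (f (proj1 A K (tens A K a2 k2)))) k
      = sweedler K (\<lambda>k1 k2. scl U (counit K k2) (\<mu> (u (tens A K a1 k1)) (f a2))) k"
      using * linear_map_scl[OF f] linear_map_scl[OF bilinear_map_right[OF \<mu>]] linear_map_carr[OF u] linear_map_carr[OF f]
      by (intro sweedler_cong) (simp add: proj1_tens tens_in_tcoalg)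
    also have "\<dots> = \<mu> (u (tens A K a1 k)) (f a2)"
      by (rule sweedler_counit_right[OF K U linear_map_comp[OF bilinear_map_comp_left[OF \<mu> u linear_map_carr[OF f *(2)]]
            bilinear_map_right[OF bilinear_tens_tcoalg *(1)]] k])
    finally show "sweedler K (\<lambda>k1 k2. \<mu> (u (tens A K a1 k1)) (f (proj1 A K (tens A K a2 k2)))) k
      = \<mu> (u (tens A K a1 k)) (f a2)" .
  qed
  finally show ?thesis by (simp add: convol_inside a)
qed

lemma convol_proj1_left:
  assumes U: "vspace U" and \<mu>: "bilinear_map X Y U \<mu>" and u: "linear_map (tcoalg A K) Y u" and f: "linear_map A X f"
    and a: "a \<in> carr A" and k: "k \<in> carr K"
  shows "convol (tcoalg A K) \<mu> (\<lambda>t. f (proj1 A K t)) u (tens A K a k) = convol A \<mu> f (\<lambda>x. u (tens A K x k)) a"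
proof -
  have p: "linear_map (tcoalg A K) X (\<lambda>t. f (proj1 A K t))"
    by (rule linear_map_comp[OF f coalg_maps_linear[OF proj1_in_coalg_maps]])
  have "convol (tcoalg A K) \<mu> (\<lambda>t. f (proj1 A K t)) u (tens A K a k)
    = sweedler A (\<lambda>a1 a2. sweedler K (\<lambda>k1 k2. \<mu> (f (proj1 A K (tens A K a1 k1))) (u (tens A K a2 k2))) k) a"
    unfolding convol_inside[OF tens_in_tcoalg[OF a k]]
    by (rule sweedler_tens[OF A K tensor_coalg_tcoalg U bilinear_map_comp[OF \<mu> p u] a k])
  also have "\<dots> = sweedler A (\<lambda>a1 a2. \<mu> (f a1) (u (tens A K a2 k))) a"
  proof (rule sweedler_cong)
    fix a1 a2 assume *: "a1 \<in> carr A" "a2 \<in> carr A"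
    have "sweedler K (\<lambda>k1 k2. \<mu> (f (proj1 A K (tens A K a1 k1))) (u (tens A K a2 k2))) k
      = sweedler K (\<lambda>k1 k2. scl U (counit K k1) (\<mu> (f a1) (u (tens A K a2 k2)))) k"
      using * linear_map_scl[OF f] linear_map_scl[OF bilinear_map_left[OF \<mu>]] linear_map_carr[OF u] linear_map_carr[OF f]
      by (intro sweedler_cong) (simp add: proj1_tens tens_in_tcoalg)
    also have "\<dots> = \<mu> (f a1) (u (tens A K a2 k))"
      by (rule sweedler_counit_left[OF K U linear_map_comp[OF bilinear_map_comp_right[OF \<mu> u linear_map_carr[OF f *(1)]]
            bilinear_map_right[OF bilinear_tens_tcoalg *(2)]] k])
    finally show "sweedler K (\<lambda>k1 k2. \<mu> (f (proj1 A K (tens A K a1 k1))) (u (tens A K a2 k2))) k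
      = \<mu> (f a1) (u (tens A K a2 k))" .
  qed
  finally show ?thesis by (simp add: convol_inside a)
qed

lemma convol_proj2_right:
  assumes U: "vspace U" and \<mu>: "bilinear_map X Y U \<mu>" and u: "linear_map (tcoalg A K) X u" and f: "linear_map K Y f"
    and a: "a \<in> carr A" and k: "k \<in> carr K"
  shows "convol (tcoalg A K) \<mu> u (\<lambda>t. f (proj2 A K t)) (tens A K a k) = convol K \<mu> (\<lambda>y. u (tens A K a y)) f k"
proof -
  have p: "linear_map (tcoalg A K) Y (\<lambda>t. f (proj2 A K t))"
    by (rule linear_map_comp[OF f coalg_maps_linear[OF proj2_in_coalg_maps]])
  note uf = bilinear_map_comp[OF \<mu> linear_map_comp[OF u bilinear_map_right[OF bilinear_tens_tcoalg]] f]
  have "convol (tcoalg A K) \<mu> u (\<lambda>t. f (proj2 A K t)) (tens A K a k)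
    = sweedler A (\<lambda>a1 a2. sweedler K (\<lambda>k1 k2. \<mu> (u (tens A K a1 k1)) (f (proj2 A K (tens A K a2 k2)))) k) a"
    unfolding convol_inside[OF tens_in_tcoalg[OF a k]]
    by (rule sweedler_tens[OF A K tensor_coalg_tcoalg U bilinear_map_comp[OF \<mu> u p] a k])
  also have "\<dots> = sweedler A (\<lambda>a1 a2. scl U (counit A a2) (sweedler K (\<lambda>k1 k2. \<mu> (u (tens A K a1 k1)) (f k2)) k)) a"
  proof (rule sweedler_cong)
    fix a1 a2 assume *: "a1 \<in> carr A" "a2 \<in> carr A"
    have "sweedler K (\<lambda>k1 k2. \<mu> (u (tens A K a1 k1)) (f (proj2 A K (tens A K a2 k2)))) k
      = sweedler K (\<lambda>k1 k2. scl U (counit A a2) (\<mu> (u (tens A K a1 k1)) (f k2))) k"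
      using * linear_map_scl[OF f] linear_map_scl[OF bilinear_map_right[OF \<mu>]] linear_map_carr[OF u] linear_map_carr[OF f]
      by (intro sweedler_cong) (simp add: proj2_tens tens_in_tcoalg)
    also have "\<dots> = scl U (counit A a2) (sweedler K (\<lambda>k1 k2. \<mu> (u (tens A K a1 k1)) (f k2)) k)"
      by (rule linear_comp_sweedler[OF K U U uf[OF *(1)] bilinear_map_right[OF bilinear_scl[OF U]] k, symmetric]) simp
    finally show "sweedler K (\<lambda>k1 k2. \<mu> (u (tens A K a1 k1)) (f (proj2 A K (tens A K a2 k2)))) k
      = scl U (counit A a2) (sweedler K (\<lambda>k1 k2. \<mu> (u (tens A K a1 k1)) (f k2)) k)" .
  qed
  also have "\<dots> = sweedler K (\<lambda>k1 k2. \<mu> (u (tens A K a k1)) (f k2)) k"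
  proof (rule sweedler_counit_right[OF A U _ a])
    show "linear_map A U (\<lambda>a1. sweedler K (\<lambda>k1 k2. \<mu> (u (tens A K a1 k1)) (f k2)) k)"
    proof (rule linear_sweedler_param[OF K vsp_A U _ k], rule trilinear_mapI)
      show "linear_map A U (\<lambda>a1. \<mu> (u (tens A K a1 k1)) (f k2))" if "k1 \<in> carr K" "k2 \<in> carr K" for k1 k2
        by (rule linear_map_comp[OF bilinear_map_comp_left[OF \<mu> u linear_map_carr[OF f that(2)]]
              bilinear_map_left[OF bilinear_tens_tcoalg that(1)]])
    qed (auto intro: bilinear_map_left[OF uf] bilinear_map_right[OF uf])
  qed
  finally show ?thesis by (simp add: convol_inside k)
qed

text \<open>The bridge from the convolution group back to elements: the product of the two
  variables, evaluated at an elementary tensor, is the product of its entries.\<close>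

lemma convol_proj:
  assumes U: "vspace U" and X: "vspace X" and Y: "vspace Y" and \<mu>: "bilinear_map X Y U \<mu>"
    and f: "linear_map A X f" and g: "linear_map K Y g" and a: "a \<in> carr A" and k: "k \<in> carr K"
  shows "convol (tcoalg A K) \<mu> (\<lambda>t. f (proj1 A K t)) (\<lambda>t. g (proj2 A K t)) (tens A K a k) = \<mu> (f a) (g k)"
proof -
  have "convol (tcoalg A K) \<mu> (\<lambda>t. f (proj1 A K t)) (\<lambda>t. g (proj2 A K t)) (tens A K a k)
    = convol A \<mu> f (\<lambda>x. g (proj2 A K (tens A K x k))) a"
    by (rule convol_proj1_left[OF U \<mu> linear_map_comp[OF g coalg_maps_linear[OF proj2_in_coalg_maps]] f a k])
  also have "\<dots> = convol A \<mu> f (\<lambda>x. if x \<in> carr A then scl Y (counit A x) (g k) else 0) a"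
    using linear_map_scl[OF g k] by (intro fun_cong[OF convol_cong]) (simp add: proj2_tens k)
  also have "\<dots> = \<mu> (f a) (g k)"
    by (rule convol_counit_right[OF A Y U \<mu> linear_map_carr[OF g k] f a])
  finally show ?thesis .
qed

context
  fixes C :: "('k, 'c::ab_group_add, 'z) bialg_scheme" and f g
  assumes C: "cocommutative_coalgebra C" and f: "f \<in> coalg_maps C A" and g: "g \<in> coalg_maps C K"
begin

text \<open>For a cocommutative source the tensor product is a product of coalgebras: this is the
  map with components \<open>f\<close> and \<open>g\<close>, as \<open>proj1_pair\<close> and
  \<open>proj2_pair\<close> confirm.\<close>

lemma pair_in_coalg_maps: "convol C (tens A K) f g \<in> coalg_maps C (tcoalg A K)"
  using coalgebra_map_convol[OF _ _ A K coalgebra_tcoalg coalg_bimap_tens_tcoalg coalg_mapsD[OF f] coalg_mapsD[OF g]] C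
  by (simp add: coalg_maps_def cocommutative_coalgebra_def)

private lemma C': "coalgebra C"
  using C by (rule cocommutative_coalgebraD)

lemma proj1_pair: "(\<lambda>x. proj1 A K (convol C (tens A K) f g x)) = f"
proof
  fix x
  note VT = coalgebra_vspace[OF coalgebra_tcoalg] and lf = coalg_maps_linear[OF f] and lg = coalg_maps_linear[OF g]
  have "proj1 A K (convol C (tens A K) f g x) = convol C (\<lambda>a k. proj1 A K (tens A K a k)) f g x"
    by (rule fun_cong[OF linear_comp_convol[OF C' VT vsp_A bilinear_tens_tcoalg lf lg coalg_maps_linear[OF proj1_in_coalg_maps]]])
  also have "\<dots> = f x"
  proof (cases "x \<in> carr C")
    case x: True
    have "convol C (\<lambda>a k. proj1 A K (tens A K a k)) f g x = sweedler C (\<lambda>a b. scl A (counit C b) (f a)) x"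
      unfolding convol_inside[OF x] using coalgebra_map_counit[OF coalg_mapsD[OF g]]
      by (intro sweedler_cong) (simp add: proj1_tens linear_map_carr[OF lf] linear_map_carr[OF lg])
    then show ?thesis using sweedler_counit_right[OF C' vsp_A lf x] by simp
  qed (simp add: coalg_maps_outside[OF f])
  finally show "proj1 A K (convol C (tens A K) f g x) = f x" .
qed

lemma proj2_pair: "(\<lambda>x. proj2 A K (convol C (tens A K) f g x)) = g"
proof
  fix x
  note VT = coalgebra_vspace[OF coalgebra_tcoalg] and lf = coalg_maps_linear[OF f] and lg = coalg_maps_linear[OF g]
  have "proj2 A K (convol C (tens A K) f g x) = convol C (\<lambda>a k. proj2 A K (tens A K a k)) f g x"
    by (rule fun_cong[OF linear_comp_convol[OF C' VT vsp_K bilinear_tens_tcoalg lf lg coalg_maps_linear[OF proj2_in_coalg_maps]]])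
  also have "\<dots> = g x"
  proof (cases "x \<in> carr C")
    case x: True
    have "convol C (\<lambda>a k. proj2 A K (tens A K a k)) f g x = sweedler C (\<lambda>a b. scl K (counit C a) (g b)) x"
      unfolding convol_inside[OF x] using coalgebra_map_counit[OF coalg_mapsD[OF f]]
      by (intro sweedler_cong) (simp add: proj2_tens linear_map_carr[OF lf] linear_map_carr[OF lg])
    then show ?thesis using sweedler_counit_left[OF C' vsp_K lg x] by simp
  qed (simp add: coalg_maps_outside[OF g])
  finally show "proj2 A K (convol C (tens A K) f g x) = g x" .
qed

text \<open>Every convolution is a linear map on the tensor product after the pair of its arguments,
  so what is known about that linear map holds at all points.\<close>

lemma convol_eq_pair:
  assumes U: "vspace U" and \<Phi>: "linear_map (tcoalg A K) U \<Phi>"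
    and \<mu>: "\<And>a k. a \<in> carr A \<Longrightarrow> k \<in> carr K \<Longrightarrow> \<mu> a k = \<Phi> (tens A K a k)"
  shows "convol C \<mu> f g = (\<lambda>x. \<Phi> (convol C (tens A K) f g x))"
proof -
  have "convol C \<mu> f g = convol C (\<lambda>a k. \<Phi> (tens A K a k)) f g"
    by (rule convol_cong) (simp add: \<mu> coalg_maps_carr[OF f] coalg_maps_carr[OF g])
  also have "\<dots> = (\<lambda>x. \<Phi> (convol C (tens A K) f g x))"
    by (rule linear_comp_convol[OF C' coalgebra_vspace[OF coalgebra_tcoalg] U bilinear_tens_tcoalg
          coalg_maps_linear[OF f] coalg_maps_linear[OF g] \<Phi>, symmetric])
  finally show ?thesis .
qed

end

end

text \<open>\<open>f\<close>, \<open>g\<close> and \<open>h\<close> are the three projections of a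
  triple tensor product. The parametrisation \<open>q\<close> allows \<open>\<mu>\<close> to live on
  another space; it is the identity for the descendent product and \<open>qmap\<close> for the
  double cross product.\<close>

lemma assoc_of_convol_assoc:
  fixes K :: "('k::field, 'a::ab_group_add, 'z) bialg_scheme"
  assumes K: "coalgebra K" and D: "vspace D" and \<mu>: "bilinear_map D D D \<mu>" and q: "linear_map K D q"
  defines "Q \<equiv> tcoalg K K"
  defines "C \<equiv> tcoalg Q K"
  defines "f \<equiv> \<lambda>t. proj1 K K (proj1 Q K t)" and "g \<equiv> \<lambda>t. proj2 K K (proj1 Q K t)" and "h \<equiv> proj2 Q K"
  assumes eq: "convol C \<mu> (convol C \<mu> (\<lambda>t. q (f t)) (\<lambda>t. q (g t))) (\<lambda>t. q (h t))
    = convol C \<mu> (\<lambda>t. q (f t)) (convol C \<mu> (\<lambda>t. q (g t)) (\<lambda>t. q (h t)))"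
    and x: "x \<in> carr K" and y: "y \<in> carr K" and z: "z \<in> carr K"
  shows "\<mu> (\<mu> (q x) (q y)) (q z) = \<mu> (q x) (\<mu> (q y) (q z))"
proof -
  have Q: "coalgebra Q" unfolding Q_def by (rule coalgebra_tcoalg[OF K K])
  have C: "coalgebra C" unfolding C_def by (rule coalgebra_tcoalg[OF Q K])
  note VK = coalgebra_vspace[OF K]
  let ?p1 = "\<lambda>t. q (proj1 K K t)" and ?p2 = "\<lambda>t. q (proj2 K K t)"
  have p: "linear_map Q D ?p1" "linear_map Q D ?p2"
    unfolding Q_def by (rule linear_map_comp[OF q] coalg_maps_linear[OF proj1_in_coalg_maps[OF K K]]
      coalg_maps_linear[OF proj2_in_coalg_maps[OF K K]])+
  have Lp: "linear_map C D (\<lambda>t. q (g t))" "linear_map C D (\<lambda>t. q (h t))"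
    unfolding g_def h_def C_def
    by (rule linear_map_comp[OF p(2)] linear_map_comp[OF q] coalg_maps_linear[OF proj1_in_coalg_maps[OF Q K]]
        coalg_maps_linear[OF proj2_in_coalg_maps[OF Q K]])+
  let ?xy = "tens K K x y" let ?t = "tens Q K ?xy z"
  have xy: "?xy \<in> carr Q" unfolding Q_def by (rule tens_in_tcoalg[OF K K x y])
  have L: "linear_map Q D (convol Q \<mu> ?p1 ?p2)" by (rule linear_convol[OF Q D \<mu> p])
  have "convol C \<mu> (\<lambda>t. q (f t)) (\<lambda>t. q (g t)) = (\<lambda>t. convol Q \<mu> ?p1 ?p2 (proj1 Q K t))"
    unfolding f_def g_def C_def
    by (rule convol_precomp[OF C[unfolded C_def] Q D \<mu> p proj1_in_coalg_maps[OF Q K], symmetric])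
  then have "convol C \<mu> (convol C \<mu> (\<lambda>t. q (f t)) (\<lambda>t. q (g t))) (\<lambda>t. q (h t)) ?t
    = \<mu> (convol Q \<mu> ?p1 ?p2 ?xy) (q z)"
    unfolding h_def C_def using convol_proj[OF Q K D D D \<mu> L q xy z] by simp
  also have "\<dots> = \<mu> (\<mu> (q x) (q y)) (q z)"
    unfolding Q_def using convol_proj[OF K K D D D \<mu> q q x y] by simp
  finally have lhs: "convol C \<mu> (convol C \<mu> (\<lambda>t. q (f t)) (\<lambda>t. q (g t))) (\<lambda>t. q (h t)) ?t
    = \<mu> (\<mu> (q x) (q y)) (q z)" .
  let ?u = "convol C \<mu> (\<lambda>t. q (g t)) (\<lambda>t. q (h t))"
  have u: "linear_map C D ?u" by (rule linear_convol[OF C D \<mu> Lp])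
  have ut: "?u (tens Q K s z) = \<mu> (q (proj2 K K s)) (q z)" if "s \<in> carr Q" for s
    unfolding g_def h_def C_def by (rule convol_proj[OF Q K D D D \<mu> p(2) q that z])
  have lz: "linear_map K D (\<lambda>y. \<mu> (q y) (q z))"
    by (rule bilinear_map_comp_left[OF \<mu> q linear_map_carr[OF q z]])
  \<comment> \<open>The bracketing on the right does not match the nesting of the tensor product, so
    the first variable is peeled off while \<open>z\<close> stays a parameter.\<close>
  have "convol C \<mu> (\<lambda>t. q (f t)) ?u ?t = convol Q \<mu> ?p1 (\<lambda>s. ?u (tens Q K s z)) ?xy"
    unfolding f_def C_def
    by (rule convol_proj1_left[OF Q K D \<mu> u[unfolded C_def] p(1) xy z])
  also have "\<dots> = convol Q \<mu> ?p1 (\<lambda>s. \<mu> (q (proj2 K K s)) (q z)) ?xy"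
    by (rule fun_cong[OF convol_cong]) (simp add: ut)
  also have "\<dots> = \<mu> (q x) (\<mu> (q y) (q z))"
    unfolding Q_def by (rule convol_proj[OF K K D D D \<mu> q lz x y])
  finally show ?thesis using lhs eq by simp
qed

section \<open>Rota-Baxter Hopf algebras as Rota-Baxter groups\<close>

context cocommutative_hopf
begin

abbreviation "Q \<equiv> tcoalg H H"
abbreviation "p1 \<equiv> proj1 H H"
abbreviation "p2 \<equiv> proj2 H H"

lemma coalgebra_Q: "coalgebra Q"
  by (rule coalgebra_tcoalg[OF coalg coalg])

lemma cocommutative_Q: "cocommutative_coalgebra Q"
  by (rule cocommutative_coalgebra_tcoalg[OF cocommutative_coalg cocommutative_coalg])

lemma p1_in: "p1 \<in> coalg_maps Q H" and p2_in: "p2 \<in> coalg_maps Q H"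
  by (rule proj1_in_coalg_maps[OF coalg coalg] proj2_in_coalg_maps[OF coalg coalg])+

lemma convol_m_in: "cocommutative_coalgebra C \<Longrightarrow> f \<in> coalg_maps C H \<Longrightarrow> g \<in> coalg_maps C H \<Longrightarrow>
    convol C m f g \<in> coalg_maps C H"
  by (rule convol_in_coalg_maps[OF _ _ _ bialgebra_coalg_bimap[OF bialg]])

lemma convol_m_precomp:
  assumes "coalgebra C" "coalgebra D" "h \<in> coalg_maps C D" "f \<in> coalg_maps D H" "g \<in> coalg_maps D H"
  shows "convol D m f g (h x) = convol C m (\<lambda>x. f (h x)) (\<lambda>x. g (h x)) x"
  using convol_precomp[OF assms(1,2) V bilinear_m coalg_maps_linear[OF assms(4)] coalg_maps_linear[OF assms(5)] assms(3)]
  by (rule fun_cong)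

context
  fixes T
  assumes T: "coalgebra_map H H T"
begin

text \<open>The descendent product as a map on H \<otimes> H, written as a word in the two
  projections. As an element of the convolution group it is a coalgebra map at once.\<close>

private definition "\<Phi> = convol Q m (convol Q m (convol Q m (\<lambda>t. T (p1 t)) p2) (\<lambda>t. S (T (p1 t)))) p1"

private lemma T_lin: "linear_map H H T"
  by (rule coalgebra_map_linear[OF T])

private lemma ST: "coalgebra_map H H (\<lambda>x. S (T x))"
  by (rule coalgebra_map_comp[OF coalg coalg V T S_coalgebra_map])

private lemmas q_intros = convol_m_in[OF cocommutative_Q] comp_in_coalg_maps[OF cocommutative_Q T]
  comp_in_coalg_maps[OF cocommutative_Q ST] p1_in p2_in

private lemma \<Phi>_in: "\<Phi> \<in> coalg_maps Q H"
  unfolding \<Phi>_def by (intro q_intros)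

private lemma \<Phi>_tens:
  assumes x: "x \<in> carr H" and y: "y \<in> carr H"
  shows "\<Phi> (tens H H x y) = descendent_mult H T x y"
proof -
  let ?c = "convol Q m (\<lambda>t. T (p1 t)) p2"
  let ?d = "convol Q m ?c (\<lambda>t. S (T (p1 t)))"
  have c: "?c (tens H H u y) = m (T u) y" if "u \<in> carr H" for u
    by (rule convol_proj[OF coalg coalg V V V bilinear_m T_lin linear_map_ident that y])
  note ST_lin = coalgebra_map_linear[OF ST]
  have b: "bilinear_map H H H (\<lambda>x1 x2. m (m (T x1) y) (S (T x2)))"
    by (rule bilinear_map_comp[OF bilinear_m bilinear_map_comp_left[OF bilinear_m T_lin y] ST_lin])
  have d: "?d (tens H H u y) = sweedler H (\<lambda>x1 x2. m (m (T x1) y) (S (T x2))) u" if u: "u \<in> carr H" for u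
  proof -
    have "?d (tens H H u y) = convol H m (\<lambda>x. ?c (tens H H x y)) (\<lambda>x. S (T x)) u"
      by (rule convol_proj1_right[OF coalg coalg V bilinear_m _ ST_lin u y])
        (intro coalg_maps_linear q_intros)
    also have "\<dots> = sweedler H (\<lambda>x1 x2. m (m (T x1) y) (S (T x2))) u"
      unfolding convol_inside[OF u] by (rule sweedler_cong) (simp add: c)
    finally show ?thesis .
  qed
  have "\<Phi> (tens H H x y) = convol H m (\<lambda>x. ?d (tens H H x y)) (\<lambda>x. x) x"
    unfolding \<Phi>_def
    by (rule convol_proj1_right[OF coalg coalg V bilinear_m _ linear_map_ident x y])
      (intro coalg_maps_linear q_intros)
  also have "\<dots> = sweedler H (\<lambda>u x3. sweedler H (\<lambda>x1 x2. m (m (m (T x1) y) (S (T x2))) x3) u) x"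
    unfolding convol_inside[OF x]
  proof (rule sweedler_cong)
    fix u v assume u: "u \<in> carr H" and v: "v \<in> carr H"
    show "m (?d (tens H H u y)) v = sweedler H (\<lambda>x1 x2. m (m (m (T x1) y) (S (T x2))) v) u"
      unfolding d[OF u]
      by (rule linear_comp_sweedler[OF coalg V V b bilinear_map_left[OF bilinear_m v] u])
  qed
  finally show ?thesis by (simp add: descendent_mult_def sweedler3_def)
qed

lemma descendent_mult_coalg_bimap: "coalg_bimap H H H (descendent_mult H T)"
  by (rule coalg_bimap_cong[OF coalg coalg coalg_bimap_of_coalgebra_map[OF coalg coalg tensor_coalg_tcoalg coalg
          coalg_mapsD[OF \<Phi>_in]] \<Phi>_tens])

text \<open>Stated for every coalgebra map \<open>T\<close>: it is applied to \<open>Bt\<close>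
  before that is known to be a Rota-Baxter operator, and to \<open>B\<close> inside the descendent
  algebra.\<close>

lemma convol_descendent_mult:
  assumes CC: "cocommutative_coalgebra C" and f: "f \<in> coalg_maps C H" and g: "g \<in> coalg_maps C H"
  shows "convol C (descendent_mult H T) f g
    = convol C m (convol C m (convol C m (\<lambda>x. T (f x)) g) (\<lambda>x. S (T (f x)))) f"
proof -
  note C = cocommutative_coalgebraD(1)[OF CC]
  let ?h = "convol C (tens H H) f g"
  note pair = pair_in_coalg_maps[OF coalg coalg CC f g]
  have 1: "p1 (?h x) = f x" "p2 (?h x) = g x" for x
    using fun_cong[OF proj1_pair[OF coalg coalg CC f g]] fun_cong[OF proj2_pair[OF coalg coalg CC f g]] by auto
  have "convol C (descendent_mult H T) f g = (\<lambda>x. \<Phi> (?h x))"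
    by (rule convol_eq_pair[OF coalg coalg CC f g V coalg_maps_linear[OF \<Phi>_in] \<Phi>_tens[symmetric]])
  also have "\<dots> = convol C m (convol C m (convol C m (\<lambda>x. T (f x)) g) (\<lambda>x. S (T (f x)))) f"
  proof -
    note pre = convol_m_precomp[OF C coalgebra_Q pair]
    have "(\<lambda>x. \<Phi> (?h x)) = convol C m (\<lambda>x. convol Q m (convol Q m (\<lambda>t. T (p1 t)) p2) (\<lambda>t. S (T (p1 t))) (?h x)) (\<lambda>x. p1 (?h x))"
      unfolding \<Phi>_def by (intro ext pre q_intros)
    also have "(\<lambda>x. convol Q m (convol Q m (\<lambda>t. T (p1 t)) p2) (\<lambda>t. S (T (p1 t))) (?h x))
      = convol C m (\<lambda>x. convol Q m (\<lambda>t. T (p1 t)) p2 (?h x)) (\<lambda>x. S (T (p1 (?h x))))"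
      by (intro ext pre q_intros)
    also have "(\<lambda>x. convol Q m (\<lambda>t. T (p1 t)) p2 (?h x)) = convol C m (\<lambda>x. T (p1 (?h x))) (\<lambda>x. p2 (?h x))"
      by (intro ext pre q_intros)
    finally show ?thesis unfolding 1 .
  qed
  finally show ?thesis .
qed

end

end

locale rb_hopf = cocommutative_hopf H for H :: "('k::field, 'a::ab_group_add) hopf" +
  fixes B
  assumes B_map: "coalgebra_map H H B"
    and B_mult: "x \<in> carr H \<Longrightarrow> y \<in> carr H \<Longrightarrow> hmult H (B x) (B y) = B (descendent_mult H B x y)"

lemma rota_baxter_hopf_iff: "rota_baxter_hopf H B \<longleftrightarrow> rb_hopf H B"
  by (auto simp: rota_baxter_hopf_def rb_hopf_def cocommutative_hopf_def rb_hopf_axioms_def descendent_mult_def)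

context rb_hopf
begin

abbreviation "dm \<equiv> descendent_mult H B"
abbreviation "Bt \<equiv> rb_tilde H B"
abbreviation "Sd \<equiv> descendent_antipode H B"

lemmas B_linear = coalgebra_map_linear[OF B_map]
lemmas dm_bimap = descendent_mult_coalg_bimap[OF B_map]
lemmas dm_bilinear = coalg_bimap_bilinear[OF dm_bimap]

lemma SB_map: "coalgebra_map H H (\<lambda>x. S (B x))"
  by (rule coalgebra_map_comp[OF coalg coalg V B_map S_coalgebra_map])

lemma BS_map: "coalgebra_map H H (\<lambda>x. B (S x))"
  by (rule coalgebra_map_comp[OF coalg coalg V S_coalgebra_map B_map])

lemma rb_group_conv_group:
  assumes CC: "cocommutative_coalgebra C"
  shows "rb_group (conv_group C H) (\<lambda>f x. B (f x))"
proof (rule rb_group.intro[OF group_conv_group[OF CC]], rule rb_group_axioms.intro)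
  note C = cocommutative_coalgebraD(1)[OF CC]
  let ?G = "conv_group C H"
  fix f g assume "f \<in> carrier ?G" and "g \<in> carrier ?G"
  then have f: "f \<in> coalg_maps C H" and g: "g \<in> coalg_maps C H" by simp_all
  have Bf: "(\<lambda>x. B (f x)) \<in> coalg_maps C H" by (rule comp_in_coalg_maps[OF CC B_map f])
  have "convol C m (\<lambda>x. B (f x)) (\<lambda>x. B (g x)) = convol C (\<lambda>a b. B (dm a b)) f g"
    by (rule convol_cong) (simp add: B_mult coalg_maps_carr[OF f] coalg_maps_carr[OF g])
  also have "\<dots> = (\<lambda>x. B (convol C dm f g x))"
    by (rule linear_comp_convol[OF C V V dm_bilinear coalg_maps_linear[OF f] coalg_maps_linear[OF g] B_linear, symmetric])
  also have "convol C dm f g = (\<lambda>x. B (f x)) \<otimes>\<^bsub>?G\<^esub> g \<otimes>\<^bsub>?G\<^esub> inv\<^bsub>?G\<^esub> (\<lambda>x. B (f x)) \<otimes>\<^bsub>?G\<^esub> f"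
    by (simp add: convol_descendent_mult[OF B_map CC f g] inv_conv_group[OF CC Bf])
  finally show "(\<lambda>x. B (f x)) \<otimes>\<^bsub>?G\<^esub> (\<lambda>x. B (g x))
    = (\<lambda>x. B (((\<lambda>x. B (f x)) \<otimes>\<^bsub>?G\<^esub> g \<otimes>\<^bsub>?G\<^esub> inv\<^bsub>?G\<^esub> (\<lambda>x. B (f x)) \<otimes>\<^bsub>?G\<^esub> f) x))"
    by simp
next
  fix f assume "f \<in> carrier (conv_group C H)"
  then show "(\<lambda>x. B (f x)) \<in> carrier (conv_group C H)"
    using comp_in_coalg_maps[OF CC B_map] by simp
qed

section \<open>Dictionary between group operations and Hopf algebra operations\<close>

context
  fixes C :: "('k, 'c::ab_group_add, 'z) bialg_scheme"
  assumes CC: "cocommutative_coalgebra C"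
begin

private lemma C: "coalgebra C"
  using CC by (rule cocommutative_coalgebraD)

interpretation G: rb_group "conv_group C H" "\<lambda>f x. B (f x)"
  by (rule rb_group_conv_group[OF CC])

lemma circ_eq: "f \<in> coalg_maps C H \<Longrightarrow> g \<in> coalg_maps C H \<Longrightarrow> G.circ f g = convol C dm f g"
  using inv_conv_group[OF CC comp_in_coalg_maps[OF CC B_map]]
  by (simp add: G.circ_def convol_descendent_mult[OF B_map CC])

lemma Bt_eq:
  assumes f: "f \<in> coalg_maps C H"
  shows "G.Bt f = (\<lambda>x. Bt (f x))"
proof
  fix x
  note l = bilinear_map_comp[OF bilinear_m linear_map_ident coalgebra_map_linear[OF BS_map]]
  have "G.Bt f x = convol C m f (\<lambda>x. B (S (f x))) x"
    by (simp add: G.Bt_def inv_conv_group[OF CC f])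
  also have "\<dots> = Bt (f x)"
  proof (cases "x \<in> carr C")
    case True
    then show ?thesis
      using sweedler_coalgebra_map[OF C V coalg_mapsD[OF f] V l] by (simp add: convol_inside rb_tilde_def)
  next
    case False
    then show ?thesis
      using linear_map_zero[OF V linear_sweedler[OF coalg V l]] by (simp add: coalg_maps_outside[OF f] rb_tilde_def)
  qed
  finally show "G.Bt f x = Bt (f x)" .
qed

lemma Bm_eq: "f \<in> coalg_maps C H \<Longrightarrow> G.Bm f = (\<lambda>x. Bt (S (f x)))"
  using G.Bt_inv[of f] comp_in_coalg_maps[OF CC S_coalgebra_map, of f]
  by (simp add: Bt_eq inv_conv_group[OF CC])

lemma cinv_eq:
  assumes f: "f \<in> coalg_maps C H"
  shows "G.cinv f = (\<lambda>x. Sd (f x))"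
proof
  fix x
  let ?SB = "\<lambda>x. S (B x)"
  note SB = coalgebra_map_linear[OF SB_map]
  let ?c = "convol H m ?SB S"
  have lc: "linear_map H H ?c" by (rule linear_convol[OF coalg V bilinear_m SB S_linear])
  have Bf: "(\<lambda>x. B (f x)) \<in> coalg_maps C H" by (rule comp_in_coalg_maps[OF CC B_map f])
  have "G.cinv f = convol C m (convol C m (\<lambda>x. S (B (f x))) (\<lambda>x. S (f x))) (\<lambda>x. B (f x))"
    by (simp add: G.cinv_def inv_conv_group[OF CC f] inv_conv_group[OF CC Bf])
  also have "\<dots> = (\<lambda>x. convol H m ?c B (f x))"
    unfolding convol_precomp[OF C coalg V bilinear_m lc B_linear f]
      convol_precomp[OF C coalg V bilinear_m SB S_linear f] ..
  finally have "G.cinv f x = convol H m ?c B (f x)" by simp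
  also have "\<dots> = Sd (f x)"
  proof -
    have pull: "m (?c a) (B b) = sweedler H (\<lambda>x1 x2. m (m (S (B x1)) (S x2)) (B b)) a"
      if "a \<in> carr H" "b \<in> carr H" for a b
      using linear_comp_sweedler[OF coalg V V bilinear_map_comp[OF bilinear_m SB S_linear]
          bilinear_map_left[OF bilinear_m linear_map_carr[OF B_linear that(2)]] that(1)]
      by (simp add: convol_inside that)
    have "convol H m ?c B y = Sd y" if y: "y \<in> carr H" for y
      unfolding descendent_antipode_def sweedler3_def convol_inside[OF y] by (rule sweedler_cong) (rule pull)
    \<comment> \<open>Off the carrier of \<open>C\<close> the point \<open>f\<close> has the value
      0, so the equality of functions also asks for this value.\<close>
    moreover have "Sd 0 = 0"
    proof -
      have "sweedler H (\<lambda>y x3. sweedler H (\<lambda>x1 x2. m (m (S (B x1)) (S x2)) (B x3)) y) 0 = sweedler H (\<lambda>a b. m (?c a) (B b)) 0"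
        by (rule sweedler_cong) (rule pull[symmetric])
      also have "\<dots> = 0"
        by (rule linear_map_zero[OF V linear_sweedler[OF coalg V bilinear_map_comp[OF bilinear_m lc B_linear]]])
      finally show ?thesis by (simp add: descendent_antipode_def sweedler3_def)
    qed
    ultimately show ?thesis
      using linear_map_zero[OF V linear_convol[OF coalg V bilinear_m lc B_linear]]
      by (cases "x \<in> carr C") (simp_all add: coalg_maps_carr[OF f] coalg_maps_outside[OF f])
  qed
  finally show "G.cinv f x = Sd (f x)" .
qed

end

text \<open>The group of coalgebra maps is closed under its own \<open>Bt\<close>; at the identity
  of \<open>H\<close> this closure is the claim.\<close>

lemma Bt_map: "coalgebra_map H H Bt"
proof -
  interpret G: rb_group "conv_group H H" "\<lambda>f x. B (f x)" by (rule rb_group_conv_group[OF cocommutative_coalg])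
  have i: "ident_on H \<in> coalg_maps H H" by (rule ident_on_in_coalg_maps[OF coalg])
  have "(\<lambda>x. Bt (ident_on H x)) \<in> coalg_maps H H"
    using G.Bt_closed[of "ident_on H"] i Bt_eq[OF cocommutative_coalg i] by simp
  then show ?thesis using coalgebra_map_cong[OF coalg coalg_mapsD] by fastforce
qed

lemma Sd_map: "coalgebra_map H H Sd"
proof -
  interpret G: rb_group "conv_group H H" "\<lambda>f x. B (f x)" by (rule rb_group_conv_group[OF cocommutative_coalg])
  have i: "ident_on H \<in> coalg_maps H H" by (rule ident_on_in_coalg_maps[OF coalg])
  have "(\<lambda>x. Sd (ident_on H x)) \<in> coalg_maps H H"
    using G.cinv_closed[of "ident_on H"] i cinv_eq[OF cocommutative_coalg i] by simp
  then show ?thesis using coalgebra_map_cong[OF coalg coalg_mapsD] by fastforce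
qed

text \<open>A Rota-Baxter identity holds on \<open>H\<close> as soon as it holds for the two projections
  \<open>H \<otimes> H \<rightarrow> H\<close>, the generic pair of points.\<close>

lemma rb_hopf_Bt: "rb_hopf H Bt"
proof unfold_locales
  show "coalgebra_map H H Bt" by (rule Bt_map)
  fix x y assume x: "x \<in> carr H" and y: "y \<in> carr H"
  interpret G: rb_group "conv_group Q H" "\<lambda>f x. B (f x)" by (rule rb_group_conv_group[OF cocommutative_Q])
  note lBt = coalgebra_map_linear[OF Bt_map]
  have Btp: "(\<lambda>x. Bt (p1 x)) \<in> coalg_maps Q H" by (rule comp_in_coalg_maps[OF cocommutative_Q Bt_map p1_in])
  have "m (Bt x) (Bt y) = convol Q m (\<lambda>t. Bt (p1 t)) (\<lambda>t. Bt (p2 t)) (tens H H x y)"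
    by (rule convol_proj[OF coalg coalg V V V bilinear_m lBt lBt x y, symmetric])
  also have "\<dots> = Bt (convol Q (descendent_mult H Bt) p1 p2 (tens H H x y))"
    using G.Bt_mult[of p1 p2] G.m_closed G.inv_closed p1_in p2_in Btp
    by (simp add: Bt_eq[OF cocommutative_Q] convol_descendent_mult[OF Bt_map cocommutative_Q] inv_conv_group[OF cocommutative_Q]
        convol_m_in[OF cocommutative_Q] comp_in_coalg_maps[OF cocommutative_Q S_coalgebra_map])
  also have "convol Q (descendent_mult H Bt) p1 p2 (tens H H x y) = descendent_mult H Bt x y"
    by (rule convol_proj[OF coalg coalg V V V coalg_bimap_bilinear[OF descendent_mult_coalg_bimap[OF Bt_map]]
          linear_map_ident linear_map_ident x y])
  finally show "m (Bt x) (Bt y) = Bt (descendent_mult H Bt x y)" .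
qed

end

section \<open>The descendent Hopf algebra\<close>

context
  fixes C :: "('k::field, 'a::ab_group_add, 'y) bialg_scheme" and D :: "('k, 'a, 'z) bialg_scheme"
  assumes eqs: "carr C = carr D" "scl C = scl D" "comult C = comult D" "counit C = counit D"
begin

private lemma T_eq: "tensor_space C C = tensor_space D D" and t_eq: "tens C C = tens D D"
  and t3_eq: "tens C (tensor_space D D) = tens D (tensor_space D D)"
  by (rule tensor_space_cong_space tens_cong_space; simp add: eqs)+

lemma coalgebra_cong: "coalgebra C \<longleftrightarrow> coalgebra D"
  unfolding coalgebra_def sweedler3_def sweedler_cong_space[OF eqs(1-3)] T_eq t_eq t3_eq eqs
    vspace_cong_space[OF eqs(1,2)] linear_map_cong_space[OF eqs(1,2) refl refl] ..

lemma cocommutative_cong: "cocommutative C \<longleftrightarrow> cocommutative D"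
  unfolding cocommutative_def sweedler_cong_space[OF eqs(1-3)] t_eq eqs ..

lemma coalgebra_map_cong_dom: "coalgebra_map C E f \<longleftrightarrow> coalgebra_map D E f"
  unfolding coalgebra_map_def sweedler_cong_space[OF eqs(1-3)] eqs
    linear_map_cong_space[OF eqs(1,2) refl refl] ..

lemma coalgebra_map_cong_cod: "coalgebra_map E C f \<longleftrightarrow> coalgebra_map E D f"
  unfolding coalgebra_map_def t_eq eqs linear_map_cong_space[OF refl refl eqs(1,2)] ..

lemma coalg_maps_cong_cod: "coalg_maps E C = coalg_maps E D"
  by (simp add: coalg_maps_def coalgebra_map_cong_cod)

end

context rb_hopf
begin

abbreviation "Hd \<equiv> descendent H B"

lemma descendent_simps [simp]:
  "carr Hd = carr H" "scl Hd = scl H" "comult Hd = comult H" "counit Hd = counit H" "hone Hd = hone H"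
  "hmult Hd = dm" "antipode Hd = Sd"
  by (simp_all add: descendent_def)

lemmas descendent_eqs = descendent_simps(1-4)

text \<open>The coalgebra axioms are those of \<open>H\<close>. The laws of the product are the
  group laws of \<open>circ\<close>: unit and antipode at the identity of \<open>H\<close>,
  associativity at the three projections of a triple tensor product.\<close>

lemma hopf_algebra_descendent: "hopf_algebra Hd"
proof -
  note s = sweedler_cong_space[OF descendent_simps(1-3)]
  note i = ident_on_in_coalg_maps[OF coalg]
  interpret G: rb_group "conv_group H H" "\<lambda>f x. B (f x)" by (rule rb_group_conv_group[OF cocommutative_coalg])
  have one: "one (conv_group H H) x = scl H (counit H x) (hone H)" if "x \<in> carr H" for x
    using that by (simp add: one_conv_group)
  have one_in: "one (conv_group H H) \<in> coalg_maps H H" using G.one_closed by simp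
  have "algebra Hd"
    unfolding algebra_def
  proof (intro conjI ballI)
    show "vspace Hd" using V vspace_cong_space[OF descendent_simps(1,2)] by blast
    show "bilinear_map Hd Hd Hd (hmult Hd)"
      using dm_bilinear by (simp add: bilinear_map_def linear_map_def)
    show "hone Hd \<in> carr Hd" using one_carr by simp
    fix x assume "x \<in> carr Hd"
    then have x: "x \<in> carr H" by simp
    have "convol H dm (one (conv_group H H)) (ident_on H) x = ident_on H x"
      using G.circ_one(1)[of "ident_on H"] i circ_eq[OF cocommutative_coalg one_in i] by simp
    then show "hmult Hd (hone Hd) x = x"
      using convol_counit_left[OF coalg V V dm_bilinear one_carr coalg_maps_linear[OF i] x] x
      by (simp add: one_conv_group)
    have "convol H dm (ident_on H) (one (conv_group H H)) x = ident_on H x"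
      using G.circ_one(2)[of "ident_on H"] i circ_eq[OF cocommutative_coalg i one_in] by simp
    then show "hmult Hd x (hone Hd) = x"
      using convol_counit_right[OF coalg V V dm_bilinear one_carr coalg_maps_linear[OF i] x] x
      by (simp add: one_conv_group)
    fix y z assume "y \<in> carr Hd" "z \<in> carr Hd"
    then have yz: "y \<in> carr H" "z \<in> carr H" by simp_all
    let ?C = "tcoalg Q H" let ?P = "proj1 Q H"
    have CC: "cocommutative_coalgebra ?C"
      by (rule cocommutative_coalgebra_tcoalg[OF cocommutative_Q cocommutative_coalg])
    interpret G3: rb_group "conv_group ?C H" "\<lambda>f x. B (f x)" by (rule rb_group_conv_group[OF CC])
    have P: "?P \<in> coalg_maps ?C Q" and h: "proj2 Q H \<in> coalg_maps ?C H"
      by (rule proj1_in_coalg_maps[OF coalgebra_Q coalg] proj2_in_coalg_maps[OF coalgebra_Q coalg])+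
    have f: "(\<lambda>t. p1 (?P t)) \<in> coalg_maps ?C H" and g: "(\<lambda>t. p2 (?P t)) \<in> coalg_maps ?C H"
      by (rule coalg_maps_comp[OF cocommutative_coalgebraD(1)[OF CC] coalgebra_Q V P]
          coalg_mapsD[OF p1_in] coalg_mapsD[OF p2_in])+
    have "dm (dm x y) z = dm x (dm y z)"
      by (rule assoc_of_convol_assoc[OF coalg V dm_bilinear linear_map_ident _ x yz])
        (use G3.circ_assoc[of "\<lambda>t. p1 (?P t)" "\<lambda>t. p2 (?P t)" "proj2 Q H"] f g h in
          \<open>simp add: circ_eq[OF CC] convol_in_coalg_maps[OF CC _ _ dm_bimap]\<close>)
    then show "hmult Hd (hmult Hd x y) z = hmult Hd x (hmult Hd y z)" by simp
  qed
  moreover have "comult Hd (hmult Hd x y) = tensor_mult Hd (comult Hd x) (comult Hd y)"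
    if "x \<in> carr Hd" "y \<in> carr Hd" for x y
    using dm_bimap that unfolding tensor_mult_eq_sweedler s tens_cong_space[OF descendent_simps(2,2)]
    by (simp add: coalg_bimap_def)
  ultimately have "bialgebra Hd"
    unfolding bialgebra_def coalgebra_cong[OF descendent_eqs] tens_cong_space[OF descendent_simps(2,2)]
    using dm_bimap bialg coalg by (simp add: coalg_bimap_def bialgebra_def)
  moreover have "is_antipode Hd (antipode Hd)"
    unfolding is_antipode_def s
  proof (intro conjI ballI)
    show "linear_map Hd Hd (antipode Hd)"
      using coalgebra_map_linear[OF Sd_map] by (simp add: linear_map_def)
    fix x assume "x \<in> carr Hd"
    then have x: "x \<in> carr H" by simp
    have c: "(\<lambda>x. Sd (ident_on H x)) \<in> coalg_maps H H"
      by (rule comp_in_coalg_maps[OF cocommutative_coalg Sd_map i])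
    have "convol H dm (\<lambda>x. Sd (ident_on H x)) (ident_on H) x = one (conv_group H H) x"
      using G.cinv_circ[of "ident_on H"] i circ_eq[OF cocommutative_coalg c i] cinv_eq[OF cocommutative_coalg i] by simp
    moreover have "sweedler H (\<lambda>x1 x2. dm (Sd x1) x2) x = sweedler H (\<lambda>a b. dm (Sd (ident_on H a)) (ident_on H b)) x"
      by (rule sweedler_cong) simp
    ultimately show "sweedler H (\<lambda>x1 x2. hmult Hd (antipode Hd x1) x2) x = scl Hd (counit Hd x) (hone Hd)"
      using one[OF x] by (simp add: convol_inside x)
    have "convol H dm (ident_on H) (\<lambda>x. Sd (ident_on H x)) x = one (conv_group H H) x"
      using G.circ_cinv[of "ident_on H"] i circ_eq[OF cocommutative_coalg i c] cinv_eq[OF cocommutative_coalg i] by simp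
    moreover have "sweedler H (\<lambda>x1 x2. dm x1 (Sd x2)) x = sweedler H (\<lambda>a b. dm (ident_on H a) (Sd (ident_on H b))) x"
      by (rule sweedler_cong) simp
    ultimately show "sweedler H (\<lambda>x1 x2. hmult Hd x1 (antipode Hd x2)) x = scl Hd (counit Hd x) (hone Hd)"
      using one[OF x] by (simp add: convol_inside x)
  qed
  ultimately show ?thesis by (simp add: hopf_algebra_def)
qed

lemma cocommutative_hopf_descendent: "cocommutative_hopf Hd"
  using hopf_algebra_descendent cocomm cocommutative_cong[OF descendent_eqs] by (simp add: cocommutative_hopf_def)

text \<open>\<open>B_circ_B\<close> at the two projections. The descendent product formed inside
  \<open>Hd\<close> unfolds to a word whose product is \<open>circ\<close> and whose inverse is
  \<open>cinv\<close>.\<close>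

lemma rb_hopf_descendent: "rb_hopf Hd B"
proof -
  interpret D: cocommutative_hopf Hd by (rule cocommutative_hopf_descendent)
  have BD: "coalgebra_map Hd Hd B"
    using B_map coalgebra_map_cong_dom[OF descendent_eqs, of Hd B] coalgebra_map_cong_cod[OF descendent_eqs, of H B] by simp
  show ?thesis
  proof unfold_locales
    show "coalgebra_map Hd Hd B" by (rule BD)
    fix x y assume "x \<in> carr Hd" and "y \<in> carr Hd"
    then have x: "x \<in> carr H" and y: "y \<in> carr H" by simp_all
    let ?G = "conv_group Q H"
    interpret G: rb_group ?G "\<lambda>f x. B (f x)" by (rule rb_group_conv_group[OF cocommutative_Q])
    let ?dd = "descendent_mult Hd B"
    have in': "coalg_maps Q Hd = coalg_maps Q H" by (rule coalg_maps_cong_cod[OF descendent_eqs])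
    have Bp: "(\<lambda>x. B (p1 x)) \<in> coalg_maps Q H" "(\<lambda>x. B (p2 x)) \<in> coalg_maps Q H"
      by (rule comp_in_coalg_maps[OF cocommutative_Q B_map] p1_in p2_in)+
    have SBp: "(\<lambda>x. Sd (B (p1 x))) \<in> coalg_maps Q H"
      by (rule comp_in_coalg_maps[OF cocommutative_Q Sd_map Bp(1)])
    note c = convol_in_coalg_maps[OF cocommutative_Q _ _ dm_bimap]
    have dd: "convol Q ?dd p1 p2
      = convol Q dm (convol Q dm (convol Q dm (\<lambda>x. B (p1 x)) p2) (\<lambda>x. Sd (B (p1 x)))) p1"
      using D.convol_descendent_mult[OF BD cocommutative_Q, of p1 p2] p1_in p2_in by (simp add: in')
    have "convol Q dm (\<lambda>x. B (p1 x)) (\<lambda>x. B (p2 x)) = (\<lambda>x. B (convol Q ?dd p1 p2 x))"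
      using G.B_circ_B[of p1 p2] p1_in p2_in Bp SBp
      by (simp add: dd circ_eq[OF cocommutative_Q] cinv_eq[OF cocommutative_Q] c)
    then have "convol Q dm (\<lambda>x. B (p1 x)) (\<lambda>x. B (p2 x)) (tens H H x y)
      = B (convol Q ?dd p1 p2 (tens H H x y))" by simp
    moreover have "convol Q dm (\<lambda>x. B (p1 x)) (\<lambda>x. B (p2 x)) (tens H H x y) = dm (B x) (B y)"
      by (rule convol_proj[OF coalg coalg V V V dm_bilinear B_linear B_linear x y])
    moreover have "convol Q ?dd p1 p2 (tens H H x y) = ?dd x y"
    proof (rule convol_proj[OF coalg coalg V V V _ linear_map_ident linear_map_ident x y])
      show "bilinear_map H H H ?dd"
        using coalg_bimap_bilinear[OF D.descendent_mult_coalg_bimap[OF BD]] by (simp add: bilinear_map_def linear_map_def)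
    qed
    ultimately show "hmult Hd (B x) (B y) = B (?dd x y)" by simp
  qed
qed

end

section \<open>Transport along a surjection\<close>

lemma trilinear_bilinear_bilinear:
  assumes \<nu>: "bilinear_map A K X \<nu>" and \<mu>: "bilinear_map X E U \<mu>"
  shows "trilinear_map A K E U (\<lambda>a k e. \<mu> (\<nu> a k) e)"
proof (rule trilinear_mapI)
  show "linear_map A U (\<lambda>a. \<mu> (\<nu> a k) e)" if "k \<in> carr K" "e \<in> carr E" for k e
    by (rule bilinear_map_comp_left[OF \<mu> bilinear_map_left[OF \<nu> that(1)] that(2)])
  show "linear_map K U (\<lambda>k. \<mu> (\<nu> a k) e)" if "a \<in> carr A" "e \<in> carr E" for a e
    by (rule bilinear_map_comp_left[OF \<mu> bilinear_map_right[OF \<nu> that(1)] that(2)])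
  show "linear_map E U (\<mu> (\<nu> a k))" if "a \<in> carr A" "k \<in> carr K" for a k
    by (rule bilinear_map_right[OF \<mu> bilinear_map_carr[OF \<nu> that]])
qed

text \<open>Linearity of \<open>f\<close> descends from that of its composite with the surjection.
  This serves operations that are given as bare functions on the target.\<close>

lemma linear_map_of_surj:
  assumes K: "vspace K" and W: "vspace W" and \<phi>: "linear_map K W \<phi>" and surj: "\<phi> ` carr K = carr W"
    and g: "linear_map K U g" and f: "\<And>x. x \<in> carr K \<Longrightarrow> f (\<phi> x) = g x"
  shows "linear_map W U f"
proof (rule linear_mapI)
  have surjE: "\<exists>a\<in>carr K. x = \<phi> a" if "x \<in> carr W" for x using that surj by blast
  show "f x \<in> carr U" if "x \<in> carr W" for x
    using surjE[OF that] f linear_map_carr[OF g] by auto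
  show "f (x + y) = f x + f y" if xy: "x \<in> carr W" "y \<in> carr W" for x y
  proof -
    obtain a b where ab: "a \<in> carr K" "b \<in> carr K" "x = \<phi> a" "y = \<phi> b"
      using surjE[OF xy(1)] surjE[OF xy(2)] by blast
    show ?thesis
      using f[OF vspace_add[OF K ab(1,2)]] linear_map_add[OF \<phi> ab(1,2)] linear_map_add[OF g ab(1,2)] f ab by simp
  qed
  show "f (scl W c x) = scl U c (f x)" if x: "x \<in> carr W" for c x
  proof -
    obtain a where a: "a \<in> carr K" "x = \<phi> a" using surjE[OF x] by blast
    show ?thesis
      using f[OF vspace_scl[OF K a(1)]] linear_map_scl[OF \<phi> a(1)] linear_map_scl[OF g a(1)] f a by simp
  qed
qed

context
  fixes K :: "('k::field, 'a::ab_group_add, 'y) bialg_scheme" and W :: "('k, 'b::ab_group_add, 'z) bialg_scheme"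
    and \<phi> :: "'a \<Rightarrow> 'b"
  assumes K: "coalgebra K" and W: "vspace W" and \<phi>: "coalgebra_map K W \<phi>" and surj: "\<phi> ` carr K = carr W"
begin

private lemma V_dom: "vspace K" and l\<phi>: "linear_map K W \<phi>"
  using K \<phi> by (simp_all add: coalgebra_vspace coalgebra_map_linear)

private lemma linear_comult_W: "linear_map W (tensor_space W W) (comult W)"
proof (rule linear_map_of_surj[OF V_dom W l\<phi> surj])
  show "linear_map K (tensor_space W W) (sweedler K (\<lambda>a b. tens W W (\<phi> a) (\<phi> b)))"
    by (rule linear_sweedler[OF K vspace_tensor_space bilinear_map_comp[OF bilinear_tens l\<phi> l\<phi>]])
qed (use \<phi> in \<open>simp add: coalgebra_map_def\<close>)

private lemmas sw = sweedler_coalgebra_map[OF K W \<phi>]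

private lemma trilinear_\<phi>:
  assumes F: "trilinear_map W W W U F"
  shows "trilinear_map K K K U (\<lambda>a b c. F (\<phi> a) (\<phi> b) (\<phi> c))"
proof (rule trilinear_mapI)
  note c = linear_map_carr[OF l\<phi>]
  show "linear_map K U (\<lambda>x. F (\<phi> x) (\<phi> a) (\<phi> b))" "linear_map K U (\<lambda>x. F (\<phi> a) (\<phi> x) (\<phi> b))"
    "linear_map K U (\<lambda>x. F (\<phi> a) (\<phi> b) (\<phi> x))" if "a \<in> carr K" "b \<in> carr K" for a b
    using linear_map_comp[OF trilinear_map_1[OF F c[OF that(1)] c[OF that(2)]] l\<phi>]
      linear_map_comp[OF trilinear_map_2[OF F c[OF that(1)] c[OF that(2)]] l\<phi>]
      linear_map_comp[OF trilinear_map_3[OF F c[OF that(1)] c[OF that(2)]] l\<phi>] by simp_all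
qed

lemma sweedler3_surj:
  assumes U: "vspace U" and F: "trilinear_map W W W U F" and x: "x \<in> carr K"
  shows "sweedler3 W F (\<phi> x) = sweedler3 K (\<lambda>a b c. F (\<phi> a) (\<phi> b) (\<phi> c)) x"
proof -
  have "bilinear_map W W U (\<lambda>y c. sweedler W (\<lambda>a b. F a b c) y)"
    unfolding sweedler_def
  proof (rule bilinear_mapI)
    show "linear_map W U (\<lambda>y. tlift W W (\<lambda>a b. F a b c) (comult W y))" if "c \<in> carr W" for c
      by (rule linear_map_comp[OF linear_tlift[OF W W U trilinear_map_12[OF F that]] linear_comult_W])
    show "linear_map W U (\<lambda>c. tlift W W (\<lambda>a b. F a b c) (comult W y))" if "y \<in> carr W" for y
    proof (rule linear_map_tlift_param[OF W W W U _ linear_map_carr[OF linear_comult_W that]])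
      show "trilinear_map W W W U (\<lambda>c a b. F a b c)"
        by (rule trilinear_mapI) (simp_all add: trilinear_map_1[OF F] trilinear_map_2[OF F] trilinear_map_3[OF F])
    qed
  qed
  from sw[OF U this x] have "sweedler3 W F (\<phi> x) = sweedler K (\<lambda>y c. sweedler W (\<lambda>a b. F a b (\<phi> c)) (\<phi> y)) x"
    by (simp add: sweedler3_def)
  also have "\<dots> = sweedler3 K (\<lambda>a b c. F (\<phi> a) (\<phi> b) (\<phi> c)) x"
    unfolding sweedler3_def
    by (rule sweedler_cong) (rule sw[OF U trilinear_map_12[OF F linear_map_carr[OF l\<phi>]]])
  finally show ?thesis .
qed

text \<open>Sweedler sums of an image are sums over the legs of a preimage, so each axiom reduces to
  the one in \<open>K\<close>. The same device shows that the comultiplication takes values in the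
  tensor square of \<open>W\<close>.\<close>

lemma coalgebra_surj: "coalgebra W"
  unfolding coalgebra_def
proof (intro conjI ballI)
  show "vspace W" by (rule W)
  show "linear_map W (tensor_space W W) (comult W)" by (rule linear_comult_W)
  show lc: "linear_map W base_field (counit W)"
    by (rule linear_map_of_surj[OF V_dom W l\<phi> surj linear_counit[OF K]]) (rule coalgebra_map_counit[OF \<phi>])
  note s = bilinear_map_comp[OF bilinear_scl[OF W] lc linear_map_ident]
  fix y assume "y \<in> carr W"
  then obtain x where x: "x \<in> carr K" and y: "y = \<phi> x" using surj by blast
  let ?F = "\<lambda>a b c. tens W (tensor_space W W) a (tens W W b c)"
  note Tv = vspace_tensor_space
  have bc: "bilinear_map W W (tensor_space W (tensor_space W W)) (\<lambda>a y. tens W (tensor_space W W) a (comult W y))"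
    by (rule bilinear_map_comp[OF bilinear_tens linear_map_ident linear_comult_W])
  have "sweedler3 W ?F y = sweedler K (\<lambda>a y. sweedler K (\<lambda>b c. ?F (\<phi> a) (\<phi> b) (\<phi> c)) y) x"
    unfolding y sweedler3_surj[OF Tv trilinear_tens x] unfolding sweedler3_def
    by (rule sweedler_coassoc[OF K Tv trilinear_\<phi>[OF trilinear_tens] x])
  also have "\<dots> = sweedler K (\<lambda>a y. tens W (tensor_space W W) (\<phi> a) (comult W (\<phi> y))) x"
  proof (rule sweedler_cong)
    fix a y assume a: "a \<in> carr K" and y: "y \<in> carr K"
    have "sweedler K (\<lambda>b c. ?F (\<phi> a) (\<phi> b) (\<phi> c)) y
      = tens W (tensor_space W W) (\<phi> a) (sweedler K (\<lambda>b c. tens W W (\<phi> b) (\<phi> c)) y)"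
      by (rule linear_comp_sweedler[OF K Tv Tv bilinear_map_comp[OF bilinear_tens l\<phi> l\<phi>]
            bilinear_map_right[OF bilinear_tens linear_map_carr[OF l\<phi> a]] y, symmetric])
    then show "sweedler K (\<lambda>b c. ?F (\<phi> a) (\<phi> b) (\<phi> c)) y = tens W (tensor_space W W) (\<phi> a) (comult W (\<phi> y))"
      using \<phi> y by (simp add: coalgebra_map_def)
  qed
  also have "\<dots> = sweedler W (\<lambda>a y. tens W (tensor_space W W) a (comult W y)) y"
    unfolding y by (rule sw[OF Tv bc x, symmetric])
  finally show "sweedler3 W ?F y = sweedler W (\<lambda>a y. tens W (tensor_space W W) a (comult W y)) y" .
  have "sweedler W (\<lambda>a b. scl W (counit W a) b) y = sweedler K (\<lambda>a b. scl W (counit K a) (\<phi> b)) x"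
    unfolding y sw[OF W s x] by (rule sweedler_cong) (simp add: coalgebra_map_counit[OF \<phi>])
  then show "sweedler W (\<lambda>a b. scl W (counit W a) b) y = y"
    using sweedler_counit_left[OF K W l\<phi> x] y by simp
  have "sweedler W (\<lambda>a b. scl W (counit W b) a) y = sweedler K (\<lambda>a b. scl W (counit K b) (\<phi> a)) x"
    unfolding y sw[OF W bilinear_map_flip[OF s] x] by (rule sweedler_cong) (simp add: coalgebra_map_counit[OF \<phi>])
  then show "sweedler W (\<lambda>a b. scl W (counit W b) a) y = y"
    using sweedler_counit_right[OF K W l\<phi> x] y by simp
qed

lemma cocommutative_surj:
  assumes cc: "cocommutative K"
  shows "cocommutative W"
  unfolding cocommutative_def
proof
  fix y assume "y \<in> carr W"
  then obtain x where x: "x \<in> carr K" and y: "y = \<phi> x" using surj by blast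
  have "sweedler W (\<lambda>a b. tens W W b a) y = sweedler K (\<lambda>a b. tens W W (\<phi> b) (\<phi> a)) x"
    unfolding y by (rule sw[OF vspace_tensor_space bilinear_map_flip[OF bilinear_tens] x])
  also have "\<dots> = sweedler K (\<lambda>a b. tens W W (\<phi> a) (\<phi> b)) x"
    by (rule sweedler_cocommutative[OF K cc vspace_tensor_space bilinear_map_comp[OF bilinear_tens l\<phi> l\<phi>] x])
  finally show "sweedler W (\<lambda>a b. tens W W b a) y = comult W y"
    using \<phi> x y by (simp add: coalgebra_map_def)
qed

end

text \<open>\<open>W\<close> is given only as a record on a space. Its axioms are identities between
  values, hence follow from those of \<open>K\<close> once the arguments are written as images under
  \<open>\<phi>\<close>; the Rota-Baxter property of \<open>B'\<close> comes out together with the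
  homomorphism.\<close>

lemma rb_hom_surj:
  fixes K :: "('k::field, 'a::ab_group_add) hopf" and W :: "('k, 'b::ab_group_add) hopf"
  assumes rb: "rota_baxter_hopf K B" and W: "vspace W"
    and \<phi>: "coalgebra_map K W \<phi>" and surj: "\<phi> ` carr K = carr W"
    and mult: "\<And>x y. x \<in> carr K \<Longrightarrow> y \<in> carr K \<Longrightarrow> \<phi> (hmult K x y) = hmult W (\<phi> x) (\<phi> y)"
    and one: "\<phi> (hone K) = hone W"
    and anti: "\<And>x. x \<in> carr K \<Longrightarrow> \<phi> (antipode K x) = antipode W (\<phi> x)"
    and B': "\<And>x. x \<in> carr K \<Longrightarrow> \<phi> (B x) = B' (\<phi> x)"
  shows "rota_baxter_hom K B W B' \<phi>"
proof -
  interpret K: rb_hopf K B using rb by (simp add: rota_baxter_hopf_iff)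
  note C = K.coalg and VK = K.V and l\<phi> = coalgebra_map_linear[OF \<phi>]
  note carr\<phi> = coalgebra_map_carr[OF \<phi>]
  have CW: "coalgebra W" by (rule coalgebra_surj[OF C W \<phi> surj])
  note sw = sweedler_coalgebra_map[OF C W \<phi>]
  have surjE: "\<exists>x\<in>carr K. y = \<phi> x" if "y \<in> carr W" for y using that surj by blast
  have bm: "bilinear_map W W W (hmult W)"
  proof (rule bilinear_mapI)
    fix y assume "y \<in> carr W"
    then obtain x where x: "x \<in> carr K" "y = \<phi> x" using surjE by blast
    show "linear_map W W (hmult W y)"
      by (rule linear_map_of_surj[OF VK W l\<phi> surj linear_map_comp[OF l\<phi> bilinear_map_right[OF K.bilinear_m x(1)]]])
        (simp add: mult x)
    show "linear_map W W (\<lambda>z. hmult W z y)"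
      by (rule linear_map_of_surj[OF VK W l\<phi> surj linear_map_comp[OF l\<phi> bilinear_map_left[OF K.bilinear_m x(1)]]])
        (simp add: mult x)
  qed
  have lS: "linear_map W W (antipode W)"
    by (rule linear_map_of_surj[OF VK W l\<phi> surj linear_map_comp[OF l\<phi> K.S_linear]]) (simp add: anti)
  have "algebra W"
    unfolding algebra_def
  proof (intro conjI ballI W bm)
    show "hone W \<in> carr W" using carr\<phi>[OF K.one_carr] one by simp
    fix x assume "x \<in> carr W"
    then obtain a where a: "a \<in> carr K" "x = \<phi> a" using surjE by blast
    show "hmult W (hone W) x = x" "hmult W x (hone W) = x"
      using a K.one_carr bialgebra_unit[OF K.bialg] by (simp_all flip: mult one)
    fix y z assume "y \<in> carr W" "z \<in> carr W"
    then obtain b c where "b \<in> carr K" "y = \<phi> b" "c \<in> carr K" "z = \<phi> c" using surjE by blast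
    then show "hmult W (hmult W x y) z = hmult W x (hmult W y z)"
      using a K.m_carr bialgebra_assoc[OF K.bialg] by (simp flip: mult)
  qed
  moreover have "comult W (hmult W y y') = tensor_mult W (comult W y) (comult W y')"
    if yy: "y \<in> carr W" "y' \<in> carr W" for y y'
  proof -
    obtain a b where a: "a \<in> carr K" "y = \<phi> a" and b: "b \<in> carr K" "y' = \<phi> b" using surjE[OF yy(1)] surjE[OF yy(2)] by blast
    note Tv = vspace_tensor_space
    note Q = quadrilinear_bilinear_bilinear[OF bm bm bilinear_tens]
    have "comult W (hmult W y y') = sweedler K (\<lambda>a b. tens W W (\<phi> a) (\<phi> b)) (hmult K a b)"
      using \<phi> K.m_carr[OF a(1) b(1)] a b by (simp add: coalgebra_map_def flip: mult)
    also have "\<dots> = sweedler K (\<lambda>a1 a2. sweedler K (\<lambda>b1 b2. tens W W (\<phi> (hmult K a1 b1)) (\<phi> (hmult K a2 b2))) b) a"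
      by (rule sweedler_coalg_bimap[OF C C VK Tv bialgebra_coalg_bimap[OF K.bialg] bilinear_map_comp[OF bilinear_tens l\<phi> l\<phi>] a(1) b(1)])
    also have "\<dots> = sweedler K (\<lambda>a1 a2. sweedler K (\<lambda>b1 b2. tens W W (hmult W (\<phi> a1) (\<phi> b1)) (hmult W (\<phi> a2) (\<phi> b2))) b) a"
      by (rule sweedler_cong, rule sweedler_cong) (simp add: mult)
    also have "\<dots> = sweedler K (\<lambda>a1 a2. sweedler W (\<lambda>b1 b2. tens W W (hmult W (\<phi> a1) b1) (hmult W (\<phi> a2) b2)) y') a"
      unfolding b(2)
      by (rule sweedler_cong) (rule sw[OF Tv quadrilinear_map_34[OF Q carr\<phi> carr\<phi>] b(1), symmetric])
    also have "\<dots> = sweedler W (\<lambda>a1 a2. sweedler W (\<lambda>b1 b2. tens W W (hmult W a1 b1) (hmult W a2 b2)) y') y"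
      unfolding a(2)
      by (rule sw[OF Tv trilinear_map_12[OF trilinear_sweedler_last[OF CW W W Tv Q] yy(2)] a(1), symmetric])
    finally show ?thesis by (simp add: tensor_mult_eq_sweedler)
  qed
  moreover have "counit W (hmult W y y') = counit W y * counit W y'"
    if yy: "y \<in> carr W" "y' \<in> carr W" for y y'
  proof -
    obtain a b where "a \<in> carr K" "y = \<phi> a" "b \<in> carr K" "y' = \<phi> b"
      using surjE[OF yy(1)] surjE[OF yy(2)] by blast
    then show ?thesis
      using K.bialg K.m_carr coalgebra_map_counit[OF \<phi>] by (simp add: bialgebra_def flip: mult)
  qed
  moreover have "comult W (hone W) = tens W W (hone W) (hone W)"
  proof -
    have "comult W (hone W) = tlift K K (\<lambda>a b. tens W W (\<phi> a) (\<phi> b)) (comult K (hone K))"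
      using \<phi> K.one_carr by (simp add: coalgebra_map_def sweedler_def flip: one)
    also have "\<dots> = tens W W (hone W) (hone W)"
      using K.bialg tlift_tens[OF VK VK vspace_tensor_space bilinear_map_comp[OF bilinear_tens l\<phi> l\<phi>] K.one_carr K.one_carr]
      by (simp add: bialgebra_def one)
    finally show ?thesis .
  qed
  moreover have "counit W (hone W) = 1"
    using coalgebra_map_counit[OF \<phi> K.one_carr] K.bialg by (simp add: one bialgebra_def)
  ultimately have "bialgebra W" using CW by (simp add: bialgebra_def)
  moreover have "is_antipode W (antipode W)"
    unfolding is_antipode_def
  proof (intro conjI ballI lS)
    fix y assume "y \<in> carr W"
    then obtain x where x: "x \<in> carr K" "y = \<phi> x" using surjE by blast
    have e: "\<phi> (scl K (counit K x) (hone K)) = scl W (counit W y) (hone W)"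
      using linear_map_scl[OF l\<phi> K.one_carr] x by (simp add: one coalgebra_map_counit[OF \<phi>])
    have "sweedler W (\<lambda>x1 x2. hmult W (antipode W x1) x2) y = sweedler K (\<lambda>a b. hmult W (antipode W (\<phi> a)) (\<phi> b)) x"
      unfolding x(2) by (rule sw[OF W bilinear_map_comp[OF bm lS linear_map_ident] x(1)])
    also have "\<dots> = sweedler K (\<lambda>a b. \<phi> (hmult K (antipode K a) b)) x"
      by (rule sweedler_cong) (simp add: mult anti linear_map_carr[OF K.S_linear])
    also have "\<dots> = \<phi> (sweedler K (\<lambda>a b. hmult K (antipode K a) b) x)"
      by (rule linear_comp_sweedler[OF C VK W bilinear_map_comp[OF K.bilinear_m K.S_linear linear_map_ident] l\<phi> x(1), symmetric])
    finally show "sweedler W (\<lambda>x1 x2. hmult W (antipode W x1) x2) y = scl W (counit W y) (hone W)"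
      using K.antipode x(1) e by (simp add: is_antipode_def)
    have "sweedler W (\<lambda>x1 x2. hmult W x1 (antipode W x2)) y = sweedler K (\<lambda>a b. hmult W (\<phi> a) (antipode W (\<phi> b))) x"
      unfolding x(2) by (rule sw[OF W bilinear_map_comp[OF bm linear_map_ident lS] x(1)])
    also have "\<dots> = sweedler K (\<lambda>a b. \<phi> (hmult K a (antipode K b))) x"
      by (rule sweedler_cong) (simp add: mult anti linear_map_carr[OF K.S_linear])
    also have "\<dots> = \<phi> (sweedler K (\<lambda>a b. hmult K a (antipode K b)) x)"
      by (rule linear_comp_sweedler[OF C VK W bilinear_map_comp[OF K.bilinear_m linear_map_ident K.S_linear] l\<phi> x(1), symmetric])
    finally show "sweedler W (\<lambda>x1 x2. hmult W x1 (antipode W x2)) y = scl W (counit W y) (hone W)"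
      using K.antipode x(1) e by (simp add: is_antipode_def)
  qed
  ultimately have "hopf_algebra W" by (simp add: hopf_algebra_def)
  moreover have "cocommutative W" by (rule cocommutative_surj[OF C W \<phi> surj K.cocomm])
  moreover have lB: "linear_map W W B'"
    by (rule linear_map_of_surj[OF VK W l\<phi> surj linear_map_comp[OF l\<phi> K.B_linear]]) (simp add: B')
  moreover have "coalgebra_map W W B'"
    unfolding coalgebra_map_def
  proof (intro conjI ballI lB)
    fix y assume "y \<in> carr W"
    then obtain x where x: "x \<in> carr K" "y = \<phi> x" using surjE by blast
    have c: "coalgebra_map K W (\<lambda>x. \<phi> (B x))" by (rule coalgebra_map_comp[OF C C W K.B_map \<phi>])
    have "comult W (B' y) = sweedler K (\<lambda>a b. tens W W (\<phi> (B a)) (\<phi> (B b))) x"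
      using c x by (simp add: coalgebra_map_def flip: B')
    also have "\<dots> = sweedler K (\<lambda>a b. tens W W (B' (\<phi> a)) (B' (\<phi> b))) x"
      by (rule sweedler_cong) (simp add: B')
    also have "\<dots> = sweedler W (\<lambda>a b. tens W W (B' a) (B' b)) y"
      unfolding x(2) by (rule sw[OF vspace_tensor_space bilinear_map_comp[OF bilinear_tens lB lB] x(1), symmetric])
    finally show "comult W (B' y) = sweedler W (\<lambda>a b. tens W W (B' a) (B' b)) y" .
    show "counit W (B' y) = counit W y"
      using coalgebra_map_counit[OF c x(1)] coalgebra_map_counit[OF \<phi> x(1)] x by (simp add: B')
  qed
  moreover have "hmult W (B' y) (B' z) = B' (descendent_mult W B' y z)" if yz: "y \<in> carr W" "z \<in> carr W" for y z
  proof -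
    obtain a where a: "a \<in> carr K" "y = \<phi> a" using surjE[OF yz(1)] by blast
    obtain b where b: "b \<in> carr K" "z = \<phi> b" using surjE[OF yz(2)] by blast
    let ?F = "\<lambda>x1 x2 x3. hmult W (hmult W (hmult W (B' x1) z) (antipode W (B' x2))) x3"
    note lSB = linear_map_comp[OF lS lB]
    note b2 = bilinear_map_comp[OF bm bilinear_map_comp_left[OF bm lB yz(2)] lSB]
    note tri = trilinear_bilinear_bilinear[OF b2 bm]
    let ?G = "\<lambda>x1 x2 x3. hmult K (hmult K (hmult K (B x1) b) (antipode K (B x2))) x3"
    note lSBK = linear_map_comp[OF K.S_linear K.B_linear]
    note b2K = bilinear_map_comp[OF K.bilinear_m bilinear_map_comp_left[OF K.bilinear_m K.B_linear b(1)] lSBK]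
    note triK = trilinear_bilinear_bilinear[OF b2K K.bilinear_m]
    have "descendent_mult W B' y z = sweedler3 K (\<lambda>x1 x2 x3. ?F (\<phi> x1) (\<phi> x2) (\<phi> x3)) a"
      unfolding descendent_mult_def a(2) by (rule sweedler3_surj[OF C W \<phi> surj W tri a(1)])
    also have "\<dots> = sweedler3 K (\<lambda>x1 x2 x3. \<phi> (?G x1 x2 x3)) a"
      unfolding sweedler3_def b(2)
      by (rule sweedler_cong, rule sweedler_cong)
        (simp add: mult anti b K.m_carr linear_map_carr[OF K.S_linear] linear_map_carr[OF K.B_linear] flip: B')
    also have "\<dots> = \<phi> (descendent_mult K B a b)"
    proof -
      have "\<phi> (descendent_mult K B a b) = sweedler K (\<lambda>y x3. \<phi> (sweedler K (\<lambda>x1 x2. ?G x1 x2 x3) y)) a"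
        unfolding descendent_mult_def sweedler3_def
        by (rule linear_comp_sweedler[OF C VK W bilinear_sweedler_left[OF C VK VK triK] l\<phi> a(1)])
      also have "\<dots> = sweedler3 K (\<lambda>x1 x2 x3. \<phi> (?G x1 x2 x3)) a"
        unfolding sweedler3_def
        by (rule sweedler_cong) (rule linear_comp_sweedler[OF C VK W trilinear_map_12[OF triK] l\<phi>])
      finally show ?thesis ..
    qed
    finally have "descendent_mult W B' y z = \<phi> (descendent_mult K B a b)" .
    then show ?thesis
      using K.B_mult[OF a(1) b(1)] a b bilinear_map_carr[OF K.dm_bilinear a(1) b(1)] linear_map_carr[OF K.B_linear]
      by (simp flip: mult B')
  qed
  ultimately have "rota_baxter_hopf W B'"
    by (simp add: rota_baxter_hopf_def descendent_mult_def)
  then show ?thesis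
    using rb \<phi> mult one anti B' by (simp add: rota_baxter_hom_def hopf_hom_def)
qed

text \<open>The tilde operator is built from product, comultiplication, antipode and the operator,
  all of which \<open>\<phi>\<close> respects.\<close>

lemma rota_baxter_hom_tilde:
  assumes hom: "rota_baxter_hom K B W B' \<phi>"
  shows "rota_baxter_hom K (rb_tilde K B) W (rb_tilde W B') \<phi>"
proof -
  interpret K: rb_hopf K B using hom by (simp add: rota_baxter_hom_def rota_baxter_hopf_iff)
  interpret W: rb_hopf W B' using hom by (simp add: rota_baxter_hom_def rota_baxter_hopf_iff)
  have \<phi>: "coalgebra_map K W \<phi>" using hom by (simp add: rota_baxter_hom_def hopf_hom_def)
  note BS = coalgebra_map_linear[OF K.BS_map]
  have "\<phi> (rb_tilde K B x) = rb_tilde W B' (\<phi> x)" if x: "x \<in> carr K" for x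
  proof -
    have "\<phi> (rb_tilde K B x) = sweedler K (\<lambda>a b. \<phi> (hmult K a (B (antipode K b)))) x"
      unfolding rb_tilde_def
      by (rule linear_comp_sweedler[OF K.coalg K.V W.V bilinear_map_comp[OF K.bilinear_m linear_map_ident BS]
            coalgebra_map_linear[OF \<phi>] x])
    also have "\<dots> = sweedler K (\<lambda>a b. hmult W (\<phi> a) (B' (antipode W (\<phi> b)))) x"
      using hom linear_map_carr[OF BS] linear_map_carr[OF K.S_linear]
      by (intro sweedler_cong) (simp add: rota_baxter_hom_def hopf_hom_def)
    also have "\<dots> = rb_tilde W B' (\<phi> x)"
      unfolding rb_tilde_def
      by (rule sweedler_coalgebra_map[OF K.coalg W.V \<phi> W.V bilinear_map_comp[OF W.bilinear_m linear_map_ident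
            coalgebra_map_linear[OF W.BS_map]] x, symmetric])
    finally show ?thesis .
  qed
  then show ?thesis
    using hom K.rb_hopf_Bt W.rb_hopf_Bt by (simp add: rota_baxter_hom_def rota_baxter_hopf_iff)
qed

section \<open>The matched pair\<close>

context rb_group
begin

text \<open>The substitution of the inverse of \<open>y\<close> for \<open>w\<close> turns
  \<open>Bm w\<close> into \<open>Bt y\<close>, the form in which \<open>rhd\<close> and
  \<open>lhd\<close> present elements of \<open>H_minus\<close>.\<close>

lemma left_action_eq_Bt:
  assumes x: "x \<in> carrier G" and y: "y \<in> carrier G"
  shows "Bt (B x \<otimes> y \<otimes> inv (B x))
    = Bm x \<otimes> Bt y \<otimes> Bm (inv (Bm x \<otimes> Bt y) \<otimes> inv x \<otimes> (Bm x \<otimes> Bt y))"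
proof -
  have "B x \<otimes> inv y \<otimes> inv (B x) = inv (B x \<otimes> y \<otimes> inv (B x))" using x y by (simp add: group_simps)
  then have "Bt (B x \<otimes> y \<otimes> inv (B x)) = Bm (B x \<otimes> inv y \<otimes> inv (B x))"
    using Bm_inv[of "B x \<otimes> y \<otimes> inv (B x)"] x y by simp
  then show ?thesis using left_action_eq[of x "inv y"] x y by (simp add: Bm_inv)
qed

lemma right_action_eq_Bt:
  assumes x: "x \<in> carrier G" and y: "y \<in> carrier G"
  shows "inv (B (inv (Bt y) \<otimes> cinv x \<otimes> Bt y)) = inv (B (B x \<otimes> inv y \<otimes> inv (B x))) \<otimes> B x \<otimes> B (inv y)"
  using right_action_eq[of x "inv y"] x y by (simp add: Bm_inv)

lemma inv_B: "x \<in> carrier G \<Longrightarrow> inv (B x) = B (cinv x)"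
  by (simp add: B_cinv)

text \<open>Identifies the coordinates with trivial first entry as the two components of
  \<open>pi_map\<close>; the second one uses that \<open>B\<close> and \<open>Bm\<close>
  commute.\<close>

lemma psi_unit: assumes "x \<in> carrier G" shows "psiL \<one> x = Bm (B x)" "psiR \<one> x = inv (B (Bm x))"
  using assms by (simp_all add: psiL_def psiR_def Bm_B[symmetric]) (simp add: Bm_def group_simps)

end

text \<open>The bilinear maps below are defined on images of \<open>H\<close>.  They are well defined because the
  defining expression factors through the image in each argument separately.\<close>

context cocommutative_hopf
begin

definition factors where "factors P u \<longleftrightarrow> (\<exists>E\<in>coalg_maps Q H. u = (\<lambda>t. E (P t)))"

text \<open>\<open>pair_left\<close> and \<open>pair_right\<close> are \<phi> \<otimes> id and id
  \<otimes> \<psi>, written as convolutions so that their components are again points.\<close>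

definition pair_left where "pair_left \<phi> = convol Q (tens H H) (\<lambda>t. \<phi> (p1 t)) p2"
definition pair_right where "pair_right \<psi> = convol Q (tens H H) p1 (\<lambda>t. \<psi> (p2 t))"

text \<open>The maps that factor through \<open>P\<close> are closed under convolution and, by
  \<open>factors_comp\<close>, under coalgebra maps. Hence factoring can be read off from the shape
  of a word in the projections.\<close>

lemma factors_convol:
  assumes P: "P \<in> coalg_maps Q Q" and "factors P u" "factors P v"
  shows "factors P (convol Q m u v)"
proof -
  obtain E F where E: "E \<in> coalg_maps Q H" "u = (\<lambda>t. E (P t))" and F: "F \<in> coalg_maps Q H" "v = (\<lambda>t. F (P t))"
    using assms(2,3) unfolding factors_def by (elim bexE) (rule that)
  have "convol Q m u v = (\<lambda>t. convol Q m E F (P t))"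
    unfolding E(2) F(2) by (intro ext convol_m_precomp[OF coalgebra_Q coalgebra_Q P E(1) F(1), symmetric])
  then show ?thesis unfolding factors_def by (rule bexI[OF _ convol_m_in[OF cocommutative_Q E(1) F(1)]])
qed

lemma factors_comp: "coalgebra_map H H T \<Longrightarrow> factors P u \<Longrightarrow> factors P (\<lambda>t. T (u t))"
  unfolding factors_def by (elim bexE) (rule bexI[OF _ comp_in_coalg_maps[OF cocommutative_Q]]; simp)

lemma factors_pair:
  assumes P: "P \<in> coalg_maps Q Q" and "factors P u" "factors P v"
  shows "\<exists>E. convol Q (tens H H) u v = (\<lambda>t. E (P t))"
proof -
  obtain E F where E: "E \<in> coalg_maps Q H" "u = (\<lambda>t. E (P t))" and F: "F \<in> coalg_maps Q H" "v = (\<lambda>t. F (P t))"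
    using assms(2,3) unfolding factors_def by (elim bexE) (rule that)
  show ?thesis
    unfolding E(2) F(2)
    by (rule exI[of _ "convol Q (tens H H) E F"], rule convol_precomp[OF coalgebra_Q coalgebra_Q vspace_tensor_space
          bilinear_tens coalg_maps_linear[OF E(1)] coalg_maps_linear[OF F(1)] P, symmetric])
qed

context
  fixes \<phi>
  assumes \<phi>: "coalgebra_map H H \<phi>"
begin

private lemma \<phi>p: "(\<lambda>t. \<phi> (p1 t)) \<in> coalg_maps Q H" "(\<lambda>t. \<phi> (p2 t)) \<in> coalg_maps Q H"
  by (rule comp_in_coalg_maps[OF cocommutative_Q \<phi>] p1_in p2_in)+

lemma pair_left_in: "pair_left \<phi> \<in> coalg_maps Q Q" and pair_right_in: "pair_right \<phi> \<in> coalg_maps Q Q"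
  unfolding pair_left_def pair_right_def
  by (rule pair_in_coalg_maps[OF coalg coalg cocommutative_Q] \<phi>p p1_in p2_in)+

lemma factors_pair_left: "factors (pair_left \<phi>) (\<lambda>t. \<phi> (p1 t))" "factors (pair_left \<phi>) p2"
  unfolding factors_def pair_left_def
  by (rule bexI[OF _ p1_in], rule proj1_pair[OF coalg coalg cocommutative_Q \<phi>p(1) p2_in, symmetric])
    (rule bexI[OF _ p2_in], rule proj2_pair[OF coalg coalg cocommutative_Q \<phi>p(1) p2_in, symmetric])

lemma factors_pair_right: "factors (pair_right \<phi>) (\<lambda>t. \<phi> (p2 t))" "factors (pair_right \<phi>) p1"
  unfolding factors_def pair_right_def
  by (rule bexI[OF _ p2_in], rule proj2_pair[OF coalg coalg cocommutative_Q p1_in \<phi>p(2), symmetric])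
    (rule bexI[OF _ p1_in], rule proj1_pair[OF coalg coalg cocommutative_Q p1_in \<phi>p(2), symmetric])

lemma pair_left_tens: "x \<in> carr H \<Longrightarrow> y \<in> carr H \<Longrightarrow> pair_left \<phi> (tens H H x y) = tens H H (\<phi> x) y"
  and pair_right_tens: "x \<in> carr H \<Longrightarrow> y \<in> carr H \<Longrightarrow> pair_right \<phi> (tens H H x y) = tens H H x (\<phi> y)"
  unfolding pair_left_def pair_right_def
  using convol_proj[OF coalg coalg vspace_tensor_space V V bilinear_tens coalgebra_map_linear[OF \<phi>] linear_map_ident]
    convol_proj[OF coalg coalg vspace_tensor_space V V bilinear_tens linear_map_ident coalgebra_map_linear[OF \<phi>]]
  by blast+

end

text \<open>The arguments are exchanged one at a time: \<open>x\<close> for \<open>x'\<close> by the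
  factorisation on the left, then \<open>y\<close> for \<open>y'\<close> by the one on the
  right.\<close>

lemma well_defined_on_images:
  assumes \<phi>: "coalgebra_map H H \<phi>" and \<psi>: "coalgebra_map H H \<psi>"
    and L: "\<exists>E. u = (\<lambda>t. E (pair_left \<phi> t))" and R: "\<exists>E. u = (\<lambda>t. E (pair_right \<psi> t))"
    and carr: "x \<in> carr H" "x' \<in> carr H" "y \<in> carr H" "y' \<in> carr H"
    and eq: "\<phi> x = \<phi> x'" "\<psi> y = \<psi> y'"
  shows "u (tens H H x y) = u (tens H H x' y')"
proof -
  have "u (tens H H x y) = u (tens H H x' y)"
    using L pair_left_tens[OF \<phi>] carr eq by auto
  also have "\<dots> = u (tens H H x' y')"
    using R pair_right_tens[OF \<psi>] carr eq by auto
  finally show ?thesis .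
qed

lemma factorsD: "factors P u \<Longrightarrow> \<exists>E. u = (\<lambda>t. E (P t))"
  by (auto simp: factors_def)

lemma S_S: assumes x: "x \<in> carr H" shows "S (S x) = x"
proof -
  interpret group "conv_group H H" by (rule group_conv_group[OF cocommutative_coalg])
  have i: "ident_on H \<in> coalg_maps H H" by (rule ident_on_in_coalg_maps[OF coalg])
  have "(\<lambda>x. S (S (ident_on H x))) = ident_on H"
    using inv_inv[of "ident_on H"] i comp_in_coalg_maps[OF cocommutative_coalg S_coalgebra_map i]
    by (simp add: inv_conv_group[OF cocommutative_coalg])
  from fun_cong[OF this, of x] show ?thesis using x by simp
qed

end

lemma bilinear_map_of_surj:
  assumes V: "vspace V" "vspace V'" and A: "vspace A" "vspace A'"
    and \<phi>: "linear_map V A \<phi>" "\<phi> ` carr V = carr A" and \<psi>: "linear_map V' A' \<psi>" "\<psi> ` carr V' = carr A'"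
    and F: "bilinear_map V V' U F" and r: "\<And>x y. x \<in> carr V \<Longrightarrow> y \<in> carr V' \<Longrightarrow> r (\<phi> x) (\<psi> y) = F x y"
  shows "bilinear_map A A' U r"
proof (rule bilinear_mapI)
  fix a assume "a \<in> carr A"
  then obtain x where x: "x \<in> carr V" "a = \<phi> x" using \<phi>(2) by blast
  show "linear_map A' U (r a)"
    by (rule linear_map_of_surj[OF V(2) A(2) \<psi> bilinear_map_right[OF F x(1)]]) (simp add: x r)
next
  fix a assume "a \<in> carr A'"
  then obtain y where y: "y \<in> carr V'" "a = \<psi> y" using \<psi>(2) by blast
  show "linear_map A U (\<lambda>x. r x a)"
    by (rule linear_map_of_surj[OF V(1) A(1) \<phi> bilinear_map_left[OF F y(1)]]) (simp add: y r)
qed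

text \<open>Used to carry the coalgebra property from the action formulas on H \<otimes> H to the
  actions of \<open>H_plus\<close> on \<open>H_minus\<close> and back.\<close>

lemma coalg_bimap_of_surj:
  assumes K: "coalgebra K" "coalgebra K'" and A: "coalgebra A" "coalgebra A'" and D: "vspace D"
    and \<phi>: "coalgebra_map K A \<phi>" "\<phi> ` carr K = carr A" and \<psi>: "coalgebra_map K' A' \<psi>" "\<psi> ` carr K' = carr A'"
    and F: "coalg_bimap K K' D F" and r: "\<And>x y. x \<in> carr K \<Longrightarrow> y \<in> carr K' \<Longrightarrow> r (\<phi> x) (\<psi> y) = F x y"
  shows "coalg_bimap A A' D r"
  unfolding coalg_bimap_def
proof (intro conjI ballI)
  note V = coalgebra_vspace[OF K(1)] coalgebra_vspace[OF K(2)] and VA = coalgebra_vspace[OF A(1)] coalgebra_vspace[OF A(2)]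
  note Tv = vspace_tensor_space and bF = coalg_bimap_bilinear[OF F]
  show b: "bilinear_map A A' D r"
    by (rule bilinear_map_of_surj[OF V VA coalgebra_map_linear[OF \<phi>(1)] \<phi>(2) coalgebra_map_linear[OF \<psi>(1)] \<psi>(2) bF r])
  note Q = quadrilinear_bilinear_bilinear[OF b b bilinear_tens]
  fix a k assume "a \<in> carr A" and k: "k \<in> carr A'"
  then obtain x y where x: "x \<in> carr K" "a = \<phi> x" and y: "y \<in> carr K'" "k = \<psi> y" using \<phi>(2) \<psi>(2) by blast
  have "comult D (r a k) = sweedler K (\<lambda>x1 x2. sweedler K' (\<lambda>y1 y2. tens D D (F x1 y1) (F x2 y2)) y) x"
    using F x y by (simp add: r coalg_bimap_def)
  also have "\<dots> = sweedler K (\<lambda>x1 x2. sweedler K' (\<lambda>y1 y2. tens D D (r (\<phi> x1) (\<psi> y1)) (r (\<phi> x2) (\<psi> y2))) y) x"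
    by (rule sweedler_cong, rule sweedler_cong) (simp add: r)
  also have "\<dots> = sweedler K (\<lambda>x1 x2. sweedler A' (\<lambda>y1 y2. tens D D (r (\<phi> x1) y1) (r (\<phi> x2) y2)) k) x"
    unfolding y(2)
    by (rule sweedler_cong)
      (rule sweedler_coalgebra_map[OF K(2) VA(2) \<psi>(1) Tv quadrilinear_map_34[OF Q] y(1), symmetric];
        rule coalgebra_map_carr[OF \<phi>(1)])
  also have "\<dots> = sweedler A (\<lambda>x1 x2. sweedler A' (\<lambda>y1 y2. tens D D (r x1 y1) (r x2 y2)) k) a"
    unfolding x(2)
    by (rule sweedler_coalgebra_map[OF K(1) VA(1) \<phi>(1) Tv trilinear_map_12[OF
          trilinear_sweedler_last[OF A(2) VA(1) VA(1) Tv Q] k] x(1), symmetric])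
  finally show "comult D (r a k) = sweedler A (\<lambda>a1 a2. sweedler A' (\<lambda>k1 k2. tens D D (r a1 k1) (r a2 k2)) k) a" .
  show "counit D (r a k) = counit A a * counit A' k"
    using F x y by (simp add: r coalg_bimap_def coalgebra_map_counit[OF \<phi>(1)] coalgebra_map_counit[OF \<psi>(1)])
qed

context rb_hopf
begin

lemma H_plus_simps [simp]:
  "carr (H_plus H B) = B ` carr H" "scl (H_plus H B) = scl H" "comult (H_plus H B) = comult H"
  "counit (H_plus H B) = counit H" "hmult (H_plus H B) = hmult H" "hone (H_plus H B) = hone H"
  by (simp_all add: H_plus_def)

text \<open>As \<open>Bt\<close> is a Rota-Baxter operator too, every fact about
  \<open>H_plus\<close> becomes one about \<open>H_minus\<close>.\<close>

lemma H_minus_eq: "H_minus H B = H_plus H Bt"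
  by (simp add: H_minus_def H_plus_def)

lemma vspace_H_plus: "vspace (H_plus H B)"
  by (rule linear_map_image_vspace[OF V V B_linear]) simp_all

lemma B_map_H_plus: "coalgebra_map H (H_plus H B) B"
  using B_map tens_cong_space[of "H_plus H B" H "H_plus H B" H]
  by (simp add: coalgebra_map_def linear_map_def)

text \<open>Transported along the surjection \<open>B\<close>: for a value of \<open>B\<close> the
  comultiplication has to be seen to lie in the smaller tensor space, and this holds because
  \<open>B\<close> is a coalgebra map.\<close>

lemma cocommutative_H_plus: "cocommutative_coalgebra (H_plus H B)"
  using coalgebra_surj[OF coalg vspace_H_plus B_map_H_plus] cocommutative_surj[OF coalg vspace_H_plus B_map_H_plus _ cocomm]
  by (simp add: cocommutative_coalgebra_def)

lemma B_in_H_plus: "coalgebra C \<Longrightarrow> f \<in> coalg_maps C H \<Longrightarrow> (\<lambda>x. B (f x)) \<in> coalg_maps C (H_plus H B)"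
  by (rule coalg_maps_comp[OF _ coalg vspace_H_plus _ B_map_H_plus])

text \<open>The Rota-Baxter identity exhibits a product of two values of \<open>B\<close> as a value
  of \<open>B\<close>.\<close>

lemma bilinear_m_H_plus: "bilinear_map (H_plus H B) (H_plus H B) (H_plus H B) m"
proof -
  have "m (B x) (B y) \<in> B ` carr H" if "x \<in> carr H" "y \<in> carr H" for x y
    using that B_mult bilinear_map_carr[OF dm_bilinear] by auto
  then show ?thesis
    using bilinear_m linear_map_carr[OF B_linear] by (auto simp: bilinear_map_def linear_map_def)
qed

lemma B_one: "B (hone H) = hone H"
proof -
  interpret G: rb_group "conv_group H H" "\<lambda>f x. B (f x)" by (rule rb_group_conv_group[OF cocommutative_coalg])
  show ?thesis
    using fun_cong[OF G.B_one, of "hone H"] bialg one_carr vspace_scl_one[OF V]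
    by (simp add: one_conv_group bialgebra_def)
qed

lemma one_in_H_plus: "hone H \<in> carr (H_plus H B)"
  using B_one one_carr by (metis H_plus_simps(1) imageI)

end

context rb_hopf
begin

interpretation t: rb_hopf H Bt by (rule rb_hopf_Bt)

abbreviation "Hp \<equiv> H_plus H B"
abbreviation "Hm \<equiv> H_minus H B"

lemma H_minus_simps [simp]:
  "carr Hm = Bt ` carr H" "scl Hm = scl H" "comult Hm = comult H"
  "counit Hm = counit H" "hmult Hm = hmult H" "hone Hm = hone H"
  by (simp_all add: H_minus_eq)

lemma cocommutative_H_minus: "cocommutative_coalgebra Hm"
  using t.cocommutative_H_plus by (simp add: H_minus_eq)

lemma Bt_map_H_minus: "coalgebra_map H Hm Bt"
  using t.B_map_H_plus by (simp add: H_minus_eq)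

lemma Bt_in_H_minus: "coalgebra C \<Longrightarrow> f \<in> coalg_maps C H \<Longrightarrow> (\<lambda>x. Bt (f x)) \<in> coalg_maps C Hm"
  using t.B_in_H_plus by (simp add: H_minus_eq)

lemma bilinear_m_H_minus: "bilinear_map Hm Hm Hm m"
  using t.bilinear_m_H_plus by (simp add: H_minus_eq)

lemma one_in_H_minus: "hone H \<in> carr Hm"
  using t.one_in_H_plus by (simp add: H_minus_eq)

lemmas coalgebra_Hp = cocommutative_coalgebraD(1)[OF cocommutative_H_plus]
lemmas coalgebra_Hm = cocommutative_coalgebraD(1)[OF cocommutative_H_minus]
lemmas VHp = cocommutative_coalgebraD(3)[OF cocommutative_H_plus]
lemmas VHm = cocommutative_coalgebraD(3)[OF cocommutative_H_minus]

lemma tens_Hm_Hp: "tens Hm Hp = tens H H"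
  by (rule tens_cong_space) simp_all

lemmas coalg_map_intros =
  comp_in_coalg_maps[OF _ B_map] comp_in_coalg_maps[OF _ S_coalgebra_map] comp_in_coalg_maps[OF _ Bt_map]
  comp_in_coalg_maps[OF _ Sd_map] convol_m_in

text \<open>Shows that the image of \<open>B\<close> is closed under the antipode; it is
  \<open>inv_B\<close> read at the identity of \<open>H\<close>.\<close>

lemma S_B: assumes x: "x \<in> carr H" shows "S (B x) = B (Sd x)"
proof -
  interpret G: rb_group "conv_group H H" "\<lambda>f x. B (f x)" by (rule rb_group_conv_group[OF cocommutative_coalg])
  have i: "ident_on H \<in> coalg_maps H H" by (rule ident_on_in_coalg_maps[OF coalg])
  have "(\<lambda>x. S (B (ident_on H x))) = (\<lambda>x. B (Sd (ident_on H x)))"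
    using G.inv_B[of "ident_on H"] i coalg_map_intros[OF cocommutative_coalg]
    by (simp add: inv_conv_group[OF cocommutative_coalg] cinv_eq[OF cocommutative_coalg])
  from fun_cong[OF this, of x] show ?thesis using x by simp
qed

lemma SB_in_H_plus:
  assumes C: "cocommutative_coalgebra C" and f: "f \<in> coalg_maps C H"
  shows "(\<lambda>x. S (B (f x))) \<in> coalg_maps C Hp"
proof -
  have "(\<lambda>x. S (B (f x))) = (\<lambda>x. B (Sd (f x)))"
    by (rule coalg_maps_eqI[of _ C H _ H]) (intro coalg_map_intros C f S_B coalg_maps_carr[OF f]; assumption)+
  then show ?thesis
    using B_in_H_plus[OF cocommutative_coalgebraD(1)[OF C] coalg_map_intros(4)[OF C f]] by simp
qed

text \<open>\<open>act_left\<close> and \<open>act_right\<close> are the prescribed action formulas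
  as functions of the preimages, that is, maps on H \<otimes> H; that they depend on
  \<open>B x\<close> and \<open>Bt y\<close> only is shown by the factor lemmas below.\<close>

definition act_left where
  "act_left = (\<lambda>t. Bt (convol Q m (convol Q m (\<lambda>t. B (p1 t)) p2) (\<lambda>t. S (B (p1 t))) t))"

definition act_right where
  "act_right = (\<lambda>t. S (B (convol Q m (convol Q m (\<lambda>t. S (Bt (p2 t))) (\<lambda>t. Sd (p1 t))) (\<lambda>t. Bt (p2 t)) t)))"

lemma act_left_tens:
  assumes x: "x \<in> carr H" and y: "y \<in> carr H"
  shows "act_left (tens H H x y) = Bt (sweedler H (\<lambda>x1 x2. m (m (B x1) y) (S (B x2))) x)"
proof -
  have "convol Q m (convol Q m (\<lambda>t. B (p1 t)) p2) (\<lambda>t. S (B (p1 t))) (tens H H x y)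
    = convol H m (\<lambda>x. convol Q m (\<lambda>t. B (p1 t)) p2 (tens H H x y)) (\<lambda>x. S (B x)) x"
    by (rule convol_proj1_right[OF coalg coalg V bilinear_m _ coalgebra_map_linear[OF SB_map] x y])
      (intro coalg_maps_linear coalg_map_intros cocommutative_Q p1_in p2_in)
  also have "\<dots> = sweedler H (\<lambda>x1 x2. m (m (B x1) y) (S (B x2))) x"
    unfolding convol_inside[OF x]
    by (rule sweedler_cong) (simp add: convol_proj[OF coalg coalg V V V bilinear_m B_linear linear_map_ident _ y])
  finally show ?thesis by (simp add: act_left_def)
qed

lemma act_right_tens:
  assumes x: "x \<in> carr H" and y: "y \<in> carr H"
  shows "act_right (tens H H x y) = S (B (sweedler H (\<lambda>y1 y2. m (m (S (Bt y1)) (Sd x)) (Bt y2)) y))"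
proof -
  note lBt = coalgebra_map_linear[OF Bt_map] and lSd = coalgebra_map_linear[OF Sd_map]
  note lSBt = coalgebra_map_linear[OF t.SB_map]
  have c: "convol Q m (\<lambda>t. S (Bt (p2 t))) (\<lambda>t. Sd (p1 t)) (tens H H x v) = m (S (Bt v)) (Sd x)" if v: "v \<in> carr H" for v
  proof -
    \<comment> \<open>The factor in the second variable stands first, so cocommutativity is used to
      bring the convolution to the order of \<open>convol_proj\<close>.\<close>
    have "convol Q m (\<lambda>t. S (Bt (p2 t))) (\<lambda>t. Sd (p1 t)) = convol Q (\<lambda>a b. m b a) (\<lambda>t. Sd (p1 t)) (\<lambda>t. S (Bt (p2 t)))"
      by (rule convol_commute[OF coalgebra_Q cocommutative_coalgebraD(2)[OF cocommutative_Q] V bilinear_m])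
        (intro coalg_maps_linear coalg_map_intros cocommutative_Q p1_in p2_in)+
    then show ?thesis
      using convol_proj[OF coalg coalg V V V bilinear_map_flip[OF bilinear_m] lSd lSBt x v] by simp
  qed
  have "convol Q m (convol Q m (\<lambda>t. S (Bt (p2 t))) (\<lambda>t. Sd (p1 t))) (\<lambda>t. Bt (p2 t)) (tens H H x y)
    = convol H m (\<lambda>v. convol Q m (\<lambda>t. S (Bt (p2 t))) (\<lambda>t. Sd (p1 t)) (tens H H x v)) (\<lambda>x. Bt x) y"
    by (rule convol_proj2_right[OF coalg coalg V bilinear_m _ lBt x y])
      (intro coalg_maps_linear coalg_map_intros cocommutative_Q p1_in p2_in)
  also have "\<dots> = sweedler H (\<lambda>y1 y2. m (m (S (Bt y1)) (Sd x)) (Bt y2)) y"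
    unfolding convol_inside[OF y] by (rule sweedler_cong) (simp add: c)
  finally show ?thesis by (simp add: act_right_def)
qed

context
  fixes C :: "('k, 'c::ab_group_add, 'z) bialg_scheme"
  assumes CC: "cocommutative_coalgebra C"
begin

interpretation G: rb_group "conv_group C H" "\<lambda>f x. B (f x)" by (rule rb_group_conv_group[OF CC])

lemmas group_eqs = Bt_eq[OF CC] Bm_eq[OF CC] cinv_eq[OF CC] circ_eq[OF CC] inv_conv_group[OF CC]
  coalg_map_intros[OF CC] convol_in_coalg_maps[OF CC _ _ dm_bimap]

lemma act_left_pair:
  assumes f: "f \<in> coalg_maps C H" and g: "g \<in> coalg_maps C H"
  shows "(\<lambda>x. act_left (convol C (tens H H) f g x))
    = G.Bt ((\<lambda>x. B (f x)) \<otimes>\<^bsub>conv_group C H\<^esub> g \<otimes>\<^bsub>conv_group C H\<^esub> inv\<^bsub>conv_group C H\<^esub> (\<lambda>x. B (f x)))"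
proof -
  let ?P = "convol C (tens H H) f g"
  note C = cocommutative_coalgebraD(1)[OF CC]
  note P = pair_in_coalg_maps[OF coalg coalg CC f g]
  have 1: "p1 (?P x) = f x" "p2 (?P x) = g x" for x
    using fun_cong[OF proj1_pair[OF coalg coalg CC f g]] fun_cong[OF proj2_pair[OF coalg coalg CC f g]] by auto
  note pre = convol_m_precomp[OF C coalgebra_Q P]
  have "(\<lambda>x. convol Q m (convol Q m (\<lambda>t. B (p1 t)) p2) (\<lambda>t. S (B (p1 t))) (?P x))
    = convol C m (\<lambda>x. convol Q m (\<lambda>t. B (p1 t)) p2 (?P x)) (\<lambda>x. S (B (p1 (?P x))))"
    by (intro ext pre coalg_map_intros cocommutative_Q p1_in p2_in)
  also have "(\<lambda>x. convol Q m (\<lambda>t. B (p1 t)) p2 (?P x)) = convol C m (\<lambda>x. B (p1 (?P x))) (\<lambda>x. p2 (?P x))"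
    by (intro ext pre coalg_map_intros cocommutative_Q p1_in p2_in)
  finally have "(\<lambda>x. convol Q m (convol Q m (\<lambda>t. B (p1 t)) p2) (\<lambda>t. S (B (p1 t))) (?P x))
    = convol C m (convol C m (\<lambda>x. B (f x)) g) (\<lambda>x. S (B (f x)))" unfolding 1 .
  from fun_cong[OF this] show ?thesis unfolding act_left_def using f g by (simp add: group_eqs)
qed

lemma act_right_pair:
  assumes f: "f \<in> coalg_maps C H" and g: "g \<in> coalg_maps C H"
  shows "(\<lambda>x. act_right (convol C (tens H H) f g x))
    = inv\<^bsub>conv_group C H\<^esub> (\<lambda>x. B ((inv\<^bsub>conv_group C H\<^esub> (G.Bt g) \<otimes>\<^bsub>conv_group C H\<^esub> G.cinv f \<otimes>\<^bsub>conv_group C H\<^esub> G.Bt g) x))"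
proof -
  let ?P = "convol C (tens H H) f g"
  note C = cocommutative_coalgebraD(1)[OF CC]
  note P = pair_in_coalg_maps[OF coalg coalg CC f g]
  have 1: "p1 (?P x) = f x" "p2 (?P x) = g x" for x
    using fun_cong[OF proj1_pair[OF coalg coalg CC f g]] fun_cong[OF proj2_pair[OF coalg coalg CC f g]] by auto
  note pre = convol_m_precomp[OF C coalgebra_Q P]
  have "(\<lambda>x. convol Q m (convol Q m (\<lambda>t. S (Bt (p2 t))) (\<lambda>t. Sd (p1 t))) (\<lambda>t. Bt (p2 t)) (?P x))
    = convol C m (\<lambda>x. convol Q m (\<lambda>t. S (Bt (p2 t))) (\<lambda>t. Sd (p1 t)) (?P x)) (\<lambda>x. Bt (p2 (?P x)))"
    by (intro ext pre coalg_map_intros cocommutative_Q p1_in p2_in)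
  also have "(\<lambda>x. convol Q m (\<lambda>t. S (Bt (p2 t))) (\<lambda>t. Sd (p1 t)) (?P x))
    = convol C m (\<lambda>x. S (Bt (p2 (?P x)))) (\<lambda>x. Sd (p1 (?P x)))"
    by (intro ext pre coalg_map_intros cocommutative_Q p1_in p2_in)
  finally have "(\<lambda>x. convol Q m (convol Q m (\<lambda>t. S (Bt (p2 t))) (\<lambda>t. Sd (p1 t))) (\<lambda>t. Bt (p2 t)) (?P x))
    = convol C m (convol C m (\<lambda>x. S (Bt (g x))) (\<lambda>x. Sd (f x))) (\<lambda>x. Bt (g x))" unfolding 1 .
  from fun_cong[OF this] show ?thesis unfolding act_right_def using f g by (simp add: group_eqs)
qed

end

text \<open>The pair of the two projections is the identity of H \<otimes> H. Taking it as the pair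
  of points turns the formulas for the actions at points into formulas for \<open>act_left\<close>
  and \<open>act_right\<close> themselves.\<close>

lemma pair_projections: "convol Q (tens H H) p1 p2 t = t" if "t \<in> carr Q"
proof (rule tensor_coalg_linear_eq[OF coalg coalg tensor_coalg_tcoalg _ linear_map_ident _ that])
  show "linear_map Q Q (convol Q (tens H H) p1 p2)"
    by (rule coalg_maps_linear[OF pair_in_coalg_maps[OF coalg coalg cocommutative_Q p1_in p2_in]])
  show "convol Q (tens H H) p1 p2 (tens H H x y) = tens H H x y" if "x \<in> carr H" "y \<in> carr H" for x y
    by (rule convol_proj[OF coalg coalg vspace_tensor_space V V bilinear_tens linear_map_ident linear_map_ident that])
qed

lemma act_left_in: "act_left \<in> coalg_maps Q Hm"
  unfolding act_left_def
  by (intro Bt_in_H_minus coalg_map_intros cocommutative_Q coalgebra_Q p1_in p2_in)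

lemma act_right_in: "act_right \<in> coalg_maps Q Hp"
  unfolding act_right_def
  by (intro SB_in_H_plus coalg_map_intros cocommutative_Q p1_in p2_in)

interpretation GQ: rb_group "conv_group Q H" "\<lambda>f x. B (f x)" by (rule rb_group_conv_group[OF cocommutative_Q])

lemma group_eq_on_Q:
  assumes "u \<in> coalg_maps Q D" "(\<lambda>x. u (convol Q (tens H H) p1 p2 x)) = v"
  shows "u = v"
proof -
  have "u 0 = 0" by (rule linear_map_zero[OF coalgebra_vspace[OF coalgebra_Q] coalg_maps_linear[OF assms(1)]])
  then have "u x = u (convol Q (tens H H) p1 p2 x)" for x
    using pair_projections[of x] coalg_maps_outside[OF assms(1), of x] by (cases "x \<in> carr Q") simp_all
  then show ?thesis unfolding assms(2)[symmetric] by (rule ext)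
qed

lemmas eqs_Q = group_eqs[OF cocommutative_Q] p1_in p2_in

lemma act_left_eqs:
  "act_left = GQ.Bt ((\<lambda>x. B (p1 x)) \<otimes>\<^bsub>conv_group Q H\<^esub> p2 \<otimes>\<^bsub>conv_group Q H\<^esub> inv\<^bsub>conv_group Q H\<^esub> (\<lambda>x. B (p1 x)))"
  by (rule group_eq_on_Q[OF act_left_in act_left_pair[OF cocommutative_Q p1_in p2_in]])

lemma act_right_eqs:
  "act_right = inv\<^bsub>conv_group Q H\<^esub> (\<lambda>x. B ((inv\<^bsub>conv_group Q H\<^esub> (GQ.Bt p2) \<otimes>\<^bsub>conv_group Q H\<^esub> GQ.cinv p1 \<otimes>\<^bsub>conv_group Q H\<^esub> GQ.Bt p2) x))"
  by (rule group_eq_on_Q[OF act_right_in act_right_pair[OF cocommutative_Q p1_in p2_in]])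

lemmas factors_intros_left = factors_pair_left[OF B_map] factors_convol[OF pair_left_in[OF B_map]]
  factors_comp[OF B_map] factors_comp[OF S_coalgebra_map] factors_comp[OF Bt_map] factors_comp[OF Sd_map]

lemmas factors_intros_right = factors_pair_right[OF Bt_map] factors_convol[OF pair_right_in[OF Bt_map]]
  factors_comp[OF B_map] factors_comp[OF S_coalgebra_map] factors_comp[OF Bt_map] factors_comp[OF Sd_map]

text \<open>In the defining word \<open>p1\<close> occurs only under \<open>B\<close>, which gives
  the first factorisation. In the word from \<open>left_action_eq_Bt\<close> the projection
  \<open>p2\<close> occurs only under \<open>Bt\<close>, which gives the second.\<close>

lemma act_left_factors:
  "factors (pair_left B) act_left" "factors (pair_right Bt) act_left"
proof -
  show "factors (pair_left B) act_left"
    unfolding act_left_def by (intro factors_intros_left)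
  have "act_left = GQ.Bm p1 \<otimes>\<^bsub>conv_group Q H\<^esub> GQ.Bt p2 \<otimes>\<^bsub>conv_group Q H\<^esub> GQ.Bm (inv\<^bsub>conv_group Q H\<^esub> (GQ.Bm p1 \<otimes>\<^bsub>conv_group Q H\<^esub> GQ.Bt p2)
     \<otimes>\<^bsub>conv_group Q H\<^esub> inv\<^bsub>conv_group Q H\<^esub> p1 \<otimes>\<^bsub>conv_group Q H\<^esub> (GQ.Bm p1 \<otimes>\<^bsub>conv_group Q H\<^esub> GQ.Bt p2))"
    unfolding act_left_eqs by (rule GQ.left_action_eq_Bt) (simp_all add: p1_in p2_in)
  also have "\<dots> = convol Q m (convol Q m (\<lambda>x. Bt (S (p1 x))) (\<lambda>x. Bt (p2 x)))
     (\<lambda>x. Bt (S (convol Q m (convol Q m (\<lambda>x. S (convol Q m (\<lambda>x. Bt (S (p1 x))) (\<lambda>x. Bt (p2 x)) x)) (\<lambda>x. S (p1 x)))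
        (convol Q m (\<lambda>x. Bt (S (p1 x))) (\<lambda>x. Bt (p2 x))) x)))"
    by (simp add: eqs_Q)
  finally show "factors (pair_right Bt) act_left"
    by (simp only:) (intro factors_intros_right)
qed

text \<open>Here the defining word has \<open>p2\<close> only under \<open>Bt\<close>, and
  \<open>right_action_eq_Bt\<close> supplies the word with \<open>p1\<close> only under
  \<open>B\<close>.\<close>

lemma act_right_factors:
  "factors (pair_left B) act_right" "factors (pair_right Bt) act_right"
proof -
  show "factors (pair_right Bt) act_right"
    unfolding act_right_def by (intro factors_intros_right)
  have "act_right = inv\<^bsub>conv_group Q H\<^esub> (\<lambda>x. B (((\<lambda>x. B (p1 x)) \<otimes>\<^bsub>conv_group Q H\<^esub> inv\<^bsub>conv_group Q H\<^esub> p2 \<otimes>\<^bsub>conv_group Q H\<^esub> inv\<^bsub>conv_group Q H\<^esub> (\<lambda>x. B (p1 x))) x))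
     \<otimes>\<^bsub>conv_group Q H\<^esub> (\<lambda>x. B (p1 x)) \<otimes>\<^bsub>conv_group Q H\<^esub> (\<lambda>x. B ((inv\<^bsub>conv_group Q H\<^esub> p2) x))"
    unfolding act_right_eqs by (rule GQ.right_action_eq_Bt) (simp_all add: p1_in p2_in)
  also have "\<dots> = convol Q m (convol Q m (\<lambda>x. S (B (convol Q m (convol Q m (\<lambda>x. B (p1 x)) (\<lambda>x. S (p2 x))) (\<lambda>x. S (B (p1 x))) x)))
     (\<lambda>x. B (p1 x))) (\<lambda>x. B (S (p2 x)))"
    by (simp add: eqs_Q)
  finally show "factors (pair_left B) act_right"
    by (simp only:) (intro factors_intros_left)
qed

text \<open>\<open>rhd\<close> asks for one value valid for all preimages: it exists by
  \<open>well_defined_on_images\<close>, and the given preimages determine it.\<close>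

lemma rhd_eq:
  assumes x: "x \<in> carr H" and y: "y \<in> carr H"
  shows "rhd H B (B x) (Bt y) = act_left (tens H H x y)"
  unfolding rhd_def
proof (rule the_equality)
  note wd = well_defined_on_images[OF B_map Bt_map factorsD[OF act_left_factors(1)] factorsD[OF act_left_factors(2)]]
  show "\<forall>x'\<in>carr H. \<forall>y'\<in>carr H. B x = B x' \<longrightarrow> Bt y = Bt y' \<longrightarrow>
      act_left (tens H H x y) = Bt (sweedler H (\<lambda>x1 x2. m (m (B x1) y') (S (B x2))) x')"
    using wd[OF x _ y] by (simp add: act_left_tens)
qed (use x y in \<open>simp add: act_left_tens\<close>)

lemma lhd_eq:
  assumes x: "x \<in> carr H" and y: "y \<in> carr H"
  shows "lhd H B (B x) (Bt y) = act_right (tens H H x y)"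
  unfolding lhd_def
proof (rule the_equality)
  note wd = well_defined_on_images[OF B_map Bt_map factorsD[OF act_right_factors(1)] factorsD[OF act_right_factors(2)]]
  show "\<forall>x'\<in>carr H. \<forall>y'\<in>carr H. B x = B x' \<longrightarrow> Bt y = Bt y' \<longrightarrow>
      act_right (tens H H x y) = S (B (sweedler H (\<lambda>y1 y2. m (m (S (Bt y1)) (Sd x')) (Bt y2)) y'))"
    using wd[OF x _ y] by (simp add: act_right_tens)
qed (use x y in \<open>simp add: act_right_tens\<close>)

lemma rhd_bimap: "coalg_bimap Hp Hm Hm (rhd H B)"
  by (rule coalg_bimap_of_surj[OF coalg coalg coalgebra_Hp coalgebra_Hm VHm B_map_H_plus _ Bt_map_H_minus _
        coalg_bimap_of_coalgebra_map[OF coalg coalg tensor_coalg_tcoalg coalgebra_Hm coalg_mapsD[OF act_left_in]] rhd_eq])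
    simp_all

lemma lhd_bimap: "coalg_bimap Hp Hm Hp (lhd H B)"
  by (rule coalg_bimap_of_surj[OF coalg coalg coalgebra_Hp coalgebra_Hm VHp B_map_H_plus _ Bt_map_H_minus _
        coalg_bimap_of_coalgebra_map[OF coalg coalg tensor_coalg_tcoalg coalgebra_Hp coalg_mapsD[OF act_right_in]] lhd_eq])
    simp_all

lemma convol_rhd:
  assumes CC: "cocommutative_coalgebra C" and f: "f \<in> coalg_maps C H" and g: "g \<in> coalg_maps C H"
  shows "convol C (rhd H B) (\<lambda>x. B (f x)) (\<lambda>x. Bt (g x)) = (\<lambda>x. act_left (convol C (tens H H) f g x))"
    and "convol C (lhd H B) (\<lambda>x. B (f x)) (\<lambda>x. Bt (g x)) = (\<lambda>x. act_right (convol C (tens H H) f g x))"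
proof -
  have "convol C (rhd H B) (\<lambda>x. B (f x)) (\<lambda>x. Bt (g x)) = convol C (\<lambda>x y. rhd H B (B x) (Bt y)) f g"
    by (simp add: convol_def)
  also have "\<dots> = (\<lambda>x. act_left (convol C (tens H H) f g x))"
    by (rule convol_eq_pair[OF coalg coalg CC f g VHm coalg_maps_linear[OF act_left_in] rhd_eq])
  finally show "convol C (rhd H B) (\<lambda>x. B (f x)) (\<lambda>x. Bt (g x)) = (\<lambda>x. act_left (convol C (tens H H) f g x))" .
  have "convol C (lhd H B) (\<lambda>x. B (f x)) (\<lambda>x. Bt (g x)) = convol C (\<lambda>x y. lhd H B (B x) (Bt y)) f g"
    by (simp add: convol_def)
  also have "\<dots> = (\<lambda>x. act_right (convol C (tens H H) f g x))"
    by (rule convol_eq_pair[OF coalg coalg CC f g VHp coalg_maps_linear[OF act_right_in] lhd_eq])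
  finally show "convol C (lhd H B) (\<lambda>x. B (f x)) (\<lambda>x. Bt (g x)) = (\<lambda>x. act_right (convol C (tens H H) f g x))" .
qed

end

section \<open>The double cross product\<close>

context rb_hopf
begin

abbreviation "W \<equiv> H_bowtie H B"
abbreviation "DB \<equiv> double_cross_bialg Hm Hp (rhd H B) (lhd H B)"

lemma H_bowtie_simps:
  "carr W = carr DB" "scl W = scl DB" "hmult W = hmult DB" "hone W = hone DB" "comult W = comult DB"
  "counit W = counit DB" "antipode W = (SOME S. is_antipode DB S)"
  by (simp_all add: H_bowtie_def double_cross_def bialg.defs hopf.defs)

lemma tensor_coalg_W: "tensor_coalg Hm Hp W"
  using tensor_coalg_double_cross_bialg[of Hm Hp "rhd H B" "lhd H B"]
  by (simp add: tensor_coalg_def H_bowtie_simps)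

lemmas coalgebra_W = coalgebra_tensor_coalg[OF coalgebra_Hm coalgebra_Hp tensor_coalg_W]
lemmas VW = coalgebra_vspace[OF coalgebra_W]

lemma carr_W: "carr W = carr (tensor_space Hm Hp)" and scl_W: "scl W = tensor_scl"
  and hone_W: "hone W = tens H H (hone H) (hone H)"
  using tensor_coalg_W by (simp_all add: tensor_coalg_def H_bowtie_simps(4) double_cross_bialg_def tens_Hm_Hp)

lemma tens_bimap_W: "coalg_bimap Hm Hp W (tens H H)"
  using coalg_bimap_tens[OF coalgebra_Hm coalgebra_Hp tensor_coalg_W] by (simp add: tens_Hm_Hp)

lemmas bilinear_tens_W = coalg_bimap_bilinear[OF tens_bimap_W]

lemma linear_tlift_W: "vspace U \<Longrightarrow> bilinear_map Hm Hp U F \<Longrightarrow> linear_map W U (tlift Hm Hp F)"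
  by (rule linear_tlift_coalg[OF coalgebra_Hm coalgebra_Hp tensor_coalg_W])

lemma tlift_tens_W: "vspace U \<Longrightarrow> bilinear_map Hm Hp U F \<Longrightarrow> a \<in> carr Hm \<Longrightarrow> x \<in> carr Hp \<Longrightarrow>
    tlift Hm Hp F (tens H H a x) = F a x"
  using tlift_tens[OF VHm VHp] by (simp add: tens_Hm_Hp)

lemma bilinear_tlift_W:
  assumes "vspace A" "vspace U" and F: "trilinear_map A Hm Hp U F"
  shows "bilinear_map A W U (\<lambda>a t. tlift Hm Hp (F a) t)"
  by (rule bilinear_mapI)
    (simp_all only: linear_tlift_W[OF assms(2) trilinear_map_23[OF F]] linear_map_tlift_param[OF assms(1) VHm VHp assms(2) F] carr_W)

text \<open>The product of the double cross product is cut into bilinear stages: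
  \<open>exchange\<close> moves an element of \<open>Hp\<close> past one of \<open>Hm\<close>,
  \<open>mult_right\<close> and \<open>mult_left\<close> multiply by the outer entries. Each stage
  is then accessible to \<open>convol_assoc\<close>.\<close>

definition mult_left where "mult_left a t = tlift Hm Hp (\<lambda>u v. tens H H (m a u) v) t"
definition mult_right where "mult_right t x = tlift Hm Hp (\<lambda>u v. tens H H u (m v x)) t"
definition exchange where
  "exchange x a = sweedler Hp (\<lambda>x1 x2. sweedler Hm (\<lambda>a1 a2. tens H H (rhd H B x1 a1) (lhd H B x2 a2)) a) x"
definition act where "act x t = tlift Hm Hp (\<lambda>a x'. mult_right (exchange x a) x') t"

lemmas rhd_bilinear = coalg_bimap_bilinear[OF rhd_bimap]
lemmas lhd_bilinear = coalg_bimap_bilinear[OF lhd_bimap]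

lemma tri_left: "trilinear_map Hm Hm Hp W (\<lambda>a u v. tens H H (m a u) v)"
  by (rule trilinear_bilinear_bilinear[OF bilinear_m_H_minus bilinear_tens_W])

lemma bilinear_mult_left: "bilinear_map Hm W W mult_left"
  unfolding mult_left_def by (rule bilinear_tlift_W[OF VHm VW tri_left])

lemma mult_left_tens: "a \<in> carr Hm \<Longrightarrow> u \<in> carr Hm \<Longrightarrow> v \<in> carr Hp \<Longrightarrow>
    mult_left a (tens H H u v) = tens H H (m a u) v"
  unfolding mult_left_def by (rule tlift_tens_W[OF VW trilinear_map_23[OF tri_left]])

lemma tri_right: "trilinear_map Hp Hm Hp W (\<lambda>x u v. tens H H u (m v x))"
proof (rule trilinear_mapI)
  note mc = bilinear_map_carr[OF bilinear_m_H_plus]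
  show "linear_map Hp W (\<lambda>x. tens H H u (m v x))" if "u \<in> carr Hm" "v \<in> carr Hp" for u v
    by (rule bilinear_map_comp_right[OF bilinear_tens_W bilinear_map_right[OF bilinear_m_H_plus that(2)] that(1)])
  show "linear_map Hm W (\<lambda>u. tens H H u (m v x))" if "x \<in> carr Hp" "v \<in> carr Hp" for x v
    by (rule bilinear_map_left[OF bilinear_tens_W mc[OF that(2,1)]])
  show "linear_map Hp W (\<lambda>v. tens H H u (m v x))" if "x \<in> carr Hp" "u \<in> carr Hm" for x u
    by (rule bilinear_map_comp_right[OF bilinear_tens_W bilinear_map_left[OF bilinear_m_H_plus that(1)] that(2)])
qed

lemma bilinear_mult_right: "bilinear_map W Hp W mult_right"
  unfolding mult_right_def by (rule bilinear_map_flip[OF bilinear_tlift_W[OF VHp VW tri_right]])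

lemma mult_right_tens: "u \<in> carr Hm \<Longrightarrow> v \<in> carr Hp \<Longrightarrow> x \<in> carr Hp \<Longrightarrow>
    mult_right (tens H H u v) x = tens H H u (m v x)"
  unfolding mult_right_def by (rule tlift_tens_W[OF VW trilinear_map_23[OF tri_right]])

lemmas quad_exchange = quadrilinear_bilinear_bilinear[OF rhd_bilinear lhd_bilinear bilinear_tens_W]

lemma bilinear_exchange: "bilinear_map Hp Hm W exchange"
  unfolding exchange_def by (rule bilinear_sweedler_sweedler[OF coalgebra_Hp coalgebra_Hm VW quad_exchange])

lemma tri_act: "trilinear_map Hp Hm Hp W (\<lambda>x a x'. mult_right (exchange x a) x')"
  by (rule trilinear_bilinear_bilinear[OF bilinear_exchange bilinear_mult_right])

lemma bilinear_act: "bilinear_map Hp W W act"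
  unfolding act_def by (rule bilinear_tlift_W[OF VHp VW tri_act])

lemma act_tens: "x \<in> carr Hp \<Longrightarrow> a \<in> carr Hm \<Longrightarrow> x' \<in> carr Hp \<Longrightarrow>
    act x (tens H H a x') = mult_right (exchange x a) x'"
  unfolding act_def by (rule tlift_tens_W[OF VW trilinear_map_23[OF tri_act]])

text \<open>The definition nests lifts and Sweedler sums around one elementary tensor; linearity of
  \<open>mult_left\<close> and \<open>mult_right\<close> pulls the outer multiplications
  out.\<close>

lemma hmult_W:
  assumes t: "t \<in> carr W"
  shows "hmult W s t = tlift Hm Hp (\<lambda>a x. mult_left a (act x t)) s"
proof -
  have "tlift Hm Hp (\<lambda>a' x'. sweedler Hp (\<lambda>x1 x2. sweedler Hm (\<lambda>a1 a2.
      tens Hm Hp (m a (rhd H B x1 a1)) (m (lhd H B x2 a2) x')) a') x) t = mult_left a (act x t)"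
    if a: "a \<in> carr Hm" and x: "x \<in> carr Hp" for a x
  proof -
    have "sweedler Hp (\<lambda>x1 x2. sweedler Hm (\<lambda>a1 a2. tens Hm Hp (m a (rhd H B x1 a1)) (m (lhd H B x2 a2) x')) a') x
      = mult_left a (mult_right (exchange x a') x')" if a': "a' \<in> carr Hm" and x': "x' \<in> carr Hp" for a' x'
    proof -
      have "mult_left a (mult_right (exchange x a') x')
        = sweedler Hp (\<lambda>x1 x2. sweedler Hm (\<lambda>a1 a2. mult_left a (mult_right (tens H H (rhd H B x1 a1) (lhd H B x2 a2)) x')) a') x"
        unfolding exchange_def
        by (rule linear_comp_sweedler_sweedler[OF coalgebra_Hp coalgebra_Hm VW VW quad_exchange linear_map_comp[OF
              bilinear_map_right[OF bilinear_mult_left a] bilinear_map_left[OF bilinear_mult_right x']] x a'])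
      also have "\<dots> = sweedler Hp (\<lambda>x1 x2. sweedler Hm (\<lambda>a1 a2. tens Hm Hp (m a (rhd H B x1 a1)) (m (lhd H B x2 a2) x')) a') x"
        by (rule sweedler_cong, rule sweedler_cong)
          (simp only: mult_left_tens mult_right_tens tens_Hm_Hp a x' bilinear_map_carr[OF rhd_bilinear] bilinear_map_carr[OF lhd_bilinear]
            bilinear_map_carr[OF bilinear_m_H_plus])
      finally show ?thesis ..
    qed
    then have "tlift Hm Hp (\<lambda>a' x'. sweedler Hp (\<lambda>x1 x2. sweedler Hm (\<lambda>a1 a2.
        tens Hm Hp (m a (rhd H B x1 a1)) (m (lhd H B x2 a2) x')) a') x) t
      = tlift Hm Hp (\<lambda>a' x'. mult_left a (mult_right (exchange x a') x')) t" by (rule tlift_cong)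
    also have "\<dots> = mult_left a (act x t)"
      unfolding act_def
      by (rule linear_comp_tlift[OF VHm VHp VW VW trilinear_map_23[OF tri_act x] bilinear_map_right[OF bilinear_mult_left a]
            t[unfolded carr_W], symmetric])
    finally show ?thesis .
  qed
  then show ?thesis
    unfolding H_bowtie_simps(3) double_cross_bialg_def
    by (simp only: bialg.simps H_minus_simps(5) H_plus_simps(5)) (rule tlift_cong)
qed

lemma tri_hmult: "trilinear_map W Hm Hp W (\<lambda>t a x. mult_left a (act x t))"
proof (rule trilinear_mapI)
  note ac = bilinear_map_carr[OF bilinear_act]
  show "linear_map W W (\<lambda>t. mult_left a (act x t))" if "a \<in> carr Hm" "x \<in> carr Hp" for a x
    by (rule bilinear_map_comp_right[OF bilinear_mult_left bilinear_map_right[OF bilinear_act that(2)] that(1)])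
  show "linear_map Hm W (\<lambda>a. mult_left a (act x t))" if "t \<in> carr W" "x \<in> carr Hp" for t x
    by (rule bilinear_map_left[OF bilinear_mult_left ac[OF that(2,1)]])
  show "linear_map Hp W (\<lambda>x. mult_left a (act x t))" if "t \<in> carr W" "a \<in> carr Hm" for t a
    by (rule bilinear_map_comp_right[OF bilinear_mult_left bilinear_map_left[OF bilinear_act that(1)] that(2)])
qed

lemma bilinear_hmult_W: "bilinear_map W W W (hmult W)"
  by (rule bilinear_map_cong[OF VW VW bilinear_map_flip[OF bilinear_tlift_W[OF VW VW tri_hmult]]])
    (simp add: hmult_W)

lemma hmult_W_tens: "a \<in> carr Hm \<Longrightarrow> x \<in> carr Hp \<Longrightarrow> t \<in> carr W \<Longrightarrow>
    hmult W (tens H H a x) t = mult_left a (act x t)"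
  unfolding hmult_W by (rule tlift_tens_W[OF VW trilinear_map_23[OF tri_hmult]])

text \<open>On the tensor coalgebra of \<open>Hp\<close> and \<open>Hm\<close>,
  \<open>exchange\<close> is the pair of the two lifted actions; precomposition with the pair of
  \<open>f\<close> and \<open>g\<close> gives the formula.\<close>

lemma convol_exchange:
  assumes CC: "cocommutative_coalgebra C" and f: "f \<in> coalg_maps C Hp" and g: "g \<in> coalg_maps C Hm"
  shows "convol C exchange f g = convol C (tens H H) (convol C (rhd H B) f g) (convol C (lhd H B) f g)"
proof -
  note C = cocommutative_coalgebraD(1)[OF CC]
  let ?T = "tcoalg Hp Hm" let ?l = "tlift Hp Hm (rhd H B)" and ?r = "tlift Hp Hm (lhd H B)"
  have T: "coalgebra ?T" by (rule coalgebra_tcoalg[OF coalgebra_Hp coalgebra_Hm])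
  have l: "linear_map ?T Hm ?l" and r: "linear_map ?T Hp ?r"
    by (rule linear_tlift_coalg[OF coalgebra_Hp coalgebra_Hm tensor_coalg_tcoalg] VHm VHp rhd_bilinear lhd_bilinear)+
  note lt = tlift_tens[OF VHp VHm VHm rhd_bilinear] and rt = tlift_tens[OF VHp VHm VHp lhd_bilinear]
  note P = pair_in_coalg_maps[OF coalgebra_Hp coalgebra_Hm CC f g]
  have "exchange x a = convol ?T (tens H H) ?l ?r (tens Hp Hm x a)" if x: "x \<in> carr Hp" and a: "a \<in> carr Hm" for x a
    unfolding convol_inside[OF tens_in_tcoalg[OF coalgebra_Hp coalgebra_Hm x a]]
      sweedler_tens[OF coalgebra_Hp coalgebra_Hm tensor_coalg_tcoalg VW bilinear_map_comp[OF bilinear_tens_W l r] x a] exchange_def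
    by (rule sweedler_cong, rule sweedler_cong) (simp only: lt rt)
  then have "convol C exchange f g = (\<lambda>x. convol ?T (tens H H) ?l ?r (convol C (tens Hp Hm) f g x))"
    by (rule convol_eq_pair[OF coalgebra_Hp coalgebra_Hm CC f g VW linear_convol[OF T VW bilinear_tens_W l r]])
  also have "\<dots> = convol C (tens H H) (\<lambda>x. ?l (convol C (tens Hp Hm) f g x)) (\<lambda>x. ?r (convol C (tens Hp Hm) f g x))"
    by (rule convol_precomp[OF C T VW bilinear_tens_W l r P])
  also have "(\<lambda>x. ?l (convol C (tens Hp Hm) f g x)) = convol C (rhd H B) f g"
    by (rule convol_eq_pair[OF coalgebra_Hp coalgebra_Hm CC f g VHm l lt[symmetric], symmetric])
  also have "(\<lambda>x. ?r (convol C (tens Hp Hm) f g x)) = convol C (lhd H B) f g"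
    by (rule convol_eq_pair[OF coalgebra_Hp coalgebra_Hm CC f g VHp r rt[symmetric], symmetric])
  finally show ?thesis .
qed

text \<open>Four regroupings by \<open>convol_assoc\<close> and one use of
  \<open>convol_exchange\<close> absorb all Sweedler legs; what remains is the product formula of a
  double cross product of groups, at points.\<close>

lemma convol_hmult_W:
  assumes CC: "cocommutative_coalgebra C"
    and a: "a \<in> coalg_maps C Hm" and x: "x \<in> coalg_maps C Hp" and a': "a' \<in> coalg_maps C Hm" and x': "x' \<in> coalg_maps C Hp"
  shows "convol C (hmult W) (convol C (tens H H) a x) (convol C (tens H H) a' x')
    = convol C (tens H H) (convol C m a (convol C (rhd H B) x a')) (convol C m (convol C (lhd H B) x a') x')"
proof -
  note C = cocommutative_coalgebraD(1)[OF CC]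
  note la = coalg_maps_linear[OF a] and lx = coalg_maps_linear[OF x] and la' = coalg_maps_linear[OF a'] and lx' = coalg_maps_linear[OF x']
  let ?t = "tens H H" let ?s = "convol C ?t a' x'" let ?l = "convol C (rhd H B) x a'" and ?r = "convol C (lhd H B) x a'"
  note bt = bilinear_tens_W
  have ls: "linear_map C W ?s" by (rule linear_convol[OF C VW bt la' lx'])
  have ll: "linear_map C Hm ?l" by (rule linear_convol[OF C VHm rhd_bilinear lx la'])
  have lr: "linear_map C Hp ?r" by (rule linear_convol[OF C VHp lhd_bilinear lx la'])
  have lmr: "linear_map C Hp (convol C m ?r x')" by (rule linear_convol[OF C VHp bilinear_m_H_plus lr lx'])
  have "convol C (hmult W) (convol C ?t a x) ?s = convol C mult_left a (convol C act x ?s)"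
    by (rule convol_assoc[OF C VW VW VW la lx ls bt bilinear_hmult_W bilinear_act bilinear_mult_left]) (rule hmult_W_tens)
  also have "convol C act x ?s = convol C mult_right (convol C exchange x a') x'"
    by (rule convol_assoc[OF C VW VW VW lx la' lx' bilinear_exchange bilinear_mult_right bt bilinear_act, symmetric])
      (rule act_tens[symmetric])
  also have "\<dots> = convol C mult_right (convol C ?t ?l ?r) x'"
    by (simp only: convol_exchange[OF CC x a'])
  also have "\<dots> = convol C ?t ?l (convol C m ?r x')"
    by (rule convol_assoc[OF C VW VHp VW ll lr lx' bt bilinear_mult_right bilinear_m_H_plus bt]) (rule mult_right_tens)
  also have "convol C mult_left a \<dots> = convol C ?t (convol C m a ?l) (convol C m ?r x')"
    by (rule convol_assoc[OF C VHm VW VW la ll lmr bilinear_m_H_minus bt bt bilinear_mult_left, symmetric])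
      (rule mult_left_tens[symmetric])
  finally show ?thesis .
qed

definition psi where
  "psi C f g = convol C (tens H H) (rb_group.psiL (conv_group C H) (\<lambda>f x. B (f x)) f g)
    (rb_group.psiR (conv_group C H) (\<lambda>f x. B (f x)) f g)"

text \<open>The map Bt \<otimes> B from H \<otimes> H onto \<open>W\<close>: the generic pair at
  which identities in the double cross product are tested.\<close>

definition qmap where "qmap = convol Q (tens H H) (\<lambda>t. Bt (p1 t)) (\<lambda>t. B (p2 t))"

lemma pair_in_W:
  assumes CC: "cocommutative_coalgebra C" and "f \<in> coalg_maps C Hm" "g \<in> coalg_maps C Hp"
  shows "convol C (tens H H) f g \<in> coalg_maps C W"
  using coalgebra_map_convol[OF cocommutative_coalgebraD(1,2)[OF CC] coalgebra_Hm coalgebra_Hp coalgebra_W tens_bimap_W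
      coalg_mapsD[OF assms(2)] coalg_mapsD[OF assms(3)]]
  by (simp add: coalg_maps_def)

section \<open>The group coordinates of the double cross product\<close>

context
  fixes C :: "('k, 'c::ab_group_add, 'z) bialg_scheme"
  assumes CC: "cocommutative_coalgebra C"
begin

interpretation G: rb_group "conv_group C H" "\<lambda>f x. B (f x)" by (rule rb_group_conv_group[OF CC])

private lemma C_coalg: "coalgebra C" using CC by (rule cocommutative_coalgebraD)

private abbreviation "unit_C \<equiv> \<one>\<^bsub>conv_group C H\<^esub>"

text \<open>\<open>psiL\<close> is a value of \<open>Bt\<close> at an inverse, and
  \<open>psiR_in_B\<close> writes \<open>psiR\<close> as a value of \<open>B\<close>.\<close>

lemma psi_components:
  assumes f: "f \<in> coalg_maps C H" and g: "g \<in> coalg_maps C H"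
  shows "G.psiL f g \<in> coalg_maps C Hm" "G.psiR f g \<in> coalg_maps C Hp"
proof -
  have "G.psiL f g = (\<lambda>x. Bt (S (convol C m (\<lambda>x. B (g x)) (\<lambda>x. S (f x)) x)))"
    using f g by (simp add: G.psiL_def group_eqs[OF CC])
  then show "G.psiL f g \<in> coalg_maps C Hm"
    using Bt_in_H_minus[OF C_coalg] coalg_map_intros[OF CC] f g by simp
  have "G.circ (G.cinv ((\<lambda>x. B (g x)) \<otimes>\<^bsub>conv_group C H\<^esub> inv\<^bsub>conv_group C H\<^esub> f)) g \<in> coalg_maps C H"
    using G.circ_closed G.cinv_closed G.m_closed G.inv_closed G.B_closed f g by simp
  then show "G.psiR f g \<in> coalg_maps C Hp"
    using G.psiR_in_B[of f g] B_in_H_plus[OF C_coalg] f g by simp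
qed

lemma psi_in_W: "f \<in> coalg_maps C H \<Longrightarrow> g \<in> coalg_maps C H \<Longrightarrow> psi C f g \<in> coalg_maps C W"
  unfolding psi_def using pair_in_W[OF CC] psi_components by blast

text \<open>\<open>convol_hmult_W\<close> reduces the product to the two actions, which are then
  brought to the form they have in \<open>psi_mult\<close>.\<close>

lemma psi_hmult:
  assumes f: "f \<in> coalg_maps C H" and g: "g \<in> coalg_maps C H" and f': "f' \<in> coalg_maps C H" and g': "g' \<in> coalg_maps C H"
  shows "convol C (hmult W) (psi C f g) (psi C f' g') = psi C (convol C m f f') (convol C dm g g')"
proof -
  let ?G = "conv_group C H"
  \<comment> \<open>The actions are known on values of \<open>B\<close>; this is the preimage of
    \<open>h\<close> under \<open>B\<close> supplied by \<open>psiR_in_B\<close>.\<close>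
  define k where "k = G.circ (G.cinv ((\<lambda>x. B (g x)) \<otimes>\<^bsub>?G\<^esub> inv\<^bsub>?G\<^esub> f)) g"
  define w where "w = (\<lambda>x. B (g' x)) \<otimes>\<^bsub>?G\<^esub> inv\<^bsub>?G\<^esub> f'"
  define h where "h = G.psiR f g"
  have in_G: "f \<in> carrier ?G" "g \<in> carrier ?G" "f' \<in> carrier ?G" "g' \<in> carrier ?G" using assms by simp_all
  have kG: "k \<in> carrier ?G" unfolding k_def
    by (intro G.circ_closed G.cinv_closed G.m_closed G.inv_closed G.B_closed in_G)
  have wG: "w \<in> carrier ?G" unfolding w_def by (intro G.m_closed G.inv_closed G.B_closed in_G)
  have iwG: "inv\<^bsub>?G\<^esub> w \<in> carrier ?G" using wG by (rule G.inv_closed)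
  have k: "k \<in> coalg_maps C H" and w: "w \<in> coalg_maps C H" and iw: "inv\<^bsub>?G\<^esub> w \<in> coalg_maps C H"
    using kG wG iwG by simp_all
  have h: "h = (\<lambda>x. B (k x))" unfolding h_def k_def by (rule G.psiR_in_B[OF in_G(1,2)])
  have hG: "h \<in> carrier ?G" unfolding h using G.B_closed[OF kG] .
  \<comment> \<open>The argument acted upon must appear as a value of \<open>Bt\<close>, hence the
    passage to the inverse of \<open>w\<close>.\<close>
  have L': "G.psiL f' g' = (\<lambda>x. Bt ((inv\<^bsub>?G\<^esub> w) x))"
    using G.Bt_inv[OF wG] unfolding Bt_eq[OF CC iw] G.psiL_def w_def[symmetric] by (rule sym)
  \<comment> \<open>Conjugation commutes with inversion, which leads back from \<open>Bt\<close> to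
    \<open>Bm\<close>.\<close>
  have c: "h \<otimes>\<^bsub>?G\<^esub> inv\<^bsub>?G\<^esub> w \<otimes>\<^bsub>?G\<^esub> inv\<^bsub>?G\<^esub> h = inv\<^bsub>?G\<^esub> (h \<otimes>\<^bsub>?G\<^esub> w \<otimes>\<^bsub>?G\<^esub> inv\<^bsub>?G\<^esub> h)"
    using hG wG by (simp add: G.group_simps del: mult_conv_group carrier_conv_group)
  have hw: "h \<otimes>\<^bsub>?G\<^esub> w \<otimes>\<^bsub>?G\<^esub> inv\<^bsub>?G\<^esub> h \<in> carrier ?G" by (intro G.m_closed G.inv_closed hG wG)
  have l: "convol C (rhd H B) h (G.psiL f' g') = G.Bm (h \<otimes>\<^bsub>?G\<^esub> w \<otimes>\<^bsub>?G\<^esub> inv\<^bsub>?G\<^esub> h)"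
  proof -
    have "convol C (rhd H B) h (G.psiL f' g') = G.Bt (h \<otimes>\<^bsub>?G\<^esub> inv\<^bsub>?G\<^esub> w \<otimes>\<^bsub>?G\<^esub> inv\<^bsub>?G\<^esub> h)"
      unfolding h L' convol_rhd(1)[OF CC k iw] by (rule act_left_pair[OF CC k iw])
    then show ?thesis unfolding c G.Bt_inv[OF hw] .
  qed
  have r: "convol C (lhd H B) h (G.psiL f' g')
    = inv\<^bsub>?G\<^esub> (\<lambda>x. B ((h \<otimes>\<^bsub>?G\<^esub> w \<otimes>\<^bsub>?G\<^esub> inv\<^bsub>?G\<^esub> h) x)) \<otimes>\<^bsub>?G\<^esub> h \<otimes>\<^bsub>?G\<^esub> (\<lambda>x. B (w x))"
  proof -
    have "convol C (lhd H B) h (G.psiL f' g') = inv\<^bsub>?G\<^esub> (\<lambda>x. B ((inv\<^bsub>?G\<^esub> (G.Bt (inv\<^bsub>?G\<^esub> w)) \<otimes>\<^bsub>?G\<^esub> G.cinv k \<otimes>\<^bsub>?G\<^esub> G.Bt (inv\<^bsub>?G\<^esub> w)) x))"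
      unfolding h L' convol_rhd(2)[OF CC k iw] by (rule act_right_pair[OF CC k iw])
    then show ?thesis unfolding G.right_action_eq_Bt[OF kG iwG] G.inv_inv[OF wG] h[symmetric] .
  qed
  note comp = psi_components[OF f g] psi_components[OF f' g']
  have "convol C (hmult W) (psi C f g) (psi C f' g')
    = convol C (tens H H) (convol C m (G.psiL f g) (convol C (rhd H B) h (G.psiL f' g')))
       (convol C m (convol C (lhd H B) h (G.psiL f' g')) (G.psiR f' g'))"
    unfolding psi_def h_def by (rule convol_hmult_W[OF CC comp])
  also have "convol C m (G.psiL f g) (convol C (rhd H B) h (G.psiL f' g')) = G.psiL (convol C m f f') (convol C dm g g')"
    using G.psi_mult(1)[OF in_G] unfolding l h_def[symmetric] w_def[symmetric] by (simp add: circ_eq[OF CC g g'])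
  also have "convol C m (convol C (lhd H B) h (G.psiL f' g')) (G.psiR f' g') = G.psiR (convol C m f f') (convol C dm g g')"
    using G.psi_mult(2)[OF in_G] unfolding r h_def[symmetric] w_def[symmetric] by (simp add: circ_eq[OF CC g g'])
  finally show ?thesis by (simp add: psi_def)
qed

lemma psi_one_one: "psi C unit_C unit_C = (\<lambda>x. if x \<in> carr C then scl W (counit C x) (hone W) else 0)"
proof
  fix x
  have o: "unit_C \<in> coalg_maps C H" using G.one_closed by simp
  have p: "G.psiL unit_C unit_C = unit_C" "G.psiR unit_C unit_C = unit_C" by (rule G.psi_one)+
  have lo: "linear_map C Hp unit_C" using coalg_maps_linear[OF psi_components(2)[OF o o]] by (simp only: p)
  show "psi C unit_C unit_C x = (if x \<in> carr C then scl W (counit C x) (hone W) else 0)"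
  proof (cases "x \<in> carr C")
    case True
    have "psi C unit_C unit_C x = convol C (tens H H) (\<lambda>x. if x \<in> carr C then scl Hm (counit C x) (hone H) else 0) unit_C x"
      unfolding psi_def p unfolding one_conv_group H_minus_simps(2) ..
    also have "\<dots> = tens H H (hone H) (unit_C x)"
      by (rule convol_counit_left[OF C_coalg VHm VW bilinear_tens_W one_in_H_minus lo True])
    finally show ?thesis using True by (simp add: one_conv_group tens_scl_right scl_W hone_W)
  qed (simp add: psi_def)
qed

text \<open>\<open>psi_surj\<close> with the inverse of \<open>f\<close> in the place of
  \<open>w\<close>: every pair of points in \<open>Hm\<close> and \<open>Hp\<close> that is given by
  preimages has group coordinates.\<close>

lemma pair_eq_psi:
  assumes f: "f \<in> coalg_maps C H" and g: "g \<in> coalg_maps C H"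
  shows "convol C (tens H H) (\<lambda>x. Bt (f x)) (\<lambda>x. B (g x))
    = psi C (convol C m (\<lambda>x. Bt (f x)) (\<lambda>x. B (g x))) (convol C dm (\<lambda>x. S (f x)) g)"
proof -
  let ?G = "conv_group C H"
  have fG: "f \<in> carrier ?G" "g \<in> carrier ?G" using f g by simp_all
  have Sf: "(\<lambda>x. S (f x)) \<in> coalg_maps C H" by (intro coalg_map_intros CC f)
  have e: "G.Bm (inv\<^bsub>?G\<^esub> f) \<otimes>\<^bsub>?G\<^esub> (\<lambda>x. B (g x)) = convol C m (\<lambda>x. Bt (f x)) (\<lambda>x. B (g x))"
    "G.circ (inv\<^bsub>?G\<^esub> f) g = convol C dm (\<lambda>x. S (f x)) g" "G.Bm (inv\<^bsub>?G\<^esub> f) = (\<lambda>x. Bt (f x))"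
    using G.Bm_inv[OF fG(1)] by (simp_all add: Bt_eq[OF CC f] inv_conv_group[OF CC f] circ_eq[OF CC Sf g])
  show ?thesis
    using G.psi_surj[OF G.inv_closed[OF fG(1)] fG(2)] unfolding e by (simp add: psi_def)
qed

lemma qmap_pair:
  assumes h: "h \<in> coalg_maps C Q"
  shows "(\<lambda>x. qmap (h x)) = psi C (convol C m (\<lambda>x. Bt (p1 (h x))) (\<lambda>x. B (p2 (h x)))) (convol C dm (\<lambda>x. S (p1 (h x))) (\<lambda>x. p2 (h x)))"
    and "(\<lambda>x. p1 (h x)) \<in> coalg_maps C H" and "(\<lambda>x. p2 (h x)) \<in> coalg_maps C H"
proof -
  show p: "(\<lambda>x. p1 (h x)) \<in> coalg_maps C H" "(\<lambda>x. p2 (h x)) \<in> coalg_maps C H"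
    by (rule coalg_maps_comp[OF C_coalg coalgebra_Q V h] coalg_mapsD[OF p1_in] coalg_mapsD[OF p2_in])+
  have "(\<lambda>x. qmap (h x)) = convol C (tens H H) (\<lambda>x. Bt (p1 (h x))) (\<lambda>x. B (p2 (h x)))"
    unfolding qmap_def
    by (rule convol_precomp[OF C_coalg coalgebra_Q vspace_tensor_space bilinear_tens _ _ h])
      (intro coalg_maps_linear coalg_map_intros cocommutative_Q p1_in p2_in)+
  then show "(\<lambda>x. qmap (h x)) = psi C (convol C m (\<lambda>x. Bt (p1 (h x))) (\<lambda>x. B (p2 (h x)))) (convol C dm (\<lambda>x. S (p1 (h x))) (\<lambda>x. p2 (h x)))"
    unfolding pair_eq_psi[OF p] .
qed

end

lemma qmap_tens: "x \<in> carr H \<Longrightarrow> y \<in> carr H \<Longrightarrow> qmap (tens H H x y) = tens H H (Bt x) (B y)"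
  unfolding qmap_def
  by (rule convol_proj[OF coalg coalg vspace_tensor_space V V bilinear_tens coalgebra_map_linear[OF Bt_map] B_linear])

lemma qmap_in: "qmap \<in> coalg_maps Q W"
  unfolding qmap_def by (intro pair_in_W cocommutative_Q Bt_in_H_minus B_in_H_plus coalgebra_Q p1_in p2_in)

text \<open>The image is a subspace and contains all elementary tensors of \<open>Hm\<close> and
  \<open>Hp\<close>.\<close>

lemma qmap_surj: "qmap ` carr Q = carr W"
proof
  show "qmap ` carr Q \<subseteq> carr W" using coalg_maps_carr[OF qmap_in] by blast
  let ?I = "\<lparr>carr = qmap ` carr Q, scl = scl W\<rparr>"
  have VI: "vspace ?I"
    by (rule linear_map_image_vspace[OF coalgebra_vspace[OF coalgebra_Q] VW coalg_maps_linear[OF qmap_in]]) simp_all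
  show "carr W \<subseteq> qmap ` carr Q"
  proof
    fix t assume "t \<in> carr W"
    then obtain ps where ps: "set ps \<subseteq> carr Hm \<times> carr Hp" "t = (\<Sum>(v, w)\<leftarrow>ps. tens Hm Hp v w)"
      using iffD1[OF tensor_space_sum_list[OF VHm VHp]] unfolding carr_W by blast
    have "(case p of (v, w) \<Rightarrow> tens Hm Hp v w) \<in> carr ?I" if p: "p \<in> set ps" for p
    proof -
      obtain x y where "x \<in> carr H" "y \<in> carr H" "p = (Bt x, B y)" using p ps(1) by auto
      then show ?thesis
        using qmap_tens[of x y] tens_in_tcoalg[OF coalg coalg, of x y] by (auto simp: tens_Hm_Hp intro!: image_eqI[where x = "tens H H x y"])
    qed
    then show "t \<in> qmap ` carr Q" using vspace_sum_list[OF VI, of ps] unfolding ps(2) by simp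
  qed
qed

text \<open>At the three projections of a triple tensor power of H \<otimes> H,
  \<open>psi_hmult\<close> replaces the product of \<open>W\<close> by the products \<open>m\<close>
  and \<open>dm\<close> in the two coordinates, and both are associative.\<close>

lemma hmult_W_assoc:
  assumes "r \<in> carr W" "s \<in> carr W" "t \<in> carr W"
  shows "hmult W (hmult W r s) t = hmult W r (hmult W s t)"
proof -
  obtain x y z where x: "x \<in> carr Q" "r = qmap x" and y: "y \<in> carr Q" "s = qmap y" and z: "z \<in> carr Q" "t = qmap z"
    using assms unfolding qmap_surj[symmetric] by blast
  let ?T = "tcoalg Q Q" let ?C = "tcoalg ?T Q"
  have TT: "cocommutative_coalgebra ?T" by (rule cocommutative_coalgebra_tcoalg[OF cocommutative_Q cocommutative_Q])
  have CC: "cocommutative_coalgebra ?C" by (rule cocommutative_coalgebra_tcoalg[OF TT cocommutative_Q])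
  note T = cocommutative_coalgebraD[OF TT] and C = cocommutative_coalgebraD[OF CC]
  interpret G: rb_group "conv_group ?C H" "\<lambda>f x. B (f x)" by (rule rb_group_conv_group[OF CC])
  have P: "proj1 ?T Q \<in> coalg_maps ?C ?T" and h: "proj2 ?T Q \<in> coalg_maps ?C Q"
    by (rule proj1_in_coalg_maps[OF T(1) coalgebra_Q] proj2_in_coalg_maps[OF T(1) coalgebra_Q])+
  have f: "(\<lambda>t. proj1 Q Q (proj1 ?T Q t)) \<in> coalg_maps ?C Q" and g: "(\<lambda>t. proj2 Q Q (proj1 ?T Q t)) \<in> coalg_maps ?C Q"
    by (rule coalg_maps_comp[OF C(1) T(1) coalgebra_vspace[OF coalgebra_Q] P]
        coalg_mapsD[OF proj1_in_coalg_maps[OF coalgebra_Q coalgebra_Q]] coalg_mapsD[OF proj2_in_coalg_maps[OF coalgebra_Q coalgebra_Q]])+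
  note i = coalg_map_intros[OF CC] convol_in_coalg_maps[OF CC _ _ dm_bimap] qmap_pair(2,3)[OF CC f] qmap_pair(2,3)[OF CC g] qmap_pair(2,3)[OF CC h]
  have ma: "convol ?C m (convol ?C m a b) c = convol ?C m a (convol ?C m b c)"
    and da: "convol ?C dm (convol ?C dm a b) c = convol ?C dm a (convol ?C dm b c)"
    if "a \<in> coalg_maps ?C H" "b \<in> coalg_maps ?C H" "c \<in> coalg_maps ?C H" for a b c
    using G.m_assoc[of a b c] G.circ_assoc[of a b c] that
    by (simp_all add: circ_eq[OF CC] convol_in_coalg_maps[OF CC _ _ dm_bimap])
  show ?thesis
    unfolding x(2) y(2) z(2)
  proof (rule assoc_of_convol_assoc[OF coalgebra_Q VW bilinear_hmult_W coalg_maps_linear[OF qmap_in] _ x(1) y(1) z(1)])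
    show "convol ?C (hmult W) (convol ?C (hmult W) (\<lambda>t. qmap (proj1 Q Q (proj1 ?T Q t))) (\<lambda>t. qmap (proj2 Q Q (proj1 ?T Q t))))
        (\<lambda>t. qmap (proj2 ?T Q t))
      = convol ?C (hmult W) (\<lambda>t. qmap (proj1 Q Q (proj1 ?T Q t))) (convol ?C (hmult W) (\<lambda>t. qmap (proj2 Q Q (proj1 ?T Q t)))
        (\<lambda>t. qmap (proj2 ?T Q t)))"
      unfolding qmap_pair(1)[OF CC f] qmap_pair(1)[OF CC g] qmap_pair(1)[OF CC h]
      by (simp add: psi_hmult[OF CC] i ma da)
  qed
qed

lemma one_in_W: "hone W \<in> carr W"
  unfolding hone_W by (rule bilinear_map_carr[OF bilinear_tens_W one_in_H_minus one_in_H_plus])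

lemma hmult_W_unit:
  assumes "t \<in> carr W"
  shows "hmult W (hone W) t = t" "hmult W t (hone W) = t"
proof -
  obtain x where x: "x \<in> carr Q" "t = qmap x" using assms unfolding qmap_surj[symmetric] by blast
  interpret G: rb_group "conv_group Q H" "\<lambda>f x. B (f x)" by (rule rb_group_conv_group[OF cocommutative_Q])
  let ?o = "\<one>\<^bsub>conv_group Q H\<^esub>"
  have o: "?o \<in> coalg_maps Q H" using G.one_closed by simp
  note lq = coalg_maps_linear[OF qmap_in]
  define f g where "f = convol Q m (\<lambda>t. Bt (p1 t)) (\<lambda>t. B (p2 t))" and "g = convol Q dm (\<lambda>t. S (p1 t)) p2"
  have q: "qmap = psi Q f g" unfolding qmap_def f_def g_def by (rule pair_eq_psi[OF cocommutative_Q p1_in p2_in])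
  have fg: "f \<in> coalg_maps Q H" "g \<in> coalg_maps Q H"
    unfolding f_def g_def by (intro coalg_map_intros convol_in_coalg_maps dm_bimap cocommutative_Q p1_in p2_in)+
  have u: "convol Q m ?o f = f" "convol Q m f ?o = f" "convol Q dm ?o g = g" "convol Q dm g ?o = g"
    using G.l_one[of f] G.r_one[of f] G.circ_one[of g] fg by (simp_all add: circ_eq[OF cocommutative_Q] o)
  have "convol Q (hmult W) (psi Q ?o ?o) qmap = qmap" "convol Q (hmult W) qmap (psi Q ?o ?o) = qmap"
    unfolding q by (simp_all add: psi_hmult[OF cocommutative_Q] o fg u)
  then show "hmult W (hone W) t = t" "hmult W t (hone W) = t"
    using convol_counit_left[OF coalgebra_Q VW VW bilinear_hmult_W one_in_W lq x(1)]
      convol_counit_right[OF coalgebra_Q VW VW bilinear_hmult_W one_in_W lq x(1)]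
    by (simp_all add: psi_one_one[OF cocommutative_Q] x(2))
qed

text \<open>Produces a linear map on \<open>W\<close> from a formula in preimages, used for the
  antipode and for the second projection. Here \<open>Bt\<close> belongs to the left variable and
  \<open>B\<close> to the right one, the reverse of the situation for the actions.\<close>

lemma linear_map_on_W_exists:
  assumes u: "u \<in> coalg_maps Q W"
    and L: "\<exists>E. u = (\<lambda>t. E (pair_left Bt t))" and R: "\<exists>E. u = (\<lambda>t. E (pair_right B t))"
  obtains f where "linear_map W W f"
    "\<And>x y. x \<in> carr H \<Longrightarrow> y \<in> carr H \<Longrightarrow> f (tens H H (Bt x) (B y)) = u (tens H H x y)"
proof -
  define r where "r a k = u (tens H H (inv_into (carr H) Bt a) (inv_into (carr H) B k))" for a k
  have r: "r (Bt x) (B y) = u (tens H H x y)" if "x \<in> carr H" "y \<in> carr H" for x y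
    unfolding r_def
    by (rule well_defined_on_images[OF Bt_map B_map L R])
      (use that in \<open>auto intro: inv_into_into f_inv_into_f\<close>)
  have bu: "bilinear_map H H W (\<lambda>x y. u (tens H H x y))"
    by (rule linear_comp_bilinear[OF coalg_maps_linear[OF u] coalg_bimap_bilinear[OF coalg_bimap_tens_tcoalg[OF coalg coalg]]])
  have b: "bilinear_map Hm Hp W r"
    by (rule bilinear_map_of_surj[OF V V VHm VHp coalgebra_map_linear[OF Bt_map_H_minus] _ coalgebra_map_linear[OF B_map_H_plus] _ bu r])
      simp_all
  show thesis
  proof (rule that[of "tlift Hm Hp r"])
    show "linear_map W W (tlift Hm Hp r)" by (rule linear_tlift_W[OF VW b])
    show "tlift Hm Hp r (tens H H (Bt x) (B y)) = u (tens H H x y)" if "x \<in> carr H" "y \<in> carr H" for x y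
      using tlift_tens_W[OF VW b, of "Bt x" "B y"] r that by simp
  qed
qed

end

section \<open>Antipode and projections of the double cross product\<close>

lemma is_antipode_cong:
  assumes eqs: "carr C = carr D" "scl C = scl D" "comult C = comult D" "counit C = counit D"
    "hmult C = hmult D" "hone C = hone D"
  shows "is_antipode C S \<longleftrightarrow> is_antipode D S"
  unfolding is_antipode_def sweedler_cong_space[OF eqs(1-3)] eqs linear_map_cong_space[OF eqs(1,2) eqs(1,2)] ..

context rb_hopf
begin

interpretation GQ: rb_group "conv_group Q H" "\<lambda>f x. B (f x)" by (rule rb_group_conv_group[OF cocommutative_Q])

abbreviation "conv_Q \<equiv> conv_group Q H"

lemmas in_Q = p1_in p2_in coalg_map_intros[OF cocommutative_Q]
lemmas eqs_in_Q = group_eqs[OF cocommutative_Q] p1_in p2_in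

lemmas factors_Bt = factors_pair_left[OF Bt_map] factors_convol[OF pair_left_in[OF Bt_map]]
  factors_comp[OF B_map] factors_comp[OF S_coalgebra_map] factors_comp[OF Bt_map] factors_comp[OF Sd_map]

lemmas factors_B = factors_pair_right[OF B_map] factors_convol[OF pair_right_in[OF B_map]]
  factors_comp[OF B_map] factors_comp[OF S_coalgebra_map] factors_comp[OF Bt_map] factors_comp[OF Sd_map]

lemma factors_psi:
  assumes P: "P \<in> coalg_maps Q Q" and "factors P (GQ.psiL f g)" "factors P (GQ.psiR f g)"
  shows "\<exists>E. psi Q f g = (\<lambda>t. E (P t))"
  unfolding psi_def by (rule factors_pair[OF assms])

text \<open>\<open>q_g\<close> and \<open>q_t\<close> are the group coordinates of the generic pair
  (Bt x, B y): the product of the entries, and the descendent product of S x and y.\<close>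

definition "q_g = convol Q m (\<lambda>t. Bt (p1 t)) (\<lambda>t. B (p2 t))"
definition "q_t = convol Q dm (\<lambda>t. S (p1 t)) p2"

lemma q_in: "q_g \<in> coalg_maps Q H" "q_t \<in> coalg_maps Q H"
  unfolding q_g_def q_t_def by (intro in_Q convol_in_coalg_maps[OF cocommutative_Q _ _ dm_bimap])+

lemma qmap_psi: "qmap = psi Q q_g q_t"
  unfolding qmap_def q_g_def q_t_def by (rule pair_eq_psi[OF cocommutative_Q p1_in p2_in])

lemma Bm_inv_p1: "GQ.Bm (inv\<^bsub>conv_Q\<^esub> p1) = (\<lambda>t. Bt (p1 t))"
  using GQ.Bm_inv[of p1] by (simp add: eqs_in_Q)

lemma q_eqs: "q_g = GQ.Bm (inv\<^bsub>conv_Q\<^esub> p1) \<otimes>\<^bsub>conv_Q\<^esub> (\<lambda>t. B (p2 t))" "q_t = GQ.circ (inv\<^bsub>conv_Q\<^esub> p1) p2"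
  unfolding Bm_inv_p1 by (simp_all add: q_g_def q_t_def eqs_in_Q)

text \<open>Inversion in both coordinates of the generic pair: the antipode of \<open>W\<close>,
  pulled back along \<open>qmap\<close>.\<close>

definition "S_pre = psi Q (\<lambda>t. S (q_g t)) (\<lambda>t. Sd (q_t t))"

lemma S_pre_in: "S_pre \<in> coalg_maps Q W"
  unfolding S_pre_def by (intro psi_in_W in_Q cocommutative_Q q_in)

text \<open>\<open>psi_inv\<close> gives a word with \<open>p2\<close> only under \<open>B\<close>,
  and \<open>psi_inv_left\<close> one with \<open>p1\<close> only under \<open>Bt\<close>.\<close>

lemma S_pre_factors:
  "\<exists>E. S_pre = (\<lambda>t. E (pair_left Bt t))" "\<exists>E. S_pre = (\<lambda>t. E (pair_right B t))"
proof -
  let ?w = "inv\<^bsub>conv_Q\<^esub> p1"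
  have w: "?w \<in> carrier conv_Q" "p2 \<in> carrier conv_Q" using GQ.inv_closed[of p1] p1_in p2_in by simp_all
  define w' where "w' = inv\<^bsub>conv_Q\<^esub> (\<lambda>t. B (p2 t)) \<otimes>\<^bsub>conv_Q\<^esub> GQ.cinv ?w \<otimes>\<^bsub>conv_Q\<^esub> (\<lambda>t. B (p2 t))"
  have e: "(\<lambda>t. S (q_g t)) = inv\<^bsub>conv_Q\<^esub> q_g" "(\<lambda>t. Sd (q_t t)) = GQ.cinv q_t"
    using q_in by (simp_all add: eqs_in_Q)
  have 1: "GQ.psiL (\<lambda>t. S (q_g t)) (\<lambda>t. Sd (q_t t)) = GQ.Bm w'"
    "GQ.psiR (\<lambda>t. S (q_g t)) (\<lambda>t. Sd (q_t t))
      = inv\<^bsub>conv_Q\<^esub> (\<lambda>t. B (w' t)) \<otimes>\<^bsub>conv_Q\<^esub> inv\<^bsub>conv_Q\<^esub> (\<lambda>t. B (p2 t)) \<otimes>\<^bsub>conv_Q\<^esub> inv\<^bsub>conv_Q\<^esub> (\<lambda>t. B (?w t))"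
    using GQ.psi_inv[OF w] unfolding e unfolding q_eqs w'_def by blast+
  note 2 = GQ.psi_inv_left[OF w, folded w'_def, folded 1, unfolded Bm_inv_p1]
  have w'_eq: "w' = convol Q m (convol Q m (\<lambda>t. S (B (p2 t))) (\<lambda>t. Sd (S (p1 t)))) (\<lambda>t. B (p2 t))"
    by (simp add: w'_def eqs_in_Q)
  have w'_in: "w' \<in> coalg_maps Q H" unfolding w'_eq by (intro in_Q)
  have fw: "factors (pair_right B) w'" unfolding w'_eq by (intro factors_B)
  have "GQ.Bm w' = (\<lambda>t. Bt (S (w' t)))"
    "inv\<^bsub>conv_Q\<^esub> (\<lambda>t. B (w' t)) \<otimes>\<^bsub>conv_Q\<^esub> inv\<^bsub>conv_Q\<^esub> (\<lambda>t. B (p2 t)) \<otimes>\<^bsub>conv_Q\<^esub> inv\<^bsub>conv_Q\<^esub> (\<lambda>t. B (?w t))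
      = convol Q m (convol Q m (\<lambda>t. S (B (w' t))) (\<lambda>t. S (B (p2 t)))) (\<lambda>t. S (B (S (p1 t))))"
    using w'_in by (simp_all add: eqs_in_Q)
  then show "\<exists>E. S_pre = (\<lambda>t. E (pair_right B t))"
    unfolding S_pre_def
    by (intro factors_psi pair_right_in B_map) (simp_all only: 1, (intro factors_B fw)+)
  show "\<exists>E. S_pre = (\<lambda>t. E (pair_left Bt t))"
    unfolding S_pre_def
  proof (rule factors_psi[OF pair_left_in[OF Bt_map]])
    have "GQ.psiL (\<lambda>t. S (q_g t)) (\<lambda>t. Sd (q_t t)) = convol Q m (convol Q m (\<lambda>t. S (Bt (S (p2 t)))) (\<lambda>t. S (Bt (p1 t))))
        (\<lambda>t. Bt (S (convol Q m (convol Q m (convol Q m (convol Q m (\<lambda>t. Bt (p1 t)) (\<lambda>t. Bt (S (p2 t)))) (\<lambda>t. S (Sd (p2 t)))) (\<lambda>t. S (Bt (S (p2 t)))))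
          (\<lambda>t. S (Bt (p1 t))) t)))"
      unfolding 2(1) by (simp add: eqs_in_Q)
    then show "factors (pair_left Bt) (GQ.psiL (\<lambda>t. S (q_g t)) (\<lambda>t. Sd (q_t t)))"
      by (simp only:) (intro factors_Bt)
    have "GQ.psiR (\<lambda>t. S (q_g t)) (\<lambda>t. Sd (q_t t))
      = (\<lambda>t. S (B (convol Q m (convol Q m (\<lambda>t. Bt (p1 t)) p2) (\<lambda>t. S (Bt (p1 t))) t)))"
      unfolding 2(2) by (simp add: eqs_in_Q)
    then show "factors (pair_left Bt) (GQ.psiR (\<lambda>t. S (q_g t)) (\<lambda>t. Sd (q_t t)))"
      by (simp only:) (intro factors_Bt)
  qed
qed

text \<open>The antipode of \<open>W\<close> is a choice, so it is enough to exhibit one.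
  \<open>S_pre\<close> descends to \<open>W\<close>, and \<open>psi_hmult\<close> turns its two
  convolutions with \<open>qmap\<close> into the unit in both coordinates.\<close>

lemma antipode_W: "is_antipode W (antipode W)"
proof -
  obtain f where f: "linear_map W W f"
    "\<And>x y. x \<in> carr H \<Longrightarrow> y \<in> carr H \<Longrightarrow> f (tens H H (Bt x) (B y)) = S_pre (tens H H x y)"
    using linear_map_on_W_exists[OF S_pre_in S_pre_factors] by blast
  note lq = coalg_maps_linear[OF qmap_in] and qc = coalg_mapsD[OF qmap_in]
  have fq: "f (qmap t) = S_pre t" if "t \<in> carr Q" for t
    by (rule tensor_coalg_linear_eq[OF coalg coalg tensor_coalg_tcoalg linear_map_comp[OF f(1) lq]
          coalg_maps_linear[OF S_pre_in] _ that])
      (simp add: qmap_tens f(2))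
  let ?o = "\<one>\<^bsub>conv_Q\<^esub>"
  have gt: "q_g \<in> carrier conv_Q" "q_t \<in> carrier conv_Q" using q_in by simp_all
  have u: "convol Q m (\<lambda>t. S (q_g t)) q_g = ?o" "convol Q m q_g (\<lambda>t. S (q_g t)) = ?o"
    "convol Q dm (\<lambda>t. Sd (q_t t)) q_t = ?o" "convol Q dm q_t (\<lambda>t. Sd (q_t t)) = ?o"
    using GQ.l_inv[OF gt(1)] GQ.r_inv[OF gt(1)] GQ.cinv_circ[OF gt(2)] GQ.circ_cinv[OF gt(2)] q_in
    by (simp_all add: eqs_in_Q)
  have "is_antipode W f"
    unfolding is_antipode_def
  proof (intro conjI ballI f(1))
    fix z assume "z \<in> carr W"
    then obtain t where t: "t \<in> carr Q" "z = qmap t" unfolding qmap_surj[symmetric] by blast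
    note c = coalgebra_map_counit[OF qc t(1)]
    have "sweedler W (\<lambda>x1 x2. hmult W (f x1) x2) z = sweedler Q (\<lambda>a b. hmult W (f (qmap a)) (qmap b)) t"
      unfolding t(2)
      by (rule sweedler_coalgebra_map[OF coalgebra_Q VW qc VW bilinear_map_comp[OF bilinear_hmult_W f(1) linear_map_ident] t(1)])
    also have "\<dots> = convol Q (hmult W) S_pre qmap t"
      unfolding convol_inside[OF t(1)] by (rule sweedler_cong) (simp add: fq)
    also have "convol Q (hmult W) S_pre qmap = psi Q ?o ?o"
      unfolding S_pre_def qmap_psi
      using psi_hmult[OF cocommutative_Q in_Q(4)[OF q_in(1)] in_Q(6)[OF q_in(2)] q_in] by (simp only: u)
    finally show "sweedler W (\<lambda>x1 x2. hmult W (f x1) x2) z = scl W (counit W z) (hone W)"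
      using t c by (simp add: psi_one_one[OF cocommutative_Q])
    have "sweedler W (\<lambda>x1 x2. hmult W x1 (f x2)) z = sweedler Q (\<lambda>a b. hmult W (qmap a) (f (qmap b))) t"
      unfolding t(2)
      by (rule sweedler_coalgebra_map[OF coalgebra_Q VW qc VW bilinear_map_comp[OF bilinear_hmult_W linear_map_ident f(1)] t(1)])
    also have "\<dots> = convol Q (hmult W) qmap S_pre t"
      unfolding convol_inside[OF t(1)] by (rule sweedler_cong) (simp add: fq)
    also have "convol Q (hmult W) qmap S_pre = psi Q ?o ?o"
      unfolding S_pre_def qmap_psi
      using psi_hmult[OF cocommutative_Q q_in in_Q(4)[OF q_in(1)] in_Q(6)[OF q_in(2)]] by (simp only: u)
    finally show "sweedler W (\<lambda>x1 x2. hmult W x1 (f x2)) z = scl W (counit W z) (hone W)"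
      using t c by (simp add: psi_one_one[OF cocommutative_Q])
  qed
  \<comment> \<open>The choice in \<open>double_cross\<close> is made over the bialgebra
    \<open>DB\<close>, which agrees with \<open>W\<close> in all fields that
    \<open>is_antipode\<close> reads.\<close>
  then have "is_antipode DB f"
    using is_antipode_cong[of W DB] by (simp add: H_bowtie_simps(1-6))
  then have "is_antipode DB (antipode W)"
    unfolding H_bowtie_simps(7) by (rule someI[where P = "is_antipode DB"])
  then show ?thesis
    using is_antipode_cong[of W DB] by (simp add: H_bowtie_simps(1-6))
qed

section \<open>The homomorphism pi\<close>

abbreviation "\<pi> \<equiv> pi_map H B"

lemma pi_comp:
  assumes CC: "cocommutative_coalgebra C" and f: "f \<in> coalg_maps C H"
  shows "psi C (\<one>\<^bsub>conv_group C H\<^esub>) f = (\<lambda>x. convol H (tens H H) (\<lambda>x. Bt (S (B x))) (\<lambda>x. S (B (Bt (S x)))) (f x))"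
proof -
  interpret G: rb_group "conv_group C H" "\<lambda>f x. B (f x)" by (rule rb_group_conv_group[OF CC])
  note C = cocommutative_coalgebraD(1)[OF CC]
  have fG: "f \<in> carrier (conv_group C H)" using f by simp
  have e: "G.Bm (\<lambda>x. B (f x)) = (\<lambda>x. Bt (S (B (f x))))" "inv\<^bsub>conv_group C H\<^esub> (\<lambda>x. B (G.Bm f x)) = (\<lambda>x. S (B (Bt (S (f x)))))"
    using f by (simp_all add: group_eqs[OF CC])
  have l: "linear_map H H (\<lambda>x. Bt (S (B x)))" "linear_map H H (\<lambda>x. S (B (Bt (S x))))"
    by (intro linear_map_comp[OF coalgebra_map_linear[OF Bt_map]] linear_map_comp[OF S_linear] linear_map_comp[OF B_linear]
        B_linear S_linear)+
  show ?thesis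
    unfolding psi_def G.psi_unit[OF fG] e
    by (rule convol_precomp[OF C coalg vspace_tensor_space bilinear_tens l f, symmetric])
qed

lemma pi_eq:
  assumes x: "x \<in> carr H"
  shows "\<pi> x = convol H (tens H H) (\<lambda>x. Bt (S (B x))) (\<lambda>x. S (B (Bt (S x)))) x"
  by (simp add: pi_map_def convol_inside[OF x] Let_def)

text \<open>\<open>\<pi>\<close> is the inclusion of the second coordinate, the first being the
  unit; it therefore inherits multiplicativity and unit from \<open>psi\<close>.\<close>

lemma pi_point:
  assumes CC: "cocommutative_coalgebra C" and f: "f \<in> coalg_maps C H" and x: "x \<in> carr C"
  shows "psi C (\<one>\<^bsub>conv_group C H\<^esub>) f x = \<pi> (f x)"
  unfolding pi_comp[OF CC f] pi_eq[OF coalg_maps_carr[OF f x]] ..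

lemma pi_map_W: "coalgebra_map H W \<pi>"
proof -
  interpret G: rb_group "conv_group H H" "\<lambda>f x. B (f x)" by (rule rb_group_conv_group[OF cocommutative_coalg])
  have i: "ident_on H \<in> coalg_maps H H" by (rule ident_on_in_coalg_maps[OF coalg])
  have "psi H (\<one>\<^bsub>conv_group H H\<^esub>) (ident_on H) \<in> coalg_maps H W"
    using G.one_closed by (intro psi_in_W cocommutative_coalg i) simp
  then show ?thesis
    by (rule coalgebra_map_cong[OF coalg coalg_mapsD]) (simp add: pi_point[OF cocommutative_coalg i])
qed

lemmas pi_linear = coalgebra_map_linear[OF pi_map_W]

text \<open>\<open>psi_hmult\<close> at the two projections with both first coordinates equal to the
  unit.\<close>

lemma pi_mult:
  assumes x: "x \<in> carr H" and y: "y \<in> carr H"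
  shows "\<pi> (dm x y) = hmult W (\<pi> x) (\<pi> y)"
proof -
  let ?o = "\<one>\<^bsub>conv_Q\<^esub>"
  have o: "?o \<in> coalg_maps Q H" using GQ.one_closed by simp
  have oo: "convol Q m ?o ?o = ?o" using GQ.l_one[OF GQ.one_closed] by simp
  have c: "convol Q dm p1 p2 \<in> coalg_maps Q H"
    by (rule convol_in_coalg_maps[OF cocommutative_Q p1_in p2_in dm_bimap])
  have "hmult W (\<pi> x) (\<pi> y) = convol Q (hmult W) (\<lambda>t. \<pi> (p1 t)) (\<lambda>t. \<pi> (p2 t)) (tens H H x y)"
    by (rule convol_proj[OF coalg coalg VW VW VW bilinear_hmult_W pi_linear pi_linear x y, symmetric])
  also have "convol Q (hmult W) (\<lambda>t. \<pi> (p1 t)) (\<lambda>t. \<pi> (p2 t)) = convol Q (hmult W) (psi Q ?o p1) (psi Q ?o p2)"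
    by (rule convol_cong) (simp add: pi_point[OF cocommutative_Q] p1_in p2_in)
  also have "\<dots> = psi Q ?o (convol Q dm p1 p2)"
    using psi_hmult[OF cocommutative_Q o p1_in o p2_in] by (simp only: oo)
  also have "\<dots> (tens H H x y) = \<pi> (convol Q dm p1 p2 (tens H H x y))"
    by (rule pi_point[OF cocommutative_Q c tens_in_tcoalg[OF coalg coalg x y]])
  also have "convol Q dm p1 p2 (tens H H x y) = dm x y"
    by (rule convol_proj[OF coalg coalg V V V dm_bilinear linear_map_ident linear_map_ident x y])
  finally show ?thesis ..
qed

lemma pi_one: "\<pi> (hone H) = hone W"
proof -
  interpret G: rb_group "conv_group H H" "\<lambda>f x. B (f x)" by (rule rb_group_conv_group[OF cocommutative_coalg])
  let ?o = "\<one>\<^bsub>conv_group H H\<^esub>"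
  have o: "?o \<in> coalg_maps H H" using G.one_closed by simp
  have "?o (hone H) = hone H" using bialg one_carr vspace_scl_one[OF V] by (simp add: one_conv_group bialgebra_def)
  then show ?thesis
    using pi_point[OF cocommutative_coalg o one_carr] bialg one_carr vspace_scl_one[OF VW]
    by (simp add: psi_one_one[OF cocommutative_coalg] bialgebra_def)
qed

text \<open>Both \<open>S \<circ> \<pi>\<close> and \<open>\<pi> \<circ> S_B\<close> are convolution inverses of \<open>\<pi>\<close>.\<close>

lemma pi_antipode:
  assumes x: "x \<in> carr H"
  shows "\<pi> (Sd x) = antipode W (\<pi> x)"
proof -
  let ?S = "antipode W" and ?u = "\<lambda>x. if x \<in> carr H then scl W (counit H x) (hone W) else 0"
  interpret G: rb_group "conv_group H H" "\<lambda>f x. B (f x)" by (rule rb_group_conv_group[OF cocommutative_coalg])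
  note i = ident_on_in_coalg_maps[OF coalg]
  have Si: "(\<lambda>x. Sd (ident_on H x)) \<in> coalg_maps H H"
    by (rule comp_in_coalg_maps[OF cocommutative_coalg Sd_map i])
  let ?o = "\<one>\<^bsub>conv_group H H\<^esub>"
  have o: "?o \<in> coalg_maps H H" using G.one_closed by simp
  have oo: "convol H m ?o ?o = ?o" using G.l_one[OF G.one_closed] by simp
  have lS: "linear_map W W ?S" using antipode_W by (simp add: is_antipode_def)
  have lSp: "linear_map H W (\<lambda>x. ?S (\<pi> x))" by (rule linear_map_comp[OF lS pi_linear])
  have lpS: "linear_map H W (\<lambda>x. \<pi> (Sd x))" by (rule linear_map_comp[OF pi_linear coalgebra_map_linear[OF Sd_map]])
  have 1: "convol H (hmult W) (\<lambda>x. ?S (\<pi> x)) \<pi> = ?u"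
  proof
    fix y
    have "sweedler H (\<lambda>a b. hmult W (?S (\<pi> a)) (\<pi> b)) y = scl W (counit H y) (hone W)" if y: "y \<in> carr H"
    proof -
      have "sweedler H (\<lambda>a b. hmult W (?S (\<pi> a)) (\<pi> b)) y = sweedler W (\<lambda>a b. hmult W (?S a) b) (\<pi> y)"
        by (rule sweedler_coalgebra_map[OF coalg VW pi_map_W VW bilinear_map_comp[OF bilinear_hmult_W lS linear_map_ident] y, symmetric])
      then show ?thesis
        using antipode_W coalgebra_map_carr[OF pi_map_W y] coalgebra_map_counit[OF pi_map_W y] by (simp add: is_antipode_def)
    qed
    then show "convol H (hmult W) (\<lambda>x. ?S (\<pi> x)) \<pi> y = ?u y" by (simp add: convol_def)
  qed
  have 2: "convol H (hmult W) \<pi> (\<lambda>x. \<pi> (Sd x)) = ?u"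
  proof -
    have "convol H (hmult W) \<pi> (\<lambda>x. \<pi> (Sd x))
      = convol H (hmult W) (psi H ?o (ident_on H)) (psi H ?o (\<lambda>x. Sd (ident_on H x)))"
      by (rule convol_cong) (simp add: pi_point[OF cocommutative_coalg i] pi_point[OF cocommutative_coalg Si])
    also have "\<dots> = psi H ?o (convol H dm (ident_on H) (\<lambda>x. Sd (ident_on H x)))"
      using psi_hmult[OF cocommutative_coalg o i o Si] by (simp only: oo)
    also have "convol H dm (ident_on H) (\<lambda>x. Sd (ident_on H x)) = ?o"
      using G.circ_cinv[of "ident_on H"] i Si by (simp add: circ_eq[OF cocommutative_coalg] cinv_eq[OF cocommutative_coalg])
    finally show ?thesis unfolding psi_one_one[OF cocommutative_coalg] .
  qed
  have "convol H (hmult W) (convol H (hmult W) (\<lambda>x. ?S (\<pi> x)) \<pi>) (\<lambda>x. \<pi> (Sd x))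
    = convol H (hmult W) (\<lambda>x. ?S (\<pi> x)) (convol H (hmult W) \<pi> (\<lambda>x. \<pi> (Sd x)))"
    by (rule convol_assoc[OF coalg VW VW VW lSp pi_linear lpS bilinear_hmult_W bilinear_hmult_W bilinear_hmult_W bilinear_hmult_W])
      (rule hmult_W_assoc)
  then have "convol H (hmult W) ?u (\<lambda>x. \<pi> (Sd x)) x = convol H (hmult W) (\<lambda>x. ?S (\<pi> x)) ?u x"
    unfolding 1 2 by simp
  then show ?thesis
    using hmult_W_unit(1)[OF linear_map_carr[OF lpS x]] hmult_W_unit(2)[OF linear_map_carr[OF lSp x]]
    by (simp only: convol_counit_left[OF coalg VW VW bilinear_hmult_W one_in_W lpS x]
        convol_counit_right[OF coalg VW VW bilinear_hmult_W one_in_W lSp x])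
qed

section \<open>The second projection in group coordinates\<close>

abbreviation "Ct \<equiv> proj_C_tilde H B"

text \<open>Keeps the second coordinate of the generic pair and replaces the first by the unit: the
  second projection, pulled back along \<open>qmap\<close>.\<close>

definition "C_pre = psi Q (\<one>\<^bsub>conv_Q\<^esub>) q_t"

lemma C_pre_in: "C_pre \<in> coalg_maps Q W"
  unfolding C_pre_def using GQ.one_closed by (intro psi_in_W cocommutative_Q q_in) simp

text \<open>\<open>B\<close> and \<open>Bm\<close> are homomorphisms for \<open>circ\<close>, so
  each of them splits \<open>q_t\<close> into a plain product.\<close>

lemma q_t_B: "(\<lambda>t. B (q_t t)) = convol Q m (\<lambda>t. B (S (p1 t))) (\<lambda>t. B (p2 t))"
  and q_t_Bm: "GQ.Bm q_t = convol Q m (\<lambda>t. Bt (p1 t)) (\<lambda>t. Bt (S (p2 t)))"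
proof -
  have w: "inv\<^bsub>conv_Q\<^esub> p1 \<in> carrier conv_Q" "p2 \<in> carrier conv_Q" using GQ.inv_closed[of p1] p1_in p2_in by simp_all
  show "(\<lambda>t. B (q_t t)) = convol Q m (\<lambda>t. B (S (p1 t))) (\<lambda>t. B (p2 t))"
    using GQ.B_circ[OF w] unfolding q_eqs by (simp add: eqs_in_Q)
  show "GQ.Bm q_t = convol Q m (\<lambda>t. Bt (p1 t)) (\<lambda>t. Bt (S (p2 t)))"
    using GQ.Bm_circ[OF w] unfolding q_eqs Bm_inv_p1 by (simp add: eqs_in_Q)
qed

lemma C_pre_components:
  "GQ.psiL (\<one>\<^bsub>conv_Q\<^esub>) q_t = (\<lambda>t. Bt (S (convol Q m (\<lambda>t. B (S (p1 t))) (\<lambda>t. B (p2 t)) t)))"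
  "GQ.psiR (\<one>\<^bsub>conv_Q\<^esub>) q_t = (\<lambda>t. S (B (convol Q m (\<lambda>t. Bt (p1 t)) (\<lambda>t. Bt (S (p2 t))) t)))"
proof -
  have q: "q_t \<in> carrier conv_Q" using q_in by simp
  show "GQ.psiL (\<one>\<^bsub>conv_Q\<^esub>) q_t = (\<lambda>t. Bt (S (convol Q m (\<lambda>t. B (S (p1 t))) (\<lambda>t. B (p2 t)) t)))"
    unfolding GQ.psi_unit[OF q] q_t_B by (simp add: eqs_in_Q)
  show "GQ.psiR (\<one>\<^bsub>conv_Q\<^esub>) q_t = (\<lambda>t. S (B (convol Q m (\<lambda>t. Bt (p1 t)) (\<lambda>t. Bt (S (p2 t))) t)))"
    unfolding GQ.psi_unit[OF q] q_t_Bm by (simp add: eqs_in_Q)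
qed

text \<open>As \<open>B\<close> and \<open>Bm\<close> commute, each component has a second word.
  Those of \<open>C_pre_components\<close> have \<open>p2\<close> only under \<open>B\<close> on the
  left and \<open>p1\<close> only under \<open>Bt\<close> on the right; here it is the other way
  round, so both factorisations are available for both components.\<close>

lemma C_pre_components':
  "GQ.psiL (\<one>\<^bsub>conv_Q\<^esub>) q_t = (\<lambda>t. B (convol Q m (\<lambda>t. Bt (p1 t)) (\<lambda>t. Bt (S (p2 t))) t))"
  "GQ.psiR (\<one>\<^bsub>conv_Q\<^esub>) q_t = (\<lambda>t. S (Bt (S (convol Q m (\<lambda>t. B (S (p1 t))) (\<lambda>t. B (p2 t)) t))))"
proof -
  have q: "q_t \<in> carrier conv_Q" using q_in by simp
  show "GQ.psiL (\<one>\<^bsub>conv_Q\<^esub>) q_t = (\<lambda>t. B (convol Q m (\<lambda>t. Bt (p1 t)) (\<lambda>t. Bt (S (p2 t))) t))"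
    unfolding GQ.psi_unit[OF q] GQ.Bm_B[OF q] q_t_Bm ..
  show "GQ.psiR (\<one>\<^bsub>conv_Q\<^esub>) q_t = (\<lambda>t. S (Bt (S (convol Q m (\<lambda>t. B (S (p1 t))) (\<lambda>t. B (p2 t)) t))))"
    unfolding GQ.psi_unit[OF q] GQ.Bm_B[OF q, symmetric] q_t_B by (simp add: eqs_in_Q)
qed

lemma C_pre_factors:
  "\<exists>E. C_pre = (\<lambda>t. E (pair_left Bt t))" "\<exists>E. C_pre = (\<lambda>t. E (pair_right B t))"
proof -
  show "\<exists>E. C_pre = (\<lambda>t. E (pair_left Bt t))"
    unfolding C_pre_def
    by (rule factors_psi[OF pair_left_in[OF Bt_map]])
      (simp_all only: C_pre_components(2) C_pre_components'(1), (intro factors_Bt)+)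
  show "\<exists>E. C_pre = (\<lambda>t. E (pair_right B t))"
    unfolding C_pre_def
    by (rule factors_psi[OF pair_right_in[OF B_map]])
      (simp_all only: C_pre_components(1) C_pre_components'(2), (intro factors_B)+)
qed

lemma C_pre_pi:
  assumes x: "x \<in> carr H" and y: "y \<in> carr H"
  shows "C_pre (tens H H x y) = \<pi> (dm (S x) y)"
proof -
  have "C_pre (tens H H x y) = \<pi> (q_t (tens H H x y))"
    unfolding C_pre_def by (rule pi_point[OF cocommutative_Q q_in(2) tens_in_tcoalg[OF coalg coalg x y]])
  also have "q_t (tens H H x y) = dm (S x) y"
    unfolding q_t_def by (rule convol_proj[OF coalg coalg V V V dm_bilinear S_linear linear_map_ident x y])
  finally show ?thesis .
qed

text \<open>The displayed formula of \<open>proj_C_tilde\<close> is thus the projection onto the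
  second coordinate; its four legs are the legs of the generic pair.\<close>

lemma C_pre_tens:
  assumes x: "x \<in> carr H" and y: "y \<in> carr H"
  shows "C_pre (tens H H x y) = sweedler H (\<lambda>x1 x2. sweedler H (\<lambda>y1 y2.
      tens H H (Bt (S (m (B (S x1)) (B y1)))) (S (B (m (Bt x2) (Bt (S y2)))))) y) x"
proof -
  let ?a = "\<lambda>t. Bt (S (convol Q m (\<lambda>t. B (S (p1 t))) (\<lambda>t. B (p2 t)) t))"
  let ?b = "\<lambda>t. S (B (convol Q m (\<lambda>t. Bt (p1 t)) (\<lambda>t. Bt (S (p2 t))) t))"
  have l: "linear_map Q H ?a" "linear_map Q H ?b" by (intro coalg_maps_linear in_Q)+
  note lBt = coalgebra_map_linear[OF Bt_map] and lBS = coalgebra_map_linear[OF BS_map]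
  note lBtS = linear_map_comp[OF lBt S_linear]
  have a: "?a (tens H H u v) = Bt (S (m (B (S u)) (B v)))" if "u \<in> carr H" "v \<in> carr H" for u v
    using convol_proj[OF coalg coalg V V V bilinear_m lBS B_linear that] by simp
  have b: "?b (tens H H u v) = S (B (m (Bt u) (Bt (S v))))" if "u \<in> carr H" "v \<in> carr H" for u v
    using convol_proj[OF coalg coalg V V V bilinear_m lBt lBtS that] by simp
  have "C_pre (tens H H x y) = sweedler Q (\<lambda>s t. tens H H (?a s) (?b t)) (tens H H x y)"
    unfolding C_pre_def psi_def C_pre_components by (simp only: convol_inside[OF tens_in_tcoalg[OF coalg coalg x y]])
  also have "\<dots> = sweedler H (\<lambda>x1 x2. sweedler H (\<lambda>y1 y2. tens H H (?a (tens H H x1 y1)) (?b (tens H H x2 y2))) y) x"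
    by (rule sweedler_tens[OF coalg coalg tensor_coalg_tcoalg vspace_tensor_space bilinear_map_comp[OF bilinear_tens l] x y])
  also have "\<dots> = sweedler H (\<lambda>x1 x2. sweedler H (\<lambda>y1 y2.
      tens H H (Bt (S (m (B (S x1)) (B y1)))) (S (B (m (Bt x2) (Bt (S y2)))))) y) x"
    by (rule sweedler_cong, rule sweedler_cong) (simp only: a b)
  finally show ?thesis .
qed

text \<open>The choice in \<open>proj_C_tilde\<close> has a witness because \<open>C_pre\<close>
  descends to \<open>W\<close>. The chosen map then has the values of \<open>C_pre\<close>, which
  \<open>C_pre_pi\<close> identifies.\<close>

lemma Ct_linear: "linear_map W W Ct"
  and Ct_tens: "x \<in> carr H \<Longrightarrow> y \<in> carr H \<Longrightarrow> Ct (tens H H (Bt x) (B y)) = \<pi> (dm (S x) y)"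
proof -
  let ?P = "\<lambda>f. linear_map W W f \<and> (\<forall>x\<in>carr H. \<forall>y\<in>carr H. f (tens H H (Bt x) (B y)) =
    sweedler H (\<lambda>x1 x2. sweedler H (\<lambda>y1 y2.
      tens H H (Bt (S (m (B (S x1)) (B y1)))) (S (B (m (Bt x2) (Bt (S y2)))))) y) x)"
  obtain f where f: "linear_map W W f"
    "\<And>x y. x \<in> carr H \<Longrightarrow> y \<in> carr H \<Longrightarrow> f (tens H H (Bt x) (B y)) = C_pre (tens H H x y)"
    using linear_map_on_W_exists[OF C_pre_in C_pre_factors] by blast
  have "?P f" using f C_pre_tens by simp
  then have P: "?P Ct" unfolding proj_C_tilde_def Let_def by (rule someI[where P = ?P])
  then show "linear_map W W Ct" by (rule conjunct1)
  show "Ct (tens H H (Bt x) (B y)) = \<pi> (dm (S x) y)" if "x \<in> carr H" "y \<in> carr H"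
    using bspec[OF bspec[OF conjunct2[OF P] that(1)] that(2)] C_pre_tens[OF that] C_pre_pi[OF that]
    by (rule trans[OF _ trans[OF sym]])
qed

section \<open>The Hopf algebra H_2 as the image of pi\<close>

abbreviation "H2 \<equiv> H_two H B"

lemma H_two_simps [simp]:
  "scl H2 = scl W" "hmult H2 = hmult W" "hone H2 = hone W" "comult H2 = comult W" "counit H2 = counit W"
  "antipode H2 = antipode W" "carr H2 = Ct ` carr W"
  by (simp_all add: H_two_def)

lemma dm_one_right: assumes x: "x \<in> carr H" shows "dm x (hone H) = x" and "dm (hone H) x = x"
  using hopf_algebra_descendent x by (simp_all add: hopf_algebra_def bialgebra_def algebra_def)

lemma S_one: "S (hone H) = hone H"
proof -
  interpret group "conv_group H H" by (rule group_conv_group[OF cocommutative_coalg])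
  have e: "inv\<^bsub>conv_group H H\<^esub> \<one>\<^bsub>conv_group H H\<^esub> = (\<lambda>x. S (\<one>\<^bsub>conv_group H H\<^esub> x))"
    by (rule inv_conv_group[OF cocommutative_coalg]) (use one_closed in simp)
  have "(\<lambda>x. S (\<one>\<^bsub>conv_group H H\<^esub> x)) = \<one>\<^bsub>conv_group H H\<^esub>"
    unfolding e[symmetric] by (rule inv_one)
  from fun_cong[OF this, of "hone H"] show ?thesis
    using bialg one_carr vspace_scl_one[OF V] by (simp add: one_conv_group bialgebra_def)
qed

text \<open>One inclusion evaluates the projection at pairs whose first entry is the unit. For the
  other, the projection sends \<open>qmap t\<close> to \<open>\<pi> (q_t t)\<close>, and
  \<open>qmap\<close> is onto.\<close>

lemma carr_H_two: "\<pi> ` carr H = carr H2"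
proof
  note Sc = linear_map_carr[OF S_linear]
  show "\<pi> ` carr H \<subseteq> carr H2"
  proof
    fix z assume "z \<in> \<pi> ` carr H"
    then obtain x where x: "x \<in> carr H" "z = \<pi> x" by blast
    \<comment> \<open>The preimage of the first entry is written as \<open>S (hone H)\<close>, so
      that the descendent product in \<open>Ct_tens\<close> has the unit on the left and leaves
      \<open>x\<close>.\<close>
    have "Ct (tens H H (Bt (S (hone H))) (B x)) = \<pi> x"
      using Ct_tens[OF Sc[OF one_carr] x(1)] by (simp add: S_one one_carr dm_one_right x(1))
    moreover have "tens H H (Bt (S (hone H))) (B x) \<in> carr W"
      using bilinear_map_carr[OF bilinear_tens_W] Sc[OF one_carr] x(1) by simp
    ultimately show "z \<in> carr H2" using x(2) by (metis H_two_simps(7) imageI)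
  qed
  let ?I = "\<lparr>carr = \<pi> ` carr H, scl = scl W\<rparr>"
  have VI: "vspace ?I"
    by (rule linear_map_image_vspace[OF V VW pi_linear]) simp_all
  have "linear_map Q ?I (\<lambda>t. Ct (qmap t))"
  proof -
    have e: "Ct (qmap t) = \<pi> (q_t t)" if "t \<in> carr Q" for t
    proof (rule tensor_coalg_linear_eq[OF coalg coalg tensor_coalg_tcoalg linear_map_comp[OF Ct_linear coalg_maps_linear[OF qmap_in]]
          linear_map_comp[OF pi_linear coalg_maps_linear[OF q_in(2)]] _ that])
      fix x y assume "x \<in> carr H" "y \<in> carr H"
      then show "Ct (qmap (tens H H x y)) = \<pi> (q_t (tens H H x y))"
        unfolding q_t_def using convol_proj[OF coalg coalg V V V dm_bilinear S_linear linear_map_ident, of x y]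
        by (simp add: qmap_tens Ct_tens)
    qed
    have "linear_map Q W (\<lambda>t. \<pi> (q_t t))" by (rule linear_map_comp[OF pi_linear coalg_maps_linear[OF q_in(2)]])
    then have "linear_map Q ?I (\<lambda>t. \<pi> (q_t t))"
      using coalg_maps_carr[OF q_in(2)] by (simp add: linear_map_def)
    then show ?thesis
      by (rule linear_map_cong[OF coalgebra_vspace[OF coalgebra_Q]]) (simp add: e)
  qed
  from linear_map_carr[OF this] show "carr H2 \<subseteq> \<pi> ` carr H"
    by (auto simp flip: qmap_surj)
qed

lemma vspace_H_two: "vspace H2"
  by (rule linear_map_image_vspace[OF VW VW Ct_linear]) simp_all

lemma pi_map_H_two: "coalgebra_map Hd H2 \<pi>"
proof -
  have "tens H2 H2 = tens W W" by (rule tens_cong_space) simp_all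
  moreover have "linear_map H H2 \<pi>" using pi_linear carr_H_two by (auto simp: linear_map_def)
  ultimately have "coalgebra_map H H2 \<pi>" using pi_map_W by (simp add: coalgebra_map_def)
  then show ?thesis using coalgebra_map_cong_dom[OF descendent_eqs] by blast
qed

text \<open>The counit removes the right component of \<open>\<pi> x\<close> and leaves the pair of
  \<open>Bt (S (B x))\<close> and the unit, which is a value of \<open>B\<close> at the unit. By
  \<open>Ct_tens\<close> and \<open>S_S\<close> its projection is
  \<open>\<pi> (B x)\<close>.\<close>

lemma pi_B:
  assumes x: "x \<in> carr H"
  shows "\<pi> (B x) = B_two H B (\<pi> x)"
proof -
  note lBt = coalgebra_map_linear[OF Bt_map]
  note Bc = linear_map_carr[OF B_linear] and Sc = linear_map_carr[OF S_linear]
  let ?F = "\<lambda>a k. Ct (tens H H a (scl H (counit H k) (hone H)))"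
  let ?\<alpha> = "\<lambda>x. Bt (S (B x))" and ?\<beta> = "\<lambda>x. S (B (Bt (S x)))"
  have i: "ident_on H \<in> coalg_maps H H" by (rule ident_on_in_coalg_maps[OF coalg])
  have \<alpha>: "linear_map H Hm ?\<alpha>"
    by (rule linear_map_comp[OF coalgebra_map_linear[OF Bt_map_H_minus] linear_map_comp[OF S_linear B_linear]])
  \<comment> \<open>A coalgebra map into \<open>Hp\<close>, so that the counit of its values is the
    counit of the argument.\<close>
  have \<beta>: "coalgebra_map H Hp ?\<beta>"
    by (rule coalgebra_map_cong[OF coalg coalg_mapsD[OF SB_in_H_plus[OF cocommutative_coalg
            coalg_map_intros(3)[OF cocommutative_coalg coalg_map_intros(2)[OF cocommutative_coalg i]]]]]) simp
  have lc: "linear_map Hp Hp (\<lambda>k. scl Hp (counit Hp k) (hone H))"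
    by (rule bilinear_map_comp_left[OF bilinear_scl[OF VHp] linear_counit[OF coalgebra_Hp] one_in_H_plus])
  have bF: "bilinear_map Hm Hp W ?F"
    using linear_comp_bilinear[OF Ct_linear bilinear_map_comp[OF bilinear_tens_W linear_map_ident lc]] by simp
  have lC: "linear_map H W (\<lambda>a. Ct (tens H H (?\<alpha> a) (hone H)))"
    by (rule linear_map_comp[OF Ct_linear bilinear_map_comp_left[OF bilinear_tens_W \<alpha> one_in_H_plus]])
  have "B_two H B (\<pi> x) = tlift Hm Hp ?F (sweedler H (\<lambda>a b. tens Hm Hp (?\<alpha> a) (?\<beta> b)) x)"
    by (simp add: B_two_def pi_map_def tens_Hm_Hp Let_def)
  also have "\<dots> = sweedler H (\<lambda>a b. ?F (?\<alpha> a) (?\<beta> b)) x"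
    by (rule tlift_sweedler_tens[OF coalg VHm VHp VW bF \<alpha> coalgebra_map_linear[OF \<beta>] x])
  also have "\<dots> = sweedler H (\<lambda>a b. scl W (counit H b) (Ct (tens H H (?\<alpha> a) (hone H)))) x"
  proof (rule sweedler_cong)
    fix a b assume a: "a \<in> carr H" and b: "b \<in> carr H"
    have "tens H H (?\<alpha> a) (hone H) \<in> carr W"
      by (rule bilinear_map_carr[OF bilinear_tens_W linear_map_carr[OF \<alpha> a] one_in_H_plus])
    then show "?F (?\<alpha> a) (?\<beta> b) = scl W (counit H b) (Ct (tens H H (?\<alpha> a) (hone H)))"
      using coalgebra_map_counit[OF \<beta> b] linear_map_scl[OF Ct_linear] by (simp add: tens_scl_right scl_W)
  qed
  also have "\<dots> = Ct (tens H H (?\<alpha> x) (hone H))"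
    by (rule sweedler_counit_right[OF coalg VW lC x])
  also have "\<dots> = \<pi> (B x)"
    using Ct_tens[OF Sc[OF Bc[OF x]] one_carr] by (simp add: B_one S_S dm_one_right Bc x)
  finally show ?thesis ..
qed

lemma rota_baxter_hom_pi: "rota_baxter_hom Hd B H2 (B_two H B) \<pi>"
  using rb_hopf_descendent carr_H_two
  by (intro rb_hom_surj vspace_H_two pi_map_H_two)
    (simp_all add: rota_baxter_hopf_iff pi_mult pi_one pi_antipode pi_B)

section \<open>Inversion between the two descendent algebras\<close>

lemma S_image: "S ` carr H = carr H"
  using linear_map_carr[OF S_linear] S_S by (metis (no_types, lifting) image_iff subsetI subset_antisym)

text \<open>Product, antipode and operator are handled by \<open>inv_circ_Bt\<close>,
  \<open>inv_cinv_Bt\<close> and \<open>inv_Bt\<close>, at the projections or at the identity of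
  \<open>H\<close>. By the last of them inversion carries \<open>Bt\<close> to the tilde operator of
  \<open>B\<close> formed inside the descendent algebra, which is therefore the target
  operator.\<close>

lemma rota_baxter_hom_S: "rota_baxter_hom (descendent H Bt) Bt Hd (rb_tilde Hd B) S"
proof (rule rb_hom_surj)
  interpret t: rb_hopf H Bt by (rule rb_hopf_Bt)
  let ?GH = "conv_group H H"
  interpret GH: rb_group ?GH "\<lambda>f x. B (f x)" by (rule rb_group_conv_group[OF cocommutative_coalg])
  interpret GtH: rb_group ?GH "\<lambda>f x. Bt (f x)" by (rule t.rb_group_conv_group[OF cocommutative_coalg])
  interpret GtQ: rb_group conv_Q "\<lambda>f x. Bt (f x)" by (rule t.rb_group_conv_group[OF cocommutative_Q])
  note i = ident_on_in_coalg_maps[OF coalg]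
  have iG: "ident_on H \<in> carrier ?GH" using i by simp
  have pG: "p1 \<in> carrier conv_Q" "p2 \<in> carrier conv_Q" using p1_in p2_in by simp_all
  note Sc = linear_map_carr[OF S_linear]
  show "rota_baxter_hopf (descendent H Bt) Bt"
    using t.rb_hopf_descendent by (simp add: rota_baxter_hopf_iff)
  show "vspace Hd" using V vspace_cong_space[OF descendent_simps(1,2)] by blast
  show "coalgebra_map (descendent H Bt) Hd S"
    using S_coalgebra_map coalgebra_map_cong_dom[OF t.descendent_eqs, of Hd S] coalgebra_map_cong_cod[OF descendent_eqs, of H S]
    by blast
  show "S ` carr (descendent H Bt) = carr Hd" using S_image by simp
  show "S (hone (descendent H Bt)) = hone Hd" using S_one by simp
  show "S (hmult (descendent H Bt) x y) = hmult Hd (S x) (S y)"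
    if "x \<in> carr (descendent H Bt)" "y \<in> carr (descendent H Bt)" for x y
  proof -
    have xy: "x \<in> carr H" "y \<in> carr H" using that by simp_all
    have "inv\<^bsub>conv_Q\<^esub> (GtQ.circ p1 p2) = GQ.circ (inv\<^bsub>conv_Q\<^esub> p1) (inv\<^bsub>conv_Q\<^esub> p2)"
      using GQ.inv_circ_Bt[OF pG] unfolding GtQ.circ_def Bt_eq[OF cocommutative_Q p1_in] .
    then have "(\<lambda>t. S (convol Q (descendent_mult H Bt) p1 p2 t)) = convol Q dm (\<lambda>t. S (p1 t)) (\<lambda>t. S (p2 t))"
      using GtQ.circ_closed[OF pG] by (simp add: t.circ_eq[OF cocommutative_Q] eqs_in_Q)
    from fun_cong[OF this, of "tens H H x y"] show ?thesis
      using convol_proj[OF coalg coalg V V V t.dm_bilinear linear_map_ident linear_map_ident xy]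
        convol_proj[OF coalg coalg V V V dm_bilinear S_linear S_linear xy] by simp
  qed
  show "S (antipode (descendent H Bt) x) = antipode Hd (S x)" if "x \<in> carr (descendent H Bt)" for x
  proof -
    have x: "x \<in> carr H" using that by simp
    have "inv\<^bsub>?GH\<^esub> (GtH.cinv (ident_on H)) = GH.cinv (inv\<^bsub>?GH\<^esub> (ident_on H))"
      using GH.inv_cinv_Bt[OF iG] unfolding GtH.cinv_def Bt_eq[OF cocommutative_coalg i] .
    then have "(\<lambda>x. S (descendent_antipode H Bt (ident_on H x))) = (\<lambda>x. Sd (S (ident_on H x)))"
      using i GtH.cinv_closed[OF iG] by (simp add: t.cinv_eq[OF cocommutative_coalg] group_eqs[OF cocommutative_coalg])
    from fun_cong[OF this, of x] show ?thesis using x by simp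
  qed
  show "S (Bt x) = rb_tilde Hd B (S x)" if "x \<in> carr (descendent H Bt)" for x
  proof -
    have x: "x \<in> carr H" using that by simp
    have l: "linear_map H H (\<lambda>x. B (Sd x))" by (rule linear_map_comp[OF B_linear coalgebra_map_linear[OF Sd_map]])
    have "inv\<^bsub>?GH\<^esub> (GH.Bt (ident_on H)) = GH.circ (inv\<^bsub>?GH\<^esub> (ident_on H)) (\<lambda>x. B (GH.cinv (inv\<^bsub>?GH\<^esub> (ident_on H)) x))"
      by (rule GH.inv_Bt[OF iG])
    then have "(\<lambda>x. S (Bt (ident_on H x))) = convol H dm (\<lambda>x. S (ident_on H x)) (\<lambda>x. B (Sd (S (ident_on H x))))"
      using i by (simp add: group_eqs[OF cocommutative_coalg])
    from fun_cong[OF this, of x] have "S (Bt x) = sweedler H (\<lambda>a b. dm (S (ident_on H a)) (B (Sd (S (ident_on H b))))) x"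
      using x by (simp add: convol_inside)
    also have "\<dots> = sweedler H (\<lambda>a b. dm (S a) (B (Sd (S b)))) x"
      by (rule sweedler_cong) simp
    also have "\<dots> = sweedler H (\<lambda>a b. dm a (B (Sd b))) (S x)"
      by (rule sweedler_coalgebra_map[OF coalg V S_coalgebra_map V bilinear_map_comp[OF dm_bilinear linear_map_ident l] x, symmetric])
    finally show ?thesis
      by (simp add: rb_tilde_def sweedler_cong_space[OF descendent_simps(1-3)])
  qed
qed

end

lemma rota_baxter_hom_comp:
  assumes f: "rota_baxter_hom H B K C f" and g: "rota_baxter_hom K C W D g"
  shows "rota_baxter_hom H B W D (g \<circ> f)"
proof -
  interpret H: rb_hopf H B using f by (simp add: rota_baxter_hom_def rota_baxter_hopf_iff)
  interpret K: rb_hopf K C using f by (simp add: rota_baxter_hom_def rota_baxter_hopf_iff)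
  interpret W: rb_hopf W D using g by (simp add: rota_baxter_hom_def rota_baxter_hopf_iff)
  have fm: "coalgebra_map H K f" and gm: "coalgebra_map K W g"
    using f g by (simp_all add: rota_baxter_hom_def hopf_hom_def)
  show ?thesis
    using f g coalgebra_map_comp[OF H.coalg K.coalg W.V fm gm] coalgebra_map_carr[OF fm]
    by (simp add: rota_baxter_hom_def hopf_hom_def comp_def)
qed

theorem theorem3p9:
  fixes H :: "('k::field_char_0, 'h::ab_group_add) hopf" and B :: "'h \<Rightarrow> 'h"
  assumes "rota_baxter_hopf H B"
  shows "rota_baxter_hom (descendent H B) B (H_two H B) (B_two H B) (pi_map H B) \<and>
         pi_map H B ` carr (descendent H B) = carr (H_two H B) \<and>
         rota_baxter_hom (descendent H (rb_tilde H B)) (rb_tilde H B)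
           (H_two H B) (B_two_tilde H B) (pi_map H B \<circ> antipode H) \<and>
         (pi_map H B \<circ> antipode H) ` carr (descendent H (rb_tilde H B)) = carr (H_two H B)"
proof -
  interpret rb_hopf H B using assms by (simp add: rota_baxter_hopf_iff)
  interpret t: rb_hopf H "rb_tilde H B" by (rule rb_hopf_Bt)
  have "rota_baxter_hom (descendent H (rb_tilde H B)) (rb_tilde H B)
      (H_two H B) (B_two_tilde H B) (pi_map H B \<circ> antipode H)"
    \<comment> \<open>\<open>B_two_tilde\<close> is the tilde operator of \<open>B_two\<close> on
      \<open>H_two\<close>, so pi intertwines it with the tilde operator of \<open>B\<close> on the
      descendent algebra, which is where the antipode arrives.\<close>
    unfolding B_two_tilde_def
    by (rule rota_baxter_hom_comp[OF rota_baxter_hom_S rota_baxter_hom_tilde[OF rota_baxter_hom_pi]])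
  moreover have "(pi_map H B \<circ> antipode H) ` carr (descendent H (rb_tilde H B)) = carr (H_two H B)"
    unfolding image_comp[symmetric] t.descendent_simps S_image by (rule carr_H_two)
  ultimately show ?thesis
    using rota_baxter_hom_pi carr_H_two by simp
qed

end
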